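(* (a) In a $1d$ MSPT state protected solely by the exact symmetry $K$, i.e. with a nontrivial invariant in $H^2(K,U(1))$, the exact symmetry is broken at the boundary such that no diagonal average subgroup is left unbroken. (b) In a $1d$ MSPT state protected jointly by an exact symmetry $K$ and an average symmetry $G$, i.e. with a nontrivial invariant in $H^1[G,H^1(K,U(1))]$, at the boundary the exact symmetry is broken to its diagonal subgroup, while the average symmetry is broken. (In either case a subgroup of $K$, respectively of $K\times G$, may remain unbroken; for example, if $K$, respectively $K\times G$, is finite abelian, this is the projective center.)
   Context: Setting. $\mathcal{H}=\bigotimes_i\mathcal{H}_i$ is the Hilbert space of a bosonic (spin) chain of length $L$ with open boundaries and finite-dimensional sites; $\mathcal N=\dim\mathcal H$. The Choi state is $|\rho\rangle\rangle=(\rho\otimes I)|\Omega\rangle\rangle\in\mathcal{H}\otimes\mathcal{H}^*$, $|\Omega\rangle\rangle=\mathcal{N}^{-1/2}\sum_a|a\rangle|a^*\rangle$. $\rho$ has exact symmetry $K$ if $U_k\rho=\rho U_k=e^{i\theta_k}\rho$ for $k\in K$, and average symmetry $G$ if $U_g\rho U_g^\dagger=\rho$ for $g\in G$, with $U_k=\bigotimes_iu_k^i$, $U_g=\bigotimes_iu_g^i$ onsite linear unitary representations. On $|\rho\rangle\rangle$, $K_+\times K_-$ acts ($K_+$ via $U_k\otimes I$, $K_-$ via $I\otimes U_k^*$), $G$ acts via $U_g\otimes U_g^*$, and the antiunitary $J(|a\rangle|b^*\rangle)=|b\rangle|a^*\rangle$ (invariance under it is Hermiticity of $\rho$) swaps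 $K_\pm$ and commutes with $G$; $G_d=((K\times K)\times G)\rtimes J$. MSPT. A pure state is short-range entangled if it is prepared from a product state by a finite-depth local unitary circuit. $\rho$ is an MSPT state if $|\rho\rangle\rangle$ is (in the bulk) an SPT state protected by $G_d$, with invariant in $H^2(G_d,U(1))$ ($J$ acting by complex conjugation). The invariants consistent with $\rho\ge0$ form $H^2(K,U(1))\oplus H^1[G,H^1(K,U(1))]$: the first summand means invariant $\alpha$ for $K_+$ and conjugate $\bar\alpha$ for $K_-$; the second means $G$-domain walls carry $K_+\times K_-$ charges $(\chi,\bar\chi)$, $\chi\in H^1(K,U(1))$. Boundary breaking. Let boundary operators $B_l,B_r$ (acting on the doubled space) be supported within a distance of the left, respectively right, end of the chain that is finite (comparable to the bulk correlation length, independent of $L$). A symmetry is broken at the boundary if there are such $B_l,B_r$, each carrying nontrivial charge under it, with $\langle\langle\rho|B_lB_r|\rho\rangle\rangle/\langle\langle\rho|\rho\rangle\rangle\sim O(1)$ as $L\to\infty$. The exact symmetry $K_+\times K_-$ is broken with no diagonal average subgroup left when such order exists for operators charged under a single copy of $K$ (hence also under the diagonal subgroup $\{(k,k)\}$). It is broken to its diagonal (average) subgroup when the order is in operators charged under $K_+$ and under $K_-$ but neutral under the diagonal subgroup. *)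

theory Defs
  imports Complex_Main "HOL-Library.FuncSet" "HOL-Algebra.Group"
begin

section \<open>Vectors and operators over a finite orthonormal basis\<close>

text \<open>
  The Hilbert space with orthonormal basis \<open>X\<close> consists of the functions vanishing off the
  finite set \<open>X\<close>; operators are given by their matrix elements, vanishing off \<open>X \<times> X\<close>.
\<close>

type_synonym 'c op = "'c \<Rightarrow> 'c \<Rightarrow> complex"

definition vecs :: "'c set \<Rightarrow> ('c \<Rightarrow> complex) set" where
  "vecs X = {v. \<forall>s. s \<notin> X \<longrightarrow> v s = 0}"

definition ops :: "'c set \<Rightarrow> 'c op set" where
  "ops X = {A. \<forall>s t. s \<notin> X \<or> t \<notin> X \<longrightarrow> A s t = 0}"

definition one_op :: "'c set \<Rightarrow> 'c op" where
  "one_op X = (\<lambda>s t. if s \<in> X \<and> s = t then 1 else 0)"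

definition times_op :: "'c set \<Rightarrow> 'c op \<Rightarrow> 'c op \<Rightarrow> 'c op" where
  "times_op X A B = (\<lambda>s t. \<Sum>r\<in>X. A s r * B r t)"

definition adj_op :: "'c op \<Rightarrow> 'c op" where
  "adj_op A = (\<lambda>s t. cnj (A t s))"

definition scale_op :: "complex \<Rightarrow> 'c op \<Rightarrow> 'c op" where
  "scale_op z A = (\<lambda>s t. z * A s t)"

definition app_op :: "'c set \<Rightarrow> 'c op \<Rightarrow> ('c \<Rightarrow> complex) \<Rightarrow> ('c \<Rightarrow> complex)" where
  "app_op X A v = (\<lambda>s. \<Sum>t\<in>X. A s t * v t)"

definition inner_on :: "'c set \<Rightarrow> ('c \<Rightarrow> complex) \<Rightarrow> ('c \<Rightarrow> complex) \<Rightarrow> complex" where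
  "inner_on X v w = (\<Sum>s\<in>X. cnj (v s) * w s)"

definition unitary_op :: "'c set \<Rightarrow> 'c op \<Rightarrow> bool" where
  "unitary_op X A \<longleftrightarrow> A \<in> ops X \<and>
     times_op X A (adj_op A) = one_op X \<and> times_op X (adj_op A) A = one_op X"

definition contraction_op :: "'c set \<Rightarrow> 'c op \<Rightarrow> bool" where
  "contraction_op X A \<longleftrightarrow> A \<in> ops X \<and>
     (\<forall>v. (\<Sum>s\<in>X. (cmod (app_op X A v s))\<^sup>2) \<le> (\<Sum>s\<in>X. (cmod (v s))\<^sup>2))"

definition density_op :: "'c set \<Rightarrow> 'c op \<Rightarrow> bool" where
  "density_op X \<rho> \<longleftrightarrow> \<rho> \<in> ops X \<and> adj_op \<rho> = \<rho> \<and>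
     (\<forall>v. 0 \<le> Re (inner_on X v (app_op X \<rho> v))) \<and> (\<Sum>s\<in>X. \<rho> s s) = 1"

definition op_subspace :: "'c set \<Rightarrow> 'c op set \<Rightarrow> bool" where
  "op_subspace X V \<longleftrightarrow> V \<subseteq> ops X \<and> (\<lambda>s t. 0) \<in> V \<and>
     (\<forall>A\<in>V. \<forall>B\<in>V. \<forall>z w. (\<lambda>s t. z * A s t + w * B s t) \<in> V)"


section \<open>Open chains\<close>

text \<open>
  A chain has sites \<open>0, \<dots>, L - 1\<close>; \<open>Q i\<close> is the finite basis of the Hilbert space of site \<open>i\<close>,
  so the product basis of the chain is the set of configurations below.
\<close>

definition configs :: "nat \<Rightarrow> (nat \<Rightarrow> 'b set) \<Rightarrow> (nat \<Rightarrow> 'b) set" where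
  "configs L Q = (\<Pi>\<^sub>E i\<in>{..<L}. Q i)"

text \<open>\<open>A = a \<otimes> 1\<close> with \<open>a\<close> acting on the sites in \<open>S\<close>. The set \<open>S\<close> may stick out of the chain.\<close>

definition supported_on ::
  "nat \<Rightarrow> (nat \<Rightarrow> 'b set) \<Rightarrow> nat set \<Rightarrow> (nat \<Rightarrow> 'b) op \<Rightarrow> bool" where
  "supported_on L Q S A \<longleftrightarrow> A \<in> ops (configs L Q) \<and>
     (\<exists>a. \<forall>s\<in>configs L Q. \<forall>t\<in>configs L Q.
        A s t = (if \<forall>i\<in>{..<L} - S. s i = t i then a (restrict s S) (restrict t S) else 0))"

definition onsite_op ::
  "nat \<Rightarrow> (nat \<Rightarrow> 'b set) \<Rightarrow> nat set \<Rightarrow> (nat \<Rightarrow> 'b op) \<Rightarrow> (nat \<Rightarrow> 'b) op" where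
  "onsite_op L Q S a = (\<lambda>s t.
     if s \<in> configs L Q \<and> t \<in> configs L Q \<and> (\<forall>i\<in>{..<L} - S. s i = t i)
     then \<Prod>i\<in>S \<inter> {..<L}. a i (s i) (t i) else 0)"

text \<open>
  A circuit layer is a product of unitary gates on disjoint windows of \<open>R\<close> consecutive sites,
  listed from left to right.
\<close>

definition circuit_layer ::
  "nat \<Rightarrow> (nat \<Rightarrow> 'b set) \<Rightarrow> nat \<Rightarrow> (nat \<Rightarrow> 'b) op \<Rightarrow> bool" where
  "circuit_layer L Q R A \<longleftrightarrow> (\<exists>gates :: (nat \<times> (nat \<Rightarrow> 'b) op) list.
     (\<forall>(p, U)\<in>set gates. unitary_op (configs L Q) U \<and> supported_on L Q {p..<p + R} U) \<and>
     sorted_wrt (\<lambda>(p, U) (p', U'). p + R \<le> p') gates \<and>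
     A = foldr (times_op (configs L Q)) (map snd gates) (one_op (configs L Q)))"

definition local_circuit ::
  "nat \<Rightarrow> (nat \<Rightarrow> 'b set) \<Rightarrow> nat \<Rightarrow> nat \<Rightarrow> (nat \<Rightarrow> 'b) op \<Rightarrow> bool" where
  "local_circuit L Q R D W \<longleftrightarrow> (\<exists>layers.
     length layers \<le> D \<and> (\<forall>A\<in>set layers. circuit_layer L Q R A) \<and>
     W = foldr (times_op (configs L Q)) layers (one_op (configs L Q)))"

text \<open>
  A vector that is a product over the sites at distance at least \<open>b\<close> from both ends, times an
  arbitrary vector \<open>\<eta>\<close> on the remaining sites (in which the two ends may be entangled).
\<close>

definition bulk_product ::
  "nat \<Rightarrow> (nat \<Rightarrow> 'b set) \<Rightarrow> nat \<Rightarrow> ((nat \<Rightarrow> 'b) \<Rightarrow> complex) \<Rightarrow> bool" where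
  "bulk_product L Q b \<phi> \<longleftrightarrow> \<phi> \<in> vecs (configs L Q) \<and>
     (\<exists>v \<eta>. \<forall>s\<in>configs L Q.
        \<phi> s = (\<Prod>i\<in>{b..<L - b}. v i (s i)) * \<eta> (restrict s ({..<L} - {b..<L - b})))"

text \<open>
  Short-range entanglement in the bulk of a family of states, one for each length. Requiring
  \<open>\<phi>\<close> to be a product at the ends as well would exclude every symmetric state on an open
  chain that has nontrivial edge modes.
\<close>

definition bulk_short_range_entangled ::
  "(nat \<Rightarrow> nat \<Rightarrow> 'b set) \<Rightarrow> (nat \<Rightarrow> (nat \<Rightarrow> 'b) \<Rightarrow> complex) \<Rightarrow> bool" where
  "bulk_short_range_entangled Q \<psi> \<longleftrightarrow> (\<exists>R D b. \<forall>L. \<exists>W \<phi>.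
     local_circuit L (Q L) R D W \<and> bulk_product L (Q L) b \<phi> \<and>
     \<psi> L = app_op (configs L (Q L)) W \<phi>)"


section \<open>The doubled chain and the Choi state\<close>

text \<open>
  Site \<open>i\<close> of the doubled chain has the basis \<open>|a\<rangle>|b\<^sup>*\<rangle>\<close>, encoded as the pair \<open>(a, b)\<close>.
\<close>

definition phys :: "(nat \<Rightarrow> nat) \<Rightarrow> nat \<Rightarrow> nat set" where
  "phys d i = {..<d i}"

definition doubled :: "(nat \<Rightarrow> nat) \<Rightarrow> nat \<Rightarrow> (nat \<times> nat) set" where
  "doubled d i = {..<d i} \<times> {..<d i}"

definition ket_part :: "nat \<Rightarrow> (nat \<Rightarrow> nat \<times> nat) \<Rightarrow> nat \<Rightarrow> nat" where
  "ket_part L s = (\<lambda>i\<in>{..<L}. fst (s i))"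

definition bra_part :: "nat \<Rightarrow> (nat \<Rightarrow> nat \<times> nat) \<Rightarrow> nat \<Rightarrow> nat" where
  "bra_part L s = (\<lambda>i\<in>{..<L}. snd (s i))"

text \<open>The operator \<open>A \<otimes> B\<^sup>*\<close> on the doubled space, \<open>B\<^sup>*\<close> being the entrywise conjugate.\<close>

definition tensor_conj ::
  "nat \<Rightarrow> (nat \<Rightarrow> nat) \<Rightarrow> (nat \<Rightarrow> nat) op \<Rightarrow> (nat \<Rightarrow> nat) op \<Rightarrow> (nat \<Rightarrow> nat \<times> nat) op" where
  "tensor_conj L d A B = (\<lambda>s t.
     if s \<in> configs L (doubled d) \<and> t \<in> configs L (doubled d)
     then A (ket_part L s) (ket_part L t) * cnj (B (bra_part L s) (bra_part L t)) else 0)"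

definition max_entangled :: "nat \<Rightarrow> (nat \<Rightarrow> nat) \<Rightarrow> (nat \<Rightarrow> nat \<times> nat) \<Rightarrow> complex" where
  "max_entangled L d = (\<lambda>s.
     if s \<in> configs L (doubled d) \<and> ket_part L s = bra_part L s
     then 1 / complex_of_real (sqrt (\<Prod>i<L. real (d i))) else 0)"

definition choi :: "nat \<Rightarrow> (nat \<Rightarrow> nat) \<Rightarrow> (nat \<Rightarrow> nat) op \<Rightarrow> (nat \<Rightarrow> nat \<times> nat) \<Rightarrow> complex" where
  "choi L d \<rho> =
     app_op (configs L (doubled d)) (tensor_conj L d \<rho> (one_op (configs L (phys d))))
       (max_entangled L d)"

text \<open>The antiunitary \<open>J(|a\<rangle>|b\<^sup>*\<rangle>) = |b\<rangle>|a\<^sup>*\<rangle>\<close>.\<close>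

definition J_op ::
  "nat \<Rightarrow> ((nat \<Rightarrow> nat \<times> nat) \<Rightarrow> complex) \<Rightarrow> ((nat \<Rightarrow> nat \<times> nat) \<Rightarrow> complex)" where
  "J_op L v = (\<lambda>s. cnj (v (\<lambda>i\<in>{..<L}. prod.swap (s i))))"

lemma configs_doubled_iff:
  "s \<in> configs L (doubled d) \<longleftrightarrow>
     s \<in> extensional {..<L} \<and> ket_part L s \<in> configs L (phys d) \<and> bra_part L s \<in> configs L (phys d)"
  by (auto simp: configs_def PiE_def doubled_def phys_def ket_part_def bra_part_def Pi_def
      mem_Times_iff)

lemma ket_bra_eqI:
  assumes "s \<in> configs L Q" "t \<in> configs L Q"
    and "ket_part L s = ket_part L t" "bra_part L s = bra_part L t"
  shows "s = t"
proof (rule extensionalityI[of _ "{..<L}"])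
  show "s \<in> extensional {..<L}" "t \<in> extensional {..<L}"
    using assms(1,2) by (auto simp: configs_def PiE_def)
  fix i assume "i \<in> {..<L}"
  then show "s i = t i"
    using fun_cong[OF assms(3), of i] fun_cong[OF assms(4), of i]
    by (auto simp: ket_part_def bra_part_def prod_eq_iff)
qed

lemma choi_apply:
  assumes s: "s \<in> configs L (doubled d)"
  shows "choi L d \<rho> s =
    \<rho> (ket_part L s) (bra_part L s) / complex_of_real (sqrt (\<Prod>i<L. real (d i)))"
proof -
  let ?X = "configs L (doubled d)"
  define c where "c = complex_of_real (sqrt (\<Prod>i<L. real (d i)))"
  define t where "t = (\<lambda>i\<in>{..<L}. (snd (s i), snd (s i)))"
  have t: "ket_part L t = bra_part L s" "bra_part L t = bra_part L s"
    by (auto simp: t_def ket_part_def bra_part_def restrict_def)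
  have tX: "t \<in> ?X"
    using s t unfolding configs_doubled_iff by (simp add: t_def)
  have fin: "finite ?X"
    unfolding configs_def by (rule finite_PiE) (auto simp: doubled_def)
  have "tensor_conj L d \<rho> (one_op (configs L (phys d))) s r * max_entangled L d r =
      (if r = t then \<rho> (ket_part L s) (bra_part L s) / c else 0)" if r: "r \<in> ?X" for r
  proof (cases "r = t")
    case True
    have "bra_part L s \<in> configs L (phys d)"
      using s unfolding configs_doubled_iff by blast
    then show ?thesis
      unfolding True tensor_conj_def max_entangled_def one_op_def t c_def[symmetric]
      using s tX by simp
  next
    case False
    have "\<not> (bra_part L s = bra_part L r \<and> ket_part L r = bra_part L r)"
      using False ket_bra_eqI[OF r tX] t by metis
    then show ?thesis
      unfolding tensor_conj_def max_entangled_def one_op_def using False by simp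
  qed
  then have "choi L d \<rho> s =
      (\<Sum>r\<in>?X. if r = t then \<rho> (ket_part L s) (bra_part L s) / c else 0)"
    unfolding choi_def app_op_def by (rule sum.cong[OF refl])
  also have "\<dots> = \<rho> (ket_part L s) (bra_part L s) / c"
    using tX fin by simp
  finally show ?thesis unfolding c_def .
qed

lemma choi_J_invariant_iff:
  assumes "\<rho> \<in> ops (configs L (phys d))" and d: "\<And>i. i < L \<Longrightarrow> 0 < d i"
  shows "(\<forall>s\<in>configs L (doubled d). J_op L (choi L d \<rho>) s = choi L d \<rho> s) \<longleftrightarrow> adj_op \<rho> = \<rho>"
proof -
  let ?X = "configs L (doubled d)"
  let ?c = "complex_of_real (sqrt (\<Prod>i<L. real (d i)))"
  define c where "c = ?c"
  have "0 < (\<Prod>i<L. real (d i))" using d by (intro prod_pos) auto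
  then have c: "c \<noteq> 0" unfolding c_def of_real_eq_0_iff real_sqrt_eq_zero_cancel_iff by linarith
  have cr: "cnj c = c" unfolding c_def by (rule complex_cnj_complex_of_real)
  have swap: "(\<lambda>i\<in>{..<L}. prod.swap (s i)) \<in> ?X"
    "ket_part L (\<lambda>i\<in>{..<L}. prod.swap (s i)) = bra_part L s"
    "bra_part L (\<lambda>i\<in>{..<L}. prod.swap (s i)) = ket_part L s" if "s \<in> ?X" for s
  proof -
    show *: "ket_part L (\<lambda>i\<in>{..<L}. prod.swap (s i)) = bra_part L s"
      "bra_part L (\<lambda>i\<in>{..<L}. prod.swap (s i)) = ket_part L s"
      by (auto simp: ket_part_def bra_part_def restrict_def)
    show "(\<lambda>i\<in>{..<L}. prod.swap (s i)) \<in> ?X"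
      using that * unfolding configs_doubled_iff by simp
  qed
  have J: "J_op L (choi L d \<rho>) s = choi L d \<rho> s \<longleftrightarrow>
      adj_op \<rho> (ket_part L s) (bra_part L s) = \<rho> (ket_part L s) (bra_part L s)" if "s \<in> ?X" for s
    unfolding J_op_def choi_apply[OF swap(1)[OF that]] choi_apply[OF that] swap(2,3)[OF that]
      adj_op_def c_def[symmetric]
    using c cr by simp
  show ?thesis
  proof
    assume L: "\<forall>s\<in>?X. J_op L (choi L d \<rho>) s = choi L d \<rho> s"
    show "adj_op \<rho> = \<rho>"
    proof (intro ext)
      fix a b
      show "adj_op \<rho> a b = \<rho> a b"
      proof (cases "a \<in> configs L (phys d) \<and> b \<in> configs L (phys d)")
        case True
        define s where "s = (\<lambda>i\<in>{..<L}. (a i, b i))"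
        have ab: "ket_part L s = restrict a {..<L}" "bra_part L s = restrict b {..<L}"
          by (rule ext, simp add: s_def ket_part_def bra_part_def)+
        have "a \<in> extensional {..<L}" "b \<in> extensional {..<L}"
          using True by (simp_all add: configs_def PiE_def)
        then have s: "ket_part L s = a" "bra_part L s = b"
          unfolding ab by (simp_all only: extensional_restrict)
        have "s \<in> extensional {..<L}" by (simp only: s_def restrict_extensional)
        then have "s \<in> ?X" using True s unfolding configs_doubled_iff by blast
        then show ?thesis using L J[of s] s by blast
      next
        case False
        then show ?thesis using assms(1) by (auto simp: adj_op_def ops_def)
      qed
    qed
  next
    assume "adj_op \<rho> = \<rho>"
    then have "adj_op \<rho> a b = \<rho> a b" for a b by (rule arg_cong)
    then show "\<forall>s\<in>?X. J_op L (choi L d \<rho>) s = choi L d \<rho> s" using J by blast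
  qed
qed


section \<open>Families of symmetric mixed states\<close>

text \<open>
  All data are indexed by the length \<open>L\<close>: the site dimensions, the onsite matrices \<open>u\<^sub>k\<close> and
  \<open>u\<^sub>g\<close>, and the density matrix.
\<close>

record ('k, 'g) chain_family =
  dim :: "nat \<Rightarrow> nat \<Rightarrow> nat"
  repK :: "nat \<Rightarrow> nat \<Rightarrow> 'k \<Rightarrow> nat op"
  repG :: "nat \<Rightarrow> nat \<Rightarrow> 'g \<Rightarrow> nat op"
  rho :: "nat \<Rightarrow> (nat \<Rightarrow> nat) op"

abbreviation basis :: "('k, 'g) chain_family \<Rightarrow> nat \<Rightarrow> (nat \<Rightarrow> nat) set" where
  "basis C L \<equiv> configs L (phys (dim C L))"

abbreviation dbasis :: "('k, 'g) chain_family \<Rightarrow> nat \<Rightarrow> (nat \<Rightarrow> nat \<times> nat) set" where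
  "dbasis C L \<equiv> configs L (doubled (dim C L))"

abbreviation choi_state ::
  "('k, 'g) chain_family \<Rightarrow> nat \<Rightarrow> (nat \<Rightarrow> nat \<times> nat) \<Rightarrow> complex" where
  "choi_state C L \<equiv> choi L (dim C L) (rho C L)"

text \<open>The truncations to the sites in \<open>S\<close> of the symmetry operators \<open>U\<^sub>k\<close> and \<open>U\<^sub>g\<close>.\<close>

definition UK :: "('k, 'g) chain_family \<Rightarrow> nat \<Rightarrow> nat set \<Rightarrow> 'k \<Rightarrow> (nat \<Rightarrow> nat) op" where
  "UK C L S k = onsite_op L (phys (dim C L)) S (\<lambda>i. repK C L i k)"

definition UG :: "('k, 'g) chain_family \<Rightarrow> nat \<Rightarrow> nat set \<Rightarrow> 'g \<Rightarrow> (nat \<Rightarrow> nat) op" where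
  "UG C L S g = onsite_op L (phys (dim C L)) S (\<lambda>i. repG C L i g)"

definition unitary_rep :: "('x, 'm) monoid_scheme \<Rightarrow> 'c set \<Rightarrow> ('x \<Rightarrow> 'c op) \<Rightarrow> bool" where
  "unitary_rep H X u \<longleftrightarrow> (\<forall>x\<in>carrier H. unitary_op X (u x)) \<and>
     (\<forall>x\<in>carrier H. \<forall>y\<in>carrier H. u (x \<otimes>\<^bsub>H\<^esub> y) = times_op X (u x) (u y))"

text \<open>The matrices \<open>u\<^sub>k\<close> and \<open>u\<^sub>g\<close> commute, because the symmetry group is the direct product.\<close>

definition onsite_symmetry ::
  "('k, 'm) monoid_scheme \<Rightarrow> ('g, 'n) monoid_scheme \<Rightarrow> ('k, 'g) chain_family \<Rightarrow> bool" where
  "onsite_symmetry K G C \<longleftrightarrow> (\<forall>L. \<forall>i<L.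
     unitary_rep K (phys (dim C L) i) (repK C L i) \<and>
     unitary_rep G (phys (dim C L) i) (repG C L i) \<and>
     (\<forall>k\<in>carrier K. \<forall>g\<in>carrier G.
        times_op (phys (dim C L) i) (repK C L i k) (repG C L i g) =
        times_op (phys (dim C L) i) (repG C L i g) (repK C L i k)))"

definition exact_symmetry :: "('k, 'm) monoid_scheme \<Rightarrow> ('k, 'g) chain_family \<Rightarrow> bool" where
  "exact_symmetry K C \<longleftrightarrow> (\<forall>L. \<exists>\<theta> :: 'k \<Rightarrow> real. \<forall>k\<in>carrier K.
     times_op (basis C L) (UK C L {..<L} k) (rho C L) = scale_op (cis (\<theta> k)) (rho C L) \<and>
     times_op (basis C L) (rho C L) (UK C L {..<L} k) = scale_op (cis (\<theta> k)) (rho C L))"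

definition average_symmetry :: "('g, 'n) monoid_scheme \<Rightarrow> ('k, 'g) chain_family \<Rightarrow> bool" where
  "average_symmetry G C \<longleftrightarrow> (\<forall>L. \<forall>g\<in>carrier G.
     times_op (basis C L) (times_op (basis C L) (UG C L {..<L} g) (rho C L))
       (adj_op (UG C L {..<L} g)) = rho C L)"

text \<open>
  The action of \<open>(K\<^sub>+ \<times> K\<^sub>-) \<times> G\<close> on the doubled chain, truncated to the sites in \<open>S\<close>:
  \<open>U\<^sub>k \<otimes> I\<close> for \<open>K\<^sub>+\<close>, \<open>I \<otimes> U\<^sub>k\<^sup>*\<close> for \<open>K\<^sub>-\<close> and \<open>U\<^sub>g \<otimes> U\<^sub>g\<^sup>*\<close> for \<open>G\<close>.
\<close>

definition dsym ::
  "('k, 'g) chain_family \<Rightarrow> nat \<Rightarrow> nat set \<Rightarrow> ('k \<times> 'k) \<times> 'g \<Rightarrow> (nat \<Rightarrow> nat \<times> nat) op" where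
  "dsym C L S = (\<lambda>((k, k'), g). tensor_conj L (dim C L)
     (times_op (basis C L) (UK C L S k) (UG C L S g))
     (times_op (basis C L) (UK C L S k') (UG C L S g)))"


section \<open>Group cohomology and the bulk invariant\<close>

definition cocycles2 :: "('x, 'm) monoid_scheme \<Rightarrow> ('x \<Rightarrow> 'x \<Rightarrow> complex) set" where
  "cocycles2 H = {\<omega>.
     (\<forall>x\<in>carrier H. \<forall>y\<in>carrier H. cmod (\<omega> x y) = 1) \<and>
     (\<forall>x\<in>carrier H. \<forall>y\<in>carrier H. \<forall>z\<in>carrier H.
        \<omega> x y * \<omega> (x \<otimes>\<^bsub>H\<^esub> y) z = \<omega> y z * \<omega> x (y \<otimes>\<^bsub>H\<^esub> z))}"

definition coboundaries2 :: "('x, 'm) monoid_scheme \<Rightarrow> ('x \<Rightarrow> 'x \<Rightarrow> complex) set" where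
  "coboundaries2 H = {\<omega>. \<exists>\<mu>. (\<forall>x\<in>carrier H. cmod (\<mu> x) = 1) \<and>
     (\<forall>x\<in>carrier H. \<forall>y\<in>carrier H. \<omega> x y = \<mu> x * \<mu> y / \<mu> (x \<otimes>\<^bsub>H\<^esub> y))}"

text \<open>
  \<open>G\<close> acts trivially on \<open>H\<^sup>1(K, U(1)) = Hom(K, U(1))\<close>, so that \<open>H\<^sup>1[G, H\<^sup>1(K, U(1))]\<close> consists
  of the homomorphisms \<open>\<chi>\<close> from \<open>G\<close> to \<open>Hom(K, U(1))\<close>, and a class is trivial only if \<open>\<chi> = 1\<close>.
\<close>

definition H1_of_characters ::
  "('k, 'm) monoid_scheme \<Rightarrow> ('g, 'n) monoid_scheme \<Rightarrow> ('g \<Rightarrow> 'k \<Rightarrow> complex) set" where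
  "H1_of_characters K G = {\<chi>.
     (\<forall>g\<in>carrier G. \<forall>k\<in>carrier K. cmod (\<chi> g k) = 1) \<and>
     (\<forall>g\<in>carrier G. \<forall>k\<in>carrier K. \<forall>k'\<in>carrier K. \<chi> g (k \<otimes>\<^bsub>K\<^esub> k') = \<chi> g k * \<chi> g k') \<and>
     (\<forall>g\<in>carrier G. \<forall>g'\<in>carrier G. \<forall>k\<in>carrier K. \<chi> (g \<otimes>\<^bsub>G\<^esub> g') k = \<chi> g k * \<chi> g' k)}"

definition nontrivial_H1 ::
  "('k, 'm) monoid_scheme \<Rightarrow> ('g, 'n) monoid_scheme \<Rightarrow> ('g \<Rightarrow> 'k \<Rightarrow> complex) \<Rightarrow> bool" where
  "nontrivial_H1 K G \<chi> \<longleftrightarrow> (\<exists>g\<in>carrier G. \<exists>k\<in>carrier K. \<chi> g k \<noteq> 1)"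

text \<open>
  The class in \<open>H\<^sup>2(H, U(1))\<close> of a bulk short-range entangled state with the onsite symmetry
  \<open>D L S x\<close> (truncated to \<open>S\<close>). On a bulk interval \<open>{a..<c}\<close> the truncated symmetry acts on the
  state through its two ends only, i.e. it is undone by unitaries \<open>El x\<close> and \<open>Er x\<close> supported
  near the end points. The \<open>El x\<close> act projectively on the state and \<open>\<omega>\<close> is their cocycle. They
  are determined by the state up to phases \<open>\<mu> x\<close> (with the opposite phases in \<open>Er x\<close>), hence
  exactly the cocycles cohomologous to \<open>\<omega>\<close> also satisfy this predicate. Placing \<open>El x\<close> and
  \<open>Er x\<close> outside the interval makes them commute with the truncated symmetry, so no twisted
  product is needed.
\<close>

definition bulk_spt_class ::
  "('x, 'm) monoid_scheme \<Rightarrow> (nat \<Rightarrow> nat \<Rightarrow> 'b set) \<Rightarrow>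
   (nat \<Rightarrow> nat set \<Rightarrow> 'x \<Rightarrow> (nat \<Rightarrow> 'b) op) \<Rightarrow>
   (nat \<Rightarrow> (nat \<Rightarrow> 'b) \<Rightarrow> complex) \<Rightarrow> ('x \<Rightarrow> 'x \<Rightarrow> complex) \<Rightarrow> bool" where
  "bulk_spt_class H Q D \<psi> \<omega> \<longleftrightarrow> (\<exists>w m. \<forall>L a c. m \<le> a \<and> a + m \<le> c \<and> c + m \<le> L \<longrightarrow>
     (\<exists>El Er.
        (\<forall>x\<in>carrier H.
           unitary_op (configs L (Q L)) (El x) \<and> supported_on L (Q L) {a - w..<a} (El x) \<and>
           unitary_op (configs L (Q L)) (Er x) \<and> supported_on L (Q L) {c..<c + w} (Er x) \<and>
           app_op (configs L (Q L)) (D L {a..<c} x)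
             (app_op (configs L (Q L)) (El x) (app_op (configs L (Q L)) (Er x) (\<psi> L))) = \<psi> L) \<and>
        (\<forall>x\<in>carrier H. \<forall>y\<in>carrier H.
           app_op (configs L (Q L)) (El x) (app_op (configs L (Q L)) (El y) (\<psi> L)) =
           (\<lambda>s. \<omega> x y * app_op (configs L (Q L)) (El (x \<otimes>\<^bsub>H\<^esub> y)) (\<psi> L) s))))"

text \<open>
  The cocycle on \<open>(K\<^sub>+ \<times> K\<^sub>-) \<times> G\<close> that is \<open>\<alpha>\<close> on \<open>K\<^sub>+\<close>, its conjugate on \<open>K\<^sub>-\<close>, and for which
  the end operator of a \<open>g\<close>-string (a domain wall) has charge \<open>\<chi> g\<close> under \<open>K\<^sub>+\<close> and the conjugate
  of \<open>\<chi> g\<close> under \<open>K\<^sub>-\<close>: \<open>E(k) E(g) E(k)\<^sup>-\<^sup>1 = \<omega>(k, g) / \<omega>(g, k) E(g)\<close>. Classes of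
  \<open>((K \<times> K) \<times> G) \<rtimes> J\<close> that are consistent with positivity of the density matrix are determined by
  their restriction to this unitary subgroup.
\<close>

definition mspt_cocycle ::
  "('k \<Rightarrow> 'k \<Rightarrow> complex) \<Rightarrow> ('g \<Rightarrow> 'k \<Rightarrow> complex) \<Rightarrow>
   ('k \<times> 'k) \<times> 'g \<Rightarrow> ('k \<times> 'k) \<times> 'g \<Rightarrow> complex" where
  "mspt_cocycle \<alpha> \<chi> = (\<lambda>((k1, k2), g) ((k1', k2'), g').
     \<alpha> k1 k1' * cnj (\<alpha> k2 k2') * \<chi> g' k1 * cnj (\<chi> g' k2))"

text \<open>
  MSPT states with invariant \<open>(\<alpha>, \<chi>)\<close>. Invariance under \<open>J\<close> is hermiticity of the density
  matrix, see \<open>choi_J_invariant_iff\<close>.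
\<close>

definition mspt ::
  "('k, 'm) monoid_scheme \<Rightarrow> ('g, 'n) monoid_scheme \<Rightarrow> ('k, 'g) chain_family \<Rightarrow>
   ('k \<Rightarrow> 'k \<Rightarrow> complex) \<Rightarrow> ('g \<Rightarrow> 'k \<Rightarrow> complex) \<Rightarrow> bool" where
  "mspt K G C \<alpha> \<chi> \<longleftrightarrow>
     (\<exists>m. \<forall>L. \<forall>i<L. 0 < dim C L i \<and> dim C L i \<le> m) \<and>
     (\<forall>L. density_op (basis C L) (rho C L)) \<and>
     onsite_symmetry K G C \<and> exact_symmetry K C \<and> average_symmetry G C \<and>
     bulk_short_range_entangled (\<lambda>L. doubled (dim C L)) (choi_state C) \<and>
     bulk_spt_class ((K \<times>\<times> K) \<times>\<times> G) (\<lambda>L. doubled (dim C L)) (dsym C) (choi_state C)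
       (mspt_cocycle \<alpha> \<chi>)"


section \<open>Symmetry breaking at the boundary\<close>

definition K_plus :: "('k, 'm) monoid_scheme \<Rightarrow> ('g, 'n) monoid_scheme \<Rightarrow> (('k \<times> 'k) \<times> 'g) set" where
  "K_plus K G = {((k, \<one>\<^bsub>K\<^esub>), \<one>\<^bsub>G\<^esub>) | k. k \<in> carrier K}"

definition K_minus :: "('k, 'm) monoid_scheme \<Rightarrow> ('g, 'n) monoid_scheme \<Rightarrow> (('k \<times> 'k) \<times> 'g) set" where
  "K_minus K G = {((\<one>\<^bsub>K\<^esub>, k), \<one>\<^bsub>G\<^esub>) | k. k \<in> carrier K}"

definition K_diag :: "('k, 'm) monoid_scheme \<Rightarrow> ('g, 'n) monoid_scheme \<Rightarrow> (('k \<times> 'k) \<times> 'g) set" where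
  "K_diag K G = {((k, k), \<one>\<^bsub>G\<^esub>) | k. k \<in> carrier K}"

definition G_average :: "('k, 'm) monoid_scheme \<Rightarrow> ('g, 'n) monoid_scheme \<Rightarrow> (('k \<times> 'k) \<times> 'g) set" where
  "G_average K G = {((\<one>\<^bsub>K\<^esub>, \<one>\<^bsub>K\<^esub>), g) | g. g \<in> carrier G}"

definition conj_sym ::
  "('k, 'g) chain_family \<Rightarrow> nat \<Rightarrow> ('k \<times> 'k) \<times> 'g \<Rightarrow>
   (nat \<Rightarrow> nat \<times> nat) op \<Rightarrow> (nat \<Rightarrow> nat \<times> nat) op" where
  "conj_sym C L x B = times_op (dbasis C L) (times_op (dbasis C L) (dsym C L {..<L} x) B)
     (adj_op (dsym C L {..<L} x))"

definition neutral ::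
  "('k, 'g) chain_family \<Rightarrow> nat \<Rightarrow> (('k \<times> 'k) \<times> 'g) set \<Rightarrow> (nat \<Rightarrow> nat \<times> nat) op \<Rightarrow> bool" where
  "neutral C L H B \<longleftrightarrow> (\<forall>x\<in>H. conj_sym C L x B = B)"

text \<open>
  \<open>B\<close> carries nontrivial charge under \<open>H\<close> if it belongs to a nontrivial irreducible multiplet of
  operators; for abelian \<open>H\<close> this means that \<open>B\<close> transforms by a nontrivial character.
\<close>

definition charged ::
  "('k, 'g) chain_family \<Rightarrow> nat \<Rightarrow> (('k \<times> 'k) \<times> 'g) set \<Rightarrow> (nat \<Rightarrow> nat \<times> nat) op \<Rightarrow> bool" where
  "charged C L H B \<longleftrightarrow> (\<exists>V. op_subspace (dbasis C L) V \<and> B \<in> V \<and> B \<noteq> (\<lambda>s t. 0) \<and>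
     (\<forall>x\<in>H. conj_sym C L x ` V \<subseteq> V) \<and>
     (\<forall>W. op_subspace (dbasis C L) W \<and> W \<subseteq> V \<and> (\<forall>x\<in>H. conj_sym C L x ` W \<subseteq> W) \<longrightarrow>
        W = {\<lambda>s t. 0} \<or> W = V) \<and>
     (\<exists>x\<in>H. \<exists>A\<in>V. conj_sym C L x A \<noteq> A))"

text \<open>
  Order in boundary operators of the type described by \<open>P\<close>. Without a bound on the norm of the
  operators the size of the correlator would be meaningless.
\<close>

definition boundary_order ::
  "('k, 'g) chain_family \<Rightarrow> (nat \<Rightarrow> (nat \<Rightarrow> nat \<times> nat) op \<Rightarrow> bool) \<Rightarrow> bool" where
  "boundary_order C P \<longleftrightarrow> (\<exists>r Bl Br. \<exists>\<epsilon>>0. \<forall>\<^sub>F L in sequentially.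
     supported_on L (doubled (dim C L)) {..<r} (Bl L) \<and>
     supported_on L (doubled (dim C L)) {L - r..<L} (Br L) \<and>
     contraction_op (dbasis C L) (Bl L) \<and> contraction_op (dbasis C L) (Br L) \<and>
     P L (Bl L) \<and> P L (Br L) \<and>
     \<epsilon> \<le> cmod (inner_on (dbasis C L) (choi_state C L)
              (app_op (dbasis C L) (times_op (dbasis C L) (Bl L) (Br L)) (choi_state C L))
            / inner_on (dbasis C L) (choi_state C L) (choi_state C L)))"

definition exact_broken_without_diagonal ::
  "('k, 'm) monoid_scheme \<Rightarrow> ('g, 'n) monoid_scheme \<Rightarrow> ('k, 'g) chain_family \<Rightarrow> bool" where
  "exact_broken_without_diagonal K G C \<longleftrightarrow>
     boundary_order C (\<lambda>L B. charged C L (K_plus K G) B \<and> neutral C L (K_minus K G) B \<and>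
       charged C L (K_diag K G) B) \<and>
     boundary_order C (\<lambda>L B. charged C L (K_minus K G) B \<and> neutral C L (K_plus K G) B \<and>
       charged C L (K_diag K G) B)"

definition exact_broken_to_diagonal ::
  "('k, 'm) monoid_scheme \<Rightarrow> ('g, 'n) monoid_scheme \<Rightarrow> ('k, 'g) chain_family \<Rightarrow> bool" where
  "exact_broken_to_diagonal K G C \<longleftrightarrow>
     boundary_order C (\<lambda>L B. charged C L (K_plus K G) B \<and> charged C L (K_minus K G) B \<and>
       neutral C L (K_diag K G) B)"

definition average_broken ::
  "('k, 'm) monoid_scheme \<Rightarrow> ('g, 'n) monoid_scheme \<Rightarrow> ('k, 'g) chain_family \<Rightarrow> bool" where
  "average_broken K G C \<longleftrightarrow> boundary_order C (\<lambda>L. charged C L (G_average K G))"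

text \<open>Breaking of a single group element, for abelian symmetry groups.\<close>

definition element_broken :: "('k, 'g) chain_family \<Rightarrow> ('k \<times> 'k) \<times> 'g \<Rightarrow> bool" where
  "element_broken C x \<longleftrightarrow>
     boundary_order C (\<lambda>L B. \<exists>z. z \<noteq> 1 \<and> conj_sym C L x B = scale_op z B)"

definition unbroken_K ::
  "('k, 'm) monoid_scheme \<Rightarrow> ('g, 'n) monoid_scheme \<Rightarrow> ('k, 'g) chain_family \<Rightarrow> 'k set" where
  "unbroken_K K G C = {k \<in> carrier K. \<not> element_broken C ((k, \<one>\<^bsub>K\<^esub>), \<one>\<^bsub>G\<^esub>)}"

definition unbroken_KG ::
  "('k, 'm) monoid_scheme \<Rightarrow> ('g, 'n) monoid_scheme \<Rightarrow> ('k, 'g) chain_family \<Rightarrow> ('k \<times> 'g) set" where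
  "unbroken_KG K G C = {(k, g). k \<in> carrier K \<and> g \<in> carrier G \<and> \<not> element_broken C ((k, \<one>\<^bsub>K\<^esub>), g)}"

definition projective_center :: "('x, 'm) monoid_scheme \<Rightarrow> ('x \<Rightarrow> 'x \<Rightarrow> complex) \<Rightarrow> 'x set" where
  "projective_center H \<omega> = {x \<in> carrier H. \<forall>y\<in>carrier H. \<omega> x y = \<omega> y x}"

end

theory Submission
  imports Defs "HOL-Analysis.Function_Topology" "HOL-Analysis.L2_Norm"
    "HOL-Computational_Algebra.Fundamental_Theorem_Algebra" "HOL-Library.Function_Algebras"
    "HOL-Combinatorics.Transposition"
begin

text \<open>
  The symmetry acts on the state by a phase and on a bulk interval it is undone by unitaries at the
  two ends. The action of \<open>x\<close> between the left edge and the interval, completed by the inverse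
  of the unitary at the left end of the interval, is therefore an operator near the left edge that is undone on
  the state by an analogous operator near the right edge, so the correlator of the two has
  modulus one. The bulk being short-range entangled, these edge operators act on the state
  projectively, with the inverse of the bulk cocycle \<open>\<omega>\<close>.

  For commuting \<open>x\<close> and \<open>y\<close> the edge operator of \<open>y\<close> thus has charge \<open>\<omega> y x / \<omega> x y\<close>
  under \<open>x\<close>. For a general group \<open>K\<close>, the vectors on which an edge operator acts are split into
  a neutral part and irreducible multiplets. If the charged part were small for all edge operators,
  then, by Schur's lemma, \<open>\<omega>\<close> would be approximately a coboundary, and by compactness of a power
  of \<open>U(1)\<close> it would be one. Charges of vectors become charges of operators by passing to
  the edge operator orthogonal to the annihilator of the state.

  The bound by the projective center is attained by a chain of maximally entangled bonds carrying an
  irreducible projective representation, in which the projective center acts by scalars.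
\<close>

section \<open>Finite-dimensional linear algebra\<close>

text \<open>The obstacle is uniformity in \<open>L\<close>: order means operators of norm at most
  one and a correlator bounded below by a constant independent of the length. Every loss is
  therefore measured by one number \<open>N\<close>, a bound on the number of basis configurations
  of an edge region. Operators there form a space of dimension at most N^2, so halving into
  irreducible parts can happen at most N^2 times, and an operator with the Hilbert-Schmidt norm of a
  unitary has operator norm at most the square root of N. As \<open>K\<close> may be infinite,
  averages over the group are replaced by orthogonal projections, and the distance of the cocycle
  from approximate coboundaries comes from compactness, in terms of \<open>K\<close> and the cocycle
  alone. Commuting pairs suffice for the joint case and for the projective center. They do not
  suffice for (a): a nontrivial class of a nonabelian group may restrict trivially to every abelian
  subgroup, and then no commutator detects it, whence the argument with Schur's lemma.\<close>

definition nsq :: "'i set \<Rightarrow> ('i \<Rightarrow> complex) \<Rightarrow> real" where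
  "nsq X v = (\<Sum>s\<in>X. (cmod (v s))\<^sup>2)"

lemma nsq_nonneg: "0 \<le> nsq X v"
  by (simp add: nsq_def sum_nonneg)

lemma inner_self: "inner_on X v v = of_real (nsq X v)"
proof -
  have "cnj z * z = of_real ((cmod z)\<^sup>2)" for z
    by (metis complex_norm_square mult.commute)
  then show ?thesis unfolding inner_on_def nsq_def by simp
qed

lemma inner_cnj: "cnj (inner_on X v w) = inner_on X w v"
  unfolding inner_on_def by (simp add: mult.commute)

lemma inner_right: "inner_on X u (\<lambda>s. z * v s + w * v' s) = z * inner_on X u v + w * inner_on X u v'"
  unfolding inner_on_def by (simp add: sum.distrib sum_distrib_left algebra_simps)

lemma inner_scale_right: "inner_on X u (\<lambda>s. z * v s) = z * inner_on X u v"
  unfolding inner_on_def by (simp add: sum_distrib_left algebra_simps)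

lemma inner_diff_right: "inner_on X u (\<lambda>s. v s - v' s) = inner_on X u v - inner_on X u v'"
  unfolding inner_on_def by (simp add: sum_subtractf algebra_simps)

lemma inner_add_right: "inner_on X u (\<lambda>s. v s + v' s) = inner_on X u v + inner_on X u v'"
  unfolding inner_on_def by (simp add: sum.distrib algebra_simps)

lemma inner_zero_right: "inner_on X u (\<lambda>s. 0) = 0"
  unfolding inner_on_def by simp

lemma inner_left: "inner_on X (\<lambda>s. z * v s + w * v' s) u = cnj z * inner_on X v u + cnj w * inner_on X v' u"
  unfolding inner_on_def by (simp add: sum.distrib sum_distrib_left algebra_simps)

lemma inner_scale_left: "inner_on X (\<lambda>s. z * v s) u = cnj z * inner_on X v u"
  unfolding inner_on_def by (simp add: sum_distrib_left algebra_simps)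

lemma inner_sum_right: "inner_on X u (\<lambda>s. \<Sum>i\<in>I. c i * f i s) = (\<Sum>i\<in>I. c i * inner_on X u (f i))"
proof -
  have "inner_on X u (\<lambda>s. \<Sum>i\<in>I. c i * f i s) = (\<Sum>s\<in>X. \<Sum>i\<in>I. c i * (cnj (u s) * f i s))"
    unfolding inner_on_def by (simp add: sum_distrib_left algebra_simps)
  also have "\<dots> = (\<Sum>i\<in>I. \<Sum>s\<in>X. c i * (cnj (u s) * f i s))" by (rule sum.swap)
  finally show ?thesis unfolding inner_on_def by (simp add: sum_distrib_left)
qed

lemma nsq_scale: "nsq X (\<lambda>s. z * v s) = (cmod z)\<^sup>2 * nsq X v"
  unfolding nsq_def by (simp add: norm_mult power_mult_distrib sum_distrib_left)

lemma nsq_zero [simp]: "nsq X (\<lambda>s. 0) = 0"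
  by (simp add: nsq_def)

lemma nsq_eq_0:
  assumes "finite X" "v \<in> vecs X" "nsq X v = 0"
  shows "v = (\<lambda>s. 0)"
proof
  fix s
  show "v s = 0"
    using assms unfolding nsq_def vecs_def
    by (cases "s \<in> X") (auto simp: sum_nonneg_eq_0_iff)
qed

lemma cauchy_schwarz_sum:
  fixes a b :: "'i \<Rightarrow> real"
  shows "(\<Sum>i\<in>I. a i * b i)\<^sup>2 \<le> (\<Sum>i\<in>I. (a i)\<^sup>2) * (\<Sum>i\<in>I. (b i)\<^sup>2)"
proof -
  have "\<bar>\<Sum>i\<in>I. a i * b i\<bar> \<le> (\<Sum>i\<in>I. \<bar>a i\<bar> * \<bar>b i\<bar>)"
    by (rule order_trans[OF sum_abs]) (simp add: abs_mult)
  also have "\<dots> \<le> L2_set a I * L2_set b I" by (rule L2_set_mult_ineq)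
  finally have "\<bar>\<Sum>i\<in>I. a i * b i\<bar>\<^sup>2 \<le> (L2_set a I * L2_set b I)\<^sup>2" by (rule power_mono) simp
  then show ?thesis by (simp add: power_mult_distrib L2_set_def sum_nonneg)
qed

lemma cauchy_schwarz: "(cmod (inner_on X u v))\<^sup>2 \<le> nsq X u * nsq X v"
proof -
  have "cmod (inner_on X u v) \<le> (\<Sum>s\<in>X. cmod (u s) * cmod (v s))"
    unfolding inner_on_def by (rule order_trans[OF norm_sum]) (simp add: norm_mult)
  then have "(cmod (inner_on X u v))\<^sup>2 \<le> (\<Sum>s\<in>X. cmod (u s) * cmod (v s))\<^sup>2"
    by (rule power_mono) simp
  also have "\<dots> \<le> nsq X u * nsq X v"
    unfolding nsq_def by (rule cauchy_schwarz_sum)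
  finally show ?thesis .
qed

text \<open>Phrased for an approximation \<open>p\<close> of \<open>u\<close> with orthogonal error,
  the shape in which projections use it: neither \<open>p\<close> nor the error is longer than
  \<open>u\<close>.\<close>

lemma pythagoras:
  assumes "inner_on X p (\<lambda>s. u s - p s) = 0"
  shows "nsq X u = nsq X p + nsq X (\<lambda>s. u s - p s)"
proof -
  let ?r = "\<lambda>s. u s - p s"
  have r: "inner_on X ?r p = 0" using assms inner_cnj by (metis complex_cnj_zero)
  have "inner_on X u u = inner_on X (\<lambda>s. 1 * p s + 1 * ?r s) (\<lambda>s. 1 * p s + 1 * ?r s)" by simp
  also have "\<dots> = inner_on X p p + inner_on X ?r ?r"
    unfolding inner_left inner_right using assms r by simp
  finally have "complex_of_real (nsq X u) = of_real (nsq X p + nsq X ?r)"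
    unfolding inner_self by simp
  then show ?thesis unfolding of_real_eq_iff .
qed

lemma nsq_add_sqrt: "sqrt (nsq X (\<lambda>s. u s + v s)) \<le> sqrt (nsq X u) + sqrt (nsq X v)"
proof -
  have "sqrt (nsq X (\<lambda>s. u s + v s)) = L2_set (\<lambda>s. cmod (u s + v s)) X"
    by (simp add: nsq_def L2_set_def)
  also have "\<dots> \<le> L2_set (\<lambda>s. cmod (u s) + cmod (v s)) X"
    by (rule L2_set_mono) (auto intro: norm_triangle_ineq)
  also have "\<dots> \<le> L2_set (\<lambda>s. cmod (u s)) X + L2_set (\<lambda>s. cmod (v s)) X"
    by (rule L2_set_triangle_ineq)
  finally show ?thesis by (simp add: nsq_def L2_set_def)
qed

section \<open>Subspaces, orthonormal families and orthogonal projection\<close>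

definition vsub :: "'i set \<Rightarrow> ('i \<Rightarrow> complex) set \<Rightarrow> bool" where
  "vsub X V \<longleftrightarrow> V \<subseteq> vecs X \<and> (\<lambda>s. 0) \<in> V \<and>
     (\<forall>u\<in>V. \<forall>v\<in>V. \<forall>z w. (\<lambda>s. z * u s + w * v s) \<in> V)"

lemma vsub_vecs: "vsub X (vecs X)"
  by (auto simp: vsub_def vecs_def)

lemma vsubD:
  assumes "vsub X V"
  shows "v \<in> V \<Longrightarrow> v \<in> vecs X" "(\<lambda>s. 0) \<in> V"
    "u \<in> V \<Longrightarrow> v \<in> V \<Longrightarrow> (\<lambda>s. z * u s + w * v s) \<in> V"
  using assms unfolding vsub_def by blast+

lemma vsub_scale: "vsub X V \<Longrightarrow> u \<in> V \<Longrightarrow> (\<lambda>s. z * u s) \<in> V"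
  using vsubD(3)[of X V u u z 0] by simp

lemma vsub_diff: "vsub X V \<Longrightarrow> u \<in> V \<Longrightarrow> v \<in> V \<Longrightarrow> (\<lambda>s. u s - v s) \<in> V"
  using vsubD(3)[of X V u v 1 "-1"] by simp

lemma vsub_sum:
  assumes "vsub X V" "finite I" "\<And>i. i \<in> I \<Longrightarrow> f i \<in> V"
  shows "(\<lambda>s. \<Sum>i\<in>I. c i * f i s) \<in> V"
  using assms(2,3)
proof (induction I rule: finite_induct)
  case empty
  then show ?case using vsubD(2)[OF assms(1)] by simp
next
  case (insert i I)
  then have "(\<lambda>s. c i * f i s + 1 * (\<Sum>i\<in>I. c i * f i s)) \<in> V"
    by (intro vsubD(3)[OF assms(1)]) auto
  then show ?case using insert by simp
qed

definition orthonormal :: "'i set \<Rightarrow> ('i \<Rightarrow> complex) set \<Rightarrow> bool" where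
  "orthonormal X E \<longleftrightarrow> E \<subseteq> vecs X \<and>
     (\<forall>e\<in>E. \<forall>f\<in>E. inner_on X e f = (if e = f then 1 else 0))"

definition proj :: "'i set \<Rightarrow> ('i \<Rightarrow> complex) set \<Rightarrow> ('i \<Rightarrow> complex) \<Rightarrow> 'i \<Rightarrow> complex" where
  "proj X E u = (\<lambda>s. \<Sum>e\<in>E. inner_on X e u * e s)"

lemma inner_proj:
  assumes "orthonormal X E" "finite E" "e \<in> E"
  shows "inner_on X e (proj X E u) = inner_on X e u"
proof -
  have "inner_on X e (proj X E u) = (\<Sum>f\<in>E. inner_on X f u * inner_on X e f)"
    unfolding proj_def by (rule inner_sum_right)
  also have "\<dots> = (\<Sum>f\<in>E. if f = e then inner_on X f u else 0)"
    using assms by (intro sum.cong) (auto simp: orthonormal_def)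
  finally show ?thesis using assms by simp
qed

text \<open>Pointwise scaling makes functions a complex vector space, so span and independence apply
  to vectors that remain plain functions.\<close>

interpretation cfun: vector_space "\<lambda>(z::complex) (v::'i \<Rightarrow> complex) s. z * v s"
  by unfold_locales (auto simp: fun_eq_iff algebra_simps)

lemma cfun_sum_apply: "(\<Sum>i\<in>I. (f i :: 'i \<Rightarrow> complex)) s = (\<Sum>i\<in>I. f i s)"
  by (induction I rule: infinite_finite_induct) auto

lemma orthonormal_independent:
  assumes "orthonormal X E"
  shows "cfun.independent E"
proof
  assume "cfun.dependent E"
  then obtain T u e where T: "finite T" "T \<subseteq> E" "(\<Sum>v\<in>T. (\<lambda>s. u v * v s)) = 0" "e \<in> T" "u e \<noteq> 0"
    unfolding cfun.dependent_explicit by blast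
  have "(\<lambda>s. \<Sum>v\<in>T. u v * v s) = (\<lambda>s. 0)"
    using T(3) unfolding fun_eq_iff cfun_sum_apply by simp
  then have "0 = (\<Sum>v\<in>T. u v * inner_on X e v)"
    using inner_sum_right[of X e u "\<lambda>v. v" T] inner_zero_right[of X e] by simp
  also have "\<dots> = (\<Sum>v\<in>T. if v = e then u v else 0)"
    using T assms by (intro sum.cong) (auto simp: orthonormal_def subset_iff)
  also have "\<dots> = u e" using T by simp
  finally show False using T by simp
qed

lemma orthonormal_card:
  assumes "orthonormal X E" "finite B" "E \<subseteq> cfun.span B"
  shows "finite E" "card E \<le> card B"
  using cfun.independent_span_bound[OF assms(2) orthonormal_independent[OF assms(1)] assms(3)] by auto

lemma sum_in_span:
  assumes "finite I" "\<And>i. i \<in> I \<Longrightarrow> f i \<in> B"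
  shows "(\<lambda>s. \<Sum>i\<in>I. c i * f i s) \<in> cfun.span B"
proof -
  have "(\<Sum>i\<in>I. (\<lambda>s. c i * f i s)) \<in> cfun.span B"
    using assms by (intro cfun.span_sum cfun.span_scale cfun.span_base) auto
  also have "(\<Sum>i\<in>I. (\<lambda>s. c i * f i s)) = (\<lambda>s. \<Sum>i\<in>I. c i * f i s)"
    by (rule ext) (simp only: cfun_sum_apply)
  finally show ?thesis .
qed

text \<open>Dimension is bounded through the size of orthonormal families alone. This makes sense
  for any set of vectors, passes to subsets at once, and drops by one as soon as a nonzero vector
  orthogonal to the subset is found.\<close>

definition rank_le :: "'i set \<Rightarrow> ('i \<Rightarrow> complex) set \<Rightarrow> nat \<Rightarrow> bool" where
  "rank_le X V N \<longleftrightarrow> (\<forall>E. E \<subseteq> V \<and> orthonormal X E \<longrightarrow> finite E \<and> card E \<le> N)"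

lemma rank_le_span:
  assumes "finite B" "V \<subseteq> cfun.span B" "card B \<le> N"
  shows "rank_le X V N"
  using assms orthonormal_card unfolding rank_le_def by (metis order_trans)

lemma rank_le_mono: "rank_le X V N \<Longrightarrow> W \<subseteq> V \<Longrightarrow> rank_le X W N"
  unfolding rank_le_def by blast

lemma rank_le_vecs:
  assumes "finite X" "V \<subseteq> vecs X"
  shows "rank_le X V (card X)"
proof (rule rank_le_span)
  let ?B = "(\<lambda>x s. if s = x then 1 else 0 :: complex) ` X"
  show "finite ?B" "card ?B \<le> card X" using assms by (auto intro: card_image_le)
  show "V \<subseteq> cfun.span ?B"
  proof
    fix v assume "v \<in> V"
    then have "v = (\<lambda>s. \<Sum>x\<in>X. v x * (if s = x then 1 else 0))"
      using assms by (auto simp: vecs_def fun_eq_iff subset_iff if_distrib cong: if_cong)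
    then show "v \<in> cfun.span ?B"
      using sum_in_span[OF assms(1), of "\<lambda>x s. if s = x then 1 else 0 :: complex" ?B v] by auto
  qed
qed

lemma proj_in:
  assumes "vsub X V" "E \<subseteq> V" "finite E"
  shows "proj X E u \<in> V"
  unfolding proj_def using assms by (intro vsub_sum) auto

lemma orthonormal_insert:
  assumes fin: "finite X" and E: "orthonormal X E" "finite E" and r: "r \<in> vecs X" "r \<noteq> (\<lambda>s. 0)"
    and orth: "\<And>e. e \<in> E \<Longrightarrow> inner_on X e r = 0"
  defines "f \<equiv> \<lambda>s. complex_of_real (1 / sqrt (nsq X r)) * r s"
  shows "orthonormal X (insert f E)" "f \<notin> E"
proof -
  have pos: "nsq X r > 0" using nsq_eq_0[OF fin r(1)] r(2) nsq_nonneg[of X r] by force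
  have ff: "inner_on X f f = 1"
    unfolding f_def inner_scale_left inner_scale_right inner_self
    using pos by (simp add: field_simps flip: of_real_mult)
  have ef: "inner_on X e f = 0" if "e \<in> E" for e
    unfolding f_def inner_scale_right using orth[OF that] by simp
  then have fe: "inner_on X f e = 0" if "e \<in> E" for e
    using that inner_cnj by (metis complex_cnj_zero)
  show "f \<notin> E" using ff ef by fastforce
  moreover have "f \<in> vecs X" using r(1) by (auto simp: f_def vecs_def)
  ultimately show "orthonormal X (insert f E)"
    using E ff ef fe unfolding orthonormal_def by auto
qed

text \<open>An orthonormal family of maximal size in \<open>V\<close> spans it: if the projection
  failed to reproduce a vector, the normalised remainder could be added.\<close>

lemma obtain_onb:
  assumes fin: "finite X" and V: "vsub X V"
  obtains E where "orthonormal X E" "finite E" "E \<subseteq> V" "\<And>u. u \<in> V \<Longrightarrow> proj X E u = u"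
proof -
  have rk: "rank_le X V (card X)" using rank_le_vecs[OF fin] V by (auto simp: vsub_def)
  define P where "P n \<longleftrightarrow> (\<exists>E. E \<subseteq> V \<and> orthonormal X E \<and> card E = n)" for n
  have "P 0" unfolding P_def by (rule exI[of _ "{}"]) (auto simp: orthonormal_def)
  moreover have "P n \<Longrightarrow> n \<le> card X" for n using rk unfolding P_def rank_le_def by auto
  ultimately obtain n where n: "P n" "\<And>k. P k \<Longrightarrow> k \<le> n"
    using GreatestI_nat[of P 0 "card X"] Greatest_le_nat[of P _ "card X"] by blast
  then obtain E where E: "E \<subseteq> V" "orthonormal X E" "card E = n" unfolding P_def by blast
  have finE: "finite E" using rk E unfolding rank_le_def by blast
  have "proj X E u = u" if u: "u \<in> V" for u
  proof (rule ccontr)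
    assume ne: "proj X E u \<noteq> u"
    define r where "r = (\<lambda>s. u s - proj X E u s)"
    have rV: "r \<in> V" unfolding r_def using u proj_in[OF V E(1) finE] V by (intro vsub_diff)
    have r0: "r \<noteq> (\<lambda>s. 0)"
    proof
      assume "r = (\<lambda>s. 0)"
      then have "u s = proj X E u s" for s unfolding r_def by (simp add: fun_eq_iff)
      then show False using ne by auto
    qed
    have orth: "inner_on X e r = 0" if "e \<in> E" for e
      unfolding r_def inner_diff_right inner_proj[OF E(2) finE that] by simp
    define f where "f = (\<lambda>s. complex_of_real (1 / sqrt (nsq X r)) * r s)"
    have rX: "r \<in> vecs X" using rV V by (auto simp: vsub_def)
    note ins = orthonormal_insert[OF fin E(2) finE rX r0 orth, folded f_def]
    have "f \<in> V" unfolding f_def by (rule vsub_scale[OF V rV])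
    then have "P (Suc n)"
      unfolding P_def using ins E finE by (intro exI[of _ "insert f E"]) auto
    then show False using n(2) by fastforce
  qed
  then show ?thesis using that E finE by blast
qed

lemma ortho_decomp:
  assumes fin: "finite X" and V: "vsub X V" and u: "u \<in> vecs X"
  obtains p where "p \<in> V" "\<And>v. v \<in> V \<Longrightarrow> inner_on X v (\<lambda>s. u s - p s) = 0"
    "nsq X u = nsq X p + nsq X (\<lambda>s. u s - p s)"
proof -
  obtain E where E: "orthonormal X E" "finite E" "E \<subseteq> V" "\<And>u. u \<in> V \<Longrightarrow> proj X E u = u"
    using obtain_onb[OF fin V] by blast
  let ?p = "proj X E u"
  have p: "?p \<in> V" by (rule proj_in[OF V E(3,2)])
  have *: "inner_on X e (\<lambda>s. u s - ?p s) = 0" if "e \<in> E" for e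
    unfolding inner_diff_right inner_proj[OF E(1,2) that] by simp
  have orth: "inner_on X v (\<lambda>s. u s - ?p s) = 0" if "v \<in> V" for v
  proof -
    have "inner_on X (\<lambda>s. u s - ?p s) v = inner_on X (\<lambda>s. u s - ?p s) (proj X E v)"
      using E(4)[OF that] by simp
    also have "\<dots> = (\<Sum>e\<in>E. inner_on X e v * inner_on X (\<lambda>s. u s - ?p s) e)"
      unfolding proj_def by (rule inner_sum_right)
    also have "\<dots> = 0"
    proof (rule sum.neutral, intro ballI)
      fix e assume "e \<in> E"
      then have "inner_on X (\<lambda>s. u s - ?p s) e = 0" using * by (metis inner_cnj complex_cnj_zero)
      then show "inner_on X e v * inner_on X (\<lambda>s. u s - ?p s) e = 0" by simp
    qed
    finally show ?thesis using inner_cnj by (metis complex_cnj_zero)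
  qed
  show ?thesis using that[OF p orth pythagoras[OF orth[OF p]]] by blast
qed

section \<open>Splitting a vector along irreducible subspaces\<close>

lemma inner_eq_0D:
  assumes "finite X" "v \<in> vecs X" "inner_on X v v = 0"
  shows "v = (\<lambda>s. 0)"
  using assms nsq_eq_0 unfolding inner_self by simp

lemma vsub_orth:
  assumes "vsub X V"
  shows "vsub X {v \<in> V. \<forall>u\<in>U. inner_on X u v = 0}"
  using assms unfolding vsub_def by (auto simp: inner_zero_right inner_right)

text \<open>Adding the normalised \<open>r\<close> to an orthonormal family in \<open>W\<close>
  gives one in \<open>V\<close> with one more member.\<close>

lemma rank_le_drop:
  assumes fin: "finite X" and V: "vsub X V" and rk: "rank_le X V (Suc N)"
    and W: "W \<subseteq> V" and r: "r \<in> V" "r \<noteq> (\<lambda>s. 0)" and orth: "\<And>w. w \<in> W \<Longrightarrow> inner_on X w r = 0"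
  shows "rank_le X W N"
  unfolding rank_le_def
proof (intro allI impI, elim conjE)
  fix E assume E: "E \<subseteq> W" "orthonormal X E"
  then have finE: "finite E" using rk W unfolding rank_le_def by blast
  define f where "f = (\<lambda>s. complex_of_real (1 / sqrt (nsq X r)) * r s)"
  have "r \<in> vecs X" using r V by (auto simp: vsub_def)
  note ins = orthonormal_insert[OF fin E(2) finE this r(2), folded f_def]
  have "f \<in> V" unfolding f_def by (rule vsub_scale[OF V r(1)])
  then have "card (insert f E) \<le> Suc N"
    using rk ins E W orth unfolding rank_le_def by (metis insert_subset order_trans subset_eq)
  then show "finite E \<and> card E \<le> N" using ins E orth finE by (metis Suc_le_mono card_insert_disjoint subset_eq)
qed

text \<open>The maps in \<Phi> are arbitrary, so that one notion serves both vectors under edge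
  operators and operators under conjugation. The zero subspace is not excluded; each use secures a
  nonzero member separately.\<close>

definition irreducible_under ::
  "'i set \<Rightarrow> (('i \<Rightarrow> complex) \<Rightarrow> ('i \<Rightarrow> complex)) set \<Rightarrow> ('i \<Rightarrow> complex) set \<Rightarrow> bool" where
  "irreducible_under X \<Phi> W \<longleftrightarrow> vsub X W \<and> (\<forall>\<phi>\<in>\<Phi>. \<phi> ` W \<subseteq> W) \<and>
     (\<forall>U. vsub X U \<and> U \<subseteq> W \<and> (\<forall>\<phi>\<in>\<Phi>. \<phi> ` U \<subseteq> U) \<longrightarrow> U = {\<lambda>s. 0} \<or> U = W)"

text \<open>
  Splitting off an invariant subspace and its complement loses a factor of at most two in
  \<open>|f|\<close> and lowers the rank, so the loss is controlled by the rank alone.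
\<close>

lemma irreducible_component:
  assumes fin: "finite X" and V: "vsub X V" and inv: "\<forall>\<phi>\<in>\<Phi>. \<phi> ` V \<subseteq> V"
    and adj: "\<forall>\<phi>\<in>\<Phi>. \<exists>\<phi>'\<in>\<Phi>. \<exists>\<kappa>. \<forall>u\<in>V. \<forall>w\<in>V. inner_on X (\<phi> u) w = \<kappa> * inner_on X u (\<phi>' w)"
    and rk: "rank_le X V N" and B: "B \<in> V"
    and f: "\<And>u v. u \<in> V \<Longrightarrow> v \<in> V \<Longrightarrow> f (\<lambda>s. u s - v s) = f u - (f v :: complex)"
    and \<epsilon>: "\<epsilon> \<le> cmod (f B)" "0 < \<epsilon>"
  shows "\<exists>W B'. irreducible_under X \<Phi> W \<and> W \<subseteq> V \<and> B' \<in> W \<and> \<epsilon> / 2 ^ N \<le> cmod (f B') \<and>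
     nsq X B' \<le> nsq X B \<and> (\<forall>w\<in>W. inner_on X w (\<lambda>s. B s - B' s) = 0)"
  using V inv adj rk B f \<epsilon>
proof (induction N arbitrary: V B \<epsilon>)
  case 0
  \<comment> \<open>Rank zero leaves only the zero vector, on which \<open>f\<close> vanishes,
    contrary to the positive lower bound.\<close>
  have "B = (\<lambda>s. 0)"
  proof (rule ccontr)
    assume "B \<noteq> (\<lambda>s. 0)"
    moreover have "B \<in> vecs X" using "0.prems" by (auto simp: vsub_def)
    moreover define g where "g = (\<lambda>s. complex_of_real (1 / sqrt (nsq X B)) * B s)"
    ultimately have "orthonormal X {g}"
      using orthonormal_insert(1)[OF fin, of "{}" B] by (auto simp: orthonormal_def)
    moreover have "g \<in> V"
      unfolding g_def by (rule vsub_scale[OF "0.prems"(1,5)])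
    ultimately have "card {g} \<le> 0" using "0.prems"(4) unfolding rank_le_def by blast
    then show False by simp
  qed
  then have "f B = 0" using "0.prems"(6)[of B B] "0.prems"(5) by simp
  then show ?case using "0.prems" by simp
next
  case (Suc N)
  note V = Suc.prems(1) and inv = Suc.prems(2) and adj = Suc.prems(3) and rk = Suc.prems(4)
    and B = Suc.prems(5) and f = Suc.prems(6)
  show ?case
  proof (cases "irreducible_under X \<Phi> V")
    case True
    have "(1::real) \<le> 2 ^ Suc N" by (rule one_le_power) simp
    then have "\<epsilon> / 2 ^ Suc N \<le> \<epsilon> / 1"
      using Suc.prems(8) by (intro divide_left_mono) auto
    then have "\<epsilon> / 2 ^ Suc N \<le> \<epsilon>" by simp
    then have "\<epsilon> / 2 ^ Suc N \<le> cmod (f B)" using Suc.prems(7) by linarith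
    then show ?thesis
      using True B by (intro exI[of _ V] exI[of _ B]) (auto simp: inner_zero_right)
  next
    case False
    then obtain U where U: "vsub X U" "U \<subseteq> V" "\<forall>\<phi>\<in>\<Phi>. \<phi> ` U \<subseteq> U" "U \<noteq> {\<lambda>s. 0}" "U \<noteq> V"
      using V inv unfolding irreducible_under_def by blast
    \<comment> \<open>Up to scalars, the adjoints of the maps again lie in \<Phi>; therefore the
      orthogonal complement of the invariant \<open>U\<close> is invariant too.\<close>
    define U' where "U' = {v \<in> V. \<forall>u\<in>U. inner_on X u v = 0}"
    have U': "vsub X U'" "U' \<subseteq> V" unfolding U'_def using vsub_orth[OF V] by auto
    have U'inv: "\<phi> ` U' \<subseteq> U'" if \<phi>: "\<phi> \<in> \<Phi>" for \<phi>
    proof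
      fix x assume "x \<in> \<phi> ` U'"
      then obtain v where v: "v \<in> U'" "x = \<phi> v" by blast
      obtain \<phi>' \<kappa> where p: "\<phi>' \<in> \<Phi>" "\<And>u w. u \<in> V \<Longrightarrow> w \<in> V \<Longrightarrow> inner_on X (\<phi> u) w = \<kappa> * inner_on X u (\<phi>' w)"
        using adj \<phi> by meson
      have "inner_on X u x = 0" if u: "u \<in> U" for u
      proof -
        have "\<phi>' u \<in> U" using U(3) p u by blast
        then have "inner_on X v (\<phi>' u) = 0" using v inner_cnj unfolding U'_def
          by (metis (mono_tags, lifting) complex_cnj_zero mem_Collect_eq)
        then have "inner_on X x u = 0" using p(2)[of v u] v u U(2) U'(2) by auto
        then show ?thesis using inner_cnj by (metis complex_cnj_zero)
      qed
      moreover have "x \<in> V" using inv \<phi> v U'(2) by blast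
      ultimately show "x \<in> U'" unfolding U'_def by blast
    qed
    then have U'inv': "\<forall>\<phi>\<in>\<Phi>. \<phi> ` U' \<subseteq> U'" by blast
    obtain u0 where u0: "u0 \<in> U" "u0 \<noteq> (\<lambda>s. 0)" using U(4) vsubD(2)[OF U(1)] by blast
    obtain v0 where v0: "v0 \<in> V" "v0 \<notin> U" using U by blast
    obtain p0 where p0: "p0 \<in> U" "\<And>v. v \<in> U \<Longrightarrow> inner_on X v (\<lambda>s. v0 s - p0 s) = 0"
      using ortho_decomp[OF fin U(1)] v0 vsubD(1)[OF V] by metis
    have r0: "(\<lambda>s. v0 s - p0 s) \<in> U'" "(\<lambda>s. v0 s - p0 s) \<noteq> (\<lambda>s. 0)"
    proof -
      show "(\<lambda>s. v0 s - p0 s) \<in> U'" unfolding U'_def using p0 v0 U(2) vsub_diff[OF V] by blast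
      show "(\<lambda>s. v0 s - p0 s) \<noteq> (\<lambda>s. 0)"
      proof
        assume "(\<lambda>s. v0 s - p0 s) = (\<lambda>s. 0)"
        then have "v0 = p0" by (simp add: fun_eq_iff)
        then show False using p0 v0 by simp
      qed
    qed
    have orthU: "inner_on X w v = 0" if "w \<in> U'" "v \<in> U" for w v
      using that inner_cnj unfolding U'_def by (metis (mono_tags, lifting) complex_cnj_zero mem_Collect_eq)
    have rkU: "rank_le X U N"
      using rank_le_drop[OF fin V rk U(2) _ r0(2)] r0(1) U'(2) unfolding U'_def by blast
    have rkU': "rank_le X U' N"
      using rank_le_drop[OF fin V rk U'(2) _ u0(2)] orthU u0(1) U(2) by blast
    obtain p where p: "p \<in> U" "\<And>v. v \<in> U \<Longrightarrow> inner_on X v (\<lambda>s. B s - p s) = 0"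
        "nsq X B = nsq X p + nsq X (\<lambda>s. B s - p s)"
      using ortho_decomp[OF fin U(1)] B vsubD(1)[OF V] by metis
    define q where "q = (\<lambda>s. B s - p s)"
    have q: "q \<in> U'" unfolding q_def U'_def using p B U(2) vsub_diff[OF V] by blast
    have "f q = f B - f p" unfolding q_def using f B p U(2) by blast
    then have "cmod (f B) \<le> cmod (f p) + cmod (f q)"
      by (metis add.commute diff_add_cancel norm_triangle_ineq)
    have adjS: "\<forall>\<phi>\<in>\<Phi>. \<exists>\<phi>'\<in>\<Phi>. \<exists>\<kappa>. \<forall>u\<in>S. \<forall>w\<in>S. inner_on X (\<phi> u) w = \<kappa> * inner_on X u (\<phi>' w)"
      if S: "S \<subseteq> V" for S
    proof
      fix \<phi> assume "\<phi> \<in> \<Phi>"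
      then obtain \<phi>' \<kappa> where "\<phi>' \<in> \<Phi>" "\<forall>u\<in>V. \<forall>w\<in>V. inner_on X (\<phi> u) w = \<kappa> * inner_on X u (\<phi>' w)"
        using adj by meson
      then show "\<exists>\<phi>'\<in>\<Phi>. \<exists>\<kappa>. \<forall>u\<in>S. \<forall>w\<in>S. inner_on X (\<phi> u) w = \<kappa> * inner_on X u (\<phi>' w)"
        using S by (intro bexI[of _ \<phi>'] exI[of _ \<kappa>]) auto
    qed
    have \<epsilon>2: "0 < \<epsilon> / 2" using Suc.prems(8) by simp
    show ?thesis
    proof -
      \<comment> \<open>One of the two orthogonal parts of \<open>B\<close> carries at least half of
        \<open>f B\<close>, and the recursion continues in its subspace, whose rank is at most
        \<open>N\<close>.\<close>
      consider "\<epsilon> / 2 \<le> cmod (f p)" | "\<epsilon> / 2 \<le> cmod (f q)"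
        using \<open>cmod (f B) \<le> cmod (f p) + cmod (f q)\<close> Suc.prems(7) by linarith
      then show ?thesis
      proof cases
      case 1
      have "\<exists>W B'. irreducible_under X \<Phi> W \<and> W \<subseteq> U \<and> B' \<in> W \<and> (\<epsilon>/2) / 2 ^ N \<le> cmod (f B') \<and>
         nsq X B' \<le> nsq X p \<and> (\<forall>w\<in>W. inner_on X w (\<lambda>s. p s - B' s) = 0)"
        by (rule Suc.IH[OF U(1) U(3) adjS[OF U(2)] rkU p(1) _ 1 \<epsilon>2]) (use f U(2) in blast)
      then obtain W B' where W: "irreducible_under X \<Phi> W" "W \<subseteq> U" "B' \<in> W" "(\<epsilon>/2) / 2 ^ N \<le> cmod (f B')"
         "nsq X B' \<le> nsq X p" "\<And>w. w \<in> W \<Longrightarrow> inner_on X w (\<lambda>s. p s - B' s) = 0" by blast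
      have "inner_on X w (\<lambda>s. B s - B' s) = 0" if "w \<in> W" for w
        using W(6)[OF that] p(2)[of w] W(2) that unfolding inner_diff_right by auto
      moreover have "nsq X B' \<le> nsq X B" using W(5) p(3) nsq_nonneg[of X "\<lambda>s. B s - p s"] by linarith
      moreover have "\<epsilon> / 2 ^ Suc N \<le> cmod (f B')" using W(4) by simp
      ultimately show ?thesis using W U by blast
    next
      case 2
      have "\<exists>W B'. irreducible_under X \<Phi> W \<and> W \<subseteq> U' \<and> B' \<in> W \<and> (\<epsilon>/2) / 2 ^ N \<le> cmod (f B') \<and>
         nsq X B' \<le> nsq X q \<and> (\<forall>w\<in>W. inner_on X w (\<lambda>s. q s - B' s) = 0)"
        by (rule Suc.IH[OF U'(1) U'inv' adjS[OF U'(2)] rkU' q _ 2 \<epsilon>2]) (use f U'(2) in blast)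
      then obtain W B' where W: "irreducible_under X \<Phi> W" "W \<subseteq> U'" "B' \<in> W" "(\<epsilon>/2) / 2 ^ N \<le> cmod (f B')"
         "nsq X B' \<le> nsq X q" "\<And>w. w \<in> W \<Longrightarrow> inner_on X w (\<lambda>s. q s - B' s) = 0" by blast
      have "inner_on X w (\<lambda>s. B s - B' s) = 0" if "w \<in> W" for w
      proof -
        have "inner_on X w p = 0" using orthU W(2) that p(1) by blast
        then show ?thesis using W(6)[OF that] unfolding q_def inner_diff_right by auto
      qed
      moreover have "nsq X B' \<le> nsq X B" using W(5) p(3) nsq_nonneg[of X p] unfolding q_def by linarith
      moreover have "\<epsilon> / 2 ^ Suc N \<le> cmod (f B')" using W(4) by simp
      ultimately show ?thesis using W U' by blast
      qed
    qed
  qed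
qed

section \<open>Operators on a chain\<close>

locale fin_basis =
  fixes X :: "'c set"
  assumes finX: "finite X"
begin

abbreviation mul (infixl "\<odot>" 70) where "A \<odot> B \<equiv> times_op X A B"
abbreviation app (infixr "\<triangleright>" 65) where "A \<triangleright> v \<equiv> app_op X A v"
abbreviation "inn \<equiv> inner_on X"
abbreviation "unitary \<equiv> unitary_op X"

lemma opsD: "A \<in> ops X \<Longrightarrow> s \<notin> X \<Longrightarrow> A s t = 0" "A \<in> ops X \<Longrightarrow> t \<notin> X \<Longrightarrow> A s t = 0"
  by (auto simp: ops_def)

lemma times_ops [simp]: "A \<in> ops X \<Longrightarrow> B \<in> ops X \<Longrightarrow> A \<odot> B \<in> ops X"
  by (auto simp: ops_def times_op_def)

lemma one_ops [simp]: "one_op X \<in> ops X"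
  by (auto simp: ops_def one_op_def)

lemma adj_ops [simp]: "A \<in> ops X \<Longrightarrow> adj_op A \<in> ops X"
  by (auto simp: ops_def adj_op_def)

lemma adj_adj [simp]: "adj_op (adj_op A) = A"
  by (auto simp: adj_op_def)

lemma adj_one [simp]: "adj_op (one_op X) = one_op X"
  by (auto simp: adj_op_def one_op_def fun_eq_iff)

lemma adj_times: "adj_op (A \<odot> B) = adj_op B \<odot> adj_op A"
  by (auto simp: adj_op_def times_op_def fun_eq_iff mult.commute)

lemma times_assoc: "(A \<odot> B) \<odot> C = A \<odot> (B \<odot> C)"
proof (intro ext)
  fix s t
  have "((A \<odot> B) \<odot> C) s t = (\<Sum>r\<in>X. \<Sum>q\<in>X. A s q * B q r * C r t)"
    by (simp add: times_op_def sum_distrib_right)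
  also have "\<dots> = (\<Sum>q\<in>X. \<Sum>r\<in>X. A s q * B q r * C r t)" by (rule sum.swap)
  also have "\<dots> = (A \<odot> (B \<odot> C)) s t"
    by (simp add: times_op_def sum_distrib_left mult.assoc)
  finally show "((A \<odot> B) \<odot> C) s t = (A \<odot> (B \<odot> C)) s t" .
qed

lemma one_times [simp]: "A \<in> ops X \<Longrightarrow> one_op X \<odot> A = A"
proof (intro ext)
  fix s t assume A: "A \<in> ops X"
  have "(one_op X \<odot> A) s t = (\<Sum>r\<in>X. if r = s then A r t else 0)"
    unfolding times_op_def one_op_def by (intro sum.cong) auto
  then show "(one_op X \<odot> A) s t = A s t" using finX opsD(1)[OF A] by auto
qed

lemma times_one [simp]: "A \<in> ops X \<Longrightarrow> A \<odot> one_op X = A"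
  by (metis adj_adj adj_one adj_ops adj_times one_times)

lemma app_times: "(A \<odot> B) \<triangleright> v = A \<triangleright> B \<triangleright> v"
proof
  fix s
  have "((A \<odot> B) \<triangleright> v) s = (\<Sum>t\<in>X. \<Sum>q\<in>X. A s q * B q t * v t)"
    by (simp add: times_op_def app_op_def sum_distrib_right)
  also have "\<dots> = (\<Sum>q\<in>X. \<Sum>t\<in>X. A s q * B q t * v t)" by (rule sum.swap)
  also have "\<dots> = (A \<triangleright> B \<triangleright> v) s"
    by (simp add: app_op_def sum_distrib_left mult.assoc)
  finally show "((A \<odot> B) \<triangleright> v) s = (A \<triangleright> B \<triangleright> v) s" .
qed

lemma app_vecs [simp]: "A \<in> ops X \<Longrightarrow> A \<triangleright> v \<in> vecs X"
  by (auto simp: vecs_def app_op_def opsD)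

lemma app_one [simp]: "v \<in> vecs X \<Longrightarrow> one_op X \<triangleright> v = v"
proof
  fix s assume v: "v \<in> vecs X"
  have "(one_op X \<triangleright> v) s = (\<Sum>r\<in>X. if r = s then v r else 0)"
    unfolding app_op_def one_op_def by (intro sum.cong) auto
  then show "(one_op X \<triangleright> v) s = v s" using finX v by (auto simp: vecs_def)
qed

lemma app_lin: "A \<triangleright> (\<lambda>s. z * v s + w * v' s) = (\<lambda>s. z * (A \<triangleright> v) s + w * (A \<triangleright> v') s)"
  by (auto simp: app_op_def fun_eq_iff sum_distrib_left algebra_simps sum.distrib)

lemma app_scale: "A \<triangleright> (\<lambda>s. z * v s) = (\<lambda>s. z * (A \<triangleright> v) s)"
  by (auto simp: app_op_def fun_eq_iff sum_distrib_left algebra_simps)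

lemma app_diff: "A \<triangleright> (\<lambda>s. v s - v' s) = (\<lambda>s. (A \<triangleright> v) s - (A \<triangleright> v') s)"
  by (auto simp: app_op_def fun_eq_iff algebra_simps sum_subtractf)

lemma app_zero [simp]: "A \<triangleright> (\<lambda>s. 0) = (\<lambda>s. 0)"
  by (auto simp: app_op_def)

lemma app_sum: "A \<triangleright> (\<lambda>s. \<Sum>i\<in>I. c i * f i s) = (\<lambda>s. \<Sum>i\<in>I. c i * (A \<triangleright> f i) s)"
proof
  fix s
  have "(A \<triangleright> (\<lambda>s. \<Sum>i\<in>I. c i * f i s)) s = (\<Sum>t\<in>X. \<Sum>i\<in>I. c i * (A s t * f i t))"
    by (simp add: app_op_def sum_distrib_left algebra_simps)
  also have "\<dots> = (\<Sum>i\<in>I. \<Sum>t\<in>X. c i * (A s t * f i t))" by (rule sum.swap)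
  finally show "(A \<triangleright> (\<lambda>s. \<Sum>i\<in>I. c i * f i s)) s = (\<Sum>i\<in>I. c i * (A \<triangleright> f i) s)"
    by (simp add: app_op_def sum_distrib_left)
qed

lemma app_op_lin: "(\<lambda>s t. z * A s t + w * B s t) \<triangleright> v = (\<lambda>s. z * (A \<triangleright> v) s + w * (B \<triangleright> v) s)"
  by (auto simp: app_op_def fun_eq_iff sum_distrib_left algebra_simps sum.distrib)

lemma inner_adj: "inn u (A \<triangleright> v) = inn (adj_op A \<triangleright> u) v"
proof -
  have "inn u (A \<triangleright> v) = (\<Sum>s\<in>X. \<Sum>t\<in>X. cnj (u s) * A s t * v t)"
    by (simp add: inner_on_def app_op_def sum_distrib_left mult.assoc)
  also have "\<dots> = (\<Sum>t\<in>X. \<Sum>s\<in>X. cnj (u s) * A s t * v t)" by (rule sum.swap)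
  also have "\<dots> = inn (adj_op A \<triangleright> u) v"
    by (simp add: inner_on_def app_op_def adj_op_def sum_distrib_right sum_distrib_left mult_ac)
  finally show ?thesis .
qed

lemma unitaryD:
  assumes "unitary U"
  shows "U \<in> ops X" "U \<odot> adj_op U = one_op X" "adj_op U \<odot> U = one_op X"
  using assms by (auto simp: unitary_op_def)

lemma unitary_app:
  assumes "unitary U" "v \<in> vecs X"
  shows "adj_op U \<triangleright> U \<triangleright> v = v" "U \<triangleright> adj_op U \<triangleright> v = v"
  using unitaryD[OF assms(1)] assms(2) app_one by (metis app_times)+

lemma unitary_one [simp]: "unitary (one_op X)"
  by (simp add: unitary_op_def)

lemma unitary_adj [simp]: "unitary U \<Longrightarrow> unitary (adj_op U)"
  by (auto simp: unitary_op_def)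

lemma unitary_times [simp]: "unitary U \<Longrightarrow> unitary V \<Longrightarrow> unitary (U \<odot> V)"
  unfolding unitary_op_def
  by (auto simp: adj_times) (metis (no_types, lifting) adj_ops one_times times_assoc times_ops times_one)+

lemma unitary_inner: "unitary U \<Longrightarrow> v \<in> vecs X \<Longrightarrow> inn (U \<triangleright> u) (U \<triangleright> v) = inn u v"
  by (metis adj_adj inner_adj unitary_app(1))

lemma unitary_nsq: "unitary U \<Longrightarrow> v \<in> vecs X \<Longrightarrow> nsq X (U \<triangleright> v) = nsq X v"
  using unitary_inner[of U v v] unfolding inner_self by simp

text \<open>The equality case of Cauchy-Schwarz: the component of
  \<open>U \<triangleright> \<psi>\<close> along \<psi> already has norm one, so by Pythagoras
  nothing is left over.\<close>

lemma unit_overlap: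
  assumes U: "unitary U" and \<psi>: "\<psi> \<in> vecs X" "nsq X \<psi> = 1" and c: "cmod (inn \<psi> (U \<triangleright> \<psi>)) = 1"
  shows "U \<triangleright> \<psi> = (\<lambda>s. inn \<psi> (U \<triangleright> \<psi>) * \<psi> s)"
proof -
  let ?c = "inn \<psi> (U \<triangleright> \<psi>)"
  let ?p = "\<lambda>s. ?c * \<psi> s"
  let ?r = "\<lambda>s. (U \<triangleright> \<psi>) s - ?p s"
  have cc: "cnj ?c * ?c = 1"
    using c by (metis complex_norm_square mult.commute of_real_1 one_power2)
  have "inn ?p ?r = 0"
    unfolding inner_scale_left inner_diff_right inner_scale_right inner_self using \<psi> by simp
  then have "nsq X (U \<triangleright> \<psi>) = nsq X ?p + nsq X ?r" by (rule pythagoras)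
  moreover have "nsq X (U \<triangleright> \<psi>) = 1" using unitary_nsq[OF U \<psi>(1)] \<psi>(2) by simp
  moreover have "nsq X ?p = 1" unfolding nsq_scale using c \<psi> by simp
  ultimately have "nsq X ?r = 0" by simp
  moreover have "?r \<in> vecs X" using unitaryD(1)[OF U] \<psi>(1)
    by (auto simp: vecs_def app_op_def opsD)
  ultimately have "?r = (\<lambda>s. 0)" using nsq_eq_0[OF finX] by blast
  then show ?thesis by (simp add: fun_eq_iff)
qed

end

section \<open>Locality of operators on a chain\<close>

locale chain =
  fixes L :: nat and Q :: "nat \<Rightarrow> 'b set"
  assumes finQ: "i < L \<Longrightarrow> finite (Q i)"
begin

abbreviation "X \<equiv> configs L Q"

lemma finite_configs: "finite X"
  unfolding configs_def using finQ by (intro finite_PiE) auto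

end

sublocale chain \<subseteq> fin_basis "configs L Q"
  by unfold_locales (rule finite_configs)

context chain
begin

abbreviation mulc (infixl "\<odot>" 70) where "A \<odot> B \<equiv> times_op X A B"
abbreviation appc (infixr "\<triangleright>" 65) where "A \<triangleright> v \<equiv> app_op X A v"
abbreviation "supp \<equiv> supported_on L Q"

lemma configs_ext: "s \<in> X \<Longrightarrow> t \<in> X \<Longrightarrow> (\<And>i. i < L \<Longrightarrow> s i = t i) \<Longrightarrow> s = t"
  unfolding configs_def by (auto intro: PiE_ext)

lemma configs_mem: "s \<in> X \<longleftrightarrow> s \<in> extensional {..<L} \<and> (\<forall>i<L. s i \<in> Q i)"
  by (auto simp: configs_def PiE_def Pi_def)

definition mix :: "nat set \<Rightarrow> (nat \<Rightarrow> 'b) \<Rightarrow> (nat \<Rightarrow> 'b) \<Rightarrow> nat \<Rightarrow> 'b" where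
  "mix S s t = (\<lambda>i. if i \<in> S then s i else t i)"

lemma mix_apply [simp]: "i \<in> S \<Longrightarrow> mix S s t i = s i" "i \<notin> S \<Longrightarrow> mix S s t i = t i"
  by (auto simp: mix_def)

lemma mix_if: "mix S s t i = (if i \<in> S then s i else t i)"
  by (simp add: mix_def)

lemma mix_configs [simp]: "s \<in> X \<Longrightarrow> t \<in> X \<Longrightarrow> mix S s t \<in> X"
  unfolding configs_mem mix_def extensional_def by auto

lemma supp_ops: "supp S A \<Longrightarrow> A \<in> ops X"
  by (simp add: supported_on_def)

lemma supp_zero:
  assumes "supp S A" "s \<in> X" "t \<in> X" "i < L" "i \<notin> S" "s i \<noteq> t i"
  shows "A s t = 0"
  using assms unfolding supported_on_def by auto

text \<open>With \<open>supp_zero\<close> this expresses support in \<open>S\<close> without the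
  witness \<open>a\<close>: matrix elements vanish between configurations that differ off
  \<open>S\<close>, and otherwise depend only on the restrictions to \<open>S\<close>.\<close>

lemma supp_eq:
  assumes "supp S A" and X: "s \<in> X" "t \<in> X" "s' \<in> X" "t' \<in> X"
    and off: "\<And>i. i < L \<Longrightarrow> i \<notin> S \<Longrightarrow> s i = t i" "\<And>i. i < L \<Longrightarrow> i \<notin> S \<Longrightarrow> s' i = t' i"
    and on: "\<And>i. i < L \<Longrightarrow> i \<in> S \<Longrightarrow> s i = s' i" "\<And>i. i < L \<Longrightarrow> i \<in> S \<Longrightarrow> t i = t' i"
  shows "A s t = A s' t'"
proof -
  have eq: "restrict u S = restrict u' S" if "u \<in> X" "u' \<in> X" "\<And>i. i < L \<Longrightarrow> i \<in> S \<Longrightarrow> u i = u' i" for u u'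
  proof
    fix i
    show "restrict u S i = restrict u' S i"
      using that by (cases "i < L") (auto simp: configs_mem extensional_def)
  qed
  obtain a where a: "\<And>s t. s \<in> X \<Longrightarrow> t \<in> X \<Longrightarrow>
     A s t = (if \<forall>i\<in>{..<L} - S. s i = t i then a (restrict s S) (restrict t S) else 0)"
    using assms(1) unfolding supported_on_def by blast
  have "restrict s S = restrict s' S" "restrict t S = restrict t' S"
    using eq[OF X(1,3)] eq[OF X(2,4)] on by auto
  then show ?thesis using a X off by auto
qed

text \<open>Converse of \<open>supp_zero\<close> and \<open>supp_eq\<close>. The local matrix is
  read off from some chosen pair of configurations that agree off \<open>S\<close> and have the
  prescribed restrictions.\<close>

lemma suppI:
  assumes A: "A \<in> ops X"
    and 0: "\<And>s t i. s \<in> X \<Longrightarrow> t \<in> X \<Longrightarrow> i < L \<Longrightarrow> i \<notin> S \<Longrightarrow> s i \<noteq> t i \<Longrightarrow> A s t = 0"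
    and eq: "\<And>s t s' t'. s \<in> X \<Longrightarrow> t \<in> X \<Longrightarrow> s' \<in> X \<Longrightarrow> t' \<in> X \<Longrightarrow>
      (\<And>i. i < L \<Longrightarrow> i \<notin> S \<Longrightarrow> s i = t i) \<Longrightarrow> (\<And>i. i < L \<Longrightarrow> i \<notin> S \<Longrightarrow> s' i = t' i) \<Longrightarrow>
      (\<And>i. i < L \<Longrightarrow> i \<in> S \<Longrightarrow> s i = s' i) \<Longrightarrow> (\<And>i. i < L \<Longrightarrow> i \<in> S \<Longrightarrow> t i = t' i) \<Longrightarrow> A s t = A s' t'"
  shows "supp S A"
proof -
  define R where "R p q st \<longleftrightarrow> fst st \<in> X \<and> snd st \<in> X \<and> (\<forall>i\<in>{..<L} - S. fst st i = snd st i) \<and>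
    restrict (fst st) S = p \<and> restrict (snd st) S = q" for p q st
  define a where "a p q = A (fst (SOME st. R p q st)) (snd (SOME st. R p q st))" for p q
  have "A s t = (if \<forall>i\<in>{..<L} - S. s i = t i then a (restrict s S) (restrict t S) else 0)"
    if s: "s \<in> X" and t: "t \<in> X" for s t
  proof (cases "\<forall>i\<in>{..<L} - S. s i = t i")
    case True
    define st where "st = (SOME st. R (restrict s S) (restrict t S) st)"
    have "R (restrict s S) (restrict t S) (s, t)" using True s t by (auto simp: R_def)
    then have st: "R (restrict s S) (restrict t S) st" unfolding st_def by (rule someI)
    have "u i = v i" if "restrict u S = restrict v S" "i \<in> S" for u v :: "nat \<Rightarrow> 'b" and i
      using that by (metis restrict_apply')
    then have "A s t = A (fst st) (snd st)"
      using st s t True unfolding R_def by (intro eq) (auto simp del: restrict_apply)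
    then show ?thesis using True by (simp add: a_def st_def)
  next
    case False
    then show ?thesis using 0[OF s t] by auto
  qed
  then show ?thesis unfolding supported_on_def using A by blast
qed

text \<open>Only sites inside the chain are compared, so gate windows and light cones may stick out
  of it.\<close>

lemma supp_mono:
  assumes "supp S A" "S \<inter> {..<L} \<subseteq> S'"
  shows "supp S' A"
proof (rule suppI)
  show "A \<in> ops X" by (rule supp_ops[OF assms(1)])
next
  fix s t i assume "s \<in> X" "t \<in> X" "i < L" "i \<notin> S'" "s i \<noteq> t i"
  then show "A s t = 0" using supp_zero[OF assms(1)] assms(2) by blast
next
  fix s t s' t'
  assume *: "s \<in> X" "t \<in> X" "s' \<in> X" "t' \<in> X"
      "\<And>i. i < L \<Longrightarrow> i \<notin> S' \<Longrightarrow> s i = t i" "\<And>i. i < L \<Longrightarrow> i \<notin> S' \<Longrightarrow> s' i = t' i"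
      "\<And>i. i < L \<Longrightarrow> i \<in> S' \<Longrightarrow> s i = s' i" "\<And>i. i < L \<Longrightarrow> i \<in> S' \<Longrightarrow> t i = t' i"
  show "A s t = A s' t'"
  proof (cases "\<forall>i<L. i \<notin> S \<longrightarrow> s i = t i")
    case True
    have "s' i = t' i" if "i < L" "i \<notin> S" for i
      using that True * by (cases "i \<in> S'") (metis, metis)
    then show ?thesis using True * assms(2) by (intro supp_eq[OF assms(1)]) auto
  next
    case False
    then obtain i where i: "i < L" "i \<notin> S" "s i \<noteq> t i" by blast
    then have "s' i \<noteq> t' i" using * by metis
    then show ?thesis using supp_zero[OF assms(1)] i * by metis
  qed
qed

lemma supp_one [simp]: "supp S (one_op X)"
proof (rule suppI)
  fix s t i assume "s \<in> X" "t \<in> X" "i < L" "i \<notin> S" "s i \<noteq> t i"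
  then show "one_op X s t = 0" by (auto simp: one_op_def)
next
  fix s t s' t'
  assume *: "s \<in> X" "t \<in> X" "s' \<in> X" "t' \<in> X"
      "\<And>i. i < L \<Longrightarrow> i \<notin> S \<Longrightarrow> s i = t i" "\<And>i. i < L \<Longrightarrow> i \<notin> S \<Longrightarrow> s' i = t' i"
      "\<And>i. i < L \<Longrightarrow> i \<in> S \<Longrightarrow> s i = s' i" "\<And>i. i < L \<Longrightarrow> i \<in> S \<Longrightarrow> t i = t' i"
  have "s = t \<longleftrightarrow> s' = t'"
  proof
    assume "s = t" then show "s' = t'" using * by (intro configs_ext) (auto, metis)
  next
    assume "s' = t'" then show "s = t" using * by (intro configs_ext) (auto, metis)
  qed
  then show "one_op X s t = one_op X s' t'" using * by (auto simp: one_op_def)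
qed auto

lemma supp_adj: "supp S A \<Longrightarrow> supp S (adj_op A)"
proof (rule suppI)
  assume A: "supp S A"
  then show "adj_op A \<in> ops X" using supp_ops by auto
  fix s t i assume "s \<in> X" "t \<in> X" "i < L" "i \<notin> S" "s i \<noteq> t i"
  then show "adj_op A s t = 0" unfolding adj_op_def using supp_zero[OF A, of t s i] by auto
next
  fix s t s' t'
  assume A: "supp S A" and *: "s \<in> X" "t \<in> X" "s' \<in> X" "t' \<in> X"
      "\<And>i. i < L \<Longrightarrow> i \<notin> S \<Longrightarrow> s i = t i" "\<And>i. i < L \<Longrightarrow> i \<notin> S \<Longrightarrow> s' i = t' i"
      "\<And>i. i < L \<Longrightarrow> i \<in> S \<Longrightarrow> s i = s' i" "\<And>i. i < L \<Longrightarrow> i \<in> S \<Longrightarrow> t i = t' i"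
  have "A t s = A t' s'" by (rule supp_eq[OF A]) (use * in auto)
  then show "adj_op A s t = adj_op A s' t'" by (simp add: adj_op_def)
qed

lemma supp_times:
  assumes A: "supp S A" and B: "supp S B"
  shows "supp S (A \<odot> B)"
proof (rule suppI)
  show "A \<odot> B \<in> ops X" using A B supp_ops by auto
next
  fix s t i assume *: "s \<in> X" "t \<in> X" "i < L" "i \<notin> S" "s i \<noteq> t i"
  have "A s r * B r t = 0" if "r \<in> X" for r
    using supp_zero[OF A *(1) that *(3,4)] supp_zero[OF B that *(2,3,4)] *(5) by fastforce
  then show "(A \<odot> B) s t = 0" unfolding times_op_def by (simp add: sum.neutral)
next
  fix s t s' t'
  assume *: "s \<in> X" "t \<in> X" "s' \<in> X" "t' \<in> X"
      "\<And>i. i < L \<Longrightarrow> i \<notin> S \<Longrightarrow> s i = t i" "\<And>i. i < L \<Longrightarrow> i \<notin> S \<Longrightarrow> s' i = t' i"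
      "\<And>i. i < L \<Longrightarrow> i \<in> S \<Longrightarrow> s i = s' i" "\<And>i. i < L \<Longrightarrow> i \<in> S \<Longrightarrow> t i = t' i"
  \<comment> \<open>An intermediate configuration contributes only if it agrees with the row index
    off \<open>S\<close>. Exchanging the part off \<open>S\<close> carries the sum for
    \<open>s\<close> to the sum for \<open>s'\<close>.\<close>
  define N where "N u = {r \<in> X. \<forall>i<L. i \<notin> S \<longrightarrow> r i = u i}" for u
  have red: "(A \<odot> B) u v = (\<Sum>r\<in>N u. A u r * B r v)" if "u \<in> X" for u v
    unfolding times_op_def
  proof (rule sum.mono_neutral_right)
    show "\<forall>i\<in>X - N u. A u i * B i v = 0"
      using supp_zero[OF A that] unfolding N_def by fastforce
  qed (auto simp: N_def finX)
  have "(\<Sum>r\<in>N s. A s r * B r t) = (\<Sum>r\<in>N s'. A s' r * B r t')"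
  proof (rule sum.reindex_bij_witness[of _ "\<lambda>r. mix S r s" "\<lambda>r. mix S r s'"])
    fix r assume r: "r \<in> N s"
    show "mix S (mix S r s') s = r" "mix S r s' \<in> N s'"
      using r * unfolding N_def by (auto intro!: configs_ext simp: mix_if)
    have "A s' (mix S r s') = A s r" "B (mix S r s') t' = B r t"
      using r * unfolding N_def
      by (auto intro!: supp_eq[OF A] supp_eq[OF B] simp: mix_if split: if_splits)
    then show "A s' (mix S r s') * B (mix S r s') t' = A s r * B r t" by simp
  next
    fix r assume r: "r \<in> N s'"
    show "mix S (mix S r s) s' = r" "mix S r s \<in> N s"
      using r * unfolding N_def by (auto intro!: configs_ext simp: mix_if)
  qed
  then show "(A \<odot> B) s t = (A \<odot> B) s' t'" using red * by simp
qed

lemma supp_times':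
  assumes "supp S A" "supp S' B" "S \<subseteq> T" "S' \<subseteq> T"
  shows "supp T (A \<odot> B)"
  using assms by (intro supp_times) (auto intro: supp_mono)

lemma supp_lin:
  assumes A: "supp S A" and B: "supp S B"
  shows "supp S (\<lambda>s t. z * A s t + w * B s t)"
proof (rule suppI)
  show "(\<lambda>s t. z * A s t + w * B s t) \<in> ops X" using supp_ops[OF A] supp_ops[OF B] by (auto simp: ops_def)
next
  fix s t i assume "s \<in> X" "t \<in> X" "i < L" "i \<notin> S" "s i \<noteq> t i"
  then show "z * A s t + w * B s t = 0" using supp_zero[OF A] supp_zero[OF B] by force
next
  fix s t s' t'
  assume *: "s \<in> X" "t \<in> X" "s' \<in> X" "t' \<in> X"
      "\<And>i. i < L \<Longrightarrow> i \<notin> S \<Longrightarrow> s i = t i" "\<And>i. i < L \<Longrightarrow> i \<notin> S \<Longrightarrow> s' i = t' i"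
      "\<And>i. i < L \<Longrightarrow> i \<in> S \<Longrightarrow> s i = s' i" "\<And>i. i < L \<Longrightarrow> i \<in> S \<Longrightarrow> t i = t' i"
  have "A s t = A s' t'" by (rule supp_eq[OF A]) (use * in auto)
  moreover have "B s t = B s' t'" by (rule supp_eq[OF B]) (use * in auto)
  ultimately show "z * A s t + w * B s t = z * A s' t' + w * B s' t'" by simp
qed

text \<open>For disjoint supports a single intermediate configuration contributes to the product,
  \<open>t\<close> on the support of the left factor and \<open>s\<close> elsewhere; by locality
  both orders then give the same two numbers.\<close>

lemma supp_commute:
  assumes A: "supp S A" and B: "supp T B" and disj: "S \<inter> T \<inter> {..<L} = {}"
  shows "A \<odot> B = B \<odot> A"
proof (intro ext)
  fix s t
  have one: "(A \<odot> B) s t = A s (mix S t s) * B (mix S t s) t"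
    if A: "supp S A" and B: "supp T B" and disj: "S \<inter> T \<inter> {..<L} = {}" and s: "s \<in> X" and t: "t \<in> X"
    for A B S T
  proof -
    have z: "A s r * B r t = 0" if r: "r \<in> X" and ne: "r \<noteq> mix S t s" for r
    proof -
      obtain i where i: "i < L" "r i \<noteq> mix S t s i"
        using configs_ext[OF r mix_configs[OF t s]] ne by metis
      show ?thesis
      proof (cases "i \<in> S")
        case True
        then have "i \<notin> T" using disj i by auto
        then show ?thesis using supp_zero[OF B r t i(1)] i True by (auto simp: mix_if)
      next
        case False
        then show ?thesis using supp_zero[OF A s r i(1)] i by (auto simp: mix_if)
      qed
    qed
    have "(A \<odot> B) s t = (\<Sum>r\<in>X. if r = mix S t s then A s r * B r t else 0)"
      unfolding times_op_def using z by (intro sum.cong) auto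
    then show ?thesis using finX mix_configs[OF t s] by simp
  qed
  show "(A \<odot> B) s t = (B \<odot> A) s t"
  proof (cases "s \<in> X \<and> t \<in> X")
    case True
    then have X: "s \<in> X" "t \<in> X" by auto
    show ?thesis
    proof (cases "\<forall>i<L. i \<notin> S \<longrightarrow> i \<notin> T \<longrightarrow> s i = t i")
      case True
      have "A s (mix S t s) = A (mix T t s) t"
        using X True disj by (intro supp_eq[OF A]) (auto simp: mix_if)
      moreover have "B (mix S t s) t = B s (mix T t s)"
        using X True disj by (intro supp_eq[OF B]) (auto simp: mix_if)
      ultimately show ?thesis
        using one[OF A B disj X] one[OF B A _ X] disj by (simp add: Int_ac)
    next
      case False
      then obtain i where i: "i < L" "i \<notin> S" "i \<notin> T" "s i \<noteq> t i" by blast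
      have "A \<odot> B \<in> ops X" "B \<odot> A \<in> ops X" using supp_ops A B by auto
      have "supp (S \<union> T) (A \<odot> B)" "supp (S \<union> T) (B \<odot> A)"
        using A B by (auto intro: supp_times')
      then have "(A \<odot> B) s t = 0" "(B \<odot> A) s t = 0"
        using i by (auto intro!: supp_zero[OF _ X i(1), of "S \<union> T"])
      then show ?thesis by simp
    qed
  next
    case False
    then show ?thesis
      using opsD[OF times_ops[OF supp_ops[OF A] supp_ops[OF B]]] opsD[OF times_ops[OF supp_ops[OF B] supp_ops[OF A]]]
      by (cases "s \<in> X") auto
  qed
qed

lemma supp_app_commute:
  assumes "supp S A" "supp T B" "S \<inter> T = {}"
  shows "A \<triangleright> B \<triangleright> v = B \<triangleright> A \<triangleright> v"
  using supp_commute[OF assms(1,2)] assms(3) app_times by (metis Int_empty_left)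

section \<open>Tensor products of one-site operators\<close>

definition prod_op :: "(nat \<Rightarrow> 'b op) \<Rightarrow> (nat \<Rightarrow> 'b) op" where
  "prod_op a = (\<lambda>s t. if s \<in> X \<and> t \<in> X then \<Prod>i<L. a i (s i) (t i) else 0)"

lemma prod_op_cong: "(\<And>i p q. i < L \<Longrightarrow> p \<in> Q i \<Longrightarrow> q \<in> Q i \<Longrightarrow> a i p q = b i p q) \<Longrightarrow> prod_op a = prod_op b"
  unfolding prod_op_def by (auto simp: fun_eq_iff configs_mem)

lemma prod_op_ops [simp]: "prod_op a \<in> ops X"
  by (auto simp: prod_op_def ops_def)

text \<open>Sites outside \<open>S\<close> carry the identity, so truncation only changes which
  factor stands at a site, and the algebra of truncated symmetries becomes sitewise.\<close>

lemma onsite_prod_op: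
  "onsite_op L Q S a = prod_op (\<lambda>i. if i \<in> S then a i else one_op (Q i))"
proof (intro ext)
  fix s t
  show "onsite_op L Q S a s t = prod_op (\<lambda>i. if i \<in> S then a i else one_op (Q i)) s t"
  proof (cases "s \<in> X \<and> t \<in> X")
    case True
    have "(\<Prod>i<L. (if i \<in> S then a i else one_op (Q i)) (s i) (t i)) =
       (\<Prod>i\<in>{..<L} \<inter> S. a i (s i) (t i)) * (\<Prod>i\<in>{..<L} - S. one_op (Q i) (s i) (t i))"
      by (subst prod.Int_Diff[of _ _ S]) (auto intro!: arg_cong2[of _ _ _ _ "(*)"] prod.cong)
    also have "(\<Prod>i\<in>{..<L} - S. one_op (Q i) (s i) (t i)) = (if \<forall>i\<in>{..<L} - S. s i = t i then 1 else 0)"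
    proof (cases "\<forall>i\<in>{..<L} - S. s i = t i")
      case True
      then show ?thesis using \<open>s \<in> X \<and> t \<in> X\<close>
        by (auto simp: one_op_def configs_mem intro!: prod.neutral)
    next
      case False
      then show ?thesis by (auto simp: one_op_def)
    qed
    finally show ?thesis using True by (auto simp: onsite_op_def prod_op_def Int_commute)
  next
    case False
    then show ?thesis by (auto simp: onsite_op_def prod_op_def)
  qed
qed

lemma prod_op_times: "prod_op a \<odot> prod_op b = prod_op (\<lambda>i. times_op (Q i) (a i) (b i))"
proof (intro ext)
  fix s t
  show "(prod_op a \<odot> prod_op b) s t = prod_op (\<lambda>i. times_op (Q i) (a i) (b i)) s t"
  proof (cases "s \<in> X \<and> t \<in> X")
    case True
    have "(prod_op a \<odot> prod_op b) s t = (\<Sum>r\<in>X. \<Prod>i<L. a i (s i) (r i) * b i (r i) (t i))"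
      unfolding times_op_def using True by (intro sum.cong) (auto simp: prod_op_def prod.distrib)
    also have "\<dots> = (\<Prod>i<L. \<Sum>q\<in>Q i. a i (s i) q * b i q (t i))"
      unfolding configs_def by (subst prod_sum_PiE) (auto simp: finQ)
    finally show ?thesis using True by (simp add: prod_op_def times_op_def)
  next
    case False
    then show ?thesis using opsD[OF times_ops[OF prod_op_ops prod_op_ops]]
      by (auto simp: prod_op_def[of "\<lambda>i. times_op (Q i) (a i) (b i)"])
  qed
qed

lemma prod_op_adj: "adj_op (prod_op a) = prod_op (\<lambda>i. adj_op (a i))"
  by (auto simp: adj_op_def prod_op_def fun_eq_iff)

lemma prod_op_one: "prod_op (\<lambda>i. one_op (Q i)) = one_op X"
proof (intro ext)
  fix s t
  show "prod_op (\<lambda>i. one_op (Q i)) s t = one_op X s t"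
  proof (cases "s \<in> X \<and> t \<in> X")
    case True
    show ?thesis
    proof (cases "s = t")
      case True
      then show ?thesis using \<open>s \<in> X \<and> t \<in> X\<close>
        by (auto simp: prod_op_def one_op_def configs_mem intro!: prod.neutral)
    next
      case False
      then obtain i where "i < L" "s i \<noteq> t i" using configs_ext True by metis
      then show ?thesis using False by (auto simp: prod_op_def one_op_def)
    qed
  qed (auto simp: prod_op_def one_op_def)
qed

lemma prod_op_unitary:
  assumes "\<And>i. i < L \<Longrightarrow> unitary_op (Q i) (a i)"
  shows "unitary (prod_op a)"
proof -
  have "prod_op (\<lambda>i. times_op (Q i) (a i) (adj_op (a i))) = prod_op (\<lambda>i. one_op (Q i))"
    "prod_op (\<lambda>i. times_op (Q i) (adj_op (a i)) (a i)) = prod_op (\<lambda>i. one_op (Q i))"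
    using assms by (auto intro!: prod_op_cong simp: unitary_op_def)
  then show ?thesis unfolding unitary_op_def by (simp add: prod_op_adj prod_op_times prod_op_one)
qed

lemma prod_op_supp:
  assumes "\<And>i. i < L \<Longrightarrow> i \<notin> S \<Longrightarrow> a i = one_op (Q i)"
  shows "supp S (prod_op a)"
proof (rule suppI)
  fix s t i assume *: "s \<in> X" "t \<in> X" "i < L" "i \<notin> S" "s i \<noteq> t i"
  then have "a i (s i) (t i) = 0" using assms by (simp add: one_op_def)
  then show "prod_op a s t = 0" using *(3) unfolding prod_op_def by auto
next
  fix s t s' t'
  assume *: "s \<in> X" "t \<in> X" "s' \<in> X" "t' \<in> X"
      "\<And>i. i < L \<Longrightarrow> i \<notin> S \<Longrightarrow> s i = t i" "\<And>i. i < L \<Longrightarrow> i \<notin> S \<Longrightarrow> s' i = t' i"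
      "\<And>i. i < L \<Longrightarrow> i \<in> S \<Longrightarrow> s i = s' i" "\<And>i. i < L \<Longrightarrow> i \<in> S \<Longrightarrow> t i = t' i"
  have "a i (s i) (t i) = a i (s' i) (t' i)" if i: "i < L" for i
  proof (cases "i \<in> S")
    case False
    then show ?thesis using *(1-6) i assms by (simp add: one_op_def configs_mem)
  qed (use * i in auto)
  then show "prod_op a s t = prod_op a s' t'" using * by (simp add: prod_op_def)
qed auto

end

section \<open>Light cones and the absence of bulk correlations\<close>

context chain
begin

lemma gates_unitary:
  assumes "\<forall>(p, U)\<in>set gs. unitary U \<and> supp {p..<p + R} U"
  shows "unitary (foldr (times_op X) (map snd gs) (one_op X))"
  using assms by (induction gs) auto

lemma conj_times: "adj_op (U \<odot> V) \<odot> Y \<odot> (U \<odot> V) = adj_op V \<odot> (adj_op U \<odot> Y \<odot> U) \<odot> V"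
  by (simp add: adj_times times_assoc)

lemma conj_disjoint:
  assumes U: "unitary U" "supp S U" and Y: "supp T Y" "S \<inter> T = {}"
  shows "adj_op U \<odot> Y \<odot> U = Y"
proof -
  have "Y \<odot> U = U \<odot> Y" using supp_commute[OF Y(1) U(2)] Y(2) by blast
  then have "adj_op U \<odot> Y \<odot> U = (adj_op U \<odot> U) \<odot> Y" by (simp add: times_assoc)
  then show ?thesis using unitaryD[OF U(1)] supp_ops[OF Y(1)] by simp
qed

text \<open>\<open>J\<close> collects the windows of gates already absorbed. As the windows of a
  layer are disjoint, later gates never meet \<open>J\<close>, so only gates meeting
  \<open>{p..<q}\<close> itself enlarge the support. Without this bookkeeping an induction over the
  gates would let the support grow by \<open>R\<close> for every gate instead of once for the
  layer.\<close>

lemma gates_light_cone: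
  assumes "\<forall>(p, U)\<in>set gs. unitary U \<and> supp {p..<p + R} U"
    and "sorted_wrt (\<lambda>(p, U) (p', U'). p + R \<le> p') gs"
    and "supp ({p..<q} \<union> J) Y" "J \<subseteq> {p - R..<q + R}" "\<forall>(p', U)\<in>set gs. J \<inter> {p'..<p' + R} = {}"
    and A: "A = foldr (times_op X) (map snd gs) (one_op X)"
  shows "supp {p - R..<q + R} (adj_op A \<odot> Y \<odot> A)"
  using assms
proof (induction gs arbitrary: J Y A)
  case Nil
  then have Y: "supp {p - R..<q + R} Y" by (intro supp_mono[OF Nil(3)]) auto
  then show ?case using Nil supp_ops by simp
next
  case (Cons g gs)
  obtain p1 U where g: "g = (p1, U)" by (cases g)
  define A' where "A' = foldr (times_op X) (map snd gs) (one_op X)"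
  have U: "unitary U" "supp {p1..<p1 + R} U" using Cons.prems(1) g by auto
  have conj: "adj_op A \<odot> Y \<odot> A = adj_op A' \<odot> (adj_op U \<odot> Y \<odot> U) \<odot> A'"
    using Cons.prems(6) unfolding g A'_def by (simp add: conj_times)
  have gs: "\<forall>(p, U)\<in>set gs. unitary U \<and> supp {p..<p + R} U"
    "sorted_wrt (\<lambda>(p, U) (p', U'). p + R \<le> p') gs"
    using Cons.prems(1,2) by auto
  show ?case
  proof (cases "{p1..<p1 + R} \<inter> {p..<q} = {}")
    case True
    then have "adj_op U \<odot> Y \<odot> U = Y"
      using Cons.prems(5) g by (intro conj_disjoint[OF U Cons.prems(3)]) auto
    then show ?thesis
      unfolding conj using Cons.IH[OF gs Cons.prems(3,4) _ A'_def] Cons.prems(5) by auto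
  next
    case False
    then have w: "{p1..<p1 + R} \<subseteq> {p - R..<q + R}" by auto
    have "supp ({p..<q} \<union> (J \<union> {p1..<p1 + R})) (adj_op U \<odot> Y \<odot> U)"
      by (intro supp_times supp_mono[OF U(2)] supp_mono[OF supp_adj[OF U(2)]] supp_mono[OF Cons.prems(3)]) auto
    moreover have "\<forall>(p', V)\<in>set gs. (J \<union> {p1..<p1 + R}) \<inter> {p'..<p' + R} = {}"
      using Cons.prems(2,5) unfolding g by fastforce
    ultimately show ?thesis
      unfolding conj using Cons.IH[OF gs _ _ _ A'_def] Cons.prems(4) w by simp
  qed
qed

lemma layer_light_cone:
  assumes "circuit_layer L Q R A" "supp {p..<q} Y"
  shows "supp {p - R..<q + R} (adj_op A \<odot> Y \<odot> A)"
proof -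
  obtain gs where gs: "\<forall>(p, U)\<in>set gs. unitary U \<and> supp {p..<p + R} U"
    "sorted_wrt (\<lambda>(p, U) (p', U'). p + R \<le> p') gs"
    "A = foldr (times_op X) (map snd gs) (one_op X)"
    using assms(1) unfolding circuit_layer_def by blast
  show ?thesis using gates_light_cone[OF gs(1,2) _ _ _ gs(3), of p q "{}" Y] assms(2) by simp
qed

lemma layer_unitary: "circuit_layer L Q R A \<Longrightarrow> unitary A"
  unfolding circuit_layer_def using gates_unitary by blast

lemma circuit_unitary:
  assumes "local_circuit L Q R D W"
  shows "unitary W"
proof -
  have "unitary (foldr (times_op X) layers (one_op X))" if "\<forall>A\<in>set layers. circuit_layer L Q R A" for layers
    using that by (induction layers) (auto simp: layer_unitary)
  then show ?thesis using assms unfolding local_circuit_def by blast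
qed

text \<open>Each layer widens the support by \<open>R\<close> on either side; a shorter list of
  layers only gives a smaller cone. Truncated subtraction is right here, since the cone stops at the
  end of the chain.\<close>

lemma circuit_light_cone:
  assumes "local_circuit L Q R D W" "supp {p..<q} Y"
  shows "supp {p - D * R..<q + D * R} (adj_op W \<odot> Y \<odot> W)"
proof -
  have *: "supp {p - length layers * R..<q + length layers * R} (adj_op W \<odot> Y \<odot> W)"
    if "\<forall>A\<in>set layers. circuit_layer L Q R A" "W = foldr (times_op X) layers (one_op X)" "supp {p..<q} Y"
    for layers W p q Y
    using that
  proof (induction layers arbitrary: W Y p q)
    case Nil
    then show ?case using supp_ops by simp
  next
    case (Cons A layers)
    define W' where "W' = foldr (times_op X) layers (one_op X)"
    have *: "supp {p - R..<q + R} (adj_op A \<odot> Y \<odot> A)"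
      using layer_light_cone Cons.prems by simp
    have "supp {p - R - length layers * R..<q + R + length layers * R}
        (adj_op W' \<odot> (adj_op A \<odot> Y \<odot> A) \<odot> W')"
      using Cons.IH[OF _ W'_def *] Cons.prems(1) by simp
    then show ?case
      using Cons.prems(2) by (simp add: conj_times W'_def algebra_simps)
  qed
  obtain layers where l: "length layers \<le> D" "\<forall>A\<in>set layers. circuit_layer L Q R A"
    "W = foldr (times_op X) layers (one_op X)"
    using assms(1) unfolding local_circuit_def by blast
  have "{p - m..<q + m} \<inter> {..<L} \<subseteq> {p - n..<q + n}" if "m \<le> n" for m n using that by auto
  moreover have "length layers * R \<le> D * R" using l(1) by simp
  ultimately show ?thesis using supp_mono[OF *[OF l(2,3) assms(2)]] by blast
qed

section \<open>States that are products across a cut in the bulk\<close>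

definition dep :: "nat set \<Rightarrow> ((nat \<Rightarrow> 'b) \<Rightarrow> complex) \<Rightarrow> bool" where
  "dep I f \<longleftrightarrow> (\<forall>s\<in>X. \<forall>t\<in>X. (\<forall>i<L. i \<in> I \<longrightarrow> s i = t i) \<longrightarrow> f s = f t)"

lemma depD: "dep I f \<Longrightarrow> s \<in> X \<Longrightarrow> t \<in> X \<Longrightarrow> (\<And>i. i < L \<Longrightarrow> i \<in> I \<Longrightarrow> s i = t i) \<Longrightarrow> f s = f t"
  unfolding dep_def by blast

text \<open>Row \<open>s\<close> of an operator supported on \<open>S\<close> can be nonzero only in
  these columns, whose number is bounded by the number of patterns on \<open>S\<close>, whatever the
  length of the chain.\<close>

definition near :: "nat set \<Rightarrow> (nat \<Rightarrow> 'b) \<Rightarrow> (nat \<Rightarrow> 'b) set" where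
  "near S s = {t \<in> X. \<forall>i<L. i \<notin> S \<longrightarrow> t i = s i}"

lemma near_subset: "near S s \<subseteq> X" and finite_near [simp]: "finite (near S s)"
  using finite_subset[OF _ finX] by (auto simp: near_def)

lemma app_near:
  assumes "supp S A" "s \<in> X"
  shows "(A \<triangleright> v) s = (\<Sum>t\<in>near S s. A s t * v t)"
  unfolding app_op_def
proof (rule sum.mono_neutral_right)
  show "\<forall>t\<in>X - near S s. A s t * v t = 0"
    using supp_zero[OF assms] unfolding near_def by fastforce
qed (auto simp: finX near_def)

lemma sum_near_transport:
  assumes s: "s \<in> X" and s': "s' \<in> X"
    and h: "\<And>t. t \<in> near S s \<Longrightarrow> h t = h' (mix S t s')"
  shows "(\<Sum>t\<in>near S s. h t) = (\<Sum>t\<in>near S s'. h' t)"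
proof (rule sum.reindex_bij_witness[of _ "\<lambda>t. mix S t s" "\<lambda>t. mix S t s'"])
  fix t assume t: "t \<in> near S s"
  show "mix S (mix S t s') s = t" "mix S t s' \<in> near S s'"
    using t s s' unfolding near_def by (auto intro!: configs_ext simp: mix_if)
  show "h' (mix S t s') = h t" using h[OF t] by simp
next
  fix t assume t: "t \<in> near S s'"
  show "mix S (mix S t s) s' = t" "mix S t s \<in> near S s"
    using t s s' unfolding near_def by (auto intro!: configs_ext simp: mix_if)
qed

text \<open>The factor \<open>f'\<close> is the same for all \<open>g\<close>. This uniformity is
  what allows a second operator, acting on the other side of the cut, to be applied before or
  after.\<close>

lemma app_product:
  assumes A: "supp I A" and f: "dep I f"
  obtains f' where "dep I f'"
    "\<And>g \<phi>. dep (- I) g \<Longrightarrow> (\<And>s. s \<in> X \<Longrightarrow> \<phi> s = f s * g s) \<Longrightarrow> (\<And>s. s \<in> X \<Longrightarrow> (A \<triangleright> \<phi>) s = f' s * g s)"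
proof
  let ?f = "\<lambda>s. \<Sum>t\<in>near I s. A s t * f t"
  show "dep I ?f"
    unfolding dep_def
  proof (intro ballI impI)
    fix s s' assume X: "s \<in> X" "s' \<in> X" and eq: "\<forall>i<L. i \<in> I \<longrightarrow> s i = s' i"
    show "?f s = ?f s'"
    proof (rule sum_near_transport[OF X])
      fix t assume t: "t \<in> near I s"
      have "A s t = A s' (mix I t s')"
        using t X eq unfolding near_def by (intro supp_eq[OF A]) (auto simp: mix_if)
      moreover have "f t = f (mix I t s')"
        using t X unfolding near_def by (intro depD[OF f]) auto
      ultimately show "A s t * f t = A s' (mix I t s') * f (mix I t s')" by simp
    qed
  qed
  fix g \<phi> s assume g: "dep (- I) g" and \<phi>: "\<And>s. s \<in> X \<Longrightarrow> \<phi> s = f s * g s" and s: "s \<in> X"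
  have "(A \<triangleright> \<phi>) s = (\<Sum>t\<in>near I s. A s t * f t * g s)"
    unfolding app_near[OF A s]
  proof (rule sum.cong)
    fix t assume t: "t \<in> near I s"
    then have "g t = g s" using s unfolding near_def by (intro depD[OF g]) auto
    then show "A s t * \<phi> t = A s t * f t * g s" using \<phi> t near_subset by (auto simp: subset_iff)
  qed simp
  then show "(A \<triangleright> \<phi>) s = ?f s * g s" by (simp add: sum_distrib_right)
qed

lemma dep_mult: "dep I f \<Longrightarrow> dep I g \<Longrightarrow> dep I (\<lambda>s. f s * g s)"
  unfolding dep_def by metis

lemma dep_cnj: "dep I f \<Longrightarrow> dep I (\<lambda>s. cnj (f s))"
  unfolding dep_def by metis

text \<open>Exchanging the parts off \<open>I\<close> of the two summation variables is an
  involution on pairs of configurations.\<close>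

lemma product_swap:
  assumes "dep I F" "dep (- I) G" "dep I H" "dep (- I) K"
  shows "(\<Sum>s\<in>X. F s * G s) * (\<Sum>s\<in>X. H s * K s) = (\<Sum>s\<in>X. F s * K s) * (\<Sum>s\<in>X. H s * G s)"
proof -
  have "(\<Sum>s\<in>X. F s * G s) * (\<Sum>s\<in>X. H s * K s) = (\<Sum>(s, t)\<in>X \<times> X. F s * G s * (H t * K t))"
    by (simp add: sum_product sum.cartesian_product)
  also have "\<dots> = (\<Sum>(s, t)\<in>X \<times> X. F s * K s * (H t * G t))"
  proof (rule sum.reindex_bij_witness[of _ "\<lambda>(s, t). (mix I s t, mix I t s)" "\<lambda>(s, t). (mix I s t, mix I t s)"],
      goal_cases)
    case (5 st)
    obtain s t where st: "st = (s, t)" "s \<in> X" "t \<in> X" using 5 by auto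
    have "F (mix I s t) = F s" "K (mix I s t) = K t" "H (mix I t s) = H t" "G (mix I t s) = G s"
      using st by (auto intro!: depD[OF assms(1)] depD[OF assms(2)] depD[OF assms(3)] depD[OF assms(4)])
    then show ?case using st by simp
  qed (auto intro!: configs_ext simp: mix_if)
  also have "\<dots> = (\<Sum>s\<in>X. F s * K s) * (\<Sum>s\<in>X. H s * G s)"
    by (simp add: sum_product sum.cartesian_product)
  finally show ?thesis .
qed

text \<open>All four expectation values factor across the cut. The extra norm on the left accounts
  for an unnormalised \<phi>.\<close>

lemma product_uncorrelated:
  assumes A: "supp I A" and B: "supp J B" "I \<inter> J = {}" and f: "dep I f" and g: "dep (- I) g"
    and \<phi>: "\<And>s. s \<in> X \<Longrightarrow> \<phi> s = f s * g s"
  shows "inn \<phi> (A \<triangleright> B \<triangleright> \<phi>) * inn \<phi> \<phi> = inn \<phi> (A \<triangleright> \<phi>) * inn \<phi> (B \<triangleright> \<phi>)"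
proof -
  have B': "supp (- I) B" using B by (auto intro: supp_mono)
  obtain f' where f': "dep I f'" "\<And>g \<phi> s. dep (- I) g \<Longrightarrow> (\<And>s. s \<in> X \<Longrightarrow> \<phi> s = f s * g s) \<Longrightarrow> s \<in> X \<Longrightarrow> (A \<triangleright> \<phi>) s = f' s * g s"
    using app_product[OF A f] by blast
  obtain g' where g': "dep (- I) g'" "\<And>h \<phi> s. dep (- (- I)) h \<Longrightarrow> (\<And>s. s \<in> X \<Longrightarrow> \<phi> s = g s * h s) \<Longrightarrow> s \<in> X \<Longrightarrow> (B \<triangleright> \<phi>) s = g' s * h s"
    using app_product[OF B' g] by blast
  have B\<phi>: "(B \<triangleright> \<phi>) s = f s * g' s" if "s \<in> X" for s
    using g'(2)[of f \<phi> s] f \<phi> that by (simp add: mult.commute)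
  have A\<phi>: "(A \<triangleright> \<phi>) s = f' s * g s" if "s \<in> X" for s
    using f'(2)[OF g \<phi>] that by simp
  have AB\<phi>: "(A \<triangleright> B \<triangleright> \<phi>) s = f' s * g' s" if "s \<in> X" for s
    using f'(2)[OF g'(1) B\<phi>] that by simp
  let ?F = "\<lambda>s. cnj (f s) * f' s" and ?G = "\<lambda>s. cnj (g s) * g' s"
  let ?H = "\<lambda>s. cnj (f s) * f s" and ?K = "\<lambda>s. cnj (g s) * g s"
  have "(\<Sum>s\<in>X. ?F s * ?G s) * (\<Sum>s\<in>X. ?H s * ?K s) = (\<Sum>s\<in>X. ?F s * ?K s) * (\<Sum>s\<in>X. ?H s * ?G s)"
    by (intro product_swap[of I] dep_mult dep_cnj f g f'(1) g'(1))
  moreover have "inn \<phi> (A \<triangleright> B \<triangleright> \<phi>) = (\<Sum>s\<in>X. ?F s * ?G s)" "inn \<phi> \<phi> = (\<Sum>s\<in>X. ?H s * ?K s)"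
    "inn \<phi> (A \<triangleright> \<phi>) = (\<Sum>s\<in>X. ?F s * ?K s)" "inn \<phi> (B \<triangleright> \<phi>) = (\<Sum>s\<in>X. ?H s * ?G s)"
    unfolding inner_on_def by (auto intro!: sum.cong simp: AB\<phi> A\<phi> B\<phi> \<phi>)
  ultimately show ?thesis by simp
qed

text \<open>Everything off the bulk set \<open>I\<close> goes into \<open>g\<close>, in particular
  the two ends of the chain, which may be entangled with each other.\<close>

lemma bulk_product_split:
  assumes "bulk_product L Q b \<phi>" "I \<subseteq> {b..<L - b}"
  obtains f g where "dep I f" "dep (- I) g" "\<And>s. s \<in> X \<Longrightarrow> \<phi> s = f s * g s"
proof -
  obtain v \<eta> where \<phi>: "\<And>s. s \<in> X \<Longrightarrow>
      \<phi> s = (\<Prod>i\<in>{b..<L - b}. v i (s i)) * \<eta> (restrict s ({..<L} - {b..<L - b}))"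
    using assms(1) unfolding bulk_product_def by blast
  define f where "f s = (\<Prod>i\<in>I. v i (s i))" for s
  define g where "g s = (\<Prod>i\<in>{b..<L - b} - I. v i (s i)) * \<eta> (restrict s ({..<L} - {b..<L - b}))" for s
  show ?thesis
  proof (rule that)
    show "dep I f" unfolding dep_def f_def
    proof (intro ballI impI prod.cong refl)
      fix s t :: "nat \<Rightarrow> 'b" and i assume "\<forall>i<L. i \<in> I \<longrightarrow> s i = t i" "i \<in> I"
      moreover have "i \<in> {b..<L - b}" using assms(2) \<open>i \<in> I\<close> by blast
      then have "i < L" unfolding atLeastLessThan_iff by linarith
      ultimately show "v i (s i) = v i (t i)" by simp
    qed
    show "dep (- I) g"
      unfolding dep_def
    proof (intro ballI impI)
      fix s t assume *: "s \<in> X" "t \<in> X" "\<forall>i<L. i \<in> - I \<longrightarrow> s i = t i"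
      have "restrict s ({..<L} - {b..<L - b}) = restrict t ({..<L} - {b..<L - b})"
        using * assms(2) by (auto simp: restrict_def fun_eq_iff)
      moreover have "(\<Prod>i\<in>{b..<L - b} - I. v i (s i)) = (\<Prod>i\<in>{b..<L - b} - I. v i (t i))"
        using * by (intro prod.cong) auto
      ultimately show "g s = g t" unfolding g_def by simp
    qed
    fix s assume "s \<in> X"
    then show "\<phi> s = f s * g s"
      unfolding \<phi>[OF \<open>s \<in> X\<close>] f_def g_def
      using prod.subset_diff[OF assms(2), of "\<lambda>i. v i (s i)"] by (simp add: mult_ac)
  qed
qed

text \<open>The absence of bulk correlations. Conjugated by the circuit, \<open>U\<close> stays in
  the bulk and disjoint from \<open>V\<close>, so the expectation value of the product is the
  product of the expectation values. It equals one while both factors have modulus at most one, so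
  the value for \<open>U\<close> has modulus one and \<psi> is an eigenvector. \<open>V\<close> may
  reach the right end, \<open>U\<close> must avoid both ends: only in the bulk is \<phi> a
  product.\<close>

lemma bulk_scalar:
  assumes W: "local_circuit L Q R D W" and \<phi>: "bulk_product L Q b \<phi>"
    and \<psi>: "\<psi> = W \<triangleright> \<phi>" "nsq X \<psi> = 1"
    and U: "unitary U" "supp {p..<q} U" and V: "unitary V" "supp {p'..<L} V"
    and UV: "U \<triangleright> V \<triangleright> \<psi> = \<psi>"
    and bounds: "b + D * R \<le> p" "q + D * R + D * R \<le> p'" "q + D * R \<le> L - b"
  obtains \<nu> where "cmod \<nu> = 1" "U \<triangleright> \<psi> = (\<lambda>s. \<nu> * \<psi> s)"
proof -
  have Wu: "unitary W" by (rule circuit_unitary[OF W])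
  have \<phi>v: "\<phi> \<in> vecs X" using \<phi> by (simp add: bulk_product_def)
  have \<psi>v: "\<psi> \<in> vecs X" using \<psi> unitaryD(1)[OF Wu] by simp
  let ?c = "\<lambda>Y. adj_op W \<odot> Y \<odot> W"
  have exp: "inn \<psi> (Y \<triangleright> \<psi>) = inn \<phi> (?c Y \<triangleright> \<phi>)" for Y
    unfolding \<psi>(1) app_times inner_adj[of \<phi>] adj_adj ..
  let ?I = "{p - D * R..<q + D * R}"
  have sub: "?I \<subseteq> {b..<L - b}" using bounds by auto
  obtain f g where fg: "dep ?I f" "dep (- ?I) g" "\<And>s. s \<in> X \<Longrightarrow> \<phi> s = f s * g s"
    using bulk_product_split[OF \<phi> sub] by blast
  have sU: "supp ?I (?c U)" by (rule circuit_light_cone[OF W U(2)])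
  have sV: "supp {p' - D * R..<L + D * R} (?c V)" by (rule circuit_light_cone[OF W V(2)])
  \<comment> \<open>\<open>W\<close> times its adjoint is inserted between \<open>U\<close> and
    \<open>V\<close>, so that each is conjugated on its own.\<close>
  have "adj_op W \<odot> (U \<odot> V) \<odot> W = ?c U \<odot> ?c V"
  proof -
    have "?c U \<odot> ?c V = adj_op W \<odot> U \<odot> (W \<odot> adj_op W) \<odot> V \<odot> W" by (simp add: times_assoc)
    then show ?thesis using unitaryD[OF Wu] supp_ops[OF U(2)] by (simp add: times_assoc)
  qed
  then have "inn \<phi> (?c U \<triangleright> ?c V \<triangleright> \<phi>) = inn \<psi> ((U \<odot> V) \<triangleright> \<psi>)"
    unfolding exp by (simp add: app_times)
  also have "\<dots> = 1" unfolding app_times UV inner_self \<psi>(2) by simp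
  finally have 1: "inn \<phi> (?c U \<triangleright> ?c V \<triangleright> \<phi>) = 1" .
  have "inn \<phi> \<phi> = 1"
    using unitary_inner[OF Wu \<phi>v, of \<phi>] \<psi> unfolding inner_self by simp
  moreover have "inn \<phi> (?c U \<triangleright> ?c V \<triangleright> \<phi>) * inn \<phi> \<phi> = inn \<phi> (?c U \<triangleright> \<phi>) * inn \<phi> (?c V \<triangleright> \<phi>)"
    using bounds by (intro product_uncorrelated[OF sU sV _ fg]) auto
  ultimately have prod: "inn \<psi> (U \<triangleright> \<psi>) * inn \<psi> (V \<triangleright> \<psi>) = 1"
    using 1 unfolding exp by simp
  have le: "cmod (inn \<psi> (Y \<triangleright> \<psi>)) \<le> 1" if "unitary Y" for Y
  proof -
    have "(cmod (inn \<psi> (Y \<triangleright> \<psi>)))\<^sup>2 \<le> 1"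
      using cauchy_schwarz[of X \<psi> "Y \<triangleright> \<psi>"] unitary_nsq[OF that \<psi>v] \<psi>(2) by simp
    then show ?thesis by (simp add: power2_le_iff_abs_le abs_square_le_1)
  qed
  have "cmod (inn \<psi> (U \<triangleright> \<psi>)) * cmod (inn \<psi> (V \<triangleright> \<psi>)) = 1"
    using prod by (metis norm_mult norm_one)
  then have "cmod (inn \<psi> (U \<triangleright> \<psi>)) = 1"
    using le[OF U(1)] le[OF V(1)]
    by (smt (verit) mult_left_le mult_cancel_left1 norm_ge_zero)
  then show ?thesis using that unit_overlap[OF U(1) \<psi>v \<psi>(2)] by blast
qed

section \<open>Operators on few sites: dimension and norm\<close>

definition pats :: "nat set \<Rightarrow> (nat \<Rightarrow> 'b) set" where
  "pats S = (\<lambda>s. restrict s S) ` X"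

lemma finite_pats [simp]: "finite (pats S)"
  by (simp add: pats_def finX)

text \<open>For nonempty \<open>X\<close> the number of patterns is the dimension of the Hilbert
  space of the sites of \<open>S\<close> in the chain. The bound depends on the size of
  \<open>S\<close> and on the site dimensions, but not on \<open>L\<close>.\<close>

lemma card_pats:
  assumes "\<And>i. i < L \<Longrightarrow> card (Q i) \<le> M" "0 < M" "finite S"
  shows "card (pats S) \<le> M ^ card S"
proof -
  let ?P = "PiE (S \<inter> {..<L}) Q"
  have fin: "finite ?P" using finQ by (intro finite_PiE) auto
  have "pats S \<subseteq> ?P"
    unfolding pats_def by (auto simp: configs_mem extensional_def PiE_def Pi_def)
  then have "card (pats S) \<le> card ?P" using fin by (intro card_mono)
  also have "\<dots> = (\<Prod>i\<in>S \<inter> {..<L}. card (Q i))" by (rule card_PiE) simp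
  also have "\<dots> \<le> (\<Prod>i\<in>S \<inter> {..<L}. M)" using assms(1) by (intro prod_mono) auto
  also have "\<dots> = M ^ card (S \<inter> {..<L})" by simp
  also have "\<dots> \<le> M ^ card S" using assms(2,3) by (intro power_increasing card_mono) auto
  finally show ?thesis .
qed

definition unit_op :: "nat set \<Rightarrow> (nat \<Rightarrow> 'b) \<times> (nat \<Rightarrow> 'b) \<Rightarrow> (nat \<Rightarrow> 'b) op" where
  "unit_op S = (\<lambda>(p, q) s t. if s \<in> X \<and> t \<in> X \<and> (\<forall>i\<in>{..<L} - S. s i = t i) \<and>
     restrict s S = p \<and> restrict t S = q then 1 else 0)"

lemma supp_unit_ops:
  assumes "supp S A"
  obtains a where "A = (\<lambda>s t. \<Sum>pq\<in>pats S \<times> pats S. a pq * unit_op S pq s t)"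
proof -
  obtain a where a: "\<And>s t. s \<in> X \<Longrightarrow> t \<in> X \<Longrightarrow>
     A s t = (if \<forall>i\<in>{..<L} - S. s i = t i then a (restrict s S) (restrict t S) else 0)"
    using assms unfolding supported_on_def by blast
  have "A s t = (\<Sum>pq\<in>pats S \<times> pats S. case_prod a pq * unit_op S pq s t)" for s t
  proof (cases "s \<in> X \<and> t \<in> X \<and> (\<forall>i\<in>{..<L} - S. s i = t i)")
    case True
    have "(\<Sum>pq\<in>pats S \<times> pats S. case_prod a pq * unit_op S pq s t) =
        (\<Sum>pq\<in>pats S \<times> pats S. if pq = (restrict s S, restrict t S) then case_prod a pq else 0)"
      using True by (intro sum.cong) (auto simp: unit_op_def split: if_splits)
    also have "\<dots> = a (restrict s S) (restrict t S)"
      using True by (subst sum.delta) (auto simp: pats_def finX)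
    finally show ?thesis using True a by simp
  next
    case False
    then have "A s t = 0" using a supp_ops[OF assms] opsD by (cases "s \<in> X \<and> t \<in> X") auto
    moreover have "(\<Sum>pq\<in>pats S \<times> pats S. case_prod a pq * unit_op S pq s t) = 0"
      using False by (intro sum.neutral) (auto simp: unit_op_def)
    ultimately show ?thesis by simp
  qed
  then show ?thesis using that by blast
qed

lemma rank_supp_ops:
  "rank_le Y {case_prod A | A. supp S A} ((card (pats S))\<^sup>2)"
proof (rule rank_le_span)
  let ?B = "(\<lambda>pq. case_prod (unit_op S pq)) ` (pats S \<times> pats S)"
  show "finite ?B" by simp
  show "card ?B \<le> (card (pats S))\<^sup>2"
    using card_image_le[of "pats S \<times> pats S" "\<lambda>pq. case_prod (unit_op S pq)"]
    by (simp add: card_cartesian_product power2_eq_square)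
  show "{case_prod A | A. supp S A} \<subseteq> cfun.span ?B"
  proof safe
    fix A assume "supp S A"
    then obtain a where "A = (\<lambda>s t. \<Sum>pq\<in>pats S \<times> pats S. a pq * unit_op S pq s t)"
      by (rule supp_unit_ops)
    then have "case_prod A = (\<lambda>st. \<Sum>pq\<in>pats S \<times> pats S. a pq * case_prod (unit_op S pq) st)"
      by (auto simp: fun_eq_iff)
    then show "case_prod A \<in> cfun.span ?B"
      using sum_in_span[of "pats S \<times> pats S" "\<lambda>pq. case_prod (unit_op S pq)" ?B a] by simp
  qed
qed

text \<open>The vectors reached from \<open>v\<close> are spanned by the images of the matrix units
  on \<open>S\<close>. This bounds the depth of the decomposition of edge vectors, as
  \<open>rank_supp_ops\<close> does for edge operators.\<close>

lemma rank_supp_image: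
  "rank_le Y {A \<triangleright> v | A. supp S A} ((card (pats S))\<^sup>2)"
proof (rule rank_le_span)
  let ?B = "(\<lambda>pq. unit_op S pq \<triangleright> v) ` (pats S \<times> pats S)"
  show "finite ?B" by simp
  show "card ?B \<le> (card (pats S))\<^sup>2"
    using card_image_le[of "pats S \<times> pats S" "\<lambda>pq. unit_op S pq \<triangleright> v"]
    by (simp add: card_cartesian_product power2_eq_square)
  show "{A \<triangleright> v | A. supp S A} \<subseteq> cfun.span ?B"
  proof safe
    fix A assume "supp S A"
    then obtain a where a: "A = (\<lambda>s t. \<Sum>pq\<in>pats S \<times> pats S. a pq * unit_op S pq s t)"
      by (rule supp_unit_ops)
    have "(A \<triangleright> v) s = (\<Sum>pq\<in>pats S \<times> pats S. a pq * (unit_op S pq \<triangleright> v) s)" for s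
    proof -
      have "(A \<triangleright> v) s = (\<Sum>t\<in>X. \<Sum>pq\<in>pats S \<times> pats S. a pq * (unit_op S pq s t * v t))"
        unfolding a app_op_def by (simp add: sum_distrib_right mult.assoc)
      also have "\<dots> = (\<Sum>pq\<in>pats S \<times> pats S. \<Sum>t\<in>X. a pq * (unit_op S pq s t * v t))"
        by (rule sum.swap)
      finally show ?thesis by (simp add: app_op_def sum_distrib_left)
    qed
    then have "A \<triangleright> v = (\<lambda>s. \<Sum>pq\<in>pats S \<times> pats S. a pq * (unit_op S pq \<triangleright> v) s)" by blast
    then show "A \<triangleright> v \<in> cfun.span ?B"
      using sum_in_span[of "pats S \<times> pats S" "\<lambda>pq. unit_op S pq \<triangleright> v" ?B a] by simp
  qed
qed

lemma card_near: "card (near S s) \<le> card (pats S)"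
proof (rule card_inj_on_le[of "\<lambda>t. restrict t S"])
  show "inj_on (\<lambda>t. restrict t S) (near S s)"
  proof (rule inj_onI)
    fix t u assume *: "t \<in> near S s" "u \<in> near S s" "restrict t S = restrict u S"
    have "t i = u i" if "i < L" for i
      using * that unfolding near_def by (cases "i \<in> S") (metis restrict_apply', simp)
    then show "t = u" using * near_subset configs_ext by blast
  qed
qed (use near_subset in \<open>auto simp: pats_def finX\<close>)

text \<open>
  The Hilbert--Schmidt norm of \<open>a \<otimes> 1\<close> on the whole chain is that of \<open>a\<close> times the square root
  of the dimension of the other sites, which is \<open>card X / card (pats S)\<close>.
\<close>

lemma supp_norm_bound:
  assumes A: "supp S A" and hs: "nsq (X \<times> X) (case_prod A) \<le> card X"
  shows "nsq X (A \<triangleright> v) \<le> card (pats S) * nsq X v"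
proof (cases "X = {}")
  case True
  then show ?thesis by (simp add: nsq_def)
next
  case False
  then obtain t0 where t0: "t0 \<in> X" by blast
  \<comment> \<open>\<open>r s\<close> is the squared norm of a row of the local matrix
    \<open>a\<close>, and \<open>\<rho> t\<close>, the sum over all patterns on \<open>S\<close>, is
    its squared Hilbert-Schmidt norm; the latter dominates the squared operator norm.\<close>
  define r where "r s = (\<Sum>t\<in>near S s. (cmod (A s t))\<^sup>2)" for s
  define \<rho> where "\<rho> t = (\<Sum>s\<in>near S t. r s)" for t
  have swap: "(\<Sum>s\<in>X. \<Sum>t\<in>near S s. h s t) = (\<Sum>t\<in>X. \<Sum>s\<in>near S t. h s t)" for h :: "_ \<Rightarrow> _ \<Rightarrow> real"
  proof -
    have ext: "(\<Sum>t\<in>near S s. k t) = (\<Sum>t\<in>X. if t \<in> near S s then k t else 0)" for s and k :: "_ \<Rightarrow> real"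
      by (rule sum.mono_neutral_cong_left) (auto simp: finX near_def)
    have "(\<Sum>s\<in>X. \<Sum>t\<in>near S s. h s t) = (\<Sum>t\<in>X. \<Sum>s\<in>X. if t \<in> near S s then h s t else 0)"
      unfolding ext by (rule sum.swap)
    also have "\<dots> = (\<Sum>t\<in>X. \<Sum>s\<in>X. if s \<in> near S t then h s t else 0)"
      by (intro sum.cong) (auto simp: near_def)
    finally show ?thesis unfolding ext .
  qed
  have r_dep: "r s = r s'" if "s \<in> X" "s' \<in> X" "\<And>i. i < L \<Longrightarrow> i \<in> S \<Longrightarrow> s i = s' i" for s s'
    unfolding r_def
  proof (rule sum_near_transport[OF that(1,2)])
    fix u assume u: "u \<in> near S s"
    have "A s u = A s' (mix S u s')"
      using u that unfolding near_def by (intro supp_eq[OF A]) (auto simp: mix_if)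
    then show "(cmod (A s u))\<^sup>2 = (cmod (A s' (mix S u s')))\<^sup>2" by simp
  qed
  have \<rho>_const: "\<rho> t = \<rho> t0" if "t \<in> X" for t
    unfolding \<rho>_def
  proof (rule sum_near_transport[OF that t0])
    fix u assume "u \<in> near S t"
    then have "u \<in> X" using near_subset by blast
    then show "r u = r (mix S u t0)" using t0 by (intro r_dep) auto
  qed
  have row: "r s = (\<Sum>t\<in>X. (cmod (A s t))\<^sup>2)" if "s \<in> X" for s
    unfolding r_def
  proof (rule sum.mono_neutral_left)
    show "\<forall>t\<in>X - near S s. (cmod (A s t))\<^sup>2 = 0"
      using supp_zero[OF A that] unfolding near_def by fastforce
  qed (auto simp: finX near_def)
  \<comment> \<open>Double counting: row \<open>s\<close> enters \<rho> at each of the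
    configurations near \<open>s\<close>, at most one for every pattern.\<close>
  have "card X * \<rho> t0 = (\<Sum>t\<in>X. \<Sum>s\<in>near S t. r s)" using \<rho>_const by (simp add: \<rho>_def[symmetric])
  also have "\<dots> = (\<Sum>s\<in>X. card (near S s) * r s)" using swap[of "\<lambda>s t. r s"] by simp
  also have "\<dots> \<le> (\<Sum>s\<in>X. card (pats S) * r s)"
    using card_near by (intro sum_mono mult_right_mono) (auto simp: r_def sum_nonneg)
  also have "\<dots> = card (pats S) * nsq (X \<times> X) (case_prod A)"
    unfolding nsq_def by (simp add: row sum_distrib_left sum.cartesian_product case_prod_beta)
  also have "\<dots> \<le> real (card (pats S)) * real (card X)" using hs by (intro mult_left_mono) auto
  finally have "card X * \<rho> t0 \<le> card X * card (pats S)" by (simp add: mult.commute)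
  moreover have "0 < card X" using False finX by (simp add: card_gt_0_iff)
  ultimately have \<rho>le: "\<rho> t0 \<le> card (pats S)" by simp
  have "nsq X (A \<triangleright> v) \<le> (\<Sum>s\<in>X. r s * (\<Sum>t\<in>near S s. (cmod (v t))\<^sup>2))"
    unfolding nsq_def
  proof (rule sum_mono)
    fix s assume s: "s \<in> X"
    have "cmod ((A \<triangleright> v) s) \<le> (\<Sum>t\<in>near S s. cmod (A s t) * cmod (v t))"
      unfolding app_near[OF A s] by (rule order_trans[OF norm_sum]) (simp add: norm_mult)
    then have "(cmod ((A \<triangleright> v) s))\<^sup>2 \<le> (\<Sum>t\<in>near S s. cmod (A s t) * cmod (v t))\<^sup>2"
      by (rule power_mono) simp
    also have "\<dots> \<le> r s * (\<Sum>t\<in>near S s. (cmod (v t))\<^sup>2)"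
      unfolding r_def by (rule cauchy_schwarz_sum)
    finally show "(cmod ((A \<triangleright> v) s))\<^sup>2 \<le> r s * (\<Sum>t\<in>near S s. (cmod (v t))\<^sup>2)" .
  qed
  also have "\<dots> = (\<Sum>t\<in>X. \<Sum>s\<in>near S t. r s * (cmod (v t))\<^sup>2)"
    using swap[of "\<lambda>s t. r s * (cmod (v t))\<^sup>2"] by (simp add: sum_distrib_left)
  also have "\<dots> = (\<Sum>t\<in>X. \<rho> t0 * (cmod (v t))\<^sup>2)"
    using \<rho>_const by (simp add: sum_distrib_right[symmetric] \<rho>_def)
  also have "\<dots> = \<rho> t0 * nsq X v" by (simp add: nsq_def sum_distrib_left)
  also have "\<dots> \<le> card (pats S) * nsq X v" using \<rho>le nsq_nonneg by (intro mult_right_mono)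
  finally show ?thesis .
qed

end

context fin_basis
begin

text \<open>Supplies the Hilbert-Schmidt hypothesis of \<open>supp_norm_bound\<close> for everything
  obtained from an edge unitary by orthogonal projections, which do not increase this norm.\<close>

lemma unitary_hs:
  assumes "unitary U"
  shows "nsq (X \<times> X) (case_prod U) = card X"
proof -
  have "complex_of_real (nsq (X \<times> X) (case_prod U)) = (\<Sum>s\<in>X. \<Sum>t\<in>X. cnj (U s t) * U s t)"
    unfolding inner_self[symmetric] inner_on_def by (simp add: sum.cartesian_product case_prod_beta)
  also have "\<dots> = (\<Sum>s\<in>X. times_op X U (adj_op U) s s)"
    by (simp add: times_op_def adj_op_def mult.commute)
  also have "\<dots> = complex_of_real (card X)"
    unfolding unitaryD(2)[OF assms] by (simp add: one_op_def)
  finally show ?thesis by (metis of_real_eq_iff)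
qed

end

section \<open>The doubled chain\<close>

text \<open>The one-site counterpart of \<open>tensor_conj\<close>; through
  \<open>tc_prod_op\<close> the action on the doubled chain is again a product over sites.\<close>

definition tens :: "nat op \<Rightarrow> nat op \<Rightarrow> (nat \<times> nat) op" where
  "tens A B = (\<lambda>(p, p') (q, q'). A p q * cnj (B p' q'))"

lemma tens_times:
  "times_op (doubled d i) (tens A B) (tens A' B') = tens (times_op (phys d i) A A') (times_op (phys d i) B B')"
proof (intro ext)
  fix s t :: "nat \<times> nat"
  obtain p p' q q' where st: "s = (p, p')" "t = (q, q')" by (metis prod.collapse)
  have "times_op (doubled d i) (tens A B) (tens A' B') s t =
      (\<Sum>a<d i. \<Sum>b<d i. A p a * cnj (B p' b) * (A' a q * cnj (B' b q')))"
    unfolding times_op_def doubled_def sum.cartesian_product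
    by (rule sum.cong) (auto simp: st tens_def)
  also have "\<dots> = (\<Sum>a<d i. A p a * A' a q) * (\<Sum>b<d i. cnj (B p' b * B' b q'))"
    unfolding sum_product by (intro sum.cong) (simp_all add: mult_ac)
  also have "\<dots> = tens (times_op (phys d i) A A') (times_op (phys d i) B B') s t"
    by (simp add: st tens_def times_op_def phys_def)
  finally show "times_op (doubled d i) (tens A B) (tens A' B') s t =
      tens (times_op (phys d i) A A') (times_op (phys d i) B B') s t" .
qed

lemma tens_adj: "adj_op (tens A B) = tens (adj_op A) (adj_op B)"
  by (auto simp: adj_op_def tens_def fun_eq_iff)

lemma tens_one: "tens (one_op (phys d i)) (one_op (phys d i)) = one_op (doubled d i)"
  by (auto simp: one_op_def tens_def doubled_def phys_def fun_eq_iff)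

lemma tens_ops: "A \<in> ops (phys d i) \<Longrightarrow> B \<in> ops (phys d i) \<Longrightarrow> tens A B \<in> ops (doubled d i)"
  by (auto simp: ops_def tens_def doubled_def phys_def)

lemma tens_unitary:
  "unitary_op (phys d i) A \<Longrightarrow> unitary_op (phys d i) B \<Longrightarrow> unitary_op (doubled d i) (tens A B)"
  unfolding unitary_op_def by (simp add: tens_ops tens_adj tens_times tens_one)

lemma fin_basis_phys: "fin_basis (phys d i)"
  by unfold_locales (simp add: phys_def)

lemma fin_basis_doubled: "fin_basis (doubled d i)"
  by unfold_locales (simp add: doubled_def)

locale dchain =
  fixes L :: nat and d :: "nat \<Rightarrow> nat"
begin

sublocale p: chain L "phys d"
  by unfold_locales (simp add: phys_def)

sublocale chain L "doubled d"
  by unfold_locales (simp add: doubled_def)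

abbreviation mulp (infixl "\<otimes>\<otimes>" 70) where "A \<otimes>\<otimes> B \<equiv> times_op p.X A B"
abbreviation muld (infixl "\<odot>" 70) where "A \<odot> B \<equiv> times_op X A B"
abbreviation appd (infixr "\<triangleright>" 65) where "A \<triangleright> v \<equiv> app_op X A v"

abbreviation "ket \<equiv> ket_part L"
abbreviation "bra \<equiv> bra_part L"
abbreviation "tc \<equiv> tensor_conj L d"

lemma ket_bra_configs: "s \<in> X \<Longrightarrow> ket s \<in> p.X" "s \<in> X \<Longrightarrow> bra s \<in> p.X"
  unfolding configs_doubled_iff by auto

definition join :: "(nat \<Rightarrow> nat) \<Rightarrow> (nat \<Rightarrow> nat) \<Rightarrow> nat \<Rightarrow> nat \<times> nat" where
  "join a b = (\<lambda>i\<in>{..<L}. (a i, b i))"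

lemma join:
  assumes "a \<in> p.X" "b \<in> p.X"
  shows "join a b \<in> X" "ket (join a b) = a" "bra (join a b) = b"
proof -
  show *: "ket (join a b) = a" "bra (join a b) = b"
    using assms by (auto simp: join_def ket_part_def bra_part_def p.configs_mem extensional_def restrict_def)
  show "join a b \<in> X"
    unfolding configs_doubled_iff * using assms by (simp add: join_def)
qed

lemma join_ket_bra: "s \<in> X \<Longrightarrow> join (ket s) (bra s) = s"
  using join ket_bra_configs ket_bra_eqI by metis

lemma sum_doubled: "(\<Sum>s\<in>X. h (ket s) (bra s)) = (\<Sum>a\<in>p.X. \<Sum>b\<in>p.X. h a b)"
proof -
  have "(\<Sum>s\<in>X. h (ket s) (bra s)) = (\<Sum>(a, b)\<in>p.X \<times> p.X. h a b)"
    by (rule sum.reindex_bij_witness[of _ "\<lambda>(a, b). join a b" "\<lambda>s. (ket s, bra s)"])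
      (auto simp: join join_ket_bra ket_bra_configs)
  then show ?thesis by (simp add: sum.cartesian_product)
qed

lemma tc_ops [simp]: "tc A B \<in> ops X"
  by (auto simp: ops_def tensor_conj_def)

lemma tc_times: "tc A B \<odot> tc A' B' = tc (A \<otimes>\<otimes> A') (B \<otimes>\<otimes> B')"
proof (intro ext)
  fix s t
  show "(tc A B \<odot> tc A' B') s t = tc (A \<otimes>\<otimes> A') (B \<otimes>\<otimes> B') s t"
  proof (cases "s \<in> X \<and> t \<in> X")
    case True
    let ?h = "\<lambda>a b. A (ket s) a * cnj (B (bra s) b) * (A' a (ket t) * cnj (B' b (bra t)))"
    have "(tc A B \<odot> tc A' B') s t = (\<Sum>r\<in>X. ?h (ket r) (bra r))"
      unfolding times_op_def using True by (intro sum.cong) (auto simp: tensor_conj_def)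
    also have "\<dots> = (\<Sum>a\<in>p.X. \<Sum>b\<in>p.X. ?h a b)" by (rule sum_doubled)
    also have "\<dots> = tc (A \<otimes>\<otimes> A') (B \<otimes>\<otimes> B') s t"
      using True by (auto simp: tensor_conj_def times_op_def sum_product mult_ac intro!: sum.cong)
    finally show ?thesis .
  next
    case False
    then show ?thesis using opsD[OF times_ops[OF tc_ops tc_ops]] opsD[OF tc_ops] by (metis (no_types))
  qed
qed

lemma tc_adj: "adj_op (tc A B) = tc (adj_op A) (adj_op B)"
  by (auto simp: adj_op_def tensor_conj_def fun_eq_iff)

lemma tc_one: "tc (one_op p.X) (one_op p.X) = one_op X"
proof (intro ext)
  fix s t
  show "tc (one_op p.X) (one_op p.X) s t = one_op X s t"
    using ket_bra_eqI[of s L "doubled d" t] ket_bra_configs[of s]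
    by (auto simp: tensor_conj_def one_op_def)
qed

lemma tc_unitary: "p.unitary A \<Longrightarrow> p.unitary B \<Longrightarrow> unitary (tc A B)"
  unfolding unitary_op_def by (simp add: tc_adj tc_times tc_one)

lemma tc_supp:
  assumes A: "p.supp S A" and B: "p.supp S B"
  shows "supp S (tc A B)"
proof (rule suppI)
  fix s t i assume *: "s \<in> X" "t \<in> X" "i < L" "i \<notin> S" "s i \<noteq> t i"
  then consider "ket s i \<noteq> ket t i" | "bra s i \<noteq> bra t i"
    by (auto simp: ket_part_def bra_part_def prod_eq_iff)
  then show "tc A B s t = 0"
  proof cases
    case 1
    then show ?thesis using p.supp_zero[OF A ket_bra_configs(1)[OF *(1)] ket_bra_configs(1)[OF *(2)] *(3,4) 1]
      by (simp add: tensor_conj_def)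
  next
    case 2
    then show ?thesis using p.supp_zero[OF B ket_bra_configs(2)[OF *(1)] ket_bra_configs(2)[OF *(2)] *(3,4) 2]
      by (simp add: tensor_conj_def)
  qed
next
  fix s t s' t'
  assume *: "s \<in> X" "t \<in> X" "s' \<in> X" "t' \<in> X"
      "\<And>i. i < L \<Longrightarrow> i \<notin> S \<Longrightarrow> s i = t i" "\<And>i. i < L \<Longrightarrow> i \<notin> S \<Longrightarrow> s' i = t' i"
      "\<And>i. i < L \<Longrightarrow> i \<in> S \<Longrightarrow> s i = s' i" "\<And>i. i < L \<Longrightarrow> i \<in> S \<Longrightarrow> t i = t' i"
  have "A (ket s) (ket t) = A (ket s') (ket t')"
    using * by (intro p.supp_eq[OF A]) (auto simp: ket_bra_configs, auto simp: ket_part_def)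
  moreover have "B (bra s) (bra t) = B (bra s') (bra t')"
    using * by (intro p.supp_eq[OF B]) (auto simp: ket_bra_configs, auto simp: bra_part_def)
  ultimately show "tc A B s t = tc A B s' t'" using * by (simp add: tensor_conj_def)
qed simp

lemma tc_prod_op: "tc (p.prod_op a) (p.prod_op b) = prod_op (\<lambda>i. tens (a i) (b i))"
proof (intro ext)
  fix s t
  show "tc (p.prod_op a) (p.prod_op b) s t = prod_op (\<lambda>i. tens (a i) (b i)) s t"
  proof (cases "s \<in> X \<and> t \<in> X")
    case True
    have "(\<Prod>i<L. a i (ket s i) (ket t i)) * cnj (\<Prod>i<L. b i (bra s i) (bra t i)) =
      (\<Prod>i<L. tens (a i) (b i) (s i) (t i))"
      unfolding cnj_prod prod.distrib[symmetric]
      by (intro prod.cong) (auto simp: ket_part_def bra_part_def tens_def case_prod_beta)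
    then show ?thesis using True
      by (simp add: tensor_conj_def p.prod_op_def prod_op_def ket_bra_configs)
  qed (auto simp: tensor_conj_def prod_op_def)
qed

section \<open>Vectorised operators and the Choi state\<close>

definition vop :: "(nat \<Rightarrow> nat) op \<Rightarrow> (nat \<Rightarrow> nat \<times> nat) \<Rightarrow> complex" where
  "vop M = (\<lambda>s. if s \<in> X then M (ket s) (bra s) else 0)"

lemma vop_vecs [simp]: "vop M \<in> vecs X"
  by (auto simp: vop_def vecs_def)

lemma vop_scale: "vop (scale_op z M) = (\<lambda>s. z * vop M s)"
  by (auto simp: vop_def scale_op_def)

text \<open>The dictionary between the doubled chain and density matrices: the first factor
  multiplies from the left, the second from the right by its adjoint. Exact and average symmetry of
  \<rho> thereby become statements on the Choi state.\<close>

lemma tc_vop: "tc A B \<triangleright> vop M = vop (A \<otimes>\<otimes> M \<otimes>\<otimes> adj_op B)"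
proof
  fix s
  show "(tc A B \<triangleright> vop M) s = vop (A \<otimes>\<otimes> M \<otimes>\<otimes> adj_op B) s"
  proof (cases "s \<in> X")
    case True
    let ?h = "\<lambda>a b. A (ket s) a * cnj (B (bra s) b) * M a b"
    have "(tc A B \<triangleright> vop M) s = (\<Sum>r\<in>X. ?h (ket r) (bra r))"
      unfolding app_op_def using True by (intro sum.cong) (auto simp: tensor_conj_def vop_def)
    also have "\<dots> = (\<Sum>a\<in>p.X. \<Sum>b\<in>p.X. ?h a b)" by (rule sum_doubled)
    also have "\<dots> = (\<Sum>b\<in>p.X. \<Sum>a\<in>p.X. ?h a b)" by (rule sum.swap)
    also have "\<dots> = vop (A \<otimes>\<otimes> M \<otimes>\<otimes> adj_op B) s"
      using True by (auto simp: vop_def times_op_def adj_op_def sum_distrib_right sum_distrib_left mult_ac intro!: sum.cong)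
    finally show ?thesis .
  qed (auto simp: vop_def app_op_def tensor_conj_def)
qed

lemma choi_vop: "choi L d \<rho> = (\<lambda>s. 1 / complex_of_real (sqrt (\<Prod>i<L. real (d i))) * vop \<rho> s)"
proof
  fix s
  show "choi L d \<rho> s = 1 / complex_of_real (sqrt (\<Prod>i<L. real (d i))) * vop \<rho> s"
  proof (cases "s \<in> X")
    case True
    then show ?thesis using choi_apply[OF True] by (simp add: vop_def)
  next
    case False
    then show ?thesis by (simp add: choi_def app_op_def tensor_conj_def vop_def)
  qed
qed

end

section \<open>Symmetric states\<close>

text \<open>One length \<open>L\<close> is fixed for all constructions on the chain, while the
  symmetry assumptions remain those of the whole family.\<close>

locale family =
  fixes K :: "('k, 'm) monoid_scheme" and G :: "('g, 'n) monoid_scheme"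
    and C :: "('k, 'g) chain_family" and L :: nat
  assumes K: "group K" and G: "group G"
    and dims: "\<And>i. i < L \<Longrightarrow> 0 < chain_family.dim C L i"
    and rho: "density_op (basis C L) (rho C L)"
    and onsite: "onsite_symmetry K G C" and exact: "exact_symmetry K C" and average: "average_symmetry G C"
begin

abbreviation "H \<equiv> (K \<times>\<times> K) \<times>\<times> G"

sublocale dchain L "chain_family.dim C L" .

sublocale H: group H
  by (intro DirProd_group K G)

text \<open>Products and inverses in \<open>H\<close> stay folded, so that group laws apply to
  elements of the threefold product as such.\<close>

declare mult_DirProd [simp del] one_DirProd [simp del] carrier_DirProd [simp del] inv_DirProd [simp del]

abbreviation mulpf (infixl "\<otimes>\<otimes>" 70) where "A \<otimes>\<otimes> B \<equiv> times_op p.X A B"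
abbreviation mulf (infixl "\<odot>" 70) where "A \<odot> B \<equiv> times_op X A B"
abbreviation appf (infixr "\<triangleright>" 65) where "A \<triangleright> v \<equiv> app_op X A v"
abbreviation "d \<equiv> chain_family.dim C L"

definition \<psi> :: "(nat \<Rightarrow> nat \<times> nat) \<Rightarrow> complex" where
  "\<psi> = (\<lambda>s. complex_of_real (1 / sqrt (nsq X (choi_state C L))) * choi_state C L s)"

abbreviation DS :: "nat set \<Rightarrow> ('k \<times> 'k) \<times> 'g \<Rightarrow> (nat \<Rightarrow> nat \<times> nat) op" where
  "DS \<equiv> dsym C L"

definition wsite :: "('k \<times> 'k) \<times> 'g \<Rightarrow> nat \<Rightarrow> (nat \<times> nat) op" where
  "wsite = (\<lambda>((k, k'), g) i. tens (times_op (phys d i) (repK C L i k) (repG C L i g))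
     (times_op (phys d i) (repK C L i k') (repG C L i g)))"

lemma site_rep:
  assumes "i < L"
  shows "unitary_rep K (phys d i) (repK C L i)" "unitary_rep G (phys d i) (repG C L i)"
    "k \<in> carrier K \<Longrightarrow> g \<in> carrier G \<Longrightarrow>
        times_op (phys d i) (repK C L i k) (repG C L i g) =
        times_op (phys d i) (repG C L i g) (repK C L i k)"
  using onsite assms unfolding onsite_symmetry_def by blast+

lemma wsite_unitary:
  assumes "x \<in> carrier H" "i < L"
  shows "unitary_op (doubled d i) (wsite x i)"
proof -
  interpret f: fin_basis "phys d i" by (rule fin_basis_phys)
  obtain k k' g where x: "x = ((k, k'), g)" by (metis prod.collapse)
  show ?thesis
    unfolding wsite_def x using assms(1) site_rep[OF assms(2)]
    by (auto simp: x DirProd_def unitary_rep_def intro!: tens_unitary f.unitary_times)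
qed

lemma wsite_mult:
  assumes "x \<in> carrier H" "y \<in> carrier H" "i < L"
  shows "wsite (x \<otimes>\<^bsub>H\<^esub> y) i = times_op (doubled d i) (wsite x i) (wsite y i)"
proof -
  interpret f: fin_basis "phys d i" by (rule fin_basis_phys)
  obtain k1 k2 g where x: "x = ((k1, k2), g)" by (metis prod.collapse)
  obtain l1 l2 h where y: "y = ((l1, l2), h)" by (metis prod.collapse)
  have c: "k1 \<in> carrier K" "k2 \<in> carrier K" "g \<in> carrier G" "l1 \<in> carrier K" "l2 \<in> carrier K" "h \<in> carrier G"
    using assms(1,2) by (auto simp: x y DirProd_def)
  have r: "times_op (phys d i) (repK C L i (k \<otimes>\<^bsub>K\<^esub> l)) (repG C L i (g \<otimes>\<^bsub>G\<^esub> h)) =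
     times_op (phys d i) (times_op (phys d i) (repK C L i k) (repG C L i g))
       (times_op (phys d i) (repK C L i l) (repG C L i h))" if "k \<in> carrier K" "l \<in> carrier K" for k l
    using site_rep[OF assms(3)] that c unfolding unitary_rep_def by (metis f.times_assoc)
  show ?thesis
    unfolding x y wsite_def using r c by (simp add: DirProd_def tens_times)
qed

lemma UK_prod: "UK C L S k = p.prod_op (\<lambda>i. if i \<in> S then repK C L i k else one_op (phys d i))"
  unfolding UK_def by (rule p.onsite_prod_op)

lemma UG_prod: "UG C L S g = p.prod_op (\<lambda>i. if i \<in> S then repG C L i g else one_op (phys d i))"
  unfolding UG_def by (rule p.onsite_prod_op)

lemma DS_prod:
  assumes "x \<in> carrier H"
  shows "DS S x = prod_op (\<lambda>i. if i \<in> S then wsite x i else one_op (doubled d i))"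
proof -
  obtain k k' g where x: "x = ((k, k'), g)" by (metis prod.collapse)
  have *: "UK C L S k \<otimes>\<otimes> UG C L S g =
      p.prod_op (\<lambda>i. if i \<in> S then times_op (phys d i) (repK C L i k) (repG C L i g) else one_op (phys d i))" for k
  proof -
    have "times_op (phys d i) (one_op (phys d i)) (one_op (phys d i)) = one_op (phys d i)" for i
      using fin_basis.one_times[OF fin_basis_phys fin_basis.one_ops[OF fin_basis_phys]] .
    then show ?thesis unfolding UK_prod UG_prod p.prod_op_times
      by (intro p.prod_op_cong) auto
  qed
  show ?thesis
    unfolding dsym_def x prod.case * tc_prod_op
    by (intro prod_op_cong) (auto simp: wsite_def tens_one)
qed

lemma DS_ops [simp]: "x \<in> carrier H \<Longrightarrow> DS S x \<in> ops X"
  by (simp add: DS_prod)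

lemma DS_unitary [simp]: "x \<in> carrier H \<Longrightarrow> unitary (DS S x)"
  unfolding DS_prod by (intro prod_op_unitary) (auto simp: wsite_unitary fin_basis.unitary_one[OF fin_basis_doubled])

lemma DS_supp: "x \<in> carrier H \<Longrightarrow> supp S (DS S x)"
  unfolding DS_prod by (intro prod_op_supp) auto

lemma DS_mult:
  assumes "x \<in> carrier H" "y \<in> carrier H"
  shows "DS S (x \<otimes>\<^bsub>H\<^esub> y) = DS S x \<odot> DS S y"
proof -
  have "times_op (doubled d i) (one_op (doubled d i)) (one_op (doubled d i)) = one_op (doubled d i)" for i
    using fin_basis.one_times[OF fin_basis_doubled fin_basis.one_ops[OF fin_basis_doubled]] .
  then show ?thesis
    using assms by (simp only: DS_prod[OF H.m_closed[OF assms]] DS_prod prod_op_times)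
      (intro prod_op_cong, auto simp: wsite_mult)
qed

text \<open>An onsite symmetry can be cut at any site. This is what permits the symmetry of the
  chain to be split into left edge, bulk interval and right edge.\<close>

lemma DS_union:
  assumes "x \<in> carrier H" "S \<inter> T = {}"
  shows "DS (S \<union> T) x = DS S x \<odot> DS T x"
proof -
  interpret f: fin_basis "doubled d i" for i by (rule fin_basis_doubled)
  have w: "wsite x i \<in> ops (doubled d i)" if "i < L" for i
    using wsite_unitary[OF assms(1) that] by (simp add: unitary_op_def)
  have "prod_op (\<lambda>i. if i \<in> S \<union> T then wsite x i else one_op (doubled d i)) =
     prod_op (\<lambda>i. times_op (doubled d i) (if i \<in> S then wsite x i else one_op (doubled d i)) (if i \<in> T then wsite x i else one_op (doubled d i)))"
    using assms(2) w by (intro prod_op_cong) (auto simp: f.one_times f.times_one f.one_ops)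
  then show ?thesis using assms(1) by (simp only: DS_prod prod_op_times)
qed

lemma DS_one: "DS S \<one>\<^bsub>H\<^esub> = one_op X"
proof -
  let ?D = "DS S \<one>\<^bsub>H\<^esub>"
  have "?D \<odot> ?D = ?D" using DS_mult[of "\<one>\<^bsub>H\<^esub>" "\<one>\<^bsub>H\<^esub>" S] by simp
  then have "adj_op ?D \<odot> (?D \<odot> ?D) = adj_op ?D \<odot> ?D" by simp
  then show ?thesis using unitaryD[of ?D] by (simp add: times_assoc[symmetric])
qed

lemma DS_inv: "x \<in> carrier H \<Longrightarrow> DS S (inv\<^bsub>H\<^esub> x) = adj_op (DS S x)"
proof -
  assume x: "x \<in> carrier H"
  have "DS S (inv\<^bsub>H\<^esub> x) \<odot> DS S x = one_op X" using DS_mult[of "inv\<^bsub>H\<^esub> x" x S] x DS_one by simp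
  then have "DS S (inv\<^bsub>H\<^esub> x) \<odot> (DS S x \<odot> adj_op (DS S x)) = adj_op (DS S x)"
    using x by (simp add: times_assoc[symmetric])
  then show ?thesis using unitaryD(2)[OF DS_unitary[OF x]] x by simp
qed

lemma UK_unitary: "k \<in> carrier K \<Longrightarrow> p.unitary (UK C L S k)"
  unfolding UK_prod using site_rep(1) fin_basis.unitary_one[OF fin_basis_phys]
  by (intro p.prod_op_unitary) (auto simp: unitary_rep_def)

lemma scale_times: "times_op Y (scale_op z A) B = scale_op z (times_op Y A B)"
  "times_op Y A (scale_op z B) = scale_op z (times_op Y A B)"
  by (auto simp: scale_op_def times_op_def sum_distrib_left mult_ac)

lemma rho_ops: "rho C L \<in> ops p.X"
  using rho by (simp add: density_op_def)

text \<open>Exact symmetry from the left gives the phase of \<open>k\<close>, from the right the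
  inverse phase of \<open>k'\<close>, and the average symmetry leaves the density matrix fixed. So
  the Choi state is an eigenvector even where \<rho> is only averaged.\<close>

lemma DS_choi:
  assumes x: "x \<in> carrier H"
  shows "\<exists>e. cmod e = 1 \<and> DS {..<L} x \<triangleright> vop (rho C L) = (\<lambda>s. e * vop (rho C L) s)"
proof -
  let ?U = "UK C L {..<L}" and ?V = "UG C L {..<L}" and ?\<rho> = "rho C L"
  obtain k k' g where xk: "x = ((k, k'), g)" by (metis prod.collapse)
  have c: "k \<in> carrier K" "k' \<in> carrier K" "g \<in> carrier G" using x by (auto simp: xk DirProd_def)
  obtain \<theta> where \<theta>: "\<And>k. k \<in> carrier K \<Longrightarrow> ?U k \<otimes>\<otimes> ?\<rho> = scale_op (cis (\<theta> k)) ?\<rho>"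
      "\<And>k. k \<in> carrier K \<Longrightarrow> ?\<rho> \<otimes>\<otimes> ?U k = scale_op (cis (\<theta> k)) ?\<rho>"
    using exact unfolding exact_symmetry_def by metis
  have av: "?V g \<otimes>\<otimes> ?\<rho> \<otimes>\<otimes> adj_op (?V g) = ?\<rho>"
    using average c unfolding average_symmetry_def by blast
  \<comment> \<open>Multiplying the right-hand exact symmetry by the adjoint of \<open>U\<close>
    inverts the phase.\<close>
  have r: "?\<rho> \<otimes>\<otimes> adj_op (?U k') = scale_op (cis (- \<theta> k')) ?\<rho>"
  proof -
    have "scale_op (cis (- \<theta> k')) (?\<rho> \<otimes>\<otimes> ?U k' \<otimes>\<otimes> adj_op (?U k')) =
        scale_op (cis (- \<theta> k')) (scale_op (cis (\<theta> k')) ?\<rho> \<otimes>\<otimes> adj_op (?U k'))"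
      using \<theta>(2)[OF c(2)] by simp
    also have "\<dots> = ?\<rho> \<otimes>\<otimes> adj_op (?U k')"
      unfolding scale_times by (auto simp: scale_op_def cis_mult mult.assoc[symmetric])
    finally show ?thesis
      using p.unitaryD[OF UK_unitary[OF c(2)]] rho_ops by (simp add: p.times_assoc)
  qed
  have "DS {..<L} x \<triangleright> vop ?\<rho> = vop ((?U k \<otimes>\<otimes> ?V g) \<otimes>\<otimes> ?\<rho> \<otimes>\<otimes> adj_op (?U k' \<otimes>\<otimes> ?V g))"
    unfolding dsym_def xk prod.case tc_vop ..
  also have "(?U k \<otimes>\<otimes> ?V g) \<otimes>\<otimes> ?\<rho> \<otimes>\<otimes> adj_op (?U k' \<otimes>\<otimes> ?V g) =
      ?U k \<otimes>\<otimes> (?V g \<otimes>\<otimes> ?\<rho> \<otimes>\<otimes> adj_op (?V g)) \<otimes>\<otimes> adj_op (?U k')"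
    by (simp add: p.adj_times p.times_assoc)
  also have "\<dots> = ?U k \<otimes>\<otimes> (?\<rho> \<otimes>\<otimes> adj_op (?U k'))" unfolding av by (simp add: p.times_assoc)
  also have "\<dots> = scale_op (cis (\<theta> k - \<theta> k')) ?\<rho>"
    unfolding r scale_times \<theta>(1)[OF c(1)] by (auto simp: scale_op_def cis_mult mult.assoc[symmetric])
  finally show ?thesis unfolding vop_scale by (intro exI[of _ "cis (\<theta> k - \<theta> k')"]) simp
qed

text \<open>A vanishing Choi vector would make the diagonal of the density matrix zero, against
  trace one.\<close>

lemma nsq_choi: "0 < nsq X (choi_state C L)"
proof (rule ccontr)
  assume "\<not> 0 < nsq X (choi_state C L)"
  then have "nsq X (choi_state C L) = 0" using nsq_nonneg[of X "choi_state C L"] by linarith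
  moreover have "choi_state C L \<in> vecs X" unfolding choi_vop using vop_vecs by (auto simp: vecs_def)
  ultimately have z: "choi_state C L = (\<lambda>s. 0)" using nsq_eq_0 finite_configs by blast
  have c: "complex_of_real (sqrt (\<Prod>i<L. real (d i))) \<noteq> 0"
  proof -
    have "0 < (\<Prod>i<L. real (d i))" using dims by (intro prod_pos) auto
    then show ?thesis by (metis less_numeral_extra(3) of_real_eq_0_iff real_sqrt_eq_zero_cancel_iff)
  qed
  have 0: "vop (rho C L) s = 0" for s
    using fun_cong[OF z, of s] c unfolding choi_vop by (metis divide_eq_0_iff mult_eq_0_iff zero_neq_one)
  have "rho C L s s = 0" if "s \<in> p.X" for s
    using 0[of "join s s"] join[OF that that] by (simp add: vop_def)
  then have "(\<Sum>s\<in>p.X. rho C L s s) = 0" by simp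
  then show False using rho by (simp add: density_op_def)
qed

lemma \<psi>_vecs [simp]: "\<psi> \<in> vecs X"
  unfolding \<psi>_def choi_vop using vop_vecs by (auto simp: vecs_def)

lemma \<psi>_norm: "nsq X \<psi> = 1"
  unfolding \<psi>_def nsq_scale using nsq_choi by (simp add: norm_divide power_divide)

text \<open>The eigenvalue of the global symmetry on the state, a choice for all group elements at
  once. It is the reference against which the charge of an edge vector is measured.\<close>

definition e :: "('k \<times> 'k) \<times> 'g \<Rightarrow> complex" where
  "e x = (SOME z. cmod z = 1 \<and> DS {..<L} x \<triangleright> \<psi> = (\<lambda>s. z * \<psi> s))"

lemma DS_\<psi>:
  assumes "x \<in> carrier H"
  shows "cmod (e x) = 1" "DS {..<L} x \<triangleright> \<psi> = (\<lambda>s. e x * \<psi> s)"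
proof -
  obtain z where z: "cmod z = 1" "DS {..<L} x \<triangleright> vop (rho C L) = (\<lambda>s. z * vop (rho C L) s)"
    using DS_choi[OF assms] by blast
  have "DS {..<L} x \<triangleright> \<psi> = (\<lambda>s. z * \<psi> s)"
    unfolding \<psi>_def choi_vop app_scale z(2) by (simp add: mult_ac)
  then have "\<exists>z. cmod z = 1 \<and> DS {..<L} x \<triangleright> \<psi> = (\<lambda>s. z * \<psi> s)" using z by blast
  from someI_ex[OF this] show "cmod (e x) = 1" "DS {..<L} x \<triangleright> \<psi> = (\<lambda>s. e x * \<psi> s)"
    unfolding e_def by blast+
qed

lemma e_unit: "x \<in> carrier H \<Longrightarrow> e x \<noteq> 0" "x \<in> carrier H \<Longrightarrow> cnj (e x) * e x = 1"
  using DS_\<psi>(1)[of x] by (auto simp: complex_norm_square[symmetric] mult.commute)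

lemma correlator:
  "inner_on X (choi_state C L) (A \<triangleright> choi_state C L) / inner_on X (choi_state C L) (choi_state C L) =
   inner_on X \<psi> (A \<triangleright> \<psi>)"
proof -
  have "complex_of_real (sqrt (nsq X (choi_state C L))) * complex_of_real (sqrt (nsq X (choi_state C L))) =
     complex_of_real (nsq X (choi_state C L))"
    using nsq_choi by (simp flip: of_real_mult)
  then show ?thesis
    unfolding \<psi>_def app_scale inner_scale_left inner_scale_right inner_self using nsq_choi
    by (simp add: field_simps)
qed

end

section \<open>Edge operators\<close>

text \<open>Two intervals with the same left end \<open>a\<close> are kept: \<open>{a..<c}\<close>
  ends close to the right edge, \<open>{a..<c2}\<close> ends in between. The end operators of the
  shorter one show that the excitation made by \<open>E x\<close> can be created without touching
  either edge. The bounds keep the light cone of an operator at \<open>a\<close> away from the ends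
  of the chain and from everything right of \<open>c2\<close>.\<close>

locale edge = family K G C L
  for K :: "('k, 'm) monoid_scheme" and G :: "('g, 'n) monoid_scheme"
    and C :: "('k, 'g) chain_family" and L :: nat +
  fixes \<omega> :: "('k \<times> 'k) \<times> 'g \<Rightarrow> ('k \<times> 'k) \<times> 'g \<Rightarrow> complex"
    and R D b a c c2 rng :: nat
    and W :: "(nat \<Rightarrow> nat \<times> nat) op" and \<phi> :: "(nat \<Rightarrow> nat \<times> nat) \<Rightarrow> complex"
    and E F E2 F2 :: "('k \<times> 'k) \<times> 'g \<Rightarrow> (nat \<Rightarrow> nat \<times> nat) op"
  assumes \<omega>: "\<And>x y. x \<in> carrier H \<Longrightarrow> y \<in> carrier H \<Longrightarrow> \<omega> x y \<noteq> 0"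
    and cocycle: "\<And>x y z. x \<in> carrier H \<Longrightarrow> y \<in> carrier H \<Longrightarrow> z \<in> carrier H \<Longrightarrow>
        \<omega> x y * \<omega> (x \<otimes>\<^bsub>H\<^esub> y) z = \<omega> y z * \<omega> x (y \<otimes>\<^bsub>H\<^esub> z)"
    and W: "local_circuit L (doubled d) R D W" and \<phi>: "bulk_product L (doubled d) b \<phi>"
    and \<psi>W: "choi_state C L = W \<triangleright> \<phi>"
    and E: "\<And>x. x \<in> carrier H \<Longrightarrow> unitary (E x)" "\<And>x. x \<in> carrier H \<Longrightarrow> supp {a - rng..<a} (E x)"
    and F: "\<And>x. x \<in> carrier H \<Longrightarrow> unitary (F x)" "\<And>x. x \<in> carrier H \<Longrightarrow> supp {c..<c + rng} (F x)"
    and EF: "\<And>x. x \<in> carrier H \<Longrightarrow> DS {a..<c} x \<triangleright> E x \<triangleright> F x \<triangleright> choi_state C L = choi_state C L"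
    and EE: "\<And>x y. x \<in> carrier H \<Longrightarrow> y \<in> carrier H \<Longrightarrow>
        E x \<triangleright> E y \<triangleright> choi_state C L = (\<lambda>s. \<omega> x y * (E (x \<otimes>\<^bsub>H\<^esub> y) \<triangleright> choi_state C L) s)"
    and E2: "\<And>x. x \<in> carrier H \<Longrightarrow> unitary (E2 x)" "\<And>x. x \<in> carrier H \<Longrightarrow> supp {a - rng..<a} (E2 x)"
    and F2: "\<And>x. x \<in> carrier H \<Longrightarrow> unitary (F2 x)" "\<And>x. x \<in> carrier H \<Longrightarrow> supp {c2..<c2 + rng} (F2 x)"
    and EF2: "\<And>x. x \<in> carrier H \<Longrightarrow> DS {a..<c2} x \<triangleright> E2 x \<triangleright> F2 x \<triangleright> choi_state C L = choi_state C L"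
    and bounds: "b + D * R + rng \<le> a" "a + D * R + D * R \<le> c2" "a + D * R \<le> L - b" "c2 + rng \<le> c" "c \<le> L"
begin

lemma EF_\<psi>:
  assumes "x \<in> carrier H"
  shows "DS {a..<c} x \<triangleright> E x \<triangleright> F x \<triangleright> \<psi> = \<psi>" "DS {a..<c2} x \<triangleright> E2 x \<triangleright> F2 x \<triangleright> \<psi> = \<psi>"
  unfolding \<psi>_def app_scale EF[OF assms] EF2[OF assms] by simp_all

lemma EE_\<psi>:
  assumes "x \<in> carrier H" "y \<in> carrier H"
  shows "E x \<triangleright> E y \<triangleright> \<psi> = (\<lambda>s. \<omega> x y * (E (x \<otimes>\<^bsub>H\<^esub> y) \<triangleright> \<psi>) s)"
  unfolding \<psi>_def app_scale EE[OF assms] by (simp add: mult_ac)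

lemma \<psi>_circuit: obtains \<phi>' where "bulk_product L (doubled d) b \<phi>'" "\<psi> = W \<triangleright> \<phi>'"
proof -
  let ?z = "complex_of_real (1 / sqrt (nsq X (choi_state C L)))"
  obtain v \<eta> where "\<phi> \<in> vecs X" and *: "\<And>s. s \<in> X \<Longrightarrow>
      \<phi> s = (\<Prod>i\<in>{b..<L - b}. v i (s i)) * \<eta> (restrict s ({..<L} - {b..<L - b}))"
    using \<phi> unfolding bulk_product_def by blast
  then have "(\<lambda>s. ?z * \<phi> s) \<in> vecs X" by (auto simp: vecs_def)
  then have "bulk_product L (doubled d) b (\<lambda>s. ?z * \<phi> s)"
    unfolding bulk_product_def
    by (intro conjI exI[of _ v] exI[of _ "\<lambda>t. ?z * \<eta> t"]) (auto simp: *)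
  moreover have "\<psi> = W \<triangleright> (\<lambda>s. ?z * \<phi> s)" unfolding \<psi>_def \<psi>W app_scale ..
  ultimately show ?thesis using that by blast
qed

abbreviation "Ei x \<equiv> adj_op (E x)"
abbreviation "Fi x \<equiv> adj_op (F x)"

lemma EFi_supp:
  assumes "x \<in> carrier H"
  shows "supp {a - rng..<a} (Ei x)" "supp {c..<c + rng} (Fi x)" "supp {c2..<c2 + rng} (adj_op (F2 x))"
    "supp {a - rng..<a} (adj_op (E2 x))"
    "E x \<in> ops X" "F x \<in> ops X" "E2 x \<in> ops X" "F2 x \<in> ops X"
  using supp_adj[OF E(2)[OF assms]] supp_adj[OF F(2)[OF assms]] supp_adj[OF F2(2)[OF assms]]
    supp_adj[OF E2(2)[OF assms]] supp_ops[OF E(2)[OF assms]] supp_ops[OF F(2)[OF assms]]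
    supp_ops[OF E2(2)[OF assms]] supp_ops[OF F2(2)[OF assms]]
  by blast+

lemma app_in [simp]: "x \<in> carrier H \<Longrightarrow> E x \<triangleright> u \<in> vecs X" "x \<in> carrier H \<Longrightarrow> F x \<triangleright> u \<in> vecs X"
  "x \<in> carrier H \<Longrightarrow> Ei x \<triangleright> u \<in> vecs X" "x \<in> carrier H \<Longrightarrow> Fi x \<triangleright> u \<in> vecs X"
  "x \<in> carrier H \<Longrightarrow> DS S x \<triangleright> u \<in> vecs X"
  "x \<in> carrier H \<Longrightarrow> E2 x \<triangleright> u \<in> vecs X" "x \<in> carrier H \<Longrightarrow> F2 x \<triangleright> u \<in> vecs X"
  using EFi_supp by auto

lemma DS_ac: "x \<in> carrier H \<Longrightarrow> DS {a..<c} x \<triangleright> \<psi> = Ei x \<triangleright> Fi x \<triangleright> \<psi>"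
proof -
  assume x: "x \<in> carrier H"
  have "DS {a..<c} x \<triangleright> E x \<triangleright> F x \<triangleright> \<psi> = E x \<triangleright> DS {a..<c} x \<triangleright> F x \<triangleright> \<psi>"
    by (rule supp_app_commute[OF DS_supp[OF x] E(2)[OF x]]) auto
  also have "DS {a..<c} x \<triangleright> F x \<triangleright> \<psi> = F x \<triangleright> DS {a..<c} x \<triangleright> \<psi>"
    by (rule supp_app_commute[OF DS_supp[OF x] F(2)[OF x]]) auto
  finally have "E x \<triangleright> F x \<triangleright> DS {a..<c} x \<triangleright> \<psi> = \<psi>" unfolding EF_\<psi>(1)[OF x] by (rule sym)
  then have "Ei x \<triangleright> \<psi> = F x \<triangleright> DS {a..<c} x \<triangleright> \<psi>"
    using unitary_app(1)[OF E(1)[OF x], of "F x \<triangleright> DS {a..<c} x \<triangleright> \<psi>"] x by simp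
  then have "Fi x \<triangleright> Ei x \<triangleright> \<psi> = DS {a..<c} x \<triangleright> \<psi>"
    using unitary_app(1)[OF F(1)[OF x]] x by simp
  moreover have "Fi x \<triangleright> Ei x \<triangleright> \<psi> = Ei x \<triangleright> Fi x \<triangleright> \<psi>"
    using bounds by (intro supp_app_commute[OF EFi_supp(2,1)] x) auto
  ultimately show ?thesis by simp
qed

lemma E2_\<psi>: "x \<in> carrier H \<Longrightarrow> adj_op (E2 x) \<triangleright> \<psi> = DS {a..<c2} x \<triangleright> F2 x \<triangleright> \<psi>"
proof -
  assume x: "x \<in> carrier H"
  have "DS {a..<c2} x \<triangleright> E2 x \<triangleright> F2 x \<triangleright> \<psi> = E2 x \<triangleright> DS {a..<c2} x \<triangleright> F2 x \<triangleright> \<psi>"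
    by (rule supp_app_commute[OF DS_supp[OF x] E2(2)[OF x]]) auto
  then have "E2 x \<triangleright> DS {a..<c2} x \<triangleright> F2 x \<triangleright> \<psi> = \<psi>" unfolding EF_\<psi>(2)[OF x] by (rule sym)
  then show ?thesis using unitary_app(1)[OF E2(1)[OF x], of "DS {a..<c2} x \<triangleright> F2 x \<triangleright> \<psi>"] x by simp
qed

text \<open>The projective law of \<open>E\<close> is known on \<psi> alone, so adjoints cannot
  simply be taken. On \<psi> the adjoint of \<open>E x\<close> is a scalar times \<open>E\<close> of
  the inverse of \<open>x\<close>; the law is applied to \<open>y\<close> and the inverse of the
  product, and the scalars combine by the cocycle identity.\<close>

lemma EE_inverse:
  assumes x: "x \<in> carrier H" and y: "y \<in> carrier H"
  shows "Ei y \<triangleright> Ei x \<triangleright> \<psi> = (\<lambda>s. 1 / \<omega> x y * (Ei (x \<otimes>\<^bsub>H\<^esub> y) \<triangleright> \<psi>) s)"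
proof -
  let ?i = "\<lambda>x. inv\<^bsub>H\<^esub> x" and ?I = "\<one>\<^bsub>H\<^esub>"
  have cancel: "E x \<triangleright> u = w \<Longrightarrow> u \<in> vecs X \<Longrightarrow> u = Ei x \<triangleright> w" if "x \<in> carrier H" for x u w
    using unitary_app(1)[OF E(1)[OF that], of u] by simp
  have "E ?I \<triangleright> \<psi> = Ei ?I \<triangleright> (\<lambda>s. \<omega> ?I ?I * (E ?I \<triangleright> \<psi>) s)"
    using EE_\<psi>[of ?I ?I] by (intro cancel) auto
  also have "\<dots> = (\<lambda>s. \<omega> ?I ?I * \<psi> s)"
    unfolding app_scale using unitary_app(1)[OF E(1), of ?I \<psi>] by simp
  finally have E1: "E ?I \<triangleright> \<psi> = (\<lambda>s. \<omega> ?I ?I * \<psi> s)" .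
  have inv: "E (?i x) \<triangleright> \<psi> = (\<lambda>s. \<omega> x (?i x) * \<omega> ?I ?I * (Ei x \<triangleright> \<psi>) s)" if x: "x \<in> carrier H" for x
  proof -
    have *: "E x \<triangleright> E (?i x) \<triangleright> \<psi> = (\<lambda>s. \<omega> x (?i x) * \<omega> ?I ?I * \<psi> s)"
      using EE_\<psi>[of x "?i x"] x E1 by (simp add: mult_ac)
    have "E (?i x) \<triangleright> \<psi> = Ei x \<triangleright> (\<lambda>s. \<omega> x (?i x) * \<omega> ?I ?I * \<psi> s)"
      by (rule cancel[OF x *]) (simp add: x)
    then show ?thesis unfolding app_scale .
  qed
  let ?z = "?i (x \<otimes>\<^bsub>H\<^esub> y)"
  have z: "?z \<in> carrier H" "y \<otimes>\<^bsub>H\<^esub> ?z = ?i x"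
    using x y by (auto simp: H.inv_mult_group H.m_assoc[symmetric])
  let ?o = "\<omega> ?I ?I"
  have *: "E y \<triangleright> E ?z \<triangleright> \<psi> = (\<lambda>s. \<omega> y ?z * \<omega> x (?i x) * ?o * (Ei x \<triangleright> \<psi>) s)"
    unfolding EE_\<psi>[OF y z(1)] z(2) inv[OF x] by (simp only: mult.assoc)
  have "E ?z \<triangleright> \<psi> = Ei y \<triangleright> (\<lambda>s. \<omega> y ?z * \<omega> x (?i x) * ?o * (Ei x \<triangleright> \<psi>) s)"
    by (rule cancel[OF y *]) (simp add: z)
  then have "(\<lambda>s. \<omega> y ?z * \<omega> x (?i x) * ?o * (Ei y \<triangleright> Ei x \<triangleright> \<psi>) s) = E ?z \<triangleright> \<psi>"
    unfolding app_scale by simp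
  also have "\<dots> = (\<lambda>s. \<omega> (x \<otimes>\<^bsub>H\<^esub> y) ?z * ?o * (Ei (x \<otimes>\<^bsub>H\<^esub> y) \<triangleright> \<psi>) s)"
    by (rule inv[OF H.m_closed[OF x y]])
  finally have eq: "\<omega> y ?z * \<omega> x (?i x) * ?o * (Ei y \<triangleright> Ei x \<triangleright> \<psi>) s =
      \<omega> (x \<otimes>\<^bsub>H\<^esub> y) ?z * ?o * (Ei (x \<otimes>\<^bsub>H\<^esub> y) \<triangleright> \<psi>) s" for s
    by (rule fun_cong)
  have coc: "\<omega> x y * \<omega> (x \<otimes>\<^bsub>H\<^esub> y) ?z = \<omega> y ?z * \<omega> x (?i x)"
    using cocycle[OF x y z(1)] z(2) by simp
  have nz: "?o \<noteq> 0" "\<omega> (x \<otimes>\<^bsub>H\<^esub> y) ?z \<noteq> 0" "\<omega> x y \<noteq> 0" using \<omega> x y z by auto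
  show ?thesis
  proof
    fix s
    have "\<omega> (x \<otimes>\<^bsub>H\<^esub> y) ?z * ?o * (\<omega> x y * (Ei y \<triangleright> Ei x \<triangleright> \<psi>) s) =
        \<omega> (x \<otimes>\<^bsub>H\<^esub> y) ?z * ?o * (Ei (x \<otimes>\<^bsub>H\<^esub> y) \<triangleright> \<psi>) s"
    proof -
      have "\<omega> (x \<otimes>\<^bsub>H\<^esub> y) ?z * ?o * (\<omega> x y * (Ei y \<triangleright> Ei x \<triangleright> \<psi>) s) =
          (\<omega> x y * \<omega> (x \<otimes>\<^bsub>H\<^esub> y) ?z) * ?o * (Ei y \<triangleright> Ei x \<triangleright> \<psi>) s" by (simp only: mult_ac)
      then show ?thesis unfolding coc eq .
    qed
    then show "(Ei y \<triangleright> Ei x \<triangleright> \<psi>) s = 1 / \<omega> x y * (Ei (x \<otimes>\<^bsub>H\<^esub> y) \<triangleright> \<psi>) s"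
      using nz by (simp add: field_simps)
  qed
qed

text \<open>
  The left end operators for two intervals with the same left end agree on the state up to a
  phase, because their quotient acts on the state like an operator near the right ends.
\<close>

lemma E_E2:
  assumes x: "x \<in> carrier H"
  obtains \<nu> where "Ei x \<triangleright> \<psi> = (\<lambda>s. \<nu> * (adj_op (E2 x) \<triangleright> \<psi>) s)"
proof -
  let ?D = "DS {c2..<c} x" and ?D2 = "DS {a..<c2} x"
  let ?T = "?D \<odot> adj_op (F2 x)"
  let ?U = "E2 x \<odot> Ei x" and ?V = "adj_op ?T \<odot> Fi x"
  have D2F: "?D2 \<triangleright> \<psi> = adj_op (E2 x) \<triangleright> adj_op (F2 x) \<triangleright> \<psi>"
  proof -
    have "?D2 \<triangleright> F2 x \<triangleright> \<psi> = F2 x \<triangleright> ?D2 \<triangleright> \<psi>"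
      by (rule supp_app_commute[OF DS_supp[OF x] F2(2)[OF x]]) auto
    then have "F2 x \<triangleright> ?D2 \<triangleright> \<psi> = adj_op (E2 x) \<triangleright> \<psi>" using E2_\<psi>[OF x] by simp
    then have "?D2 \<triangleright> \<psi> = adj_op (F2 x) \<triangleright> adj_op (E2 x) \<triangleright> \<psi>"
      using unitary_app(1)[OF F2(1)[OF x], of "?D2 \<triangleright> \<psi>"] x by simp
    also have "\<dots> = adj_op (E2 x) \<triangleright> adj_op (F2 x) \<triangleright> \<psi>"
      using bounds by (intro supp_app_commute[OF EFi_supp(3,4)] x) auto
    finally show ?thesis .
  qed
  have "{a..<c} = {c2..<c} \<union> {a..<c2}" using bounds by auto
  then have "DS {a..<c} x = ?D \<odot> ?D2" using DS_union[OF x, of "{c2..<c}" "{a..<c2}"] by auto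
  then have "Ei x \<triangleright> Fi x \<triangleright> \<psi> = ?D \<triangleright> adj_op (E2 x) \<triangleright> adj_op (F2 x) \<triangleright> \<psi>"
    using DS_ac[OF x] D2F by (simp add: app_times)
  also have "\<dots> = adj_op (E2 x) \<triangleright> ?D \<triangleright> adj_op (F2 x) \<triangleright> \<psi>"
    using bounds by (intro supp_app_commute[OF DS_supp EFi_supp(4)] x) auto
  finally have "?U \<triangleright> Fi x \<triangleright> \<psi> = ?T \<triangleright> \<psi>"
    using unitary_app(2)[OF E2(1)[OF x]] x EFi_supp(8)[OF x] by (simp add: app_times)
  then have UT: "adj_op ?T \<triangleright> ?U \<triangleright> Fi x \<triangleright> \<psi> = \<psi>"
    using unitary_app(1)[of ?T \<psi>] x F2(1)[OF x] by simp
  have sU: "supp {a - rng..<a} ?U" by (rule supp_times[OF E2(2)[OF x] EFi_supp(1)[OF x]])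
  have sT: "supp {c2..<L} (adj_op ?T)"
    by (intro supp_adj supp_times supp_mono[OF DS_supp[OF x]] supp_mono[OF EFi_supp(3)[OF x]]) auto
  have sV: "supp {c2..<L} ?V"
    using bounds by (intro supp_times sT supp_mono[OF EFi_supp(2)[OF x]]) auto
  have "adj_op ?T \<triangleright> ?U \<triangleright> Fi x \<triangleright> \<psi> = ?U \<triangleright> adj_op ?T \<triangleright> Fi x \<triangleright> \<psi>"
    using bounds by (intro supp_app_commute[OF sT sU]) auto
  then have UV: "?U \<triangleright> ?V \<triangleright> \<psi> = \<psi>" using UT by (simp add: app_times)
  obtain \<phi>' where \<phi>': "bulk_product L (doubled d) b \<phi>'" "\<psi> = W \<triangleright> \<phi>'" by (rule \<psi>_circuit)
  have uU: "unitary ?U" "unitary ?V" using E E2 F F2 x by auto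
  have ba: "b + D * R \<le> a - rng" using bounds by linarith
  \<comment> \<open>\<open>?U\<close> compares the two end operators at \<open>a\<close>, and
    \<open>?V\<close> gathers all that differs between the intervals from \<open>c2\<close> on;
    together they fix \<psi>, so each is a scalar on it.\<close>
  obtain \<nu> where "?U \<triangleright> \<psi> = (\<lambda>s. \<nu> * \<psi> s)"
    using bulk_scalar[OF W \<phi>' \<psi>_norm uU(1) sU uU(2) sV UV ba bounds(2,3)] by blast
  then have "adj_op (E2 x) \<triangleright> E2 x \<triangleright> Ei x \<triangleright> \<psi> = (\<lambda>s. \<nu> * (adj_op (E2 x) \<triangleright> \<psi>) s)"
    by (simp add: app_times app_scale)
  then have "Ei x \<triangleright> \<psi> = (\<lambda>s. \<nu> * (adj_op (E2 x) \<triangleright> \<psi>) s)"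
    using unitary_app(1)[OF E2(1)[OF x], of "Ei x \<triangleright> \<psi>"] x by simp
  then show ?thesis by (rule that)
qed

section \<open>Operators at the two edges of the chain\<close>

definition Bl :: "('k \<times> 'k) \<times> 'g \<Rightarrow> (nat \<Rightarrow> nat \<times> nat) op" where
  "Bl x = DS {..<a} x \<odot> Ei x"

definition Br :: "('k \<times> 'k) \<times> 'g \<Rightarrow> (nat \<Rightarrow> nat \<times> nat) op" where
  "Br x = DS {c..<L} x \<odot> Fi x"

lemma Bl: "x \<in> carrier H \<Longrightarrow> unitary (Bl x)" "x \<in> carrier H \<Longrightarrow> supp {..<a} (Bl x)"
  unfolding Bl_def using E(1) by (auto intro!: supp_times DS_supp supp_mono[OF EFi_supp(1)])

lemma Br: "x \<in> carrier H \<Longrightarrow> unitary (Br x)" "x \<in> carrier H \<Longrightarrow> supp {c..<L} (Br x)"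
  unfolding Br_def using F(1) by (auto intro!: supp_times DS_supp supp_mono[OF EFi_supp(2)])

lemma ac: "a \<le> c" using bounds by linarith

lemma Br_commute: "x \<in> carrier H \<Longrightarrow> supp {..<c} A \<Longrightarrow> Br x \<triangleright> A \<triangleright> u = A \<triangleright> Br x \<triangleright> u"
  by (rule supp_app_commute[OF Br(2)]) auto

lemma Bl_c: "x \<in> carrier H \<Longrightarrow> supp {..<c} (Bl x)" "x \<in> carrier H \<Longrightarrow> supp {..<c} (Ei x)"
  "x \<in> carrier H \<Longrightarrow> supp {..<c} (DS {..<a} x)"
  using ac by (auto intro: supp_mono[OF Bl(2)] supp_mono[OF EFi_supp(1)] supp_mono[OF DS_supp])

lemma DS_full: "x \<in> carrier H \<Longrightarrow> DS {..<L} x = DS {..<a} x \<odot> (DS {a..<c} x \<odot> DS {c..<L} x)"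
proof -
  assume x: "x \<in> carrier H"
  have "{..<L} = {..<a} \<union> ({a..<c} \<union> {c..<L})" using bounds ac by auto
  then have "DS {..<L} x = DS ({..<a} \<union> ({a..<c} \<union> {c..<L})) x" by (rule arg_cong)
  also have "\<dots> = DS {..<a} x \<odot> DS ({a..<c} \<union> {c..<L}) x" using ac by (intro DS_union[OF x]) auto
  also have "DS ({a..<c} \<union> {c..<L}) x = DS {a..<c} x \<odot> DS {c..<L} x" by (intro DS_union[OF x]) auto
  finally show ?thesis .
qed

text \<open>The string on \<open>{a..<c}\<close> is traded for its two ends; the right end then
  merges with the symmetry on \<open>{c..<L}\<close> into \<open>Br x\<close>.\<close>

lemma DS_right: "x \<in> carrier H \<Longrightarrow> DS {a..<c} x \<triangleright> DS {c..<L} x \<triangleright> \<psi> = Br x \<triangleright> Ei x \<triangleright> \<psi>"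
proof -
  assume x: "x \<in> carrier H"
  have "DS {a..<c} x \<triangleright> DS {c..<L} x \<triangleright> \<psi> = DS {c..<L} x \<triangleright> Ei x \<triangleright> Fi x \<triangleright> \<psi>"
    unfolding DS_ac[OF x, symmetric] by (rule supp_app_commute[OF DS_supp[OF x] DS_supp[OF x]]) auto
  also have "\<dots> = Ei x \<triangleright> DS {c..<L} x \<triangleright> Fi x \<triangleright> \<psi>"
    using ac by (intro supp_app_commute[OF DS_supp EFi_supp(1)] x) auto
  also have "\<dots> = Br x \<triangleright> Ei x \<triangleright> \<psi>"
    using Br_commute[OF x Bl_c(2)[OF x]] by (simp add: Br_def app_times)
  finally show ?thesis .
qed

lemma Bl_Br:
  assumes x: "x \<in> carrier H"
  shows "Bl x \<triangleright> Br x \<triangleright> \<psi> = (\<lambda>s. e x * \<psi> s)"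
proof -
  have "(\<lambda>s. e x * \<psi> s) = DS {..<a} x \<triangleright> Br x \<triangleright> Ei x \<triangleright> \<psi>"
    using DS_\<psi>(2)[OF x] DS_right[OF x] unfolding DS_full[OF x] by (simp add: app_times)
  also have "\<dots> = Bl x \<triangleright> Br x \<triangleright> \<psi>"
    using Br_commute[OF x Bl_c(2)[OF x]] by (simp add: Bl_def app_times)
  finally show ?thesis by simp
qed

text \<open>Up to a scalar, the excitation at \<open>a\<close> is created by an operator on
  \<open>{a..<c}\<close>, namely the shorter string with its right end. This operator commutes with
  both edge operators, so the relation known on \<psi> carries over.\<close>

lemma Bl_Br_E:
  assumes x: "x \<in> carrier H" and y: "y \<in> carrier H"
  shows "Bl y \<triangleright> Br y \<triangleright> Ei x \<triangleright> \<psi> = (\<lambda>s. e y * (Ei x \<triangleright> \<psi>) s)"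
proof -
  obtain \<nu> where "Ei x \<triangleright> \<psi> = (\<lambda>s. \<nu> * (adj_op (E2 x) \<triangleright> \<psi>) s)" by (rule E_E2[OF x])
  moreover define M where "M = DS {a..<c2} x \<odot> F2 x"
  ultimately have Ei: "Ei x \<triangleright> \<psi> = (\<lambda>s. \<nu> * (M \<triangleright> \<psi>) s)"
    using E2_\<psi>[OF x] by (simp add: app_times)
  have M: "supp {a..<c} M" unfolding M_def
    using bounds by (intro supp_times supp_mono[OF DS_supp[OF x]] supp_mono[OF F2(2)[OF x]]) auto
  have "Bl y \<triangleright> Br y \<triangleright> M \<triangleright> \<psi> = Bl y \<triangleright> M \<triangleright> Br y \<triangleright> \<psi>"
    using supp_app_commute[OF Br(2)[OF y] M] by auto
  also have "\<dots> = M \<triangleright> Bl y \<triangleright> Br y \<triangleright> \<psi>"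
    by (rule supp_app_commute[OF Bl(2)[OF y] M]) auto
  also have "\<dots> = (\<lambda>s. e y * (M \<triangleright> \<psi>) s)" unfolding Bl_Br[OF y] app_scale ..
  finally have fin: "Bl y \<triangleright> Br y \<triangleright> M \<triangleright> \<psi> = (\<lambda>s. e y * (M \<triangleright> \<psi>) s)" .
  show ?thesis unfolding Ei app_scale fin by (simp only: mult.left_commute)
qed

text \<open>On \<psi>, and on \<psi> with an excitation at \<open>a\<close>, the operator
  \<open>Bl y\<close> may be traded for the adjoint of \<open>Br y\<close>. The latter commutes with
  everything on the left, so the adjoint of \<open>E x\<close> passes through; the truncated
  symmetries multiply linearly and the adjoints with the inverse cocycle.\<close>

lemma Bl_Bl:
  assumes x: "x \<in> carrier H" and y: "y \<in> carrier H"
  shows "Bl x \<triangleright> Bl y \<triangleright> \<psi> = (\<lambda>s. 1 / \<omega> x y * (Bl (x \<otimes>\<^bsub>H\<^esub> y) \<triangleright> \<psi>) s)"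
proof -
  \<comment> \<open>The pair acts as a phase on \<open>u\<close>, so either member is that phase
    times the adjoint of the other.\<close>
  have swap: "Bl y \<triangleright> u = (\<lambda>s. e y * (adj_op (Br y) \<triangleright> u) s)"
    if "Bl y \<triangleright> Br y \<triangleright> u = (\<lambda>s. e y * u s)" "u \<in> vecs X" for u
  proof -
    have "Br y \<triangleright> Bl y \<triangleright> u = (\<lambda>s. e y * u s)" using Br_commute[OF y Bl_c(1)[OF y]] that by simp
    then have "adj_op (Br y) \<triangleright> Br y \<triangleright> Bl y \<triangleright> u = (\<lambda>s. e y * (adj_op (Br y) \<triangleright> u) s)"
      by (simp add: app_scale)
    then show ?thesis using unitary_app(1)[OF Br(1)[OF y]] supp_ops[OF Bl(2)[OF y]] by simp
  qed
  have "Bl x \<triangleright> Bl y \<triangleright> \<psi> = DS {..<a} x \<triangleright> Ei x \<triangleright> (\<lambda>s. e y * (adj_op (Br y) \<triangleright> \<psi>) s)"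
    unfolding swap[OF Bl_Br[OF y] \<psi>_vecs] unfolding Bl_def app_times ..
  also have "Ei x \<triangleright> (\<lambda>s. e y * (adj_op (Br y) \<triangleright> \<psi>) s) = (\<lambda>s. e y * (adj_op (Br y) \<triangleright> Ei x \<triangleright> \<psi>) s)"
  proof -
    have "{c..<L} \<inter> {..<c} = {}" by auto
    from supp_app_commute[OF supp_adj[OF Br(2)[OF y]] Bl_c(2)[OF x] this, of \<psi>]
    show ?thesis unfolding app_scale by simp
  qed
  also have "\<dots> = Bl y \<triangleright> Ei x \<triangleright> \<psi>"
    using swap[OF Bl_Br_E[OF x y]] x by simp
  also have "DS {..<a} x \<triangleright> Bl y \<triangleright> Ei x \<triangleright> \<psi> = DS {..<a} (x \<otimes>\<^bsub>H\<^esub> y) \<triangleright> Ei y \<triangleright> Ei x \<triangleright> \<psi>"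
    unfolding Bl_def DS_mult[OF x y] app_times ..
  also have "\<dots> = (\<lambda>s. 1 / \<omega> x y * (Bl (x \<otimes>\<^bsub>H\<^esub> y) \<triangleright> \<psi>) s)"
    unfolding EE_inverse[OF x y] app_scale Bl_def app_times ..
  finally show ?thesis .
qed

text \<open>On edge vectors the global symmetry is a product of two edge operators, the bulk string
  being absorbed by its ends. The projective law of the \<open>Bl\<close> thus determines how edge
  vectors transform.\<close>

lemma DS_Bl:
  assumes x: "x \<in> carrier H" and y: "y \<in> carrier H"
  shows "DS {..<L} y \<triangleright> Bl x \<triangleright> \<psi> = Br y \<triangleright> Bl y \<triangleright> Bl x \<triangleright> \<psi>"
proof -
  have cL: "{c..<L} \<inter> {..<a} = {}" using ac by auto
  have "DS {a..<c} y \<triangleright> DS {c..<L} y \<triangleright> Bl x \<triangleright> \<psi> = DS {a..<c} y \<triangleright> Bl x \<triangleright> DS {c..<L} y \<triangleright> \<psi>"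
    using supp_app_commute[OF DS_supp[OF y] Bl(2)[OF x], of "{c..<L}" \<psi>] cL by simp
  also have "\<dots> = Bl x \<triangleright> DS {a..<c} y \<triangleright> DS {c..<L} y \<triangleright> \<psi>"
    by (rule supp_app_commute[OF DS_supp[OF y] Bl(2)[OF x]]) auto
  finally have *: "DS {a..<c} y \<triangleright> DS {c..<L} y \<triangleright> Bl x \<triangleright> \<psi> = Bl x \<triangleright> Br y \<triangleright> Ei y \<triangleright> \<psi>"
    unfolding DS_right[OF y] .
  have "DS {..<L} y \<triangleright> Bl x \<triangleright> \<psi> = DS {..<a} y \<triangleright> Bl x \<triangleright> Br y \<triangleright> Ei y \<triangleright> \<psi>"
    unfolding DS_full[OF y] app_times * ..
  also have "\<dots> = DS {..<a} y \<triangleright> Br y \<triangleright> Bl x \<triangleright> Ei y \<triangleright> \<psi>"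
    using Br_commute[OF y Bl_c(1)[OF x]] by simp
  also have "\<dots> = Br y \<triangleright> DS {..<a} y \<triangleright> Bl x \<triangleright> Ei y \<triangleright> \<psi>"
    using Br_commute[OF y Bl_c(3)[OF y]] by simp
  also have "DS {..<a} y \<triangleright> Bl x \<triangleright> Ei y \<triangleright> \<psi> = DS {..<a} (y \<otimes>\<^bsub>H\<^esub> x) \<triangleright> Ei x \<triangleright> Ei y \<triangleright> \<psi>"
    unfolding Bl_def DS_mult[OF y x] app_times ..
  also have "\<dots> = Bl y \<triangleright> Bl x \<triangleright> \<psi>"
    unfolding EE_inverse[OF y x] Bl_Bl[OF y x] app_scale Bl_def[of "y \<otimes>\<^bsub>H\<^esub> x"] app_times ..
  finally show ?thesis .
qed

end

section \<open>Charges of boundary operators\<close>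

context fin_basis
begin

abbreviation "hs A B \<equiv> inner_on (X \<times> X) (case_prod A) (case_prod B)"
abbreviation "hsq A \<equiv> nsq (X \<times> X) (case_prod A)"

lemma hs_trace: "hs A B = (\<Sum>t\<in>X. times_op X (adj_op A) B t t)"
proof -
  have "hs A B = (\<Sum>s\<in>X. \<Sum>t\<in>X. cnj (A s t) * B s t)"
    unfolding inner_on_def by (simp add: sum.cartesian_product case_prod_beta)
  also have "\<dots> = (\<Sum>t\<in>X. \<Sum>s\<in>X. cnj (A s t) * B s t)" by (rule sum.swap)
  finally show ?thesis by (simp add: times_op_def adj_op_def)
qed

lemma trace_commute: "(\<Sum>t\<in>X. times_op X A B t t) = (\<Sum>t\<in>X. times_op X B A t t)"
  unfolding times_op_def by (subst sum.swap) (simp add: mult.commute)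

text \<open>By cyclicity of the trace; conjugation by a unitary is therefore unitary for the
  Hilbert-Schmidt product, which makes complements of invariant operator spaces invariant.\<close>

lemma hs_conj:
  "hs (times_op X (times_op X U A) (adj_op U)) B = hs A (times_op X (times_op X (adj_op U) B) U)"
  unfolding hs_trace
  using trace_commute[of U "times_op X (adj_op A) (times_op X (adj_op U) B)"]
  by (simp add: adj_times times_assoc)

lemma case_prod_vecs: "A \<in> ops X \<Longrightarrow> case_prod A \<in> vecs (X \<times> X)"
  by (auto simp: ops_def vecs_def)

lemma hs_eq_0: "A \<in> ops X \<Longrightarrow> hs A A = 0 \<Longrightarrow> A = (\<lambda>s t. 0)"
  using inner_eq_0D[of "X \<times> X" "case_prod A"] finX case_prod_vecs by (auto simp: fun_eq_iff)

lemma case_prod_lin: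
  "case_prod (\<lambda>s t. z * A s t + w * B s t) = (\<lambda>st. z * case_prod A st + w * case_prod B st)"
  by auto

text \<open>Operators on \<open>X\<close> are read as vectors over \<open>X \<times> X\<close>, so
  projections and irreducible components of vectors apply to them.\<close>

lemma op_subspace_vsub: "op_subspace X V \<longleftrightarrow> vsub (X \<times> X) (case_prod ` V)"
proof
  assume V: "op_subspace X V"
  show "vsub (X \<times> X) (case_prod ` V)"
    unfolding vsub_def
  proof (intro conjI ballI allI)
    show "case_prod ` V \<subseteq> vecs (X \<times> X)" using V case_prod_vecs unfolding op_subspace_def by blast
    show "(\<lambda>s. 0) \<in> case_prod ` V"
      using V unfolding op_subspace_def by (intro image_eqI[of _ _ "\<lambda>s t. 0"]) auto
  next
    fix u v :: "'c \<times> 'c \<Rightarrow> complex" and z w assume "u \<in> case_prod ` V" "v \<in> case_prod ` V"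
    then obtain A B where "A \<in> V" "B \<in> V" "u = case_prod A" "v = case_prod B" by blast
    then show "(\<lambda>s. z * u s + w * v s) \<in> case_prod ` V"
      using V unfolding op_subspace_def by (intro image_eqI[of _ _ "\<lambda>s t. z * A s t + w * B s t"]) auto
  qed
next
  assume V: "vsub (X \<times> X) (case_prod ` V)"
  have inj: "A \<in> V" if "case_prod A \<in> case_prod ` V" for A :: "'c \<Rightarrow> 'c \<Rightarrow> complex"
  proof -
    obtain B where "B \<in> V" "case_prod A = case_prod B" using \<open>case_prod A \<in> case_prod ` V\<close> by blast
    then show ?thesis by (metis curry_case_prod)
  qed
  show "op_subspace X V"
    unfolding op_subspace_def
  proof (intro conjI ballI allI subsetI)
    fix A assume "A \<in> V"
    then have "case_prod A \<in> vecs (X \<times> X)" using V by (auto simp: vsub_def)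
    then show "A \<in> ops X" by (auto simp: ops_def vecs_def)
  next
    show "(\<lambda>s t. 0) \<in> V" using vsubD(2)[OF V] by (intro inj) (simp add: case_prod_beta')
  next
    fix A B z w assume "A \<in> V" "B \<in> V"
    then show "(\<lambda>s t. z * A s t + w * B s t) \<in> V"
      using vsubD(3)[OF V, of "case_prod A" "case_prod B" z w] by (intro inj) (simp add: case_prod_lin)
  qed
qed

end

context family
begin

section \<open>Symmetry action on operators and on vectors\<close>

abbreviation "CS x A \<equiv> conj_sym C L x A"
abbreviation "DD x \<equiv> DS {..<L} x"

lemma CS_lin: "CS x (\<lambda>s t. z * A s t + u * B s t) = (\<lambda>s t. z * CS x A s t + u * CS x B s t)"
  unfolding conj_sym_def times_op_def
  by (auto simp: fun_eq_iff sum_distrib_left sum_distrib_right sum.distrib algebra_simps)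

lemma CS_scale: "CS x (scale_op z A) = scale_op z (CS x A)"
  unfolding conj_sym_def by (simp add: scale_times)

lemma CS_mult:
  assumes "x \<in> carrier H" "y \<in> carrier H"
  shows "CS (x \<otimes>\<^bsub>H\<^esub> y) A = CS x (CS y A)"
  unfolding conj_sym_def DS_mult[OF assms] by (simp add: adj_times times_assoc)

text \<open>The onsite factors off \<open>S\<close> commute with the operator and cancel, so
  conjugation by the global symmetry does not spread it.\<close>

lemma CS_supp:
  assumes x: "x \<in> carrier H" and A: "supp S A"
  shows "supp S (CS x A)"
proof -
  let ?D = "DS (S \<inter> {..<L}) x" and ?T = "DS ({..<L} - S) x"
  have "DD x = DS ((S \<inter> {..<L}) \<union> ({..<L} - S)) x" by (rule arg_cong[of _ _ "\<lambda>S. DS S x"]) auto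
  also have "\<dots> = ?D \<odot> ?T" by (rule DS_union[OF x]) auto
  finally have "CS x A = ?D \<odot> (?T \<odot> A \<odot> adj_op ?T) \<odot> adj_op ?D"
    unfolding conj_sym_def by (simp add: adj_times times_assoc)
  also have "?T \<odot> A \<odot> adj_op ?T = A"
    using conj_disjoint[OF unitary_adj[OF DS_unitary[OF x]] supp_adj[OF DS_supp[OF x]] A, of "{..<L} - S"]
    by auto
  finally show ?thesis
    using supp_mono[OF DS_supp[OF x, of "S \<inter> {..<L}"], of S]
      supp_mono[OF supp_adj[OF DS_supp[OF x, of "S \<inter> {..<L}"]], of S] A
    by (auto intro!: supp_times)
qed

lemma CS_ops: "x \<in> carrier H \<Longrightarrow> A \<in> ops X \<Longrightarrow> CS x A \<in> ops X"
  unfolding conj_sym_def by simp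

lemma CS_hs:
  assumes "x \<in> carrier H"
  shows "hs (CS x A) B = hs A (CS (inv\<^bsub>H\<^esub> x) B)"
  unfolding conj_sym_def hs_conj DS_inv[OF assms] adj_adj ..

lemma DD_adj_\<psi>:
  assumes "x \<in> carrier H"
  shows "adj_op (DD x) \<triangleright> \<psi> = (\<lambda>s. cnj (e x) * \<psi> s)"
proof -
  have "adj_op (DD x) \<triangleright> (\<lambda>s. e x * \<psi> s) = \<psi>"
    using unitary_app(1)[OF DS_unitary[OF assms, of "{..<L}"] \<psi>_vecs] unfolding DS_\<psi>(2)[OF assms] .
  then have "(\<lambda>s. e x * (adj_op (DD x) \<triangleright> \<psi>) s) = \<psi>" unfolding app_scale .
  then have "(adj_op (DD x) \<triangleright> \<psi>) s = cnj (e x) * \<psi> s" for s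
    using e_unit(2)[OF assms] by (metis (no_types, lifting) mult.assoc mult_1)
  then show ?thesis by blast
qed

text \<open>The charge of an operator is that of its action on \<psi> relative to \<psi> itself;
  hence the conjugate of \<open>e x\<close>.\<close>

lemma CS_\<psi>:
  assumes "x \<in> carrier H"
  shows "CS x A \<triangleright> \<psi> = (\<lambda>s. cnj (e x) * (DD x \<triangleright> A \<triangleright> \<psi>) s)"
  unfolding conj_sym_def app_times DD_adj_\<psi>[OF assms] app_scale ..

text \<open>
  Among the operators on \<open>S\<close> with the same action on the state there is a unique one that is
  orthogonal to the annihilator of the state. It transforms under the symmetry exactly as its
  action on the state does.
\<close>

definition canon :: "nat set \<Rightarrow> (nat \<Rightarrow> nat \<times> nat) op \<Rightarrow> bool" where
  "canon S B \<longleftrightarrow> supp S B \<and> (\<forall>A. supp S A \<and> A \<triangleright> \<psi> = (\<lambda>s. 0) \<longrightarrow> hs A B = 0)"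

lemma supp_subspace: "vsub (X \<times> X) {case_prod A | A. supp S A \<and> A \<triangleright> \<psi> = (\<lambda>s. 0)}"
proof -
  have "supp S (\<lambda>s t. 0)" using supp_lin[OF supp_one supp_one, of S 0 0] by simp
  then have "op_subspace X {A. supp S A \<and> A \<triangleright> \<psi> = (\<lambda>s. 0)}"
    unfolding op_subspace_def using supp_ops by (auto simp: supp_lin app_op_lin) (simp add: app_op_def)
  then show ?thesis unfolding op_subspace_vsub setcompr_eq_image .
qed

text \<open>Removing the component along the annihilator keeps the action on the state and does not
  increase the Hilbert-Schmidt norm, so the norm estimate for edge unitaries survives.\<close>

lemma canon_exists:
  assumes "supp S B"
  obtains B0 where "canon S B0" "B0 \<triangleright> \<psi> = B \<triangleright> \<psi>" "hsq B0 \<le> hsq B"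
proof -
  have fin: "finite (X \<times> X)" using finX by simp
  obtain p where p: "p \<in> {case_prod A | A. supp S A \<and> A \<triangleright> \<psi> = (\<lambda>s. 0)}"
    "\<And>v. v \<in> {case_prod A | A. supp S A \<and> A \<triangleright> \<psi> = (\<lambda>s. 0)} \<Longrightarrow> inner_on (X \<times> X) v (\<lambda>s. case_prod B s - p s) = 0"
    "nsq (X \<times> X) (case_prod B) = nsq (X \<times> X) p + nsq (X \<times> X) (\<lambda>s. case_prod B s - p s)"
    using ortho_decomp[OF fin supp_subspace[of S] case_prod_vecs[OF supp_ops[OF assms]]] by blast
  obtain P where P: "p = case_prod P" "supp S P" "P \<triangleright> \<psi> = (\<lambda>s. 0)" using p(1) by blast
  define B0 where "B0 = (\<lambda>s t. 1 * B s t + (-1) * P s t)"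
  have B0: "case_prod B0 = (\<lambda>s. case_prod B s - p s)" by (auto simp: B0_def P)
  have "supp S B0" unfolding B0_def by (rule supp_lin[OF assms P(2)])
  then have "canon S B0" using p(2) unfolding canon_def B0 by blast
  moreover have "B0 \<triangleright> \<psi> = B \<triangleright> \<psi>" unfolding B0_def app_op_lin P(3) by simp
  moreover have "hsq B0 \<le> hsq B" unfolding B0 p(3) using nsq_nonneg by simp
  ultimately show ?thesis using that by blast
qed

lemma canon_unique:
  assumes "canon S A" "canon S B" "A \<triangleright> \<psi> = B \<triangleright> \<psi>"
  shows "A = B"
proof -
  let ?D = "\<lambda>s t. 1 * A s t + (-1) * B s t"
  have D: "supp S ?D" using assms supp_lin unfolding canon_def by blast
  have 0: "?D \<triangleright> \<psi> = (\<lambda>s. 0)" unfolding app_op_lin assms(3) by simp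
  have "hs ?D ?D = 1 * hs ?D A + (-1) * hs ?D B"
    unfolding case_prod_lin inner_right ..
  also have "\<dots> = 0" using assms D 0 unfolding canon_def by simp
  finally have "?D = (\<lambda>s t. 0)" using hs_eq_0 supp_ops[OF D] by blast
  then show ?thesis by (simp add: fun_eq_iff)
qed

lemma canon_lin:
  assumes "canon S A" "canon S B"
  shows "canon S (\<lambda>s t. z * A s t + u * B s t)"
  using assms supp_lin unfolding canon_def case_prod_lin inner_right by simp

lemma canon_scale: "canon S A \<Longrightarrow> canon S (scale_op z A)"
  using canon_lin[of S A A z 0] by (simp add: scale_op_def)

text \<open>The symmetry maps the annihilator of \<psi> to itself, \<psi> being an eigenvector, and
  preserves the Hilbert-Schmidt product; so it also preserves the complement.\<close>

lemma canon_CS: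
  assumes x: "x \<in> carrier H" and B: "canon S B"
  shows "canon S (CS x B)"
  unfolding canon_def
proof (intro conjI allI impI)
  show "supp S (CS x B)" using CS_supp[OF x] B unfolding canon_def by blast
  fix A assume A: "supp S A \<and> A \<triangleright> \<psi> = (\<lambda>s. 0)"
  have xi: "inv\<^bsub>H\<^esub> x \<in> carrier H" using x by simp
  have "supp S (CS (inv\<^bsub>H\<^esub> x) A)" using CS_supp[OF xi] A by blast
  moreover have "CS (inv\<^bsub>H\<^esub> x) A \<triangleright> \<psi> = (\<lambda>s. 0)" unfolding CS_\<psi>[OF xi] using A by simp
  ultimately have "hs (CS (inv\<^bsub>H\<^esub> x) A) B = 0" using B unfolding canon_def by blast
  then show "hs A (CS x B) = 0" using CS_hs[OF xi, of A B] x by simp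
qed

lemma canon_transforms:
  assumes x: "x \<in> carrier H" and B: "canon S B" and t: "DD x \<triangleright> B \<triangleright> \<psi> = (\<lambda>s. z * e x * (B \<triangleright> \<psi>) s)"
  shows "CS x B = scale_op z B"
proof (rule canon_unique[OF canon_CS[OF x B] canon_scale[OF B]])
  have "cnj (e x) * (z * e x * u) = z * u" for u
    using e_unit(2)[OF x] by (metis mult.assoc mult.commute mult_1)
  then have "CS x B \<triangleright> \<psi> = (\<lambda>s. z * (B \<triangleright> \<psi>) s)" unfolding CS_\<psi>[OF x] t by (rule ext)
  also have "\<dots> = scale_op z B \<triangleright> \<psi>" using app_op_lin[of z B 0 B \<psi>] by (simp add: scale_op_def)
  finally show "CS x B \<triangleright> \<psi> = scale_op z B \<triangleright> \<psi>" .
qed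

text \<open>The squared norm of \<open>A\<close> is at most \<open>N\<close>, so dividing by
  \<open>N\<close> more than suffices; the price for a pair of operators is a factor
  \<open>(1 / N)\<^sup>2\<close> in the correlator.\<close>

lemma scaled_contraction:
  assumes "supp S A" "hsq A \<le> card X" "real (card (pats S)) \<le> N" "1 \<le> N"
  shows "contraction_op X (scale_op (complex_of_real (1 / N)) A)"
proof -
  have "scale_op (complex_of_real (1 / N)) A \<in> ops X"
    using supp_ops[OF assms(1)] by (auto simp: ops_def scale_op_def)
  moreover have "nsq X (scale_op (complex_of_real (1 / N)) A \<triangleright> v) \<le> nsq X v" for v
  proof -
    have "scale_op (complex_of_real (1 / N)) A \<triangleright> v = (\<lambda>s. complex_of_real (1 / N) * (A \<triangleright> v) s)"
      using app_op_lin[of "complex_of_real (1 / N)" A 0 A v] by (simp add: scale_op_def)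
    then have "nsq X (scale_op (complex_of_real (1 / N)) A \<triangleright> v) = (1 / N)\<^sup>2 * nsq X (A \<triangleright> v)"
      using assms(4) by (simp only: nsq_scale norm_of_real abs_of_nonneg) simp
    also have "\<dots> \<le> (1 / N)\<^sup>2 * (N * nsq X v)"
      using supp_norm_bound[OF assms(1,2), of v] assms(3) nsq_nonneg[of X v]
      by (intro mult_left_mono) (auto intro: order_trans mult_right_mono)
    also have "\<dots> = nsq X v / N" using assms(4) by (simp add: power2_eq_square)
    also have "\<dots> \<le> nsq X v" using assms(4) nsq_nonneg[of X v] by (simp add: divide_le_eq mult_le_cancel_left1)
    finally show ?thesis .
  qed
  ultimately show ?thesis unfolding contraction_op_def nsq_def by blast
qed

end

context edge
begin

section \<open>Charges of edge operators under commuting elements\<close>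

definition ratio :: "('k \<times> 'k) \<times> 'g \<Rightarrow> ('k \<times> 'k) \<times> 'g \<Rightarrow> complex" where
  "ratio y x = \<omega> y x / \<omega> x y"

text \<open>\<open>ratio\<close> is the commutator of the cocycle, which for commuting elements is
  unchanged by coboundaries. It appears on exchanging \<open>Bl x\<close> and \<open>Bl y\<close> by
  the projective law; the remaining \<open>Bl x\<close> and \<open>Br x\<close> give the phase
  \<open>e x\<close> of the state.\<close>

lemma DD_Bl:
  assumes x: "x \<in> carrier H" and y: "y \<in> carrier H" and xy: "x \<otimes>\<^bsub>H\<^esub> y = y \<otimes>\<^bsub>H\<^esub> x"
  shows "DD x \<triangleright> Bl y \<triangleright> \<psi> = (\<lambda>s. ratio y x * e x * (Bl y \<triangleright> \<psi>) s)"
proof -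
  have "Bl x \<triangleright> Bl y \<triangleright> \<psi> = (\<lambda>s. 1 / \<omega> x y * (Bl (y \<otimes>\<^bsub>H\<^esub> x) \<triangleright> \<psi>) s)"
    using Bl_Bl[OF x y] xy by simp
  also have "\<dots> = (\<lambda>s. ratio y x * (Bl y \<triangleright> Bl x \<triangleright> \<psi>) s)"
    unfolding Bl_Bl[OF y x] using \<omega>[OF y x] by (simp add: ratio_def)
  finally have "DD x \<triangleright> Bl y \<triangleright> \<psi> = (\<lambda>s. ratio y x * (Br x \<triangleright> Bl y \<triangleright> Bl x \<triangleright> \<psi>) s)"
    unfolding DS_Bl[OF y x] by (simp only: app_scale)
  also have "Br x \<triangleright> Bl y \<triangleright> Bl x \<triangleright> \<psi> = Bl y \<triangleright> Bl x \<triangleright> Br x \<triangleright> \<psi>"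
    using Br_commute[OF x Bl_c(1)[OF y]] Br_commute[OF x Bl_c(1)[OF x]] by simp
  finally have *: "DD x \<triangleright> Bl y \<triangleright> \<psi> = (\<lambda>s. ratio y x * (Bl y \<triangleright> Bl x \<triangleright> Br x \<triangleright> \<psi>) s)" .
  show ?thesis unfolding * Bl_Br[OF x] app_scale by (simp only: mult.assoc)
qed

lemma Br_\<psi>: "y \<in> carrier H \<Longrightarrow> Br y \<triangleright> \<psi> = (\<lambda>s. e y * (adj_op (Bl y) \<triangleright> \<psi>) s)"
proof -
  assume y: "y \<in> carrier H"
  have "adj_op (Bl y) \<triangleright> Bl y \<triangleright> Br y \<triangleright> \<psi> = Br y \<triangleright> \<psi>"
    using supp_ops[OF Br(2)[OF y]] by (intro unitary_app(1)[OF Bl(1)[OF y]]) simp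
  then show ?thesis unfolding Bl_Br[OF y] app_scale by (rule sym)
qed

text \<open>The two edge operators of \<open>y\<close> together fix \<psi> up to a phase, so the
  right one must carry the inverse of the charge of the left one.\<close>

lemma DD_Br:
  assumes x: "x \<in> carrier H" and y: "y \<in> carrier H" and xy: "x \<otimes>\<^bsub>H\<^esub> y = y \<otimes>\<^bsub>H\<^esub> x"
  shows "DD x \<triangleright> Br y \<triangleright> \<psi> = (\<lambda>s. ratio x y * e x * (Br y \<triangleright> \<psi>) s)"
proof -
  let ?B = "DD x \<triangleright> Br y \<triangleright> \<psi>"
  have uv: "DD x \<triangleright> u \<in> vecs X" for u using x by simp
  have BrX: "Br y \<in> ops X" "Bl y \<in> ops X" using supp_ops Br(2)[OF y] Bl(2)[OF y] by auto
  have "Bl y \<triangleright> CS x (Br y) \<triangleright> \<psi> = CS x (Br y) \<triangleright> Bl y \<triangleright> \<psi>"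
    by (rule supp_app_commute[OF Bl_c(1)[OF y] CS_supp[OF x Br(2)[OF y]]]) auto
  also have "\<dots> = DD x \<triangleright> Br y \<triangleright> adj_op (DD x) \<triangleright> Bl y \<triangleright> \<psi>" by (simp add: conj_sym_def app_times)
  also have "adj_op (DD x) \<triangleright> Bl y \<triangleright> \<psi> = (\<lambda>s. 1 / (ratio y x * e x) * (Bl y \<triangleright> \<psi>) s)"
  proof -
    have nz: "ratio y x * e x \<noteq> 0" using \<omega>[OF x y] \<omega>[OF y x] e_unit(1)[OF x] by (simp add: ratio_def)
    have "Bl y \<triangleright> \<psi> = (\<lambda>s. ratio y x * e x * (adj_op (DD x) \<triangleright> Bl y \<triangleright> \<psi>) s)"
      using unitary_app(1)[OF DS_unitary[OF x, of "{..<L}"], of "Bl y \<triangleright> \<psi>"] BrX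
      unfolding DD_Bl[OF x y xy] app_scale by simp
    then have "(Bl y \<triangleright> \<psi>) s = ratio y x * e x * (adj_op (DD x) \<triangleright> Bl y \<triangleright> \<psi>) s" for s by (rule fun_cong)
    then have "(adj_op (DD x) \<triangleright> Bl y \<triangleright> \<psi>) s = 1 / (ratio y x * e x) * (Bl y \<triangleright> \<psi>) s" for s
      using nz by (simp add: field_simps)
    then show ?thesis by blast
  qed
  also have "Br y \<triangleright> (\<lambda>s. 1 / (ratio y x * e x) * (Bl y \<triangleright> \<psi>) s) = (\<lambda>s. 1 / (ratio y x * e x) * e y * \<psi> s)"
    unfolding app_scale Br_commute[OF y Bl_c(1)[OF y], of \<psi>] Bl_Br[OF y] by (simp only: mult.assoc)
  also have "DD x \<triangleright> \<dots> = (\<lambda>s. 1 / (ratio y x * e x) * e y * (e x * \<psi> s))"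
    unfolding app_scale DS_\<psi>(2)[OF x] ..
  also have "\<dots> = (\<lambda>s. ratio x y * e y * \<psi> s)" using e_unit(1)[OF x] by (auto simp: ratio_def fun_eq_iff)
  finally have "CS x (Br y) \<triangleright> \<psi> = adj_op (Bl y) \<triangleright> (\<lambda>s. ratio x y * e y * \<psi> s)"
    using unitary_app(1)[OF Bl(1)[OF y], of "CS x (Br y) \<triangleright> \<psi>"] CS_ops[OF x BrX(1)] by simp
  also have "\<dots> = (\<lambda>s. ratio x y * (Br y \<triangleright> \<psi>) s)" unfolding app_scale Br_\<psi>[OF y] by (simp only: mult.assoc)
  finally have *: "cnj (e x) * (DD x \<triangleright> Br y \<triangleright> \<psi>) s = ratio x y * (Br y \<triangleright> \<psi>) s" for s
    unfolding CS_\<psi>[OF x] by (rule fun_cong)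
  show ?thesis
  proof
    fix s
    have "ratio x y * e x * (Br y \<triangleright> \<psi>) s = e x * (ratio x y * (Br y \<triangleright> \<psi>) s)" by simp
    also have "\<dots> = (cnj (e x) * e x) * (DD x \<triangleright> Br y \<triangleright> \<psi>) s" unfolding *[symmetric] by simp
    finally show "(DD x \<triangleright> Br y \<triangleright> \<psi>) s = ratio x y * e x * (Br y \<triangleright> \<psi>) s" using e_unit(2)[OF x] by simp
  qed
qed

text \<open>Canonical representatives act on \<psi> like the edge unitaries, and the left one
  commutes with \<open>Br y\<close>. The correlator is therefore a phase times the two
  normalisations, while the charges now belong to the operators and not merely to the
  vectors.\<close>

lemma commutator_pair:
  assumes y: "y \<in> carrier H" and N: "real (card (pats {..<a})) \<le> N" "real (card (pats {c..<L})) \<le> N" "1 \<le> N"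
  obtains B B' where "supp {..<a} B" "supp {c..<L} B'" "contraction_op X B" "contraction_op X B'"
    "\<And>x. x \<in> carrier H \<Longrightarrow> x \<otimes>\<^bsub>H\<^esub> y = y \<otimes>\<^bsub>H\<^esub> x \<Longrightarrow> CS x B = scale_op (ratio y x) B"
    "\<And>x. x \<in> carrier H \<Longrightarrow> x \<otimes>\<^bsub>H\<^esub> y = y \<otimes>\<^bsub>H\<^esub> x \<Longrightarrow> CS x B' = scale_op (ratio x y) B'"
    "cmod (inn \<psi> ((B \<odot> B') \<triangleright> \<psi>)) = (1 / N)\<^sup>2"
proof -
  obtain A where A: "canon {..<a} A" "A \<triangleright> \<psi> = Bl y \<triangleright> \<psi>" "hsq A \<le> hsq (Bl y)"
    by (rule canon_exists[OF Bl(2)[OF y]])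
  obtain A' where A': "canon {c..<L} A'" "A' \<triangleright> \<psi> = Br y \<triangleright> \<psi>" "hsq A' \<le> hsq (Br y)"
    by (rule canon_exists[OF Br(2)[OF y]])
  have s: "supp {..<a} A" "supp {c..<L} A'" using A A' by (auto simp: canon_def)
  let ?n = "complex_of_real (1 / N)"
  have t: "CS x A = scale_op (ratio y x) A" "CS x A' = scale_op (ratio x y) A'"
    if "x \<in> carrier H" "x \<otimes>\<^bsub>H\<^esub> y = y \<otimes>\<^bsub>H\<^esub> x" for x
    unfolding atomize_conj
    by (intro conjI canon_transforms[OF that(1) A(1)] canon_transforms[OF that(1) A'(1)],
      unfold A(2) A'(2)) (rule DD_Bl[OF that(1) y that(2)], rule DD_Br[OF that(1) y that(2)])
  have sc: "scale_op p (scale_op q M) = scale_op q (scale_op p M)" for p q and M :: "(nat \<Rightarrow> nat \<times> nat) op"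
    by (simp add: scale_op_def mult.left_commute)
  have ss: "supp S (scale_op z M)" if "supp S M" for S M z
    using supp_lin[OF that that, of z 0] by (simp add: scale_op_def)
  have app_s: "scale_op z M \<triangleright> u = (\<lambda>s. z * (M \<triangleright> u) s)" for z M u
    using app_op_lin[of z M 0 M u] by (simp add: scale_op_def)
  have Ac: "supp {..<c} A" using ac by (intro supp_mono[OF s(1)]) auto
  have "A \<triangleright> A' \<triangleright> \<psi> = Br y \<triangleright> Bl y \<triangleright> \<psi>"
    unfolding A(2)[symmetric] A'(2) by (rule Br_commute[OF y Ac, symmetric])
  also have "\<dots> = (\<lambda>s. e y * \<psi> s)" unfolding Br_commute[OF y Bl_c(1)[OF y]] by (rule Bl_Br[OF y])
  finally have AA: "A \<triangleright> A' \<triangleright> \<psi> = (\<lambda>s. e y * \<psi> s)" .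
  have "(scale_op ?n A \<odot> scale_op ?n A') \<triangleright> \<psi> = (\<lambda>s. ?n * (?n * (e y * \<psi> s)))"
    unfolding app_times app_s app_scale AA ..
  then have "inn \<psi> ((scale_op ?n A \<odot> scale_op ?n A') \<triangleright> \<psi>) = ?n * (?n * e y)"
    by (simp only: inner_scale_right inner_self \<psi>_norm of_real_1 mult_1_right)
  then have cor: "cmod (inn \<psi> ((scale_op ?n A \<odot> scale_op ?n A') \<triangleright> \<psi>)) = (1 / N)\<^sup>2"
    using DS_\<psi>(1)[OF y] N(3) by (simp add: norm_mult norm_divide power2_eq_square)
  have hs: "hsq A \<le> card X" "hsq A' \<le> card X"
    using A(3) A'(3) unitary_hs[OF Bl(1)[OF y]] unitary_hs[OF Br(1)[OF y]] by auto
  show ?thesis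
    by (rule that[OF ss[OF s(1)] ss[OF s(2)] scaled_contraction[OF s(1) hs(1) N(1,3)]
          scaled_contraction[OF s(2) hs(2) N(2,3)] _ _ cor])
      (simp_all only: CS_scale t sc)
qed

end

section \<open>Schur's lemma\<close>

text \<open>The iterates of a nonzero vector are linearly dependent, so a nonzero polynomial in
  \<open>C\<close> annihilates it. For one of least degree, splitting off a root leaves a nonzero
  eigenvector.\<close>

lemma eigenvector:
  assumes fin: "finite X" and W: "vsub X W" "W \<noteq> {\<lambda>s. 0}"
    and C: "\<And>u. u \<in> W \<Longrightarrow> C u \<in> W"
    and lin: "\<And>u v z w. u \<in> W \<Longrightarrow> v \<in> W \<Longrightarrow> C (\<lambda>s. z * u s + w * v s) = (\<lambda>s. z * C u s + w * C v s)"
  obtains u c where "u \<in> W" "u \<noteq> (\<lambda>s. 0)" "C u = (\<lambda>s. c * u s)"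
proof -
  obtain u0 where u0: "u0 \<in> W" "u0 \<noteq> (\<lambda>s. 0)" using W vsubD(2)[OF W(1)] by blast
  define f where "f i = (C ^^ i) u0" for i
  have f0: "f 0 = u0" and fS: "f (Suc i) = C (f i)" for i by (auto simp: f_def)
  have fW: "f i \<in> W" for i by (induction i) (auto simp: f0 fS u0 C)
  define n where "n = card X"
  let ?B = "(\<lambda>x s. if s = x then 1 else 0 :: complex) ` X"
  have span: "W \<subseteq> cfun.span ?B"
  proof
    fix v assume "v \<in> W"
    then have "v \<in> vecs X" using vsubD(1)[OF W(1)] by blast
    then have "v = (\<lambda>s. \<Sum>x\<in>X. v x * (if s = x then 1 else 0))"
      using fin by (auto simp: vecs_def fun_eq_iff if_distrib cong: if_cong)
    then show "v \<in> cfun.span ?B"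
      using sum_in_span[OF fin, of "\<lambda>x s. if s = x then 1 else 0 :: complex" ?B v] by auto
  qed
  \<comment> \<open>Dependence of a set of vectors does not see repetitions, so two equal iterates
    are treated apart: they give the relation with coefficients 1 and -1.\<close>
  obtain a where a: "\<And>s. (\<Sum>i\<le>n. a i * f i s) = 0" "\<exists>i\<le>n. a i \<noteq> 0"
  proof (cases "inj_on f {..n}")
    case True
    have "cfun.dependent (f ` {..n})"
    proof (rule ccontr)
      assume "cfun.independent (f ` {..n})"
      then have "card (f ` {..n}) \<le> card ?B"
        using cfun.independent_span_bound[of ?B "f ` {..n}"] span fW fin by blast
      also have "\<dots> \<le> n" unfolding n_def by (rule card_image_le[OF fin])
      finally show False using card_image[OF True] by simp
    qed
    then obtain T u v where T: "finite T" "T \<subseteq> f ` {..n}" "(\<Sum>v\<in>T. (\<lambda>s. u v * v s)) = 0" "v \<in> T" "u v \<noteq> 0"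
      unfolding cfun.dependent_explicit by blast
    define I where "I = {i \<in> {..n}. f i \<in> T}"
    have TI: "T = f ` I" "inj_on f I" "I \<subseteq> {..n}" using T(2) True by (auto simp: I_def inj_on_def)
    define a where "a i = (if i \<in> I then u (f i) else 0)" for i
    have "(\<Sum>i\<le>n. a i * f i s) = 0" for s
    proof -
      have "(\<Sum>i\<le>n. a i * f i s) = (\<Sum>i\<in>I. u (f i) * f i s)"
        using TI(3) by (intro sum.mono_neutral_cong_right) (auto simp: a_def)
      also have "\<dots> = (\<Sum>v\<in>T. u v * v s)" unfolding TI(1) by (simp add: sum.reindex[OF TI(2)])
      also have "\<dots> = 0" using T(3) unfolding fun_eq_iff cfun_sum_apply by simp
      finally show ?thesis .
    qed
    moreover have "\<exists>i\<le>n. a i \<noteq> 0" using T(4,5) TI by (auto simp: a_def)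
    ultimately show ?thesis using that by blast
  next
    case False
    then obtain i j where ij: "i \<le> n" "j \<le> n" "i \<noteq> j" "f i = f j" by (auto simp: inj_on_def)
    define a where "a k = (if k = i then 1 else if k = j then -1 else 0 :: complex)" for k
    have "(\<Sum>k\<le>n. a k * f k s) = 0" for s
    proof -
      have "(\<Sum>k\<le>n. a k * f k s) = (\<Sum>k\<in>{i, j}. a k * f k s)"
        using ij by (intro sum.mono_neutral_right) (auto simp: a_def)
      then show ?thesis using ij by (simp add: a_def)
    qed
    moreover have "\<exists>k\<le>n. a k \<noteq> 0" using ij by (intro exI[of _ i]) (auto simp: a_def)
    ultimately show ?thesis using that by blast
  qed
  define ev where "ev p = (\<lambda>s. \<Sum>i\<le>degree p. coeff p i * f i s)" for p :: "complex poly"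
  have ev_bound: "ev p = (\<lambda>s. \<Sum>i\<le>m. coeff p i * f i s)" if "degree p \<le> m" for p m
    unfolding ev_def using that
    by (intro ext sum.mono_neutral_left) (auto simp: coeff_eq_0)
  have evW: "ev p \<in> W" for p unfolding ev_def using fW by (intro vsub_sum[OF W(1)]) auto
  have C_sum: "C (\<lambda>s. \<Sum>i\<in>I. c i * f i s) = (\<lambda>s. \<Sum>i\<in>I. c i * f (Suc i) s)" if "finite I" for I c
    using that
  proof (induction I)
    case empty
    show ?case using lin[OF u0(1) u0(1), of 0 0] by simp
  next
    case (insert i I)
    have "C (\<lambda>s. c i * f i s + 1 * (\<Sum>i\<in>I. c i * f i s)) =
        (\<lambda>s. c i * C (f i) s + 1 * C (\<lambda>s. \<Sum>i\<in>I. c i * f i s) s)"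
      using insert fW by (intro lin vsub_sum[OF W(1)]) auto
    then show ?case using insert by (simp add: fS)
  qed
  have ev_shift: "ev (pCons 0 p) = C (ev p)" for p
  proof -
    have "ev (pCons 0 p) = (\<lambda>s. \<Sum>i\<le>Suc (degree p). coeff (pCons 0 p) i * f i s)"
      by (rule ev_bound) (simp add: degree_pCons_le)
    also have "\<dots> = (\<lambda>s. \<Sum>i\<le>degree p. coeff p i * f (Suc i) s)"
      by (simp only: sum.atMost_Suc_shift coeff_pCons_0 coeff_pCons_Suc) simp
    also have "\<dots> = C (ev p)" unfolding ev_def by (rule C_sum[symmetric]) simp
    finally show ?thesis .
  qed
  have ev_lin: "ev (smult z p + q) s = z * ev p s + ev q s" for z p q s
  proof -
    let ?m = "max (degree p) (degree q)"
    have d: "degree (smult z p + q) \<le> ?m" "degree p \<le> ?m" "degree q \<le> ?m"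
      by (auto intro!: degree_add_le degree_smult_le[THEN order_trans])
    show ?thesis unfolding d[THEN ev_bound]
      by (simp add: algebra_simps sum.distrib sum_distrib_left)
  qed
  define p0 where "p0 = (\<Sum>i\<le>n. monom (a i) i)"
  have cp0: "coeff p0 k = (if k \<le> n then a k else 0)" for k
    unfolding p0_def coeff_sum by (simp add: if_distrib cong: if_cong)
  have "p0 \<noteq> 0" using a(2) cp0 by (metis coeff_0)
  moreover have "degree p0 \<le> n" by (rule degree_le) (simp add: cp0)
  then have "ev p0 = (\<lambda>s. 0)" using ev_bound[of p0 n] a(1) by (simp add: cp0)
  ultimately have ex: "\<exists>p. p \<noteq> 0 \<and> ev p = (\<lambda>s. 0)" by blast
  obtain p where p: "p \<noteq> 0" "ev p = (\<lambda>s. 0)" "\<And>q. q \<noteq> 0 \<Longrightarrow> ev q = (\<lambda>s. 0) \<Longrightarrow> degree p \<le> degree q"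
    using ex_has_least_nat[of "\<lambda>p. p \<noteq> 0 \<and> ev p = (\<lambda>s. 0)" _ degree] ex by blast
  have "degree p \<noteq> 0"
  proof
    assume "degree p = 0"
    then have "(\<lambda>s. coeff p 0 * u0 s) = (\<lambda>s. 0)" "coeff p 0 \<noteq> 0"
      using p(1,2) leading_coeff_neq_0[OF p(1)] by (auto simp: ev_def f0)
    then show False using u0(2) by (auto simp: fun_eq_iff)
  qed
  then have "\<not> Fundamental_Theorem_Algebra.constant (poly p)" by (simp add: constant_degree)
  then obtain z where "poly p z = 0" using fundamental_theorem_of_algebra by blast
  \<comment> \<open>By minimality of the degree \<open>ev q\<close> is nonzero, while
    \<open>C - z\<close> annihilates it.\<close>
  then obtain q where q: "p = [:- z, 1:] * q" unfolding poly_eq_0_iff_dvd by (auto elim: dvdE)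
  have q0: "q \<noteq> 0" using p(1) q by auto
  then have "degree p = Suc (degree q)" unfolding q by (subst degree_mult_eq) auto
  then have qn: "ev q \<noteq> (\<lambda>s. 0)" using p(3)[of q] q0 by force
  have "p = smult (- z) q + pCons 0 q" unfolding q by simp
  then have "C (ev q) s = z * ev q s" for s
    using ev_lin[of "- z" q "pCons 0 q" s] fun_cong[OF p(2), of s] ev_shift[of q] by simp
  then have "C (ev q) = (\<lambda>s. z * ev q s)" by blast
  then show ?thesis using that[OF evW qn] by blast
qed

text \<open>An eigenspace of \<open>C\<close> in \<open>W\<close> is nonzero and stable under all
  maps that commute with \<open>C\<close> and with scalars, so it is all of
  \<open>W\<close>.\<close>

lemma schur:
  assumes fin: "finite X" and W: "irreducible_under X \<Phi> W" "W \<noteq> {\<lambda>s. 0}"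
    and C: "\<And>u. u \<in> W \<Longrightarrow> C u \<in> W"
    and lin: "\<And>u v z w. u \<in> W \<Longrightarrow> v \<in> W \<Longrightarrow> C (\<lambda>s. z * u s + w * v s) = (\<lambda>s. z * C u s + w * C v s)"
    and \<Phi>: "\<And>\<phi> c u. \<phi> \<in> \<Phi> \<Longrightarrow> u \<in> W \<Longrightarrow> \<phi> (\<lambda>s. c * u s) = (\<lambda>s. c * \<phi> u s)"
    and com: "\<And>\<phi> u. \<phi> \<in> \<Phi> \<Longrightarrow> u \<in> W \<Longrightarrow> C (\<phi> u) = \<phi> (C u)"
  obtains c where "\<And>u. u \<in> W \<Longrightarrow> C u = (\<lambda>s. c * u s)"
proof -
  have V: "vsub X W" and inv: "\<And>\<phi> u. \<phi> \<in> \<Phi> \<Longrightarrow> u \<in> W \<Longrightarrow> \<phi> u \<in> W"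
    and irr: "\<And>U. vsub X U \<Longrightarrow> U \<subseteq> W \<Longrightarrow> (\<forall>\<phi>\<in>\<Phi>. \<phi> ` U \<subseteq> U) \<Longrightarrow> U = {\<lambda>s. 0} \<or> U = W"
    using W(1) unfolding irreducible_under_def by blast+
  obtain u c where u: "u \<in> W" "u \<noteq> (\<lambda>s. 0)" "C u = (\<lambda>s. c * u s)"
    by (rule eigenvector[OF fin V W(2) C lin])
  define U where "U = {u \<in> W. C u = (\<lambda>s. c * u s)}"
  have "C (\<lambda>s. 0) = (\<lambda>s. 0)" using lin[OF u(1) u(1), of 0 0] by simp
  then have "vsub X U"
    using V lin unfolding vsub_def U_def by (auto simp: algebra_simps)
  moreover have "\<phi> ` U \<subseteq> U" if "\<phi> \<in> \<Phi>" for \<phi>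
    using inv[OF that] com[OF that] \<Phi>[OF that] unfolding U_def by auto
  moreover have "u \<in> U" using u by (simp add: U_def)
  ultimately have "U = W" using irr[of U] u(2) unfolding U_def by blast
  then show ?thesis using that unfolding U_def by blast
qed

section \<open>Approximately trivial cocycles\<close>

text \<open>\<open>K\<close> may be infinite, so a limit of approximate solutions is needed. Outside
  zero and infinity they range over a product of compact annuli, and the closed sets of solutions
  with tolerance 1/(n+1) have the finite intersection property. A common point solves the equation
  exactly, and the annulus keeps it away from zero.\<close>

lemma approx_coboundary:
  fixes K :: "('k, 'm) monoid_scheme" and \<beta> :: "'k \<Rightarrow> 'k \<Rightarrow> complex"
  assumes K: "group K" and \<beta>: "\<And>x y. x \<in> carrier K \<Longrightarrow> y \<in> carrier K \<Longrightarrow> cmod (\<beta> x y) = 1"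
    and approx: "\<And>\<epsilon>. 0 < \<epsilon> \<Longrightarrow> \<exists>c. (\<forall>k\<in>carrier K. 1 / 2 \<le> cmod (c k) \<and> cmod (c k) \<le> 2) \<and>
      (\<forall>x\<in>carrier K. \<forall>y\<in>carrier K. cmod (c x * c y - c (x \<otimes>\<^bsub>K\<^esub> y) / \<beta> x y) \<le> \<epsilon>)"
  shows "\<beta> \<in> coboundaries2 K"
proof -
  interpret K: group K by (rule K)
  \<comment> \<open>The annulus is presented as a continuous image of a rectangle, which shows that
    it is compact.\<close>
  define A :: "complex set" where "A = (\<lambda>(r, t). of_real r * cis t) ` ({1 / 2..2} \<times> {- pi..pi})"
  have A: "compact A" "\<And>z. z \<in> A \<longleftrightarrow> 1 / 2 \<le> cmod z \<and> cmod z \<le> 2"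
  proof -
    show "compact A"
      unfolding A_def case_prod_unfold
      by (intro compact_continuous_image compact_Times compact_Icc continuous_intros)
    fix z
    have "z \<in> A" if "1 / 2 \<le> cmod z" "cmod z \<le> 2"
    proof -
      have "z = of_real (cmod z) * cis (Arg z)" using rcis_cmod_Arg[of z] by (simp add: rcis_def)
      moreover have "(cmod z, Arg z) \<in> {1 / 2..2} \<times> {- pi..pi}" using that Arg_bounded[of z] by simp
      ultimately show ?thesis unfolding A_def by (metis (no_types, lifting) image_eqI case_prod_conv)
    qed
    then show "z \<in> A \<longleftrightarrow> 1 / 2 \<le> cmod z \<and> cmod z \<le> 2" by (auto simp: A_def norm_mult)
  qed
  have comp: "compact (PiE UNIV (\<lambda>_::'k. A))"
    using A(1) compactin_PiE[of "\<lambda>_. euclidean" UNIV "\<lambda>_::'k. A"]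
    by (simp add: euclidean_product_topology flip: compactin_euclidean_iff)
  define F :: "nat \<Rightarrow> ('k \<Rightarrow> complex) set" where
    "F n = {c. \<forall>x\<in>carrier K. \<forall>y\<in>carrier K. cmod (c x * c y - c (x \<otimes>\<^bsub>K\<^esub> y) / \<beta> x y) \<le> 1 / real (Suc n)}" for n
  have coord: "continuous_on UNIV (\<lambda>c :: 'k \<Rightarrow> complex. c x)" for x
    by (rule continuous_on_product_coordinates)
  have closed: "closed (F n)" for n
  proof -
    have eq: "F n = (\<Inter>x\<in>carrier K. \<Inter>y\<in>carrier K. {c. cmod (c x * c y - c (x \<otimes>\<^bsub>K\<^esub> y) / \<beta> x y) \<le> 1 / real (Suc n)})"
      by (auto simp: F_def)
    have cl: "closed {c :: 'k \<Rightarrow> complex. cmod (c x * c y - c (x \<otimes>\<^bsub>K\<^esub> y) / \<beta> x y) \<le> 1 / real (Suc n)}"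
      if "x \<in> carrier K" "y \<in> carrier K" for x y
    proof -
      have "continuous_on UNIV (\<lambda>c :: 'k \<Rightarrow> complex. cmod (c x * c y - c (x \<otimes>\<^bsub>K\<^esub> y) / \<beta> x y))"
        using \<beta>[OF that] by (intro continuous_intros coord) auto
      then show ?thesis by (intro closed_Collect_le continuous_on_const)
    qed
    show ?thesis unfolding eq by (intro closed_INT ballI cl)
  qed
  have "PiE UNIV (\<lambda>_::'k. A) \<inter> \<Inter> (range F) \<noteq> {}"
  proof (rule compact_imp_fip[OF comp])
    show "\<And>T. T \<in> range F \<Longrightarrow> closed T" using closed by blast
  next
    fix F' assume F': "finite F'" "F' \<subseteq> range F"
    then obtain N where N: "finite N" "F' = F ` N" by (metis finite_subset_image)
    define n where "n = Max (insert 0 N)"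
    have n: "m \<le> n" if "m \<in> N" for m using that N(1) by (simp add: n_def)
    obtain c where c: "\<forall>k\<in>carrier K. 1 / 2 \<le> cmod (c k) \<and> cmod (c k) \<le> 2"
      "\<forall>x\<in>carrier K. \<forall>y\<in>carrier K. cmod (c x * c y - c (x \<otimes>\<^bsub>K\<^esub> y) / \<beta> x y) \<le> 1 / real (Suc n)"
      using approx[of "1 / real (Suc n)"] by auto
    \<comment> \<open>Values off the carrier are irrelevant to the equation but must lie in the
      annulus; hence the default 1.\<close>
    define c' where "c' k = (if k \<in> carrier K then c k else 1)" for k
    have "c' \<in> PiE UNIV (\<lambda>_. A)" using c(1) by (auto simp: c'_def A(2))
    moreover have "c' \<in> F m" if "m \<in> N" for m
    proof -
      have "1 / real (Suc n) \<le> 1 / real (Suc m)" using n[OF that] by (intro divide_left_mono) auto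
      then show ?thesis using c(2) unfolding F_def c'_def by (auto intro: order_trans)
    qed
    ultimately show "PiE UNIV (\<lambda>_. A) \<inter> \<Inter> F' \<noteq> {}" using N by blast
  qed
  then obtain c where c: "c \<in> PiE UNIV (\<lambda>_. A)" "\<And>n. c \<in> F n" by blast
  have cA: "c k \<noteq> 0" for k using c(1) A(2)[of "c k"] by auto
  have rel: "c x * c y = c (x \<otimes>\<^bsub>K\<^esub> y) / \<beta> x y" if "x \<in> carrier K" "y \<in> carrier K" for x y
  proof (rule ccontr)
    assume "c x * c y \<noteq> c (x \<otimes>\<^bsub>K\<^esub> y) / \<beta> x y"
    then have "0 < cmod (c x * c y - c (x \<otimes>\<^bsub>K\<^esub> y) / \<beta> x y)" by simp
    then obtain n where "1 / real (Suc n) < cmod (c x * c y - c (x \<otimes>\<^bsub>K\<^esub> y) / \<beta> x y)"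
      using nat_approx_posE by blast
    then show False using c(2)[of n] that unfolding F_def by force
  qed
  \<comment> \<open>The moduli of \<open>c\<close> are multiplicative because \<beta> is unimodular,
    so dividing them out leaves a solution by phases. The quotient is inverted since
    \<open>c\<close> satisfies the equation for the inverse of \<beta>.\<close>
  show ?thesis
    unfolding coboundaries2_def mem_Collect_eq
  proof (intro exI[of _ "\<lambda>k. complex_of_real (cmod (c k)) / c k"] conjI ballI)
    fix x assume "x \<in> carrier K"
    show "cmod (complex_of_real (cmod (c x)) / c x) = 1" using cA by (simp add: norm_divide)
  next
    fix x y assume xy: "x \<in> carrier K" "y \<in> carrier K"
    have r: "c x * c y * \<beta> x y = c (x \<otimes>\<^bsub>K\<^esub> y)" using rel[OF xy] \<beta>[OF xy] by (auto simp: field_simps)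
    have "cmod (c x) * cmod (c y) = cmod (c (x \<otimes>\<^bsub>K\<^esub> y))"
      using arg_cong[OF r, of cmod] \<beta>[OF xy] by (simp add: norm_mult)
    then have n: "complex_of_real (cmod (c x)) * complex_of_real (cmod (c y)) = complex_of_real (cmod (c (x \<otimes>\<^bsub>K\<^esub> y)))"
      by (metis of_real_mult)
    have "complex_of_real (cmod (c x)) / c x * (complex_of_real (cmod (c y)) / c y) /
        (complex_of_real (cmod (c (x \<otimes>\<^bsub>K\<^esub> y))) / c (x \<otimes>\<^bsub>K\<^esub> y)) =
      (complex_of_real (cmod (c x)) * complex_of_real (cmod (c y))) / complex_of_real (cmod (c (x \<otimes>\<^bsub>K\<^esub> y))) *
        (c (x \<otimes>\<^bsub>K\<^esub> y) / (c x * c y))" by simp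
    also have "\<dots> = c (x \<otimes>\<^bsub>K\<^esub> y) / (c x * c y)"
      unfolding n using cA[of "x \<otimes>\<^bsub>K\<^esub> y"] by simp
    also have "\<dots> = \<beta> x y" unfolding r[symmetric] using cA[of x] cA[of y] by simp
    finally show "\<beta> x y = complex_of_real (cmod (c x)) / c x * (complex_of_real (cmod (c y)) / c y) /
        (complex_of_real (cmod (c (x \<otimes>\<^bsub>K\<^esub> y))) / c (x \<otimes>\<^bsub>K\<^esub> y))" by simp
  qed
qed

section \<open>Decomposition of operators into multiplets\<close>

lemma rank_le_weaken: "rank_le X V n \<Longrightarrow> n \<le> m \<Longrightarrow> rank_le X V m"
  unfolding rank_le_def by (meson order_trans)

context family
begin

lemma charged_scale:
  assumes "charged C L \<Gamma> B" "z \<noteq> 0"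
  shows "charged C L \<Gamma> (scale_op z B)"
proof -
  obtain V where V: "op_subspace X V" "B \<in> V" "B \<noteq> (\<lambda>s t. 0)" "\<forall>x\<in>\<Gamma>. CS x ` V \<subseteq> V"
    "\<forall>W. op_subspace X W \<and> W \<subseteq> V \<and> (\<forall>x\<in>\<Gamma>. CS x ` W \<subseteq> W) \<longrightarrow> W = {\<lambda>s t. 0} \<or> W = V"
    "\<exists>x\<in>\<Gamma>. \<exists>A\<in>V. CS x A \<noteq> A"
    using assms(1) unfolding charged_def by blast
  have "(\<lambda>s t. z * B s t + 0 * B s t) \<in> V" using V(1,2) unfolding op_subspace_def by blast
  then have "scale_op z B \<in> V" by (simp add: scale_op_def)
  moreover have "scale_op z B \<noteq> (\<lambda>s t. 0)" using V(3) assms(2) by (auto simp: scale_op_def fun_eq_iff)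
  ultimately show ?thesis unfolding charged_def using V by blast
qed

text \<open>The line through \<open>B\<close> is the multiplet; being one-dimensional, it is
  irreducible.\<close>

lemma charged_character:
  assumes B: "B \<in> ops X" "B \<noteq> (\<lambda>s t. 0)" and t: "\<And>x. x \<in> \<Gamma> \<Longrightarrow> CS x B = scale_op (f x) B"
    and nt: "\<exists>x\<in>\<Gamma>. f x \<noteq> 1"
  shows "charged C L \<Gamma> B"
proof -
  define V where "V = range (\<lambda>z. scale_op z B)"
  have "op_subspace X V"
    unfolding op_subspace_def
  proof (intro conjI ballI allI)
    show "V \<subseteq> ops X" using B(1) by (auto simp: V_def ops_def scale_op_def)
    show "(\<lambda>s t. 0) \<in> V" unfolding V_def by (rule range_eqI[of _ _ 0]) (simp add: scale_op_def)
    fix A A' z w assume "A \<in> V" "A' \<in> V"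
    then obtain p q where "A = scale_op p B" "A' = scale_op q B" by (auto simp: V_def)
    then show "(\<lambda>s t. z * A s t + w * A' s t) \<in> V"
      unfolding V_def by (intro range_eqI[of _ _ "z * p + w * q"]) (auto simp: scale_op_def algebra_simps)
  qed
  moreover have "B \<in> V" unfolding V_def by (rule range_eqI[of _ _ 1]) (simp add: scale_op_def)
  moreover have "CS x ` V \<subseteq> V" if "x \<in> \<Gamma>" for x
  proof
    fix A assume "A \<in> CS x ` V"
    then obtain p where "A = CS x (scale_op p B)" by (auto simp: V_def)
    then have "A = scale_op (p * f x) B" unfolding CS_scale t[OF that] by (simp only: scale_op_def mult.assoc)
    then show "A \<in> V" by (auto simp: V_def)
  qed
  moreover have "W = {\<lambda>s t. 0} \<or> W = V" if W: "op_subspace X W" "W \<subseteq> V" for W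
  proof (cases "W = {\<lambda>s t. 0}")
    case False
    then obtain A where A: "A \<in> W" "A \<noteq> (\<lambda>s t. 0)" using W(1) unfolding op_subspace_def by blast
    then obtain p where p: "A = scale_op p B" using W(2) by (auto simp: V_def)
    then have "p \<noteq> 0" using A(2) by (auto simp: scale_op_def)
    have "scale_op q B \<in> W" for q
    proof -
      have "(\<lambda>s t. q / p * A s t + 0 * A s t) \<in> W" using A(1) W(1) unfolding op_subspace_def by blast
      then show ?thesis using \<open>p \<noteq> 0\<close> by (simp add: p scale_op_def)
    qed
    then show ?thesis using W(2) by (auto simp: V_def)
  qed simp
  moreover have "\<exists>x\<in>\<Gamma>. \<exists>A\<in>V. CS x A \<noteq> A"
  proof -
    obtain x where x: "x \<in> \<Gamma>" "f x \<noteq> 1" using nt by blast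
    obtain s t where st: "B s t \<noteq> 0" using B(2) by (auto simp: fun_eq_iff)
    have "CS x B s t = f x * B s t" using t[OF x(1)] by (simp add: scale_op_def)
    then have "CS x B \<noteq> B" using st x(2) by (metis mult_cancel_right1)
    then show ?thesis using x \<open>B \<in> V\<close> by blast
  qed
  ultimately show ?thesis
    unfolding charged_def using B(2) by (intro exI[of _ V] conjI ballI allI impI) (assumption | blast)+
qed

end

text \<open>\<Gamma> is the symmetry into whose multiplets operators on \<open>S\<close> are
  decomposed, \<Theta> a symmetry under which they are to stay neutral. As the two commute
  elementwise, \<Gamma> acts within the operators neutral under \<Theta>.\<close>

locale multiplets = family K G C L
  for K :: "('k, 'm) monoid_scheme" and G :: "('g, 'n) monoid_scheme"
    and C :: "('k, 'g) chain_family" and L :: nat +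
  fixes S :: "nat set" and \<Gamma> \<Theta> :: "(('k \<times> 'k) \<times> 'g) set"
  assumes \<Gamma>: "\<Gamma> \<subseteq> carrier H" "\<And>x. x \<in> \<Gamma> \<Longrightarrow> inv\<^bsub>H\<^esub> x \<in> \<Gamma>"
    and \<Theta>: "\<Theta> \<subseteq> carrier H" "\<And>x y. x \<in> \<Gamma> \<Longrightarrow> y \<in> \<Theta> \<Longrightarrow> x \<otimes>\<^bsub>H\<^esub> y = y \<otimes>\<^bsub>H\<^esub> x"
begin

definition V :: "(nat \<Rightarrow> nat \<times> nat) op set" where
  "V = {A. supp S A \<and> (\<forall>y\<in>\<Theta>. CS y A = A)}"

definition Fx :: "(nat \<Rightarrow> nat \<times> nat) op set" where
  "Fx = {A \<in> V. \<forall>x\<in>\<Gamma>. CS x A = A}"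

text \<open>The complement of the invariants: it contains no invariant operator but zero, so every
  nonzero irreducible subspace of it is a charged multiplet.\<close>

definition V' :: "(nat \<Rightarrow> nat \<times> nat) op set" where
  "V' = {A \<in> V. \<forall>F\<in>Fx. hs F A = 0}"

lemma zero_op: "supp S (\<lambda>s t. 0)" "CS x (\<lambda>s t. 0) = (\<lambda>s t. 0)"
  using supp_lin[OF supp_one supp_one, of S 0 0] CS_lin[of x 0 undefined 0 undefined] by simp_all

lemma V_sub: "op_subspace X V" and Fx_sub: "op_subspace X Fx"
  unfolding op_subspace_def V_def Fx_def using supp_ops by (auto simp: zero_op supp_lin CS_lin)

lemma V_lin: "A \<in> V \<Longrightarrow> B \<in> V \<Longrightarrow> (\<lambda>s t. z * A s t + u * B s t) \<in> V"
  using V_sub unfolding op_subspace_def by blast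

lemma V'_sub: "op_subspace X V'"
  using V_sub unfolding op_subspace_def V'_def
  by (auto simp: case_prod_lin inner_right) (simp add: inner_on_def)

lemma V_ops: "A \<in> V \<Longrightarrow> A \<in> ops X"
  using V_sub unfolding op_subspace_def by blast

lemma V_CS: "x \<in> \<Gamma> \<Longrightarrow> A \<in> V \<Longrightarrow> CS x A \<in> V"
proof -
  assume x: "x \<in> \<Gamma>" and A: "A \<in> V"
  have "CS y (CS x A) = CS x A" if y: "y \<in> \<Theta>" for y
  proof -
    have c: "x \<in> carrier H" "y \<in> carrier H" using x y \<Gamma> \<Theta> by blast+
    have "CS y (CS x A) = CS (x \<otimes>\<^bsub>H\<^esub> y) A" unfolding CS_mult[OF c(2,1), symmetric] \<Theta>(2)[OF x y] ..
    also have "\<dots> = CS x (CS y A)" by (rule CS_mult[OF c])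
    finally show ?thesis using A y by (simp add: V_def)
  qed
  then show ?thesis using A x \<Gamma> CS_supp unfolding V_def by blast
qed

lemma V'_CS: "x \<in> \<Gamma> \<Longrightarrow> A \<in> V' \<Longrightarrow> CS x A \<in> V'"
proof -
  assume x: "x \<in> \<Gamma>" and A: "A \<in> V'"
  have "hs F (CS x A) = 0" if F: "F \<in> Fx" for F
  proof -
    have xi: "inv\<^bsub>H\<^esub> x \<in> \<Gamma>" "inv\<^bsub>H\<^esub> x \<in> carrier H" "inv\<^bsub>H\<^esub> (inv\<^bsub>H\<^esub> x) = x" using x \<Gamma> by auto
    have "hs F (CS x A) = hs (CS (inv\<^bsub>H\<^esub> x) F) A" using CS_hs[OF xi(2), of F A] xi(3) by simp
    also have "\<dots> = hs F A" using F xi(1) by (simp add: Fx_def)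
    finally show ?thesis using A F by (simp add: V'_def)
  qed
  then show ?thesis using A x V_CS unfolding V'_def by blast
qed

lemma fin2: "finite (X \<times> X)" using finX by simp

lemma split:
  assumes "B \<in> V"
  obtains B0 B1 where "B0 \<in> Fx" "B1 \<in> V'" "B = (\<lambda>s t. B0 s t + B1 s t)" "hsq B1 \<le> hsq B"
proof -
  obtain p where p: "p \<in> case_prod ` Fx"
    "\<And>v. v \<in> case_prod ` Fx \<Longrightarrow> inner_on (X \<times> X) v (\<lambda>s. case_prod B s - p s) = 0"
    "hsq B = nsq (X \<times> X) p + nsq (X \<times> X) (\<lambda>s. case_prod B s - p s)"
    using ortho_decomp[OF fin2 Fx_sub[unfolded op_subspace_vsub] case_prod_vecs[OF V_ops[OF assms]]] by blast
  obtain B0 where B0: "B0 \<in> Fx" "p = case_prod B0" using p(1) by blast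
  define B1 where "B1 = (\<lambda>s t. 1 * B s t + (-1) * B0 s t)"
  have c: "case_prod B1 = (\<lambda>s. case_prod B s - p s)" by (auto simp: B1_def B0)
  have "B0 \<in> V" using B0 by (simp add: Fx_def)
  then have "B1 \<in> V" using V_sub assms unfolding op_subspace_def B1_def by blast
  moreover have "hs F B1 = 0" if "F \<in> Fx" for F
    unfolding c by (rule p(2)) (rule imageI[OF that])
  ultimately have "B1 \<in> V'" by (simp add: V'_def)
  moreover have "hsq B1 \<le> hsq B" unfolding c p(3) using nsq_nonneg by simp
  ultimately show ?thesis using that[OF B0(1)] by (auto simp: B1_def)
qed

text \<open>An invariant functional is represented by an operator, which is itself invariant by
  uniqueness; and \<open>V'\<close> is orthogonal to the invariants. This takes the place of
  averaging over \<Gamma>, which may be infinite.\<close>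

lemma invariant_functional:
  assumes lin: "\<And>A B z u. A \<in> V \<Longrightarrow> B \<in> V \<Longrightarrow> f (\<lambda>s t. z * A s t + u * B s t) = z * f A + u * (f B :: complex)"
    and inv: "\<And>x A. x \<in> \<Gamma> \<Longrightarrow> A \<in> V \<Longrightarrow> f (CS x A) = f A" and A: "A \<in> V'"
  shows "f A = 0"
proof -
  obtain E where E: "orthonormal (X \<times> X) E" "finite E" "E \<subseteq> case_prod ` V"
    "\<And>u. u \<in> case_prod ` V \<Longrightarrow> proj (X \<times> X) E u = u"
    using obtain_onb[OF fin2 V_sub[unfolded op_subspace_vsub]] by blast
  have fsum: "f (\<lambda>s t. \<Sum>e\<in>I. c e * g e s t) = (\<Sum>e\<in>I. c e * f (g e)) \<and> (\<lambda>s t. \<Sum>e\<in>I. c e * g e s t) \<in> V"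
    if "finite I" "\<And>e. e \<in> I \<Longrightarrow> g e \<in> V" for I c and g :: "_ \<Rightarrow> _ op"
    using that
  proof (induction I)
    case empty
    have "(\<lambda>s t. 0) \<in> V" using V_sub unfolding op_subspace_def by blast
    then show ?case using lin[of "\<lambda>s t. 0" "\<lambda>s t. 0" 0 0] by simp
  next
    case (insert e I)
    then have g: "g e \<in> V" "(\<lambda>s t. \<Sum>e\<in>I. c e * g e s t) \<in> V"
      and IH: "f (\<lambda>s t. \<Sum>e\<in>I. c e * g e s t) = (\<Sum>e\<in>I. c e * f (g e))" by auto
    have eq: "(\<lambda>s t. \<Sum>e\<in>insert e I. c e * g e s t) = (\<lambda>s t. c e * g e s t + 1 * (\<Sum>e\<in>I. c e * g e s t))"
      using insert(1,2) by (intro ext) simp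
    show ?case
      unfolding eq using V_lin[OF g, of "c e" 1] lin[OF g, of "c e" 1] IH insert(1,2) by simp
  qed
  have curryV: "curry u \<in> V" "case_prod (curry u) = u" if "u \<in> E" for u
    using E(3) that by auto
  have fE: "f (\<lambda>s t. \<Sum>u\<in>E. c u * curry u s t) = (\<Sum>u\<in>E. c u * f (curry u))"
    "(\<lambda>s t. \<Sum>u\<in>E. c u * curry u s t) \<in> V" for c
    using fsum[of E curry c, OF E(2) curryV(1)] by blast+
  \<comment> \<open>The Riesz representative of \<open>f\<close>, written in the orthonormal basis
    \<open>E\<close> of \<open>V\<close>.\<close>
  define r where "r = (\<lambda>s t. \<Sum>u\<in>E. cnj (f (curry u)) * curry u s t)"
  have rV: "r \<in> V" unfolding r_def by (rule fE(2))
  have rep: "hs r B = f B" if B: "B \<in> V" for B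
  proof -
    have "case_prod B = proj (X \<times> X) E (case_prod B)" using E(4) B by simp
    then have "B = (\<lambda>s t. \<Sum>u\<in>E. inner_on (X \<times> X) u (case_prod B) * curry u s t)"
      unfolding proj_def by (metis (no_types, lifting) case_prod_conv curry_conv ext sum.cong)
    then have "f B = (\<Sum>u\<in>E. inner_on (X \<times> X) u (case_prod B) * f (curry u))"
      using fE(1)[of "\<lambda>u. inner_on (X \<times> X) u (case_prod B)"] by simp
    also have "\<dots> = cnj (inner_on (X \<times> X) (case_prod B) (\<lambda>st. \<Sum>u\<in>E. cnj (f (curry u)) * u st))"
      unfolding inner_sum_right by (simp add: inner_cnj mult.commute)
    also have "(\<lambda>st. \<Sum>u\<in>E. cnj (f (curry u)) * u st) = case_prod r" by (auto simp: r_def)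
    finally show ?thesis by (simp add: inner_cnj)
  qed
  have "CS x r = r" if x: "x \<in> \<Gamma>" for x
  proof -
    have xH: "x \<in> carrier H" "inv\<^bsub>H\<^esub> x \<in> \<Gamma>" using x \<Gamma> by auto
    have eq: "hs (CS x r) B = hs r B" if "B \<in> V" for B
      unfolding CS_hs[OF xH(1)] using rep V_CS[OF xH(2) that] inv[OF xH(2) that] that by simp
    let ?D = "\<lambda>s t. 1 * CS x r s t + (-1) * r s t"
    have D: "?D \<in> V" using V_sub V_CS[OF x rV] rV unfolding op_subspace_def by blast
    have "hs ?D ?D = cnj 1 * hs (CS x r) ?D + cnj (-1) * hs r ?D"
      unfolding case_prod_lin[of 1 "CS x r" "-1" r] inner_left ..
    then have "hs ?D ?D = 0" using eq[OF D] by simp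
    then have "?D = (\<lambda>s t. 0)" using hs_eq_0 V_ops[OF D] by blast
    then show ?thesis by (simp add: fun_eq_iff)
  qed
  then have "r \<in> Fx" using rV by (simp add: Fx_def)
  then have "hs r A = 0" using A by (simp add: V'_def)
  then show ?thesis using rep A by (simp add: V'_def)
qed

text \<open>The last conclusion covers every \<Gamma>' that acts on \<open>V\<close> by the same
  maps as \<Gamma>. On operators neutral under one copy of \<open>K\<close>, the other copy and the
  diagonal subgroup are such a pair, so a single operator can be charged under both. The loss of a
  factor two at each splitting is governed by the dimension of the operators on
  \<open>S\<close>.\<close>

lemma multiplet_component:
  assumes A: "A \<in> V'" and N: "(card (pats S))\<^sup>2 \<le> N"
    and f: "\<And>A B. A \<in> V' \<Longrightarrow> B \<in> V' \<Longrightarrow> f (\<lambda>s t. A s t - B s t) = f A - (f B :: complex)"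
    and \<epsilon>: "\<epsilon> \<le> cmod (f A)" "0 < \<epsilon>"
  obtains B where "B \<in> V'" "hsq B \<le> hsq A" "\<epsilon> / 2 ^ N \<le> cmod (f B)"
    "\<forall>\<Gamma>'. (\<forall>x\<in>\<Gamma>'. \<exists>y\<in>\<Gamma>. \<forall>A\<in>V. CS x A = CS y A) \<and>
        (\<forall>y\<in>\<Gamma>. \<exists>x\<in>\<Gamma>'. \<forall>A\<in>V. CS x A = CS y A) \<longrightarrow> charged C L \<Gamma>' B"
proof -
  define \<Phi> where "\<Phi> = (\<lambda>x u. case_prod (CS x (curry u))) ` \<Gamma>"
  define g where "g u = f (curry u)" for u
  have sub: "vsub (X \<times> X) (case_prod ` V')" using V'_sub unfolding op_subspace_vsub .
  have rk: "rank_le (X \<times> X) (case_prod ` V') N"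
    by (rule rank_le_weaken[OF rank_le_mono[OF rank_supp_ops[of "X \<times> X" S]] N]) (auto simp: V'_def V_def)
  have adj: "\<forall>\<phi>\<in>\<Phi>. \<exists>\<phi>'\<in>\<Phi>. \<exists>\<kappa>. \<forall>u\<in>case_prod ` V'. \<forall>w\<in>case_prod ` V'.
      inner_on (X \<times> X) (\<phi> u) w = \<kappa> * inner_on (X \<times> X) u (\<phi>' w)"
  proof
    fix \<phi> assume "\<phi> \<in> \<Phi>"
    then obtain x where x: "x \<in> \<Gamma>" "\<phi> = (\<lambda>u. case_prod (CS x (curry u)))" by (auto simp: \<Phi>_def)
    show "\<exists>\<phi>'\<in>\<Phi>. \<exists>\<kappa>. \<forall>u\<in>case_prod ` V'. \<forall>w\<in>case_prod ` V'.
      inner_on (X \<times> X) (\<phi> u) w = \<kappa> * inner_on (X \<times> X) u (\<phi>' w)"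
    proof (intro bexI[of _ "\<lambda>u. case_prod (CS (inv\<^bsub>H\<^esub> x) (curry u))"] exI[of _ 1] ballI)
      show "(\<lambda>u. case_prod (CS (inv\<^bsub>H\<^esub> x) (curry u))) \<in> \<Phi>" using \<Gamma>(2)[OF x(1)] by (auto simp: \<Phi>_def)
      fix u w assume "u \<in> case_prod ` V'" "w \<in> case_prod ` V'"
      then obtain A B where "u = case_prod A" "w = case_prod B" by blast
      then show "inner_on (X \<times> X) (\<phi> u) w = 1 * inner_on (X \<times> X) u (case_prod (CS (inv\<^bsub>H\<^esub> x) (curry w)))"
        using CS_hs[of x A B] x \<Gamma>(1) by auto
    qed
  qed
  have inv: "\<forall>\<phi>\<in>\<Phi>. \<phi> ` (case_prod ` V') \<subseteq> case_prod ` V'"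
    using V'_CS by (auto simp: \<Phi>_def)
  have "\<exists>W B'. irreducible_under (X \<times> X) \<Phi> W \<and> W \<subseteq> case_prod ` V' \<and> B' \<in> W \<and> \<epsilon> / 2 ^ N \<le> cmod (g B') \<and>
     nsq (X \<times> X) B' \<le> nsq (X \<times> X) (case_prod A) \<and> (\<forall>w\<in>W. inner_on (X \<times> X) w (\<lambda>s. case_prod A s - B' s) = 0)"
  proof (rule irreducible_component[OF fin2 sub inv adj rk])
    show "case_prod A \<in> case_prod ` V'" using A by blast
    show "\<epsilon> \<le> cmod (g (case_prod A))" "0 < \<epsilon>" using \<epsilon> by (auto simp: g_def)
    fix u v assume "u \<in> case_prod ` V'" "v \<in> case_prod ` V'"
    then obtain A B where "A \<in> V'" "B \<in> V'" "u = case_prod A" "v = case_prod B" by blast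
    then show "g (\<lambda>s. u s - v s) = g u - g v" using f[of A B] by (simp add: g_def curry_def)
  qed
  then obtain W B' where W: "irreducible_under (X \<times> X) \<Phi> W" "W \<subseteq> case_prod ` V'" "B' \<in> W"
    "\<epsilon> / 2 ^ N \<le> cmod (g B')" "nsq (X \<times> X) B' \<le> hsq A" by blast
  define U where "U = {A. case_prod A \<in> W}"
  define B where "B = curry B'"
  have WU: "W = case_prod ` U" unfolding U_def using W(2) by (auto simp: image_iff)
  have BB: "case_prod B = B'" by (simp add: B_def)
  have UV': "U \<subseteq> V'"
  proof
    fix A assume "A \<in> U"
    then obtain A' where "A' \<in> V'" "case_prod A = case_prod A'" using W(2) unfolding U_def by blast
    then show "A \<in> V'" by (metis curry_case_prod)
  qed
  have BU: "B \<in> U" using W(3) BB by (simp add: U_def)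
  have Usub: "op_subspace X U" unfolding op_subspace_vsub WU[symmetric] using W(1) by (simp add: irreducible_under_def)
  have UV: "U \<subseteq> V" using UV' by (auto simp: V'_def)
  have B0: "B \<noteq> (\<lambda>s t. 0)"
  proof
    assume 0: "B = (\<lambda>s t. 0)"
    have "B \<in> V'" using BU UV' by blast
    then have "f (\<lambda>s t. B s t - B s t) = 0" using f[of B B] by simp
    then have "g B' = 0" unfolding g_def B_def[symmetric] using 0 by simp
    moreover have "0 < \<epsilon> / 2 ^ N" using \<epsilon>(2) by simp
    ultimately show False using W(4) by simp
  qed
  have "charged C L \<Gamma>' B"
    if a1: "\<And>x. x \<in> \<Gamma>' \<Longrightarrow> \<exists>y\<in>\<Gamma>. \<forall>A\<in>V. CS x A = CS y A"
    and a2: "\<And>y. y \<in> \<Gamma> \<Longrightarrow> \<exists>x\<in>\<Gamma>'. \<forall>A\<in>V. CS x A = CS y A" for \<Gamma>'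
    unfolding charged_def
  proof (intro exI[of _ U] conjI allI impI ballI)
    show "op_subspace X U" "B \<in> U" "B \<noteq> (\<lambda>s t. 0)" by (fact Usub BU B0)+
    fix x assume "x \<in> \<Gamma>'"
    then obtain y where y: "y \<in> \<Gamma>" "\<forall>A\<in>V. CS x A = CS y A" using a1 by blast
    show "CS x ` U \<subseteq> U"
    proof
      fix A assume "A \<in> CS x ` U"
      then obtain A' where A': "A' \<in> U" "A = CS y A'" using y(2) UV by blast
      have y\<Phi>: "(\<lambda>u. case_prod (CS y (curry u))) \<in> \<Phi>" unfolding \<Phi>_def by (rule imageI[OF y(1)])
      have "\<forall>\<phi>\<in>\<Phi>. \<phi> ` W \<subseteq> W" using W(1) by (simp add: irreducible_under_def)
      from bspec[OF this y\<Phi>] have "(\<lambda>u. case_prod (CS y (curry u))) ` W \<subseteq> W" .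
      moreover have "case_prod A' \<in> W" using A'(1) by (simp add: U_def)
      ultimately have "case_prod (CS y (curry (case_prod A'))) \<in> W" by (simp only: image_subset_iff)
      then show "A \<in> U" using A' by (simp add: U_def)
    qed
  next
    fix T assume T: "op_subspace X T \<and> T \<subseteq> U \<and> (\<forall>x\<in>\<Gamma>'. CS x ` T \<subseteq> T)"
    have "vsub (X \<times> X) (case_prod ` T)" using T op_subspace_vsub by blast
    moreover have "case_prod ` T \<subseteq> W" using T WU by blast
    moreover have "\<forall>\<phi>\<in>\<Phi>. \<phi> ` (case_prod ` T) \<subseteq> case_prod ` T"
    proof
      fix \<phi> assume "\<phi> \<in> \<Phi>"
      then obtain y where y: "y \<in> \<Gamma>" "\<phi> = (\<lambda>u. case_prod (CS y (curry u)))" by (auto simp: \<Phi>_def)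
      then obtain x where x: "x \<in> \<Gamma>'" "\<forall>A\<in>V. CS x A = CS y A" using a2 by blast
      have "CS y A \<in> T" if "A \<in> T" for A
      proof -
        have "A \<in> V" using that T UV by blast
        then have "CS y A = CS x A" using x(2) by simp
        then show ?thesis using T x(1) that by blast
      qed
      then show "\<phi> ` (case_prod ` T) \<subseteq> case_prod ` T" by (auto simp: y(2))
    qed
    ultimately have "case_prod ` T = {\<lambda>s. 0} \<or> case_prod ` T = W"
      using W(1) unfolding irreducible_under_def by blast
    moreover have inj: "inj (case_prod :: (nat \<Rightarrow> nat \<times> nat) op \<Rightarrow> _)" by (metis curry_case_prod injI)
    moreover have "{\<lambda>s. 0} = case_prod ` {\<lambda>(s :: nat \<Rightarrow> nat \<times> nat) (t :: nat \<Rightarrow> nat \<times> nat). 0 :: complex}"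
      by (auto simp: case_prod_beta')
    ultimately show "T = {\<lambda>s t. 0} \<or> T = U" unfolding WU by (metis inj_image_eq_iff)
  next
    \<comment> \<open>If \<Gamma>' acted trivially on the multiplet, \<open>B\<close> would be
      invariant and hence orthogonal to itself.\<close>
    show "\<exists>x\<in>\<Gamma>'. \<exists>A\<in>U. CS x A \<noteq> A"
    proof (rule ccontr)
      assume "\<not> (\<exists>x\<in>\<Gamma>'. \<exists>A\<in>U. CS x A \<noteq> A)"
      then have fix': "CS x B = B" if "x \<in> \<Gamma>'" for x using that BU by blast
      have "CS y B = B" if "y \<in> \<Gamma>" for y using a2[OF that] fix' BU UV by force
      then have "B \<in> Fx" using BU UV by (auto simp: Fx_def)
      then have "hs B B = 0" using BU UV' by (auto simp: V'_def)
      then show False using B0 hs_eq_0 V_ops BU UV by blast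
    qed
  qed
  then have ch: "\<forall>\<Gamma>'. (\<forall>x\<in>\<Gamma>'. \<exists>y\<in>\<Gamma>. \<forall>A\<in>V. CS x A = CS y A) \<and>
      (\<forall>y\<in>\<Gamma>. \<exists>x\<in>\<Gamma>'. \<forall>A\<in>V. CS x A = CS y A) \<longrightarrow> charged C L \<Gamma>' B" by simp
  show ?thesis by (rule that[OF subsetD[OF UV' BU] _ _ ch]) (use W(4,5) BB in \<open>simp_all add: g_def B_def\<close>)
qed

end

section \<open>Order under a subgroup with a nontrivial cocycle\<close>

text \<open>In its uses \<open>j\<close> embeds \<open>K\<close> as one of the copies and \<Theta>
  is the other copy. The assumption \<open>nontrivial\<close> is the quantitative form of a
  nontrivial class: no function with moduli between 1/2 and 2 trivialises the cocycle up to
  \<delta>0. It does not mention the chain, so \<delta>0 serves for all lengths.\<close>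

locale edge_sub = edge +
  fixes j :: "'a \<Rightarrow> ('a \<times> 'a) \<times> 'c" and \<Theta> :: "(('a \<times> 'a) \<times> 'c) set" and \<delta>0 :: real and N :: nat
  assumes jc: "\<And>k. k \<in> carrier K \<Longrightarrow> j k \<in> carrier H"
    and jm: "\<And>k l. k \<in> carrier K \<Longrightarrow> l \<in> carrier K \<Longrightarrow> j (k \<otimes>\<^bsub>K\<^esub> l) = j k \<otimes>\<^bsub>H\<^esub> j l"
    and \<Theta>c: "\<Theta> \<subseteq> carrier H"
    and \<Theta>_commute: "\<And>k y. k \<in> carrier K \<Longrightarrow> y \<in> \<Theta> \<Longrightarrow> j k \<otimes>\<^bsub>H\<^esub> y = y \<otimes>\<^bsub>H\<^esub> j k"
    and \<Theta>_ratio: "\<And>k y. k \<in> carrier K \<Longrightarrow> y \<in> \<Theta> \<Longrightarrow> \<omega> (j k) y = \<omega> y (j k)"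
    and unit: "\<And>k l. k \<in> carrier K \<Longrightarrow> l \<in> carrier K \<Longrightarrow> cmod (\<omega> (j k) (j l)) = 1"
    and \<delta>0: "0 < \<delta>0"
    and nontrivial: "\<And>h. (\<forall>k\<in>carrier K. 1 / 2 \<le> cmod (h k) \<and> cmod (h k) \<le> 2) \<Longrightarrow>
      \<exists>x\<in>carrier K. \<exists>y\<in>carrier K. \<delta>0 < cmod (h x * h y - h (x \<otimes>\<^bsub>K\<^esub> y) / \<omega> (j x) (j y))"
    and N: "card (pats {..<a}) \<le> N" "card (pats {c..<L}) \<le> N" "1 \<le> N"
begin

section \<open>Projective action on the span of the edge vectors\<close>

sublocale Kg: group K by (rule K)

abbreviation "Vl k \<equiv> Bl (j k)"
abbreviation "\<beta> k l \<equiv> \<omega> (j k) (j l)"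

lemma \<beta>0: "k \<in> carrier K \<Longrightarrow> l \<in> carrier K \<Longrightarrow> \<beta> k l \<noteq> 0"
  using unit by fastforce

text \<open>The linear combinations of the left edge unitaries, generated one term at a time.
  Operators are kept besides the vectors of \<open>T\<close> because a vector of \<open>T\<close>
  must be turned into an operator on the left edge that creates it.\<close>

inductive_set comb :: "(nat \<Rightarrow> nat \<times> nat) op set" where
  zero: "(\<lambda>s t. 0) \<in> comb"
| add: "A \<in> comb \<Longrightarrow> k \<in> carrier K \<Longrightarrow> (\<lambda>s t. z * Vl k s t + A s t) \<in> comb"

definition T :: "((nat \<Rightarrow> nat \<times> nat) \<Rightarrow> complex) set" where
  "T = {A \<triangleright> \<psi> | A. A \<in> comb}"

lemma comb_lin: "A \<in> comb \<Longrightarrow> A' \<in> comb \<Longrightarrow> (\<lambda>s t. z * A s t + w * A' s t) \<in> comb"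
proof (induction arbitrary: z rule: comb.induct)
  case zero
  then have "(\<lambda>s t. w * A' s t) \<in> comb"
  proof (induction rule: comb.induct)
    case (add A k z)
    then show ?case using comb.add[of "\<lambda>s t. w * A s t" k "w * z"] by (simp add: algebra_simps)
  qed (use comb.zero in simp)
  then show ?case by simp
next
  case (add A k y)
  then show ?case using comb.add[OF add.IH[OF add.prems, of z] add.hyps(2), of "z * y"]
    by (simp add: algebra_simps)
qed

lemma app_add: "(\<lambda>s t. z * A s t + B s t) \<triangleright> u = (\<lambda>s. z * (A \<triangleright> u) s + (B \<triangleright> u) s)"
  using app_op_lin[of z A 1 B u] by simp

lemma app_zero_op: "(\<lambda>s t. 0) \<triangleright> u = (\<lambda>s. 0)"
  by (simp add: app_op_def)

lemma Vl: "k \<in> carrier K \<Longrightarrow> unitary (Vl k)" "k \<in> carrier K \<Longrightarrow> supp {..<a} (Vl k)"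
  "k \<in> carrier K \<Longrightarrow> supp {..<c} (Vl k)" "k \<in> carrier K \<Longrightarrow> Vl k \<triangleright> u \<in> vecs X"
  using Bl[OF jc] Bl_c(1)[OF jc] supp_ops[OF Bl(2)[OF jc]] by auto

lemma comb_supp: "A \<in> comb \<Longrightarrow> supp {..<a} A"
proof (induction rule: comb.induct)
  case zero
  show ?case using supp_lin[OF supp_one supp_one, of "{..<a}" 0 0] by simp
next
  case (add A k z)
  show ?case using supp_lin[OF Vl(2)[OF add.hyps(2)] add.IH, of z 1] by simp
qed

lemma T_sub: "vsub X T"
  unfolding vsub_def
proof (intro conjI ballI allI)
  show "T \<subseteq> vecs X" using supp_ops[OF comb_supp] by (auto simp: T_def)
  show "(\<lambda>s. 0) \<in> T" unfolding T_def using comb.zero app_zero_op[of \<psi>] by force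
  fix u v z w assume "u \<in> T" "v \<in> T"
  then obtain A B where "A \<in> comb" "B \<in> comb" "u = A \<triangleright> \<psi>" "v = B \<triangleright> \<psi>" by (auto simp: T_def)
  then show "(\<lambda>s. z * u s + w * v s) \<in> T"
    unfolding T_def using comb_lin[of A B z w] app_op_lin[of z A w B \<psi>] by force
qed

lemma T_vecs: "v \<in> T \<Longrightarrow> v \<in> vecs X"
  by (rule vsubD(1)[OF T_sub])

lemma T_Vl: "k \<in> carrier K \<Longrightarrow> Vl k \<triangleright> \<psi> \<in> T"
  unfolding T_def using comb.add[OF comb.zero, of k 1] by auto

lemma T_induct [consumes 1, case_names zero add]:
  assumes "v \<in> T" "P (\<lambda>s. 0)"
    "\<And>k z v. k \<in> carrier K \<Longrightarrow> v \<in> T \<Longrightarrow> P v \<Longrightarrow> P (\<lambda>s. z * (Vl k \<triangleright> \<psi>) s + 1 * v s)"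
  shows "P v"
proof -
  obtain A where "A \<in> comb" "v = A \<triangleright> \<psi>" using assms(1) by (auto simp: T_def)
  then show ?thesis
  proof (induction arbitrary: v rule: comb.induct)
    case zero
    then show ?case using assms(2) by (simp add: app_zero_op)
  next
    case (add A k z)
    have "P (\<lambda>s. z * (Vl k \<triangleright> \<psi>) s + 1 * (A \<triangleright> \<psi>) s)"
      using add.hyps by (intro assms(3) add.IH) (auto simp: T_def)
    then show ?case unfolding add.prems app_add by simp
  qed
qed

lemma Vl_Vl_\<psi>:
  assumes "k \<in> carrier K" "l \<in> carrier K"
  shows "Vl k \<triangleright> Vl l \<triangleright> \<psi> = (\<lambda>s. 1 / \<beta> k l * (Vl (k \<otimes>\<^bsub>K\<^esub> l) \<triangleright> \<psi>) s)"
  unfolding jm[OF assms] by (rule Bl_Bl[OF jc[OF assms(1)] jc[OF assms(2)]])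

text \<open>On \<psi> a left edge unitary equals, up to a phase, the adjoint of the right one. That
  adjoint commutes with all operators on the left, which is how relations known on \<psi> are
  transported to edge vectors.\<close>

lemma Vl_\<psi>:
  assumes l: "l \<in> carrier K"
  shows "Vl l \<triangleright> \<psi> = (\<lambda>s. e (j l) * (adj_op (Br (j l)) \<triangleright> \<psi>) s)"
proof -
  have "Br (j l) \<triangleright> Vl l \<triangleright> \<psi> = (\<lambda>s. e (j l) * \<psi> s)"
    unfolding Br_commute[OF jc[OF l] Vl(3)[OF l]] by (rule Bl_Br[OF jc[OF l]])
  then have "adj_op (Br (j l)) \<triangleright> Br (j l) \<triangleright> Vl l \<triangleright> \<psi> = (\<lambda>s. e (j l) * (adj_op (Br (j l)) \<triangleright> \<psi>) s)"
    by (simp only: app_scale)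
  then show ?thesis unfolding unitary_app(1)[OF Br(1)[OF jc[OF l]] Vl(4)[OF l]] .
qed

lemma app_Vl:
  assumes l: "l \<in> carrier K" and A: "supp {..<c} A"
  shows "A \<triangleright> Vl l \<triangleright> \<psi> = (\<lambda>s. e (j l) * (adj_op (Br (j l)) \<triangleright> A \<triangleright> \<psi>) s)"
proof -
  have "{..<c} \<inter> {c..<L} = {}" by auto
  then show ?thesis
    unfolding Vl_\<psi>[OF l] app_scale using supp_app_commute[OF A supp_adj[OF Br(2)[OF jc[OF l]]]] by simp
qed

text \<open>The projective law extends from \<psi> to all of \<open>T\<close>: \<open>Vl m\<close>
  next to \<psi> is traded for an operator on the right, where it does not interfere.\<close>

lemma Vl_Vl:
  assumes k: "k \<in> carrier K" and l: "l \<in> carrier K" and v: "v \<in> T"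
  shows "Vl k \<triangleright> Vl l \<triangleright> v = (\<lambda>s. 1 / \<beta> k l * (Vl (k \<otimes>\<^bsub>K\<^esub> l) \<triangleright> v) s)"
  using v
proof (induction rule: T_induct)
  case zero
  show ?case by simp
next
  case (add m z v)
  have kl: "k \<otimes>\<^bsub>K\<^esub> l \<in> carrier K" using k l by simp
  have "Vl k \<triangleright> Vl l \<triangleright> Vl m \<triangleright> \<psi> = (Vl k \<odot> Vl l) \<triangleright> Vl m \<triangleright> \<psi>" by (simp only: app_times)
  also have "\<dots> = (\<lambda>s. e (j m) * (adj_op (Br (j m)) \<triangleright> Vl k \<triangleright> Vl l \<triangleright> \<psi>) s)"
    unfolding app_Vl[OF add.hyps(1) supp_times[OF Vl(3)[OF k] Vl(3)[OF l]]] by (simp only: app_times)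
  also have "\<dots> = (\<lambda>s. 1 / \<beta> k l * (Vl (k \<otimes>\<^bsub>K\<^esub> l) \<triangleright> Vl m \<triangleright> \<psi>) s)"
    unfolding Vl_Vl_\<psi>[OF k l] app_Vl[OF add.hyps(1) Vl(3)[OF kl]] app_scale by (simp only: mult.left_commute)
  finally have *: "Vl k \<triangleright> Vl l \<triangleright> Vl m \<triangleright> \<psi> = (\<lambda>s. 1 / \<beta> k l * (Vl (k \<otimes>\<^bsub>K\<^esub> l) \<triangleright> Vl m \<triangleright> \<psi>) s)" .
  show ?case unfolding app_lin * add.IH by (simp only: distrib_left mult.left_commute)
qed

lemma Vl_T: "k \<in> carrier K \<Longrightarrow> v \<in> T \<Longrightarrow> Vl k \<triangleright> v \<in> T"
proof -
  assume k: "k \<in> carrier K" and "v \<in> T"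
  from this(2) show ?thesis
  proof (induction rule: T_induct)
    case zero
    show ?case using vsubD(2)[OF T_sub] by simp
  next
    case (add m z v)
    have "Vl k \<triangleright> Vl m \<triangleright> \<psi> \<in> T"
      unfolding Vl_Vl_\<psi>[OF k add.hyps(1)] using k add.hyps(1) by (intro vsub_scale[OF T_sub] T_Vl) simp
    then show ?case unfolding app_lin by (rule vsubD(3)[OF T_sub _ add.IH])
  qed
qed

lemma DD_T:
  assumes h: "h \<in> carrier K" and v: "v \<in> T"
  shows "DD (j h) \<triangleright> v = Vl h \<triangleright> Br (j h) \<triangleright> v"
  using v
proof (induction rule: T_induct)
  case zero
  show ?case by simp
next
  case (add k z v)
  have "DD (j h) \<triangleright> Vl k \<triangleright> \<psi> = Vl h \<triangleright> Br (j h) \<triangleright> Vl k \<triangleright> \<psi>"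
    unfolding DS_Bl[OF jc[OF add.hyps(1)] jc[OF h]] by (rule Br_commute[OF jc[OF h] Vl(3)[OF h]])
  then show ?case unfolding app_lin add.IH by simp
qed

lemma DD_in_T:
  assumes h: "h \<in> carrier K" and v: "v \<in> T"
  shows "DD (j h) \<triangleright> v \<in> T"
  using v
proof (induction rule: T_induct)
  case zero
  show ?case using vsubD(2)[OF T_sub] by simp
next
  case (add k z v)
  note k = add.hyps(1)
  \<comment> \<open>With \<open>m\<close> the conjugate of \<open>k\<close> by \<open>h\<close>, the
    symmetry \<open>h\<close> maps the edge vector of \<open>k\<close> to a multiple of that of
    \<open>m\<close>: \<open>Vl h\<close> is moved next to \<psi>, where it combines with the right
    edge operator to a phase.\<close>
  define m where "m = h \<otimes>\<^bsub>K\<^esub> k \<otimes>\<^bsub>K\<^esub> inv\<^bsub>K\<^esub> h"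
  have m: "m \<in> carrier K" "m \<otimes>\<^bsub>K\<^esub> h = h \<otimes>\<^bsub>K\<^esub> k" using h k by (auto simp: m_def Kg.m_assoc)
  have "Vl m \<triangleright> Vl h \<triangleright> \<psi> = (\<lambda>s. 1 / \<beta> m h * (Vl (h \<otimes>\<^bsub>K\<^esub> k) \<triangleright> \<psi>) s)"
    using Vl_Vl_\<psi>[OF m(1) h] unfolding m(2) .
  then have "(Vl m \<triangleright> Vl h \<triangleright> \<psi>) s = 1 / \<beta> m h * (Vl (h \<otimes>\<^bsub>K\<^esub> k) \<triangleright> \<psi>) s" for s by (rule fun_cong)
  then have hk: "Vl (h \<otimes>\<^bsub>K\<^esub> k) \<triangleright> \<psi> = (\<lambda>s. \<beta> m h * (Vl m \<triangleright> Vl h \<triangleright> \<psi>) s)"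
    using \<beta>0[OF m(1) h] by simp
  have "DD (j h) \<triangleright> Vl k \<triangleright> \<psi> = (\<lambda>s. 1 / \<beta> h k * (\<beta> m h * (Br (j h) \<triangleright> Vl m \<triangleright> Vl h \<triangleright> \<psi>) s))"
    unfolding DS_Bl[OF jc[OF k] jc[OF h]] Vl_Vl_\<psi>[OF h k] hk app_scale ..
  also have "Br (j h) \<triangleright> Vl m \<triangleright> Vl h \<triangleright> \<psi> = Vl m \<triangleright> Vl h \<triangleright> Br (j h) \<triangleright> \<psi>"
    unfolding Br_commute[OF jc[OF h] Vl(3)[OF m(1)]] Br_commute[OF jc[OF h] Vl(3)[OF h]] ..
  also have "\<dots> = (\<lambda>s. e (j h) * (Vl m \<triangleright> \<psi>) s)" unfolding Bl_Br[OF jc[OF h]] app_scale ..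
  finally have "DD (j h) \<triangleright> Vl k \<triangleright> \<psi> \<in> T"
    using T_Vl[OF m(1)] by (simp only:) (intro vsub_scale[OF T_sub])
  then show ?case unfolding app_lin by (rule vsubD(3)[OF T_sub _ add.IH])
qed

lemma Vl_one:
  assumes "w \<in> T"
  shows "Vl \<one>\<^bsub>K\<^esub> \<triangleright> w = (\<lambda>s. 1 / \<beta> \<one>\<^bsub>K\<^esub> \<one>\<^bsub>K\<^esub> * w s)"
proof -
  have 1: "\<one>\<^bsub>K\<^esub> \<in> carrier K" by simp
  have *: "Vl \<one>\<^bsub>K\<^esub> \<triangleright> Vl \<one>\<^bsub>K\<^esub> \<triangleright> w = (\<lambda>s. 1 / \<beta> \<one>\<^bsub>K\<^esub> \<one>\<^bsub>K\<^esub> * (Vl \<one>\<^bsub>K\<^esub> \<triangleright> w) s)"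
    using Vl_Vl[OF 1 1 assms] by simp
  have "Vl \<one>\<^bsub>K\<^esub> \<triangleright> w = adj_op (Vl \<one>\<^bsub>K\<^esub>) \<triangleright> Vl \<one>\<^bsub>K\<^esub> \<triangleright> Vl \<one>\<^bsub>K\<^esub> \<triangleright> w"
    by (rule unitary_app(1)[OF Vl(1)[OF 1] Vl(4)[OF 1], symmetric])
  then show ?thesis unfolding * app_scale unitary_app(1)[OF Vl(1)[OF 1] T_vecs[OF assms]] .
qed

text \<open>The scalar between the adjoint of an edge unitary and the edge unitary of the inverse,
  as operators on \<open>T\<close>. It is not 1 since the cocycle is not normalised.\<close>

definition \<kappa> where "\<kappa> k = \<beta> k (inv\<^bsub>K\<^esub> k) * \<beta> \<one>\<^bsub>K\<^esub> \<one>\<^bsub>K\<^esub>"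

lemma Vl_adj:
  assumes k: "k \<in> carrier K" and w: "w \<in> T"
  shows "adj_op (Vl k) \<triangleright> w = (\<lambda>s. \<kappa> k * (Vl (inv\<^bsub>K\<^esub> k) \<triangleright> w) s)"
proof -
  have i: "inv\<^bsub>K\<^esub> k \<in> carrier K" using k by simp
  have n: "\<beta> k (inv\<^bsub>K\<^esub> k) \<noteq> 0" "\<beta> \<one>\<^bsub>K\<^esub> \<one>\<^bsub>K\<^esub> \<noteq> 0" using \<beta>0 k i by auto
  have "Vl k \<triangleright> (\<lambda>s. \<kappa> k * (Vl (inv\<^bsub>K\<^esub> k) \<triangleright> w) s) = (\<lambda>s. \<kappa> k * (1 / \<beta> k (inv\<^bsub>K\<^esub> k) * (1 / \<beta> \<one>\<^bsub>K\<^esub> \<one>\<^bsub>K\<^esub> * w s)))"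
    unfolding app_scale Vl_Vl[OF k i w] Kg.r_inv[OF k] Vl_one[OF w] ..
  also have "\<dots> = w" using n by (simp add: \<kappa>_def)
  finally have "Vl k \<triangleright> (\<lambda>s. \<kappa> k * (Vl (inv\<^bsub>K\<^esub> k) \<triangleright> w) s) = w" .
  moreover have "(\<lambda>s. \<kappa> k * (Vl (inv\<^bsub>K\<^esub> k) \<triangleright> w) s) \<in> vecs X" using Vl(4)[OF i, of w] by (auto simp: vecs_def)
  ultimately show ?thesis using unitary_app(1)[OF Vl(1)[OF k]] by metis
qed

definition \<Phi> where "\<Phi> = (\<lambda>k. app_op X (Vl k)) ` carrier K"

text \<open>The identity is not among the generators, but the edge operator of the neutral element
  acts on \<psi> as a nonzero scalar.\<close>

lemma \<psi>_T: "\<psi> \<in> T"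
proof -
  have 1: "\<one>\<^bsub>K\<^esub> \<in> carrier K" by simp
  have "Vl \<one>\<^bsub>K\<^esub> \<triangleright> Vl \<one>\<^bsub>K\<^esub> \<triangleright> \<psi> = (\<lambda>s. 1 / \<beta> \<one>\<^bsub>K\<^esub> \<one>\<^bsub>K\<^esub> * (Vl \<one>\<^bsub>K\<^esub> \<triangleright> \<psi>) s)"
    using Vl_Vl_\<psi>[OF 1 1] by simp
  then have "adj_op (Vl \<one>\<^bsub>K\<^esub>) \<triangleright> Vl \<one>\<^bsub>K\<^esub> \<triangleright> Vl \<one>\<^bsub>K\<^esub> \<triangleright> \<psi> = (\<lambda>s. 1 / \<beta> \<one>\<^bsub>K\<^esub> \<one>\<^bsub>K\<^esub> * (adj_op (Vl \<one>\<^bsub>K\<^esub>) \<triangleright> Vl \<one>\<^bsub>K\<^esub> \<triangleright> \<psi>) s)"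
    by (simp only: app_scale)
  then have "Vl \<one>\<^bsub>K\<^esub> \<triangleright> \<psi> = (\<lambda>s. 1 / \<beta> \<one>\<^bsub>K\<^esub> \<one>\<^bsub>K\<^esub> * \<psi> s)"
    unfolding unitary_app(1)[OF Vl(1)[OF 1] Vl(4)[OF 1]] unitary_app(1)[OF Vl(1)[OF 1] \<psi>_vecs] .
  then have "(Vl \<one>\<^bsub>K\<^esub> \<triangleright> \<psi>) s = 1 / \<beta> \<one>\<^bsub>K\<^esub> \<one>\<^bsub>K\<^esub> * \<psi> s" for s by (rule fun_cong)
  then have "\<psi> = (\<lambda>s. \<beta> \<one>\<^bsub>K\<^esub> \<one>\<^bsub>K\<^esub> * (Vl \<one>\<^bsub>K\<^esub> \<triangleright> \<psi>) s)" using \<beta>0[OF 1 1] by auto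
  then show ?thesis using vsub_scale[OF T_sub T_Vl[OF 1], of "\<beta> \<one>\<^bsub>K\<^esub> \<one>\<^bsub>K\<^esub>"] by simp
qed

text \<open>\<psi> itself is decomposed under the edge unitaries, with its overlap with \<psi> as
  the functional. The component found is the projection of \<psi> onto \<open>M\<close>, so its
  overlap with \<psi> is its squared norm; the lower bound depends on \<open>N\<close>
  alone.\<close>

lemma irreducible_part:
  obtains M v where "irreducible_under X \<Phi> M" "M \<subseteq> T" "v \<in> M" "1 / 2 ^ N\<^sup>2 \<le> nsq X v" "nsq X v \<le> 1"
    "\<And>w. w \<in> M \<Longrightarrow> inn w (\<lambda>s. \<psi> s - v s) = 0"
proof -
  have inv: "\<forall>\<phi>\<in>\<Phi>. \<phi> ` T \<subseteq> T" unfolding \<Phi>_def using Vl_T by auto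
  have adj: "\<forall>\<phi>\<in>\<Phi>. \<exists>\<phi>'\<in>\<Phi>. \<exists>\<kappa>. \<forall>u\<in>T. \<forall>w\<in>T. inner_on X (\<phi> u) w = \<kappa> * inner_on X u (\<phi>' w)"
  proof
    fix \<phi> assume "\<phi> \<in> \<Phi>"
    then obtain k where k: "k \<in> carrier K" "\<phi> = app_op X (Vl k)" by (auto simp: \<Phi>_def)
    have "inn (Vl k \<triangleright> u) w = \<kappa> k * inn u (Vl (inv\<^bsub>K\<^esub> k) \<triangleright> w)" if "w \<in> T" for u w
    proof -
      have "inn (Vl k \<triangleright> u) w = inn u (adj_op (Vl k) \<triangleright> w)" using inner_adj[of u "adj_op (Vl k)" w] by simp
      then show ?thesis unfolding Vl_adj[OF k(1) that] inner_scale_right .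
    qed
    moreover have "app_op X (Vl (inv\<^bsub>K\<^esub> k)) \<in> \<Phi>" using k(1) by (auto simp: \<Phi>_def)
    ultimately show "\<exists>\<phi>'\<in>\<Phi>. \<exists>\<kappa>. \<forall>u\<in>T. \<forall>w\<in>T. inner_on X (\<phi> u) w = \<kappa> * inner_on X u (\<phi>' w)"
      unfolding k(2) by blast
  qed
  have "T \<subseteq> {A \<triangleright> \<psi> | A. supp {..<a} A}" using comb_supp by (auto simp: T_def)
  then have rk: "rank_le X T (N\<^sup>2)"
    using N(1) by (intro rank_le_weaken[OF rank_le_mono[OF rank_supp_image[where Y = X and S = "{..<a}" and v = \<psi>]]]) (auto intro: power_mono)
  have one: "1 \<le> cmod (inn \<psi> \<psi>)" unfolding inner_self \<psi>_norm by simp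
  have "\<exists>W B'. irreducible_under X \<Phi> W \<and> W \<subseteq> T \<and> B' \<in> W \<and> 1 / 2 ^ N\<^sup>2 \<le> cmod (inn \<psi> B') \<and>
     nsq X B' \<le> nsq X \<psi> \<and> (\<forall>w\<in>W. inner_on X w (\<lambda>s. \<psi> s - B' s) = 0)"
    by (rule irreducible_component[where f = "inner_on X \<psi>", OF finX T_sub inv adj rk \<psi>_T inner_diff_right one zero_less_one])
  then obtain M v where M: "irreducible_under X \<Phi> M" "M \<subseteq> T" "v \<in> M" "1 / 2 ^ N\<^sup>2 \<le> cmod (inn \<psi> v)"
    "nsq X v \<le> nsq X \<psi>" "\<And>w. w \<in> M \<Longrightarrow> inn w (\<lambda>s. \<psi> s - v s) = 0" by blast
  \<comment> \<open>\<open>v\<close> is orthogonal to the error of the approximation, which turns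
    the overlap into a norm.\<close>
  have "inn v \<psi> = of_real (nsq X v)" using M(6)[OF M(3)] unfolding inner_diff_right inner_self by simp
  then have "cmod (inn \<psi> v) = nsq X v"
    using inner_cnj[of X v \<psi>] nsq_nonneg[of X v] by (metis abs_of_nonneg complex_mod_cnj norm_of_real)
  then show ?thesis using that[OF M(1-3)] M(4-6) \<psi>_norm by simp
qed

text \<open>
  A vector near \<open>Vl k \<psi>\<close> on which the symmetry acts as on \<open>\<psi>\<close> defines an operator commuting with
  all \<open>Vl l\<close>, which is a scalar on an irreducible subspace.
\<close>

lemma near_scalar:
  assumes M: "irreducible_under X \<Phi> M" "M \<subseteq> T" "v \<in> M" "v \<noteq> (\<lambda>s. 0)"
    "\<And>w. w \<in> M \<Longrightarrow> inn w (\<lambda>s. \<psi> s - v s) = 0"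
    and k: "k \<in> carrier K" and \<eta>: "\<eta> \<in> vecs X"
    and inv: "\<And>h. h \<in> carrier K \<Longrightarrow> DD (j h) \<triangleright> \<eta> = (\<lambda>s. e (j h) * \<eta> s)"
  obtains z where "nsq X (\<lambda>s. (Vl k \<triangleright> v) s - z * v s) \<le> nsq X (\<lambda>s. (Vl k \<triangleright> \<psi>) s - \<eta> s)"
proof -
  have MV: "vsub X M" and Minv: "Vl l \<triangleright> u \<in> M" if "l \<in> carrier K" "u \<in> M" for l u
    using M(1) that unfolding irreducible_under_def \<Phi>_def by auto
  have Msub: "vsub X M" using M(1) by (simp add: irreducible_under_def)
  \<comment> \<open>\<eta> need not be an edge vector; its projection onto \<open>T\<close> is one,
    and it is still symmetric because \<open>T\<close> is invariant under the global symmetry and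
    its adjoint.\<close>
  obtain \<zeta> where \<zeta>: "\<zeta> \<in> T" "\<And>t. t \<in> T \<Longrightarrow> inn t (\<lambda>s. \<eta> s - \<zeta> s) = 0"
    using ortho_decomp[OF finX T_sub \<eta>] by blast
  have \<zeta>inv: "DD (j h) \<triangleright> \<zeta> = (\<lambda>s. e (j h) * \<zeta> s)" if h: "h \<in> carrier K" for h
  proof -
    let ?r = "\<lambda>s. 1 * (DD (j h) \<triangleright> \<zeta>) s + - e (j h) * \<zeta> s"
    have rT: "?r \<in> T" by (rule vsubD(3)[OF T_sub DD_in_T[OF h \<zeta>(1)] \<zeta>(1)])
    have ih: "inv\<^bsub>K\<^esub> h \<in> carrier K" using h by simp
    have "j (inv\<^bsub>K\<^esub> h) \<otimes>\<^bsub>H\<^esub> j h = \<one>\<^bsub>H\<^esub>"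
    proof -
      have "j \<one>\<^bsub>K\<^esub> \<otimes>\<^bsub>H\<^esub> j \<one>\<^bsub>K\<^esub> = j \<one>\<^bsub>K\<^esub>" using jm[of "\<one>\<^bsub>K\<^esub>" "\<one>\<^bsub>K\<^esub>"] by simp
      then have "j \<one>\<^bsub>K\<^esub> = \<one>\<^bsub>H\<^esub>" using jc[OF Kg.one_closed] H.l_cancel_one by blast
      then show ?thesis using jm[OF ih h] h by simp
    qed
    then have "inv\<^bsub>H\<^esub> (j h) = j (inv\<^bsub>K\<^esub> h)" using jc[OF h] jc[OF ih] by (metis H.inv_equality)
    then have DDi: "adj_op (DD (j h)) = DD (j (inv\<^bsub>K\<^esub> h))" using DS_inv[OF jc[OF h]] by simp
    have "inn t ?r = 0" if t: "t \<in> T" for t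
    proof -
      have z: "inn u \<zeta> = inn u \<eta>" if "u \<in> T" for u using \<zeta>(2)[OF that] unfolding inner_diff_right by simp
      have "inn t (DD (j h) \<triangleright> \<zeta>) = inn (DD (j (inv\<^bsub>K\<^esub> h)) \<triangleright> t) \<zeta>" unfolding inner_adj DDi ..
      also have "\<dots> = inn (DD (j (inv\<^bsub>K\<^esub> h)) \<triangleright> t) \<eta>" by (rule z[OF DD_in_T[OF ih t]])
      also have "\<dots> = inn t (DD (j h) \<triangleright> \<eta>)" unfolding inner_adj DDi ..
      also have "\<dots> = e (j h) * inn t \<zeta>" unfolding inv[OF h] inner_scale_right z[OF t] ..
      finally show ?thesis unfolding inner_right by simp
    qed
    then have "?r = (\<lambda>s. 0)" using rT by (intro inner_eq_0D[OF finX T_vecs]) auto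
    then have "1 * (DD (j h) \<triangleright> \<zeta>) s + - e (j h) * \<zeta> s = 0" for s by (rule fun_cong)
    then show ?thesis by (auto simp: fun_eq_iff)
  qed
  \<comment> \<open>\<open>Z\<close> creates \<zeta> from \<psi>. Symmetry of \<zeta> lets
    \<open>Vl l\<close> on \<zeta> be traded for a right edge operator exactly as on \<psi>, and
    hence \<open>Z\<close> commutes with all \<open>Vl l\<close> on \<open>T\<close>.\<close>
  obtain Z where Z: "Z \<in> comb" "\<zeta> = Z \<triangleright> \<psi>" using \<zeta>(1) by (auto simp: T_def)
  have Zc: "supp {..<c} Z" using ac by (intro supp_mono[OF comb_supp[OF Z(1)]]) auto
  have ZV: "Z \<triangleright> Vl l \<triangleright> \<psi> = Vl l \<triangleright> \<zeta>" if l: "l \<in> carrier K" for l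
  proof -
    have lH: "j l \<in> carrier H" by (rule jc[OF l])
    have "Br (j l) \<triangleright> Vl l \<triangleright> \<zeta> = (\<lambda>s. e (j l) * \<zeta> s)"
      unfolding Br_commute[OF lH Vl(3)[OF l]] DD_T[OF l \<zeta>(1), symmetric] by (rule \<zeta>inv[OF l])
    then have "adj_op (Br (j l)) \<triangleright> Br (j l) \<triangleright> Vl l \<triangleright> \<zeta> = (\<lambda>s. e (j l) * (adj_op (Br (j l)) \<triangleright> \<zeta>) s)"
      by (simp only: app_scale)
    then have "Vl l \<triangleright> \<zeta> = (\<lambda>s. e (j l) * (adj_op (Br (j l)) \<triangleright> \<zeta>) s)"
      unfolding unitary_app(1)[OF Br(1)[OF lH] Vl(4)[OF l]] .
    then show ?thesis unfolding app_Vl[OF l Zc] Z(2) by simp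
  qed
  have com: "Z \<triangleright> Vl l \<triangleright> u = Vl l \<triangleright> Z \<triangleright> u" if l: "l \<in> carrier K" and u: "u \<in> T" for l u
    using u
  proof (induction rule: T_induct)
    case zero
    show ?case by simp
  next
    case (add m y v)
    note m = add.hyps(1)
    have lm: "l \<otimes>\<^bsub>K\<^esub> m \<in> carrier K" using l m by simp
    have "Z \<triangleright> Vl l \<triangleright> Vl m \<triangleright> \<psi> = Vl l \<triangleright> Z \<triangleright> Vl m \<triangleright> \<psi>"
      unfolding Vl_Vl_\<psi>[OF l m] ZV[OF m] Vl_Vl[OF l m \<zeta>(1)] app_scale ZV[OF lm] ..
    then show ?case unfolding app_lin add.IH by simp
  qed
  have comb_M: "A \<triangleright> u \<in> M" if "A \<in> comb" "u \<in> M" for A u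
    using that(1)
  proof (induction rule: comb.induct)
    case zero
    show ?case using vsubD(2)[OF Msub] by (simp add: app_zero_op)
  next
    case (add A l z)
    then show ?case unfolding app_add using vsubD(3)[OF Msub Minv[OF add.hyps(2) that(2)] add.IH, of z 1] by simp
  qed
  \<comment> \<open>\<open>M\<close> is stable under the adjoints of the edge unitaries, so applying
    combinations of these to the part of \<psi> orthogonal to \<open>M\<close> keeps it orthogonal
    to \<open>M\<close>.\<close>
  have Vorth: "inn w (Vl l \<triangleright> (\<lambda>s. \<psi> s - v s)) = 0" if l: "l \<in> carrier K" and w: "w \<in> M" for l w
  proof -
    have "adj_op (Vl l) \<triangleright> w \<in> M"
      unfolding Vl_adj[OF l subsetD[OF M(2) w]] using l w by (intro vsub_scale[OF Msub] Minv) auto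
    then show ?thesis unfolding inner_adj by (rule M(5))
  qed
  have Zorth: "inn w (A \<triangleright> (\<lambda>s. \<psi> s - v s)) = 0" if "A \<in> comb" "w \<in> M" for A w
    using that(1)
  proof (induction rule: comb.induct)
    case zero
    show ?case by (simp add: app_zero_op inner_zero_right)
  next
    case (add A l z)
    have "inn w (\<lambda>s. z * (Vl l \<triangleright> (\<lambda>s. \<psi> s - v s)) s + 1 * (A \<triangleright> (\<lambda>s. \<psi> s - v s)) s) = 0"
      unfolding inner_right Vorth[OF add.hyps(2) that(2)] add.IH by simp
    then show ?case unfolding app_add by simp
  qed
  obtain z where z: "\<And>u. u \<in> M \<Longrightarrow> Z \<triangleright> u = (\<lambda>s. z * u s)"
  proof (rule schur[OF finX M(1)])
    show "M \<noteq> {\<lambda>s. 0}" using M(3,4) by blast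
    show "\<And>u. u \<in> M \<Longrightarrow> Z \<triangleright> u \<in> M" by (rule comb_M[OF Z(1)])
    show "\<And>u v z w. Z \<triangleright> (\<lambda>s. z * u s + w * v s) = (\<lambda>s. z * (Z \<triangleright> u) s + w * (Z \<triangleright> v) s)" by (rule app_lin)
    show "\<And>\<phi> c u. \<phi> \<in> \<Phi> \<Longrightarrow> \<phi> (\<lambda>s. c * u s) = (\<lambda>s. c * \<phi> u s)" unfolding \<Phi>_def using app_scale by blast
    show "\<And>\<phi> u. \<phi> \<in> \<Phi> \<Longrightarrow> u \<in> M \<Longrightarrow> Z \<triangleright> \<phi> u = \<phi> (Z \<triangleright> u)" unfolding \<Phi>_def using com M(2) by blast
  qed blast
  \<comment> \<open>Two projections that do not lengthen: \<open>?x\<close> is the component of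
    \<open>?y\<close> in \<open>T\<close>, and \<open>?q\<close> is the component of
    \<open>?x\<close> in \<open>M\<close>, where \<open>Z\<close> has become the scalar
    \<open>z\<close>.\<close>
  let ?x = "\<lambda>s. (Vl k \<triangleright> \<psi>) s - \<zeta> s" and ?q = "\<lambda>s. (Vl k \<triangleright> v) s - z * v s" and ?y = "\<lambda>s. (Vl k \<triangleright> \<psi>) s - \<eta> s"
  have qM: "?q \<in> M" by (rule vsub_diff[OF Msub Minv[OF k M(3)] vsub_scale[OF Msub M(3)]])
  have qx: "inn w (\<lambda>s. ?x s - ?q s) = 0" if "w \<in> M" for w
  proof -
    have "(\<lambda>s. ?x s - ?q s) = (\<lambda>s. (Vl k \<triangleright> (\<lambda>s. \<psi> s - v s)) s - (Z \<triangleright> (\<lambda>s. \<psi> s - v s)) s)"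
      unfolding app_diff Z(2) z[OF M(3)] by (simp add: algebra_simps)
    then show ?thesis using Vorth[OF k that] Zorth[OF Z(1) that] by (simp add: inner_diff_right)
  qed
  have "nsq X ?q \<le> nsq X ?x"
    using pythagoras[OF qx[OF qM]] nsq_nonneg[of X "\<lambda>s. ?x s - ?q s"] by linarith
  also have "\<dots> \<le> nsq X ?y"
  proof -
    have xT: "?x \<in> T" by (rule vsub_diff[OF T_sub T_Vl[OF k] \<zeta>(1)])
    have "(\<lambda>s. ?y s - ?x s) = (\<lambda>s. (- 1) * (\<eta> s - \<zeta> s))" by auto
    then have "inn ?x (\<lambda>s. ?y s - ?x s) = 0" using \<zeta>(2)[OF xT] by (simp only: inner_scale_right mult_zero_right)
    from pythagoras[OF this] show ?thesis using nsq_nonneg[of X "\<lambda>s. ?y s - ?x s"] by linarith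
  qed
  finally show ?thesis by (rule that)
qed

text \<open>\<open>1 / 2 ^ N\<^sup>2\<close> bounds the norm of the irreducible component of \<psi>
  from below. The factor 1/2 forces approximate eigenvalues to have modulus between 1/2 and 2; the
  factor \<delta>0/4 pays for an error of at most 4\<delta> in the multiplication law.\<close>

definition \<delta> :: real where "\<delta> = min (1 / 2) (\<delta>0 / 4) / 2 ^ N\<^sup>2"

lemma \<delta>_pos: "0 < \<delta>"
  using \<delta>0 by (simp add: \<delta>_def)

text \<open>If every edge vector were close to a symmetric vector, each edge unitary would be close
  to a scalar on the component \<open>v\<close> of \<psi>. Since the unitaries multiply with the
  inverse cocycle, these scalars would form an approximate coboundary.\<close>

lemma far_from_invariant:
  assumes \<eta>: "\<And>k. k \<in> carrier K \<Longrightarrow> \<eta> k \<in> vecs X"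
    and inv: "\<And>k h. k \<in> carrier K \<Longrightarrow> h \<in> carrier K \<Longrightarrow> DD (j h) \<triangleright> \<eta> k = (\<lambda>s. e (j h) * \<eta> k s)"
  obtains k where "k \<in> carrier K" "\<delta>\<^sup>2 < nsq X (\<lambda>s. (Vl k \<triangleright> \<psi>) s - \<eta> k s)"
proof -
  have "\<exists>k\<in>carrier K. \<delta>\<^sup>2 < nsq X (\<lambda>s. (Vl k \<triangleright> \<psi>) s - \<eta> k s)"
  proof (rule ccontr)
    assume "\<not> ?thesis"
    then have close: "nsq X (\<lambda>s. (Vl k \<triangleright> \<psi>) s - \<eta> k s) \<le> \<delta>\<^sup>2" if "k \<in> carrier K" for k using that by force
    obtain M v where M: "irreducible_under X \<Phi> M" "M \<subseteq> T" "v \<in> M" "1 / 2 ^ N\<^sup>2 \<le> nsq X v" "nsq X v \<le> 1"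
      "\<And>w. w \<in> M \<Longrightarrow> inn w (\<lambda>s. \<psi> s - v s) = 0" using irreducible_part by blast
    define \<nu> where "\<nu> u = sqrt (nsq X u)" for u
    have tri: "\<nu> (\<lambda>s. u s + w s) \<le> \<nu> u + \<nu> w" for u w unfolding \<nu>_def by (rule nsq_add_sqrt)
    have scale: "\<nu> (\<lambda>s. z * u s) = cmod z * \<nu> u" for z u
      unfolding \<nu>_def nsq_scale by (simp add: real_sqrt_mult)
    define \<tau> where "\<tau> = \<nu> v"
    have pos: "(0::real) < 1 / 2 ^ N\<^sup>2" by simp
    have v0: "v \<noteq> (\<lambda>s. 0)"
    proof
      assume "v = (\<lambda>s. 0)"
      then have "nsq X v = 0" by simp
      then show False using M(4) pos by linarith
    qed
    have "nsq X v \<le> sqrt (nsq X v)"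
    proof -
      have "(nsq X v)\<^sup>2 \<le> nsq X v" using M(5) nsq_nonneg[of X v] by (simp add: power2_eq_square mult_left_le)
      then show ?thesis by (rule real_le_rsqrt)
    qed
    then have \<tau>: "1 / 2 ^ N\<^sup>2 \<le> \<tau>" using M(4) unfolding \<tau>_def \<nu>_def by linarith
    then have \<tau>0: "0 < \<tau>" using pos by linarith
    have \<delta>2: "2 * \<delta> \<le> \<tau>"
    proof -
      have "2 * \<delta> \<le> 1 / 2 ^ N\<^sup>2" unfolding \<delta>_def by (simp add: divide_right_mono)
      then show ?thesis using \<tau> by linarith
    qed
    have \<delta>4: "4 * \<delta> \<le> \<delta>0 * \<tau>"
    proof -
      have "4 * \<delta> \<le> \<delta>0 * (1 / 2 ^ N\<^sup>2)" unfolding \<delta>_def by (simp add: divide_right_mono)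
      also have "\<dots> \<le> \<delta>0 * \<tau>" using \<tau> \<delta>0 by (intro mult_left_mono) auto
      finally show ?thesis .
    qed
    have "\<exists>z. \<nu> (\<lambda>s. (Vl k \<triangleright> v) s - z * v s) \<le> \<delta>" if k: "k \<in> carrier K" for k
    proof -
      obtain z where "nsq X (\<lambda>s. (Vl k \<triangleright> v) s - z * v s) \<le> nsq X (\<lambda>s. (Vl k \<triangleright> \<psi>) s - \<eta> k s)"
        by (rule near_scalar[OF M(1-3) v0 M(6) k \<eta>[OF k] inv[OF k]])
      then have "nsq X (\<lambda>s. (Vl k \<triangleright> v) s - z * v s) \<le> \<delta>\<^sup>2" using close[OF k] by linarith
      then show ?thesis unfolding \<nu>_def using \<delta>_pos by (intro exI[of _ z] real_le_lsqrt) auto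
    qed
    then obtain h where h: "\<And>k. k \<in> carrier K \<Longrightarrow> \<nu> (\<lambda>s. (Vl k \<triangleright> v) s - h k * v s) \<le> \<delta>" by metis
    have vX: "v \<in> vecs X" using M(2,3) T_vecs by blast
    have iso: "\<nu> (Vl k \<triangleright> u) = \<nu> u" if "k \<in> carrier K" "u \<in> vecs X" for k u
      unfolding \<nu>_def unitary_nsq[OF Vl(1)[OF that(1)] that(2)] ..
    \<comment> \<open>The edge unitary preserves the norm \<tau> of \<open>v\<close>, so the scalar
      changes it by at most \<delta>, which is at most half of \<tau>.\<close>
    have hb: "1 / 2 \<le> cmod (h k) \<and> cmod (h k) \<le> 2" if k: "k \<in> carrier K" for k
    proof -
      let ?q = "\<lambda>s. (Vl k \<triangleright> v) s - h k * v s"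
      have "\<tau> \<le> \<delta> + cmod (h k) * \<tau>"
        using tri[of ?q "\<lambda>s. h k * v s"] iso[OF k vX] h[OF k] scale[of "h k" v] by (simp add: \<tau>_def)
      moreover have "cmod (h k) * \<tau> \<le> \<delta> + \<tau>"
        using tri[of "\<lambda>s. (- 1) * ?q s" "Vl k \<triangleright> v"] iso[OF k vX] h[OF k] scale[of "h k" v] scale[of "- 1" ?q]
        by (simp add: \<tau>_def)
      ultimately have "1 / 2 * \<tau> \<le> cmod (h k) * \<tau>" "cmod (h k) * \<tau> \<le> 2 * \<tau>" using \<delta>2 by linarith+
      then show ?thesis using \<tau>0 by (simp only: mult_le_cancel_right_pos)
    qed
    then obtain x y where xy: "x \<in> carrier K" "y \<in> carrier K"
      "\<delta>0 < cmod (h x * h y - h (x \<otimes>\<^bsub>K\<^esub> y) / \<beta> x y)" using nontrivial by blast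
    let ?p = "h x * h y - h (x \<otimes>\<^bsub>K\<^esub> y) / \<beta> x y" and ?m = "x \<otimes>\<^bsub>K\<^esub> y"
    have m: "?m \<in> carrier K" using xy by simp
    let ?q = "\<lambda>k s. (Vl k \<triangleright> v) s - h k * v s"
    have qX: "?q y \<in> vecs X" using Vl(4)[OF xy(2), of v] vX by (auto simp: vecs_def)
    have VV: "(Vl x \<triangleright> Vl y \<triangleright> v) s = 1 / \<beta> x y * (Vl ?m \<triangleright> v) s" for s
      using Vl_Vl[OF xy(1,2) subsetD[OF M(2,3)]] by (rule fun_cong)
    \<comment> \<open>The defect of the scalars, applied to \<open>v\<close>, is a sum of three
      errors: that of \<open>x\<close> weighted by the scalar of \<open>y\<close>, that of
      \<open>y\<close> moved by a unitary, and that of the product.\<close>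
    have decomp: "(\<lambda>s. ?p * v s) = (\<lambda>s. (- h y) * ?q x s + ((- 1) * (Vl x \<triangleright> ?q y) s + 1 / \<beta> x y * ?q ?m s))"
      unfolding app_diff app_scale VV by (simp add: algebra_simps)
    have "cmod ?p * \<tau> = \<nu> (\<lambda>s. ?p * v s)" unfolding \<tau>_def scale ..
    also have "\<dots> \<le> cmod (h y) * \<nu> (?q x) + (\<nu> (Vl x \<triangleright> ?q y) + \<nu> (?q ?m))"
    proof -
      let ?A = "\<lambda>s. (- h y) * ?q x s" and ?B = "\<lambda>s. (- 1) * (Vl x \<triangleright> ?q y) s" and ?C = "\<lambda>s. 1 / \<beta> x y * ?q ?m s"
      have "\<nu> ?A = cmod (h y) * \<nu> (?q x)" by (simp only: scale norm_minus_cancel)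
      moreover have "\<nu> ?B = \<nu> (Vl x \<triangleright> ?q y)" unfolding scale[of "- 1"] by simp
      moreover have "\<nu> ?C = \<nu> (?q ?m)" unfolding scale[of "1 / \<beta> x y"] norm_divide unit[OF xy(1,2)] by simp
      ultimately show ?thesis
        unfolding decomp using tri[of ?A "\<lambda>s. ?B s + ?C s"] tri[of ?B ?C] by linarith
    qed
    also have "\<dots> \<le> 2 * \<delta> + (\<delta> + \<delta>)"
      unfolding iso[OF xy(1) qX] using h[OF xy(1)] h[OF xy(2)] h[OF m] hb[OF xy(2)] \<delta>_pos
      by (intro add_mono mult_mono) (auto simp: \<nu>_def nsq_nonneg)
    finally have "cmod ?p * \<tau> \<le> \<delta>0 * \<tau>" using \<delta>4 by linarith
    then have "cmod ?p \<le> \<delta>0" using \<tau>0 by (simp only: mult_le_cancel_right_pos)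
    then show False using xy(3) by linarith
  qed
  then show ?thesis using that by blast
qed

end

section \<open>Charged boundary operators from the charged part of an edge operator\<close>

context edge_sub
begin

lemma j_inv: "k \<in> carrier K \<Longrightarrow> inv\<^bsub>H\<^esub> (j k) = j (inv\<^bsub>K\<^esub> k)"
proof -
  assume k: "k \<in> carrier K"
  then have ik: "inv\<^bsub>K\<^esub> k \<in> carrier K" by simp
  have "j \<one>\<^bsub>K\<^esub> \<otimes>\<^bsub>H\<^esub> j \<one>\<^bsub>K\<^esub> = j \<one>\<^bsub>K\<^esub>" using jm[of "\<one>\<^bsub>K\<^esub>" "\<one>\<^bsub>K\<^esub>"] by simp
  then have "j \<one>\<^bsub>K\<^esub> = \<one>\<^bsub>H\<^esub>" using jc[OF Kg.one_closed] H.l_cancel_one by blast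
  then have "j (inv\<^bsub>K\<^esub> k) \<otimes>\<^bsub>H\<^esub> j k = \<one>\<^bsub>H\<^esub>" using jm[OF ik k] k by simp
  then show ?thesis using jc[OF k] jc[OF ik] by (metis H.inv_equality)
qed

lemma multiplets_sub: "multiplets K G C L (j ` carrier K) \<Theta>"
  by unfold_locales (use jc \<Theta>c \<Theta>_commute j_inv in auto)

lemma DD_neutral:
  assumes x: "x \<in> carrier H" and A: "CS x A = A"
  shows "DD x \<triangleright> A \<triangleright> \<psi> = (\<lambda>s. e x * (A \<triangleright> \<psi>) s)"
proof
  fix s
  have "(A \<triangleright> \<psi>) s = cnj (e x) * (DD x \<triangleright> A \<triangleright> \<psi>) s" using CS_\<psi>[OF x, of A] unfolding A by (rule fun_cong)
  then have "e x * (A \<triangleright> \<psi>) s = (cnj (e x) * e x) * (DD x \<triangleright> A \<triangleright> \<psi>) s" by simp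
  then show "(DD x \<triangleright> A \<triangleright> \<psi>) s = e x * (A \<triangleright> \<psi>) s" unfolding e_unit(2)[OF x] by simp
qed

lemma scale_op_one: "scale_op 1 A = A"
  by (simp add: scale_op_def)

lemma app_scale_op: "scale_op z A \<triangleright> u = (\<lambda>s. z * (A \<triangleright> u) s)"
  using app_op_lin[of z A 0 A u] by (simp add: scale_op_def)

text \<open>The edge operator of a suitable \<open>k\<close> has a charged part of squared norm
  above \<open>\<delta>\<^sup>2\<close> on the state. An irreducible component is taken at the left
  edge, where the functional is the correlator with the whole right unitary, and another at the
  right edge, where it is the correlator with the left component just found. Each costs
  \<open>2 ^ N\<^sup>2\<close>, and the normalisation costs
  \<open>(1 / real N)\<^sup>2\<close>.\<close>

lemma exact_pair:
  obtains B B' where "supp {..<a} B" "supp {c..<L} B'" "contraction_op X B" "contraction_op X B'"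
    "\<And>y. y \<in> \<Theta> \<Longrightarrow> CS y B = B" "\<And>y. y \<in> \<Theta> \<Longrightarrow> CS y B' = B'"
    "\<forall>\<Gamma>'. (\<forall>x\<in>\<Gamma>'. \<exists>k\<in>carrier K. \<forall>A. (\<forall>y\<in>\<Theta>. CS y A = A) \<longrightarrow> CS x A = CS (j k) A) \<and>
        (\<forall>k\<in>carrier K. \<exists>x\<in>\<Gamma>'. \<forall>A. (\<forall>y\<in>\<Theta>. CS y A = A) \<longrightarrow> CS x A = CS (j k) A) \<longrightarrow>
        charged C L \<Gamma>' B \<and> charged C L \<Gamma>' B'"
    "(1 / real N)\<^sup>2 * (\<delta>\<^sup>2 / 2 ^ N\<^sup>2 / 2 ^ N\<^sup>2) \<le> cmod (inn \<psi> ((B \<odot> B') \<triangleright> \<psi>))"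
proof -
  interpret l: multiplets K G C L "{..<a}" "j ` carrier K" \<Theta> by (rule multiplets_sub)
  interpret r: multiplets K G C L "{c..<L}" "j ` carrier K" \<Theta> by (rule multiplets_sub)
  have N2: "(card (pats {..<a}))\<^sup>2 \<le> N\<^sup>2" "(card (pats {c..<L}))\<^sup>2 \<le> N\<^sup>2"
    using N by (auto intro: power_mono)
  have split_ex: "\<exists>B0 B1. B0 \<in> l.Fx \<and> B1 \<in> l.V' \<and> Vl k \<triangleright> \<psi> = (\<lambda>s. (B0 \<triangleright> \<psi>) s + (B1 \<triangleright> \<psi>) s) \<and> hsq B1 \<le> card X"
    if k: "k \<in> carrier K" for k
  proof -
    obtain A where A: "canon {..<a} A" "A \<triangleright> \<psi> = Vl k \<triangleright> \<psi>" "hsq A \<le> hsq (Vl k)"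
      by (rule canon_exists[OF Vl(2)[OF k]])
    have "CS y A = A" if y: "y \<in> \<Theta>" for y
    proof -
      have yH: "y \<in> carrier H" using y \<Theta>c by blast
      have "ratio (j k) y = 1" using \<Theta>_ratio[OF k y] \<omega>[OF jc[OF k] yH] by (simp add: ratio_def)
      then have "DD y \<triangleright> A \<triangleright> \<psi> = (\<lambda>s. 1 * e y * (A \<triangleright> \<psi>) s)"
        using DD_Bl[OF yH jc[OF k] \<Theta>_commute[OF k y, symmetric]] unfolding A(2) by simp
      from canon_transforms[OF yH A(1) this] show ?thesis by (simp add: scale_op_one)
    qed
    then have "A \<in> l.V" using A(1) by (simp add: l.V_def canon_def)
    then obtain B0 B1 where B: "B0 \<in> l.Fx" "B1 \<in> l.V'" "A = (\<lambda>s t. B0 s t + B1 s t)" "hsq B1 \<le> hsq A"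
      by (rule l.split)
    have "Vl k \<triangleright> \<psi> = (\<lambda>s. (B0 \<triangleright> \<psi>) s + (B1 \<triangleright> \<psi>) s)"
      using app_op_lin[of 1 B0 1 B1 \<psi>] unfolding A(2)[symmetric] B(3) by simp
    moreover have "hsq B1 \<le> card X" using B(4) A(3) unitary_hs[OF Vl(1)[OF k]] by linarith
    ultimately show ?thesis using B(1,2) by blast
  qed
  define P where "P k p \<longleftrightarrow> fst p \<in> l.Fx \<and> snd p \<in> l.V' \<and>
    Vl k \<triangleright> \<psi> = (\<lambda>s. (fst p \<triangleright> \<psi>) s + (snd p \<triangleright> \<psi>) s) \<and> hsq (snd p) \<le> card X" for k p
  have "\<exists>p. P k p" if k: "k \<in> carrier K" for k
  proof -
    obtain B0 B1 where "B0 \<in> l.Fx \<and> B1 \<in> l.V' \<and> Vl k \<triangleright> \<psi> = (\<lambda>s. (B0 \<triangleright> \<psi>) s + (B1 \<triangleright> \<psi>) s) \<and> hsq B1 \<le> card X"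
      using split_ex[OF k] by (elim exE)
    then have "P k (B0, B1)" unfolding P_def fst_conv snd_conv .
    then show ?thesis by (rule exI)
  qed
  then have "\<forall>k\<in>carrier K. \<exists>p. P k p" by (intro ballI)
  from bchoice[OF this] obtain p where p: "\<forall>k\<in>carrier K. P k (p k)" by (elim exE)
  define B0 B1 where "B0 k = fst (p k)" and "B1 k = snd (p k)" for k
  have "P k (B0 k, B1 k)" if "k \<in> carrier K" for k using bspec[OF p that] by (simp add: B0_def B1_def)
  then have B: "B0 k \<in> l.Fx" "B1 k \<in> l.V'" "Vl k \<triangleright> \<psi> = (\<lambda>s. (B0 k \<triangleright> \<psi>) s + (B1 k \<triangleright> \<psi>) s)"
    "hsq (B1 k) \<le> card X" if "k \<in> carrier K" for k
    using that unfolding P_def fst_conv snd_conv by (elim meta_allE[of _ k], simp_all only: simp_thms)+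
  have Fx_CS: "CS (j h) F = F" if "F \<in> l.Fx" "h \<in> carrier K" for F h
    using that by (simp add: l.Fx_def)
  have Fx_ops: "F \<in> ops X" if "F \<in> l.Fx" for F using that l.V_ops by (simp add: l.Fx_def)
  have \<eta>X: "B0 k \<triangleright> \<psi> \<in> vecs X" if "k \<in> carrier K" for k using Fx_ops[OF B(1)[OF that]] by simp
  have \<eta>inv: "DD (j h) \<triangleright> B0 k \<triangleright> \<psi> = (\<lambda>s. e (j h) * (B0 k \<triangleright> \<psi>) s)" if "k \<in> carrier K" "h \<in> carrier K" for k h
    by (rule DD_neutral[OF jc[OF that(2)] Fx_CS[OF B(1)[OF that(1)] that(2)]])
  obtain k where k: "k \<in> carrier K" and far: "\<delta>\<^sup>2 < nsq X (\<lambda>s. (Vl k \<triangleright> \<psi>) s - (B0 k \<triangleright> \<psi>) s)"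
    by (rule far_from_invariant[OF \<eta>X \<eta>inv])
  define \<xi> where "\<xi> = B1 k \<triangleright> \<psi>"
  have far': "\<delta>\<^sup>2 < nsq X \<xi>" using far unfolding B(3)[OF k] \<xi>_def by simp
  have lH: "j k \<in> carrier H" by (rule jc[OF k])
  \<comment> \<open>Hilbert-Schmidt orthogonality of \<open>B0 k\<close> and \<open>B1 k\<close>
    says nothing about their action on \<psi>. That these vectors are orthogonal follows because the
    overlap with the symmetric vector \<open>B0 k \<triangleright> \<psi>\<close> is an invariant
    functional.\<close>
  have orth: "inn (B0 k \<triangleright> \<psi>) \<xi> = 0"
    unfolding \<xi>_def
  proof (rule l.invariant_functional[OF _ _ B(2)[OF k]])
    fix A A' z u
    show "inn (B0 k \<triangleright> \<psi>) ((\<lambda>s t. z * A s t + u * A' s t) \<triangleright> \<psi>) = z * inn (B0 k \<triangleright> \<psi>) (A \<triangleright> \<psi>) + u * inn (B0 k \<triangleright> \<psi>) (A' \<triangleright> \<psi>)"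
      unfolding app_op_lin inner_right ..
  next
    fix x A assume "x \<in> j ` carrier K"
    then obtain h where h: "h \<in> carrier K" "x = j h" by blast
    have hH: "j h \<in> carrier H" by (rule jc[OF h(1)])
    have "adj_op (DD (j h)) \<triangleright> B0 k \<triangleright> \<psi> = (\<lambda>s. cnj (e (j h)) * (B0 k \<triangleright> \<psi>) s)"
    proof -
      have "adj_op (DD (j h)) \<triangleright> (\<lambda>s. e (j h) * (B0 k \<triangleright> \<psi>) s) = B0 k \<triangleright> \<psi>"
        unfolding \<eta>inv[OF k h(1), symmetric] by (rule unitary_app(1)[OF DS_unitary[OF hH] \<eta>X[OF k]])
      then have "e (j h) * (adj_op (DD (j h)) \<triangleright> B0 k \<triangleright> \<psi>) s = (B0 k \<triangleright> \<psi>) s" for s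
        unfolding app_scale by (rule fun_cong)
      then have "cnj (e (j h)) * (B0 k \<triangleright> \<psi>) s = (cnj (e (j h)) * e (j h)) * (adj_op (DD (j h)) \<triangleright> B0 k \<triangleright> \<psi>) s" for s
        by (metis mult.assoc)
      then show ?thesis unfolding e_unit(2)[OF hH] by simp
    qed
    then have *: "inn (B0 k \<triangleright> \<psi>) (DD (j h) \<triangleright> A \<triangleright> \<psi>) = e (j h) * inn (B0 k \<triangleright> \<psi>) (A \<triangleright> \<psi>)"
      unfolding inner_adj[of _ "DD (j h)"] by (simp add: inner_scale_left)
    show "inn (B0 k \<triangleright> \<psi>) (CS x A \<triangleright> \<psi>) = inn (B0 k \<triangleright> \<psi>) (A \<triangleright> \<psi>)"
      unfolding h(2) CS_\<psi>[OF hH] inner_scale_right * mult.assoc[symmetric] e_unit(2)[OF hH] by (rule mult_1)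
  qed
  \<comment> \<open>The correlator with the right unitary is, up to a phase, the overlap with the
    left edge vector; on the charged part its modulus is the squared norm of \<xi>.\<close>
  define f where "f A = inn \<psi> (A \<triangleright> Br (j k) \<triangleright> \<psi>)" for A
  have "adj_op (Br (j k)) \<triangleright> \<psi> = (\<lambda>s. cnj (e (j k)) * (Vl k \<triangleright> \<psi>) s)"
  proof
    fix s
    have "cnj (e (j k)) * (Vl k \<triangleright> \<psi>) s = (cnj (e (j k)) * e (j k)) * (adj_op (Br (j k)) \<triangleright> \<psi>) s"
      unfolding Vl_\<psi>[OF k] by (simp only: mult.assoc)
    then show "(adj_op (Br (j k)) \<triangleright> \<psi>) s = cnj (e (j k)) * (Vl k \<triangleright> \<psi>) s" unfolding e_unit(2)[OF lH] by simp
  qed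
  then have f_alt: "f A = e (j k) * inn (Vl k \<triangleright> \<psi>) (A \<triangleright> \<psi>)" if "supp {..<a} A" for A
  proof -
    have "supp {..<c} A" using ac by (intro supp_mono[OF that]) auto
    then have "f A = inn \<psi> (Br (j k) \<triangleright> A \<triangleright> \<psi>)" unfolding f_def by (simp only: Br_commute[OF lH])
    also have "\<dots> = inn (adj_op (Br (j k)) \<triangleright> \<psi>) (A \<triangleright> \<psi>)" by (rule inner_adj)
    finally show ?thesis
      unfolding \<open>adj_op (Br (j k)) \<triangleright> \<psi> = (\<lambda>s. cnj (e (j k)) * (Vl k \<triangleright> \<psi>) s)\<close> inner_scale_left by simp
  qed
  have B1s: "supp {..<a} (B1 k)" using B(2)[OF k] by (simp add: l.V'_def l.V_def)
  have "inn (Vl k \<triangleright> \<psi>) \<xi> = of_real (nsq X \<xi>)"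
    unfolding B(3)[OF k] using inner_left[of X 1 "B0 k \<triangleright> \<psi>" 1 \<xi> \<xi>] orth by (simp add: inner_self \<xi>_def)
  then have "cmod (f (B1 k)) = nsq X \<xi>"
    unfolding f_alt[OF B1s] \<xi>_def[symmetric] using DS_\<psi>(1)[OF lH] nsq_nonneg[of X \<xi>] by (simp add: norm_mult)
  then have fB1: "\<delta>\<^sup>2 \<le> cmod (f (B1 k))" using far' by linarith
  have f_diff: "f (\<lambda>s t. A s t - A' s t) = f A - f A'" for A A'
    unfolding f_def using app_op_lin[of 1 A "-1" A' "Br (j k) \<triangleright> \<psi>"] by (simp add: inner_diff_right)
  have \<delta>2: "0 < \<delta>\<^sup>2" using \<delta>_pos by simp
  obtain Al where Al: "Al \<in> l.V'" "hsq Al \<le> hsq (B1 k)" "\<delta>\<^sup>2 / 2 ^ N\<^sup>2 \<le> cmod (f Al)"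
    and Al_ch: "\<forall>\<Gamma>'. (\<forall>x\<in>\<Gamma>'. \<exists>y\<in>j ` carrier K. \<forall>A\<in>l.V. CS x A = CS y A) \<and>
        (\<forall>y\<in>j ` carrier K. \<exists>x\<in>\<Gamma>'. \<forall>A\<in>l.V. CS x A = CS y A) \<longrightarrow> charged C L \<Gamma>' Al"
    by (rule l.multiplet_component[of "B1 k" "N\<^sup>2" f "\<delta>\<^sup>2", OF B(2)[OF k] N2(1) f_diff fB1 \<delta>2])
      (rule that, assumption+)
  have Al_V: "Al \<in> l.V" using Al(1) by (simp add: l.V'_def)
  then have Al_s: "supp {..<a} Al" by (simp add: l.V_def)
  obtain R0 where R0: "canon {c..<L} R0" "R0 \<triangleright> \<psi> = Br (j k) \<triangleright> \<psi>" "hsq R0 \<le> hsq (Br (j k))"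
    by (rule canon_exists[OF Br(2)[OF lH]])
  have "CS y R0 = R0" if y: "y \<in> \<Theta>" for y
  proof -
    have yH: "y \<in> carrier H" using y \<Theta>c by blast
    have "ratio y (j k) = 1" using \<Theta>_ratio[OF k y] \<omega>[OF yH lH] by (simp add: ratio_def)
    then have "DD y \<triangleright> R0 \<triangleright> \<psi> = (\<lambda>s. 1 * e y * (R0 \<triangleright> \<psi>) s)"
      using DD_Br[OF yH lH \<Theta>_commute[OF k y, symmetric]] unfolding R0(2) by simp
    from canon_transforms[OF yH R0(1) this] show ?thesis by (simp add: scale_op_one)
  qed
  then have "R0 \<in> r.V" using R0(1) by (simp add: r.V_def canon_def)
  then obtain RF R1 where R: "RF \<in> r.Fx" "R1 \<in> r.V'" "R0 = (\<lambda>s t. RF s t + R1 s t)" "hsq R1 \<le> hsq R0"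
    by (rule r.split)
  define g where "g A = inn \<psi> (Al \<triangleright> A \<triangleright> \<psi>)" for A
  \<comment> \<open>An invariant operator on the right has no correlation with a charged one on the
    left, so the invariant part of the right operator may be dropped without loss.\<close>
  have "inn \<psi> (Al \<triangleright> RF \<triangleright> \<psi>) = 0"
  proof (rule l.invariant_functional[OF _ _ Al(1)])
    fix A A' z u
    show "inn \<psi> ((\<lambda>s t. z * A s t + u * A' s t) \<triangleright> RF \<triangleright> \<psi>) = z * inn \<psi> (A \<triangleright> RF \<triangleright> \<psi>) + u * inn \<psi> (A' \<triangleright> RF \<triangleright> \<psi>)"
      unfolding app_op_lin inner_right ..
  next
    fix x A assume "x \<in> j ` carrier K"
    then obtain h where h: "h \<in> carrier K" "x = j h" by blast
    have hH: "j h \<in> carrier H" by (rule jc[OF h(1)])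
    have RFo: "RF \<in> ops X" using R(1) r.V_ops by (simp add: r.Fx_def)
    have "CS x RF = RF" using R(1) h by (simp add: r.Fx_def)
    then have "CS x A \<triangleright> RF \<triangleright> \<psi> = CS x A \<triangleright> CS x RF \<triangleright> \<psi>" by simp
    also have "\<dots> = (\<lambda>s. cnj (e x) * (DD x \<triangleright> A \<triangleright> RF \<triangleright> \<psi>) s)"
      unfolding CS_\<psi>[OF hH, folded h(2)] unfolding conj_sym_def app_times app_scale h(2)
      using unitary_app(1)[OF DS_unitary[OF hH], of "RF \<triangleright> \<psi>"] RFo by simp
    finally have "inn \<psi> (CS x A \<triangleright> RF \<triangleright> \<psi>) = cnj (e x) * inn (adj_op (DD x) \<triangleright> \<psi>) (A \<triangleright> RF \<triangleright> \<psi>)"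
      by (simp only: inner_scale_right inner_adj[of _ "DD x"])
    also have "\<dots> = (cnj (e x) * e x) * inn \<psi> (A \<triangleright> RF \<triangleright> \<psi>)"
      unfolding h(2) DD_adj_\<psi>[OF hH] inner_scale_left by simp
    finally show "inn \<psi> (CS x A \<triangleright> RF \<triangleright> \<psi>) = inn \<psi> (A \<triangleright> RF \<triangleright> \<psi>)"
      unfolding h(2) e_unit(2)[OF hH] by simp
  qed
  then have gRF: "g RF = 0" by (simp add: g_def)
  have "g R0 = g RF + g R1"
    unfolding g_def R(3) using app_op_lin[of 1 RF 1 R1 \<psi>] app_lin[of Al 1 "RF \<triangleright> \<psi>" 1 "R1 \<triangleright> \<psi>"]
    by (simp add: inner_add_right)
  moreover have "g R0 = f Al" unfolding g_def f_def R0(2) ..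
  ultimately have gR1: "\<delta>\<^sup>2 / 2 ^ N\<^sup>2 \<le> cmod (g R1)" using gRF Al(3) by simp
  have g_diff: "g (\<lambda>s t. A s t - A' s t) = g A - g A'" for A A'
    unfolding g_def using app_op_lin[of 1 A "-1" A' \<psi>] by (simp add: app_diff inner_diff_right)
  have \<delta>3: "0 < \<delta>\<^sup>2 / 2 ^ N\<^sup>2" using \<delta>2 by simp
  obtain Ar where Ar: "Ar \<in> r.V'" "hsq Ar \<le> hsq R1" "\<delta>\<^sup>2 / 2 ^ N\<^sup>2 / 2 ^ N\<^sup>2 \<le> cmod (g Ar)"
    and Ar_ch: "\<forall>\<Gamma>'. (\<forall>x\<in>\<Gamma>'. \<exists>y\<in>j ` carrier K. \<forall>A\<in>r.V. CS x A = CS y A) \<and>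
        (\<forall>y\<in>j ` carrier K. \<exists>x\<in>\<Gamma>'. \<forall>A\<in>r.V. CS x A = CS y A) \<longrightarrow> charged C L \<Gamma>' Ar"
    by (rule r.multiplet_component[of R1 "N\<^sup>2" g "\<delta>\<^sup>2 / 2 ^ N\<^sup>2", OF R(2) N2(2) g_diff gR1 \<delta>3])
      (rule that, assumption+)
  have Ar_V: "Ar \<in> r.V" using Ar(1) by (simp add: r.V'_def)
  then have Ar_s: "supp {c..<L} Ar" by (simp add: r.V_def)
  let ?n = "complex_of_real (1 / real N)"
  have n0: "?n \<noteq> 0" using N(3) by simp
  have hs: "hsq Al \<le> card X" "hsq Ar \<le> card X"
    using Al(2) B(4)[OF k] Ar(2) R(4) R0(3) unitary_hs[OF Br(1)[OF lH]] by linarith+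
  have ss: "supp S (scale_op z M)" if "supp S M" for S M z
    using supp_lin[OF that that, of z 0] by (simp add: scale_op_def)
  have "inn \<psi> ((scale_op ?n Al \<odot> scale_op ?n Ar) \<triangleright> \<psi>) = ?n * (?n * g Ar)"
    unfolding app_times app_scale_op app_scale inner_scale_right g_def ..
  then have "cmod (inn \<psi> ((scale_op ?n Al \<odot> scale_op ?n Ar) \<triangleright> \<psi>)) = (1 / real N)\<^sup>2 * cmod (g Ar)"
    by (simp add: norm_mult norm_divide power2_eq_square)
  then have cor: "(1 / real N)\<^sup>2 * (\<delta>\<^sup>2 / 2 ^ N\<^sup>2 / 2 ^ N\<^sup>2) \<le> cmod (inn \<psi> ((scale_op ?n Al \<odot> scale_op ?n Ar) \<triangleright> \<psi>))"
    using Ar(3) by (simp only:) (rule mult_left_mono, auto)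
  have ch: "\<forall>\<Gamma>'. (\<forall>x\<in>\<Gamma>'. \<exists>k\<in>carrier K. \<forall>A. (\<forall>y\<in>\<Theta>. CS y A = A) \<longrightarrow> CS x A = CS (j k) A) \<and>
        (\<forall>k\<in>carrier K. \<exists>x\<in>\<Gamma>'. \<forall>A. (\<forall>y\<in>\<Theta>. CS y A = A) \<longrightarrow> CS x A = CS (j k) A) \<longrightarrow>
        charged C L \<Gamma>' (scale_op ?n Al) \<and> charged C L \<Gamma>' (scale_op ?n Ar)"
  proof (intro allI impI, elim conjE)
    fix \<Gamma>'
    assume 1: "\<forall>x\<in>\<Gamma>'. \<exists>k\<in>carrier K. \<forall>A. (\<forall>y\<in>\<Theta>. CS y A = A) \<longrightarrow> CS x A = CS (j k) A"
      and 2: "\<forall>k\<in>carrier K. \<exists>x\<in>\<Gamma>'. \<forall>A. (\<forall>y\<in>\<Theta>. CS y A = A) \<longrightarrow> CS x A = CS (j k) A"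
    have *: "(\<forall>x\<in>\<Gamma>'. \<exists>y\<in>j ` carrier K. \<forall>A\<in>V. CS x A = CS y A) \<and>
        (\<forall>y\<in>j ` carrier K. \<exists>x\<in>\<Gamma>'. \<forall>A\<in>V. CS x A = CS y A)"
      if V: "\<forall>A\<in>V. \<forall>y\<in>\<Theta>. CS y A = A" for V
    proof (intro conjI ballI)
      fix x assume "x \<in> \<Gamma>'"
      from bspec[OF 1 this] obtain k where "k \<in> carrier K" "\<forall>A. (\<forall>y\<in>\<Theta>. CS y A = A) \<longrightarrow> CS x A = CS (j k) A"
        by (elim bexE)
      then show "\<exists>y\<in>j ` carrier K. \<forall>A\<in>V. CS x A = CS y A" using V by (intro bexI[of _ "j k"]) auto
    next
      fix y assume "y \<in> j ` carrier K"
      then obtain k where k: "k \<in> carrier K" "y = j k" by (elim imageE)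
      from bspec[OF 2 k(1)] obtain x where "x \<in> \<Gamma>'" "\<forall>A. (\<forall>y\<in>\<Theta>. CS y A = A) \<longrightarrow> CS x A = CS (j k) A"
        by (elim bexE)
      then show "\<exists>x\<in>\<Gamma>'. \<forall>A\<in>V. CS x A = CS y A" using V k(2) by (intro bexI[of _ x]) auto
    qed
    have "charged C L \<Gamma>' Al" by (rule mp[OF spec[OF Al_ch] *]) (simp add: l.V_def)
    moreover have "charged C L \<Gamma>' Ar" by (rule mp[OF spec[OF Ar_ch] *]) (simp add: r.V_def)
    ultimately show "charged C L \<Gamma>' (scale_op ?n Al) \<and> charged C L \<Gamma>' (scale_op ?n Ar)"
      by (intro conjI charged_scale n0)
  qed
  have nn: "real (card (pats {..<a})) \<le> real N" "real (card (pats {c..<L})) \<le> real N" "1 \<le> real N"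
    using N by auto
  have neut: "CS y (scale_op ?n Al) = scale_op ?n Al" "CS y (scale_op ?n Ar) = scale_op ?n Ar" if "y \<in> \<Theta>" for y
    unfolding CS_scale using that Al_V Ar_V by (auto simp: l.V_def r.V_def)
  show ?thesis
    by (rule that[OF ss[OF Al_s] ss[OF Ar_s] scaled_contraction[OF Al_s hs(1) nn(1,3)]
          scaled_contraction[OF Ar_s hs(2) nn(2,3)] neut ch cor])
qed

end

section \<open>Families of states\<close>

text \<open>What the single-length argument needs, with the distance \<open>r\<close> from the ends
  and the pattern bound \<open>N\<close> exposed, as these must not depend on
  \<open>L\<close>.\<close>

definition edges where
  "edges K G C \<omega> r N L \<longleftrightarrow> (\<exists>R D b a c c2 rng W \<phi> E F E2 F2.
     edge K G C L \<omega> R D b a c c2 rng W \<phi> E F E2 F2 \<and> a \<le> r \<and> L - r \<le> c \<and>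
     card (chain.pats L (doubled (chain_family.dim C L)) {..<a}) \<le> N \<and>
     card (chain.pats L (doubled (chain_family.dim C L)) {c..<L}) \<le> N)"

text \<open>Cocycles are not assumed normalised; the cocycle identity with a neutral element still
  makes the values on it constant.\<close>

lemma cocycle_ones:
  assumes "group K" "\<alpha> \<in> cocycles2 K" "k \<in> carrier K"
  shows "\<alpha> k \<one>\<^bsub>K\<^esub> = \<alpha> \<one>\<^bsub>K\<^esub> \<one>\<^bsub>K\<^esub>" "\<alpha> \<one>\<^bsub>K\<^esub> k = \<alpha> \<one>\<^bsub>K\<^esub> \<one>\<^bsub>K\<^esub>"
proof -
  interpret group K by fact
  have c: "\<alpha> x y * \<alpha> (x \<otimes>\<^bsub>K\<^esub> y) z = \<alpha> y z * \<alpha> x (y \<otimes>\<^bsub>K\<^esub> z)"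
    if "x \<in> carrier K" "y \<in> carrier K" "z \<in> carrier K" for x y z
    using assms(2) that by (simp add: cocycles2_def)
  have n: "\<alpha> x y \<noteq> 0" if "x \<in> carrier K" "y \<in> carrier K" for x y
  proof -
    have "cmod (\<alpha> x y) = 1" using assms(2) that by (simp add: cocycles2_def)
    then show ?thesis by auto
  qed
  show "\<alpha> k \<one>\<^bsub>K\<^esub> = \<alpha> \<one>\<^bsub>K\<^esub> \<one>\<^bsub>K\<^esub>" using c[of k "\<one>\<^bsub>K\<^esub>" "\<one>\<^bsub>K\<^esub>"] n[of k "\<one>\<^bsub>K\<^esub>"] assms(3) by simp
  show "\<alpha> \<one>\<^bsub>K\<^esub> k = \<alpha> \<one>\<^bsub>K\<^esub> \<one>\<^bsub>K\<^esub>" using c[of "\<one>\<^bsub>K\<^esub>" "\<one>\<^bsub>K\<^esub>" k] n[of "\<one>\<^bsub>K\<^esub>" k] assms(3) by simp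
qed

lemma mspt_cocycle_props:
  assumes K: "group K" and G: "group G" and \<alpha>: "\<alpha> \<in> cocycles2 K" and \<chi>: "\<chi> \<in> H1_of_characters K G"
    and x: "x \<in> carrier ((K \<times>\<times> K) \<times>\<times> G)" and y: "y \<in> carrier ((K \<times>\<times> K) \<times>\<times> G)"
  shows "cmod (mspt_cocycle \<alpha> \<chi> x y) = 1"
    "z \<in> carrier ((K \<times>\<times> K) \<times>\<times> G) \<Longrightarrow>
      mspt_cocycle \<alpha> \<chi> x y * mspt_cocycle \<alpha> \<chi> (x \<otimes>\<^bsub>(K \<times>\<times> K) \<times>\<times> G\<^esub> y) z =
      mspt_cocycle \<alpha> \<chi> y z * mspt_cocycle \<alpha> \<chi> x (y \<otimes>\<^bsub>(K \<times>\<times> K) \<times>\<times> G\<^esub> z)"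
proof -
  interpret K: group K by fact
  interpret G: group G by fact
  obtain k1 k2 g where xe: "x = ((k1, k2), g)" by (metis prod.collapse)
  obtain l1 l2 h where ye: "y = ((l1, l2), h)" by (metis prod.collapse)
  have c: "k1 \<in> carrier K" "k2 \<in> carrier K" "g \<in> carrier G" "l1 \<in> carrier K" "l2 \<in> carrier K" "h \<in> carrier G"
    using x y by (auto simp: xe ye)
  have a1: "cmod (\<alpha> k l) = 1" if "k \<in> carrier K" "l \<in> carrier K" for k l
    using \<alpha> that by (simp add: cocycles2_def)
  have c1: "cmod (\<chi> g k) = 1" if "k \<in> carrier K" "g \<in> carrier G" for k g
    using \<chi> that by (simp add: H1_of_characters_def)
  show "cmod (mspt_cocycle \<alpha> \<chi> x y) = 1"
    unfolding mspt_cocycle_def xe ye using c a1 c1 by (simp add: norm_mult)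
  assume z: "z \<in> carrier ((K \<times>\<times> K) \<times>\<times> G)"
  obtain m1 m2 i where ze: "z = ((m1, m2), i)" by (metis prod.collapse)
  have c': "m1 \<in> carrier K" "m2 \<in> carrier K" "i \<in> carrier G" using z by (auto simp: ze)
  have \<alpha>c: "\<alpha> x y * \<alpha> (x \<otimes>\<^bsub>K\<^esub> y) z = \<alpha> y z * \<alpha> x (y \<otimes>\<^bsub>K\<^esub> z)"
    if "x \<in> carrier K" "y \<in> carrier K" "z \<in> carrier K" for x y z
    using \<alpha> that by (simp add: cocycles2_def)
  have \<chi>K: "\<chi> g (k \<otimes>\<^bsub>K\<^esub> l) = \<chi> g k * \<chi> g l" if "k \<in> carrier K" "l \<in> carrier K" "g \<in> carrier G" for k l g
    using \<chi> that by (simp add: H1_of_characters_def)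
  have \<chi>G: "\<chi> (g \<otimes>\<^bsub>G\<^esub> h) k = \<chi> g k * \<chi> h k" if "k \<in> carrier K" "g \<in> carrier G" "h \<in> carrier G" for k g h
    using \<chi> that by (simp add: H1_of_characters_def)
  have A: "\<alpha> k1 l1 * \<alpha> (k1 \<otimes>\<^bsub>K\<^esub> l1) m1 = \<alpha> l1 m1 * \<alpha> k1 (l1 \<otimes>\<^bsub>K\<^esub> m1)" by (rule \<alpha>c) (use c c' in auto)
  have B: "cnj (\<alpha> k2 l2) * cnj (\<alpha> (k2 \<otimes>\<^bsub>K\<^esub> l2) m2) = cnj (\<alpha> l2 m2) * cnj (\<alpha> k2 (l2 \<otimes>\<^bsub>K\<^esub> m2))"
    unfolding complex_cnj_mult[symmetric] by (rule arg_cong[of _ _ cnj], rule \<alpha>c) (use c c' in auto)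
  have "mspt_cocycle \<alpha> \<chi> x y * mspt_cocycle \<alpha> \<chi> (x \<otimes>\<^bsub>(K \<times>\<times> K) \<times>\<times> G\<^esub> y) z =
      (\<alpha> k1 l1 * \<alpha> (k1 \<otimes>\<^bsub>K\<^esub> l1) m1) * (cnj (\<alpha> k2 l2) * cnj (\<alpha> (k2 \<otimes>\<^bsub>K\<^esub> l2) m2)) *
      (\<chi> h k1 * cnj (\<chi> h k2) * (\<chi> i k1 * \<chi> i l1) * (cnj (\<chi> i k2) * cnj (\<chi> i l2)))"
    unfolding mspt_cocycle_def xe ye ze using c c' by (simp add: \<chi>K mult_ac)
  also have "\<dots> = mspt_cocycle \<alpha> \<chi> y z * mspt_cocycle \<alpha> \<chi> x (y \<otimes>\<^bsub>(K \<times>\<times> K) \<times>\<times> G\<^esub> z)"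
    unfolding A B unfolding mspt_cocycle_def xe ye ze using c c' by (simp add: \<chi>G mult_ac)
  finally show "mspt_cocycle \<alpha> \<chi> x y * mspt_cocycle \<alpha> \<chi> (x \<otimes>\<^bsub>(K \<times>\<times> K) \<times>\<times> G\<^esub> y) z =
      mspt_cocycle \<alpha> \<chi> y z * mspt_cocycle \<alpha> \<chi> x (y \<otimes>\<^bsub>(K \<times>\<times> K) \<times>\<times> G\<^esub> z)" .
qed

text \<open>Both intervals are supplied by the bulk class: a long one ending at a fixed distance
  from the right edge and a short one of fixed length.\<close>

lemma mspt_edges:
  assumes K: "group K" and G: "group G" and m: "mspt K G C \<alpha> \<chi>"
    and \<alpha>: "\<alpha> \<in> cocycles2 K" and \<chi>: "\<chi> \<in> H1_of_characters K G"
  obtains r N L0 where "1 \<le> N" "\<And>L. L0 \<le> L \<Longrightarrow> edges K G C (mspt_cocycle \<alpha> \<chi>) r N L"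
proof -
  let ?H = "(K \<times>\<times> K) \<times>\<times> G" and ?\<omega> = "mspt_cocycle \<alpha> \<chi>"
  obtain dm where dm: "\<And>L i. i < L \<Longrightarrow> 0 < chain_family.dim C L i \<and> chain_family.dim C L i \<le> dm"
    using m unfolding mspt_def by blast
  obtain R D b where sre: "\<And>L. \<exists>W \<phi>. local_circuit L (doubled (chain_family.dim C L)) R D W \<and>
      bulk_product L (doubled (chain_family.dim C L)) b \<phi> \<and> choi_state C L = app_op (dbasis C L) W \<phi>"
    using m unfolding mspt_def bulk_short_range_entangled_def by blast
  obtain v mm where spt: "\<And>L a c. mm \<le> a \<and> a + mm \<le> c \<and> c + mm \<le> L \<Longrightarrow>
     (\<exists>El Er.
        (\<forall>x\<in>carrier ?H.
           unitary_op (dbasis C L) (El x) \<and> supported_on L (doubled (chain_family.dim C L)) {a - v..<a} (El x) \<and>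
           unitary_op (dbasis C L) (Er x) \<and> supported_on L (doubled (chain_family.dim C L)) {c..<c + v} (Er x) \<and>
           app_op (dbasis C L) (dsym C L {a..<c} x)
             (app_op (dbasis C L) (El x) (app_op (dbasis C L) (Er x) (choi_state C L))) = choi_state C L) \<and>
        (\<forall>x\<in>carrier ?H. \<forall>y\<in>carrier ?H.
           app_op (dbasis C L) (El x) (app_op (dbasis C L) (El y) (choi_state C L)) =
           (\<lambda>s. ?\<omega> x y * app_op (dbasis C L) (El (x \<otimes>\<^bsub>?H\<^esub> y)) (choi_state C L) s)))"
    using m unfolding mspt_def bulk_spt_class_def by blast
  \<comment> \<open>\<open>a\<close> leaves room for the margin \<open>b\<close>, a light cone and
    the window \<open>v\<close> to its left, and for the margin \<open>mm\<close> of the bulk class;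
    \<open>c2\<close> lies two light cones further, and \<open>L0\<close> makes room for all of this
    and for the right edge.\<close>
  define a where "a = b + D * R + v + mm"
  define c2 where "c2 = a + D * R + D * R + mm"
  define L0 where "L0 = c2 + v + mm + mm + a + D * R + b"
  \<comment> \<open>A doubled site has at most \<open>M\<close> basis states. The left region has
    \<open>a\<close> sites and the right one at most \<open>mm\<close>, which does not exceed
    \<open>a\<close>.\<close>
  define M where "M = (max 1 dm)\<^sup>2"
  define N where "N = M ^ a"
  have M: "1 \<le> M" unfolding M_def by simp
  have "edges K G C ?\<omega> a N L" if L: "L0 \<le> L" for L
  proof -
    define c where "c = L - mm"
    have b1: "mm \<le> a" "a + mm \<le> c" "c + mm \<le> L" "a + mm \<le> c2" "c2 + mm \<le> L"
      using L by (auto simp: a_def c2_def L0_def c_def)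
    obtain E F where EF:
      "\<And>x. x \<in> carrier ?H \<Longrightarrow>
           unitary_op (dbasis C L) (E x) \<and> supported_on L (doubled (chain_family.dim C L)) {a - v..<a} (E x) \<and>
           unitary_op (dbasis C L) (F x) \<and> supported_on L (doubled (chain_family.dim C L)) {c..<c + v} (F x) \<and>
           app_op (dbasis C L) (dsym C L {a..<c} x)
             (app_op (dbasis C L) (E x) (app_op (dbasis C L) (F x) (choi_state C L))) = choi_state C L"
      "\<And>x y. x \<in> carrier ?H \<Longrightarrow> y \<in> carrier ?H \<Longrightarrow>
           app_op (dbasis C L) (E x) (app_op (dbasis C L) (E y) (choi_state C L)) =
           (\<lambda>s. ?\<omega> x y * app_op (dbasis C L) (E (x \<otimes>\<^bsub>?H\<^esub> y)) (choi_state C L) s)"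
      using spt[of a c L] b1(1,2,3) by blast
    obtain E2 F2 where EF2:
      "\<And>x. x \<in> carrier ?H \<Longrightarrow>
           unitary_op (dbasis C L) (E2 x) \<and> supported_on L (doubled (chain_family.dim C L)) {a - v..<a} (E2 x) \<and>
           unitary_op (dbasis C L) (F2 x) \<and> supported_on L (doubled (chain_family.dim C L)) {c2..<c2 + v} (F2 x) \<and>
           app_op (dbasis C L) (dsym C L {a..<c2} x)
             (app_op (dbasis C L) (E2 x) (app_op (dbasis C L) (F2 x) (choi_state C L))) = choi_state C L"
      using spt[of a c2 L] b1(1,4,5) by blast
    obtain W \<phi> where W: "local_circuit L (doubled (chain_family.dim C L)) R D W"
      "bulk_product L (doubled (chain_family.dim C L)) b \<phi>" "choi_state C L = app_op (dbasis C L) W \<phi>"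
      using sre by blast
    have fam: "family K G C L"
      by (rule family.intro) (use K G m dm in \<open>auto simp: mspt_def\<close>)
    have \<omega>0: "?\<omega> x y \<noteq> 0" if "x \<in> carrier ?H" "y \<in> carrier ?H" for x y
      using mspt_cocycle_props(1)[OF K G \<alpha> \<chi> that] by auto
    have "edge K G C L ?\<omega> R D b a c c2 v W \<phi> E F E2 F2"
    proof (rule edge.intro[OF fam], rule edge_axioms.intro)
      show "\<And>x y. x \<in> carrier ?H \<Longrightarrow> y \<in> carrier ?H \<Longrightarrow> ?\<omega> x y \<noteq> 0" by (rule \<omega>0)
      show "\<And>x y z. x \<in> carrier ?H \<Longrightarrow> y \<in> carrier ?H \<Longrightarrow> z \<in> carrier ?H \<Longrightarrow>
        ?\<omega> x y * ?\<omega> (x \<otimes>\<^bsub>?H\<^esub> y) z = ?\<omega> y z * ?\<omega> x (y \<otimes>\<^bsub>?H\<^esub> z)"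
        by (rule mspt_cocycle_props(2)[OF K G \<alpha> \<chi>])
      show "b + D * R + v \<le> a" "a + D * R + D * R \<le> c2" "a + D * R \<le> L - b" "c2 + v \<le> c" "c \<le> L"
        using L by (auto simp: a_def c2_def L0_def c_def)
    qed (fact W EF(2)
        EF(1)[THEN conjunct1] EF(1)[THEN conjunct2, THEN conjunct1] EF(1)[THEN conjunct2, THEN conjunct2, THEN conjunct1] EF(1)[THEN conjunct2, THEN conjunct2, THEN conjunct2, THEN conjunct1] EF(1)[THEN conjunct2, THEN conjunct2, THEN conjunct2, THEN conjunct2]
        EF2[THEN conjunct1] EF2[THEN conjunct2, THEN conjunct1] EF2[THEN conjunct2, THEN conjunct2, THEN conjunct1] EF2[THEN conjunct2, THEN conjunct2, THEN conjunct2, THEN conjunct1] EF2[THEN conjunct2, THEN conjunct2, THEN conjunct2, THEN conjunct2])+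
    moreover interpret ch: chain L "doubled (chain_family.dim C L)" by unfold_locales (simp add: doubled_def)
    have dbl: "card (doubled (chain_family.dim C L) i) \<le> M" if "i < L" for i
    proof -
      have "chain_family.dim C L i \<le> max 1 dm" using dm[OF that] by simp
      then show ?thesis
        unfolding M_def doubled_def by (simp add: card_cartesian_product power2_eq_square mult_le_mono)
    qed
    have M0: "0 < M" using M by simp
    have "card (ch.pats {..<a}) \<le> N"
      using ch.card_pats[OF dbl M0, of "{..<a}"] by (simp add: N_def)
    moreover have "card (ch.pats {c..<L}) \<le> N"
    proof -
      have "card (ch.pats {c..<L}) \<le> M ^ (L - c)" using ch.card_pats[OF dbl M0, of "{c..<L}"] by simp
      also have "\<dots> \<le> N" unfolding N_def using M by (intro power_increasing) (auto simp: c_def a_def)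
      finally show ?thesis .
    qed
    moreover have "L - a \<le> c" by (auto simp: c_def a_def)
    ultimately show ?thesis unfolding edges_def by blast
  qed
  moreover have "1 \<le> N" unfolding N_def using M by simp
  ultimately show ?thesis using that by blast
qed

text \<open>Order asks for boundary operators as functions of the length; existence for every large
  length is turned into such functions by choice.\<close>

lemma boundary_orderI:
  assumes \<epsilon>: "0 < \<epsilon>"
    and pair: "\<And>L. L0 \<le> L \<Longrightarrow> \<exists>B B'. supported_on L (doubled (chain_family.dim C L)) {..<r} B \<and>
     supported_on L (doubled (chain_family.dim C L)) {L - r..<L} B' \<and>
     contraction_op (dbasis C L) B \<and> contraction_op (dbasis C L) B' \<and> P L B \<and> P L B' \<and>
     \<epsilon> \<le> cmod (inner_on (dbasis C L) (choi_state C L)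
              (app_op (dbasis C L) (times_op (dbasis C L) B B') (choi_state C L))
            / inner_on (dbasis C L) (choi_state C L) (choi_state C L))"
  shows "boundary_order C P"
proof -
  define T where "T L p \<longleftrightarrow> supported_on L (doubled (chain_family.dim C L)) {..<r} (fst p) \<and>
     supported_on L (doubled (chain_family.dim C L)) {L - r..<L} (snd p) \<and>
     contraction_op (dbasis C L) (fst p) \<and> contraction_op (dbasis C L) (snd p) \<and> P L (fst p) \<and> P L (snd p) \<and>
     \<epsilon> \<le> cmod (inner_on (dbasis C L) (choi_state C L)
              (app_op (dbasis C L) (times_op (dbasis C L) (fst p) (snd p)) (choi_state C L))
            / inner_on (dbasis C L) (choi_state C L) (choi_state C L))" for L p
  have "\<exists>p. T L p" if L: "L0 \<le> L" for L
  proof -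
    obtain B B' where "T L (B, B')" using pair[OF L] unfolding T_def fst_conv snd_conv by (elim exE)
    then show ?thesis by (rule exI)
  qed
  then have "\<forall>L. \<exists>p. L0 \<le> L \<longrightarrow> T L p" by blast
  from choice[OF this] obtain p where p: "\<And>L. L0 \<le> L \<Longrightarrow> T L (p L)" by blast
  show ?thesis
    unfolding boundary_order_def
    by (intro exI[of _ r] exI[of _ "\<lambda>L. fst (p L)"] exI[of _ "\<lambda>L. snd (p L)"] exI[of _ \<epsilon>] conjI \<epsilon>
        eventually_sequentiallyI[of L0]; insert p; simp add: T_def)
qed

lemma boundary_order_mono:
  assumes "boundary_order C P" "\<And>L B. P L B \<Longrightarrow> Q L B"
  shows "boundary_order C Q"
  using assms(1) unfolding boundary_order_def
  by (elim exE conjE) (intro exI conjI, assumption, erule eventually_mono, use assms(2) in blast)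

text \<open>The operators at the two edges carry inverse charges, but order uses one predicate for
  both; it therefore allows either of the two mutually inverse charge functions.\<close>

lemma commutator_order:
  assumes K: "group K" and G: "group G" and m: "mspt K G C \<alpha> \<chi>"
    and \<alpha>: "\<alpha> \<in> cocycles2 K" and \<chi>: "\<chi> \<in> H1_of_characters K G"
    and y: "y \<in> carrier ((K \<times>\<times> K) \<times>\<times> G)"
  shows "boundary_order C (\<lambda>L B. B \<in> ops (dbasis C L) \<and> B \<noteq> (\<lambda>s t. 0) \<and>
     (\<exists>f\<in>{\<lambda>x. mspt_cocycle \<alpha> \<chi> y x / mspt_cocycle \<alpha> \<chi> x y, \<lambda>x. mspt_cocycle \<alpha> \<chi> x y / mspt_cocycle \<alpha> \<chi> y x}.
       \<forall>x\<in>carrier ((K \<times>\<times> K) \<times>\<times> G). x \<otimes>\<^bsub>(K \<times>\<times> K) \<times>\<times> G\<^esub> y = y \<otimes>\<^bsub>(K \<times>\<times> K) \<times>\<times> G\<^esub> x \<longrightarrow>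
         conj_sym C L x B = scale_op (f x) B))"
proof -
  let ?\<omega> = "mspt_cocycle \<alpha> \<chi>" and ?H = "(K \<times>\<times> K) \<times>\<times> G"
  obtain r N L0 where N: "1 \<le> N" and e: "\<And>L. L0 \<le> L \<Longrightarrow> edges K G C ?\<omega> r N L"
    by (rule mspt_edges[OF K G m \<alpha> \<chi>]) blast
  show ?thesis
  proof (rule boundary_orderI[of "(1 / real N)\<^sup>2" L0 C r])
    show "0 < (1 / real N)\<^sup>2" using N by simp
    fix L assume "L0 \<le> L"
    from e[OF this] obtain R D b a c c2 rng W \<phi> E F E2 F2 where
      ed: "edge K G C L ?\<omega> R D b a c c2 rng W \<phi> E F E2 F2" and rc: "a \<le> r" "L - r \<le> c"
      and cards: "card (chain.pats L (doubled (chain_family.dim C L)) {..<a}) \<le> N"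
        "card (chain.pats L (doubled (chain_family.dim C L)) {c..<L}) \<le> N"
      unfolding edges_def by (elim exE conjE)
    interpret edge K G C L ?\<omega> R D b a c c2 rng W \<phi> E F E2 F2 by (rule ed)
    obtain B B' where B: "supp {..<a} B" "supp {c..<L} B'" "contraction_op X B" "contraction_op X B'"
      "\<And>x. x \<in> carrier ?H \<Longrightarrow> x \<otimes>\<^bsub>?H\<^esub> y = y \<otimes>\<^bsub>?H\<^esub> x \<Longrightarrow> CS x B = scale_op (ratio y x) B"
      "\<And>x. x \<in> carrier ?H \<Longrightarrow> x \<otimes>\<^bsub>?H\<^esub> y = y \<otimes>\<^bsub>?H\<^esub> x \<Longrightarrow> CS x B' = scale_op (ratio x y) B'"
      "cmod (inner_on X \<psi> (app_op X (times_op X B B') \<psi>)) = (1 / real N)\<^sup>2"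
      by (rule commutator_pair[OF y, of "real N"]) (use cards N in auto)
    have s: "supp {..<r} B" "supp {L - r..<L} B'"
      using rc by (auto intro: supp_mono[OF B(1)] supp_mono[OF B(2)])
    have nz: "B \<noteq> (\<lambda>s t. 0)" "B' \<noteq> (\<lambda>s t. 0)"
    proof -
      have "(1 / real N)\<^sup>2 \<noteq> 0" using N by simp
      then have "times_op X B B' \<noteq> (\<lambda>s t. 0)" using B(7) by (auto simp: app_op_def inner_on_def)
      then show "B \<noteq> (\<lambda>s t. 0)" "B' \<noteq> (\<lambda>s t. 0)" by (auto simp: times_op_def)
    qed
    have f1: "\<forall>x\<in>carrier ?H. x \<otimes>\<^bsub>?H\<^esub> y = y \<otimes>\<^bsub>?H\<^esub> x \<longrightarrow> CS x B = scale_op (?\<omega> y x / ?\<omega> x y) B"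
      and f2: "\<forall>x\<in>carrier ?H. x \<otimes>\<^bsub>?H\<^esub> y = y \<otimes>\<^bsub>?H\<^esub> x \<longrightarrow> CS x B' = scale_op (?\<omega> x y / ?\<omega> y x) B'"
      unfolding ratio_def[symmetric] by (intro ballI impI B(5), assumption+) (intro ballI impI B(6), assumption+)
    let ?T = "\<lambda>A. \<exists>f\<in>{\<lambda>x. ?\<omega> y x / ?\<omega> x y, \<lambda>x. ?\<omega> x y / ?\<omega> y x}.
      \<forall>x\<in>carrier ?H. x \<otimes>\<^bsub>?H\<^esub> y = y \<otimes>\<^bsub>?H\<^esub> x \<longrightarrow> CS x A = scale_op (f x) A"
    have g: "?T B" "?T B'"
      by (rule bexI[where x = "\<lambda>x. ?\<omega> y x / ?\<omega> x y"], rule f1, rule insertI1)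
        (rule bexI[where x = "\<lambda>x. ?\<omega> x y / ?\<omega> y x"], rule f2, rule insertI2, rule insertI1)
    have cor: "(1 / real N)\<^sup>2 \<le> cmod (inner_on X (choi_state C L) (app_op X (times_op X B B') (choi_state C L)) /
        inner_on X (choi_state C L) (choi_state C L))"
      unfolding correlator B(7) by simp
    show "\<exists>B B'. supp {..<r} B \<and> supp {L - r..<L} B' \<and> contraction_op X B \<and> contraction_op X B' \<and>
      (B \<in> ops X \<and> B \<noteq> (\<lambda>s t. 0) \<and> (\<exists>f\<in>{\<lambda>x. ?\<omega> y x / ?\<omega> x y, \<lambda>x. ?\<omega> x y / ?\<omega> y x}.
         \<forall>x\<in>carrier ?H. x \<otimes>\<^bsub>?H\<^esub> y = y \<otimes>\<^bsub>?H\<^esub> x \<longrightarrow> CS x B = scale_op (f x) B)) \<and>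
      (B' \<in> ops X \<and> B' \<noteq> (\<lambda>s t. 0) \<and> (\<exists>f\<in>{\<lambda>x. ?\<omega> y x / ?\<omega> x y, \<lambda>x. ?\<omega> x y / ?\<omega> y x}.
         \<forall>x\<in>carrier ?H. x \<otimes>\<^bsub>?H\<^esub> y = y \<otimes>\<^bsub>?H\<^esub> x \<longrightarrow> CS x B' = scale_op (f x) B')) \<and>
      (1 / real N)\<^sup>2 \<le> cmod (inner_on X (choi_state C L) (app_op X (times_op X B B') (choi_state C L)) /
        inner_on X (choi_state C L) (choi_state C L))"
      by (rule exI[of _ B], rule exI[of _ B'])
        (intro conjI s B(3,4) supp_ops[OF s(1)] supp_ops[OF s(2)] nz cor g)
  qed
qed

text \<open>The constant \<delta>0 is fixed before any length is considered, so one \<epsilon>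
  serves the whole family. The predicate keeps the freedom in \<Gamma>' until the subgroups are
  chosen.\<close>

lemma exact_order:
  fixes K :: "('k, 'm) monoid_scheme" and G :: "('g, 'n) monoid_scheme"
  assumes K: "group K" and G: "group G" and m: "mspt K G C \<alpha> \<chi>"
    and \<alpha>: "\<alpha> \<in> cocycles2 K" and \<chi>: "\<chi> \<in> H1_of_characters K G"
    and j: "\<And>k. k \<in> carrier K \<Longrightarrow> j k \<in> carrier ((K \<times>\<times> K) \<times>\<times> G)"
    "\<And>k l. k \<in> carrier K \<Longrightarrow> l \<in> carrier K \<Longrightarrow> j (k \<otimes>\<^bsub>K\<^esub> l) = j k \<otimes>\<^bsub>(K \<times>\<times> K) \<times>\<times> G\<^esub> j l"
    and \<Theta>: "\<Theta> \<subseteq> carrier ((K \<times>\<times> K) \<times>\<times> G)"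
    "\<And>k y. k \<in> carrier K \<Longrightarrow> y \<in> \<Theta> \<Longrightarrow> j k \<otimes>\<^bsub>(K \<times>\<times> K) \<times>\<times> G\<^esub> y = y \<otimes>\<^bsub>(K \<times>\<times> K) \<times>\<times> G\<^esub> j k"
    "\<And>k y. k \<in> carrier K \<Longrightarrow> y \<in> \<Theta> \<Longrightarrow> mspt_cocycle \<alpha> \<chi> (j k) y = mspt_cocycle \<alpha> \<chi> y (j k)"
    and nt: "(\<lambda>k l. mspt_cocycle \<alpha> \<chi> (j k) (j l)) \<notin> coboundaries2 K"
  shows "boundary_order C (\<lambda>L B. (\<forall>y\<in>\<Theta>. conj_sym C L y B = B) \<and>
     (\<forall>\<Gamma>'. (\<forall>x\<in>\<Gamma>'. \<exists>k\<in>carrier K. \<forall>A. (\<forall>y\<in>\<Theta>. conj_sym C L y A = A) \<longrightarrow> conj_sym C L x A = conj_sym C L (j k) A) \<and>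
        (\<forall>k\<in>carrier K. \<exists>x\<in>\<Gamma>'. \<forall>A. (\<forall>y\<in>\<Theta>. conj_sym C L y A = A) \<longrightarrow> conj_sym C L x A = conj_sym C L (j k) A) \<longrightarrow>
        charged C L \<Gamma>' B))"
proof -
  let ?\<omega> = "mspt_cocycle \<alpha> \<chi>" and ?H = "(K \<times>\<times> K) \<times>\<times> G"
  have unit: "cmod (?\<omega> (j k) (j l)) = 1" if "k \<in> carrier K" "l \<in> carrier K" for k l
    by (rule mspt_cocycle_props(1)[OF K G \<alpha> \<chi> j(1)[OF that(1)] j(1)[OF that(2)]])
  \<comment> \<open>Otherwise there would be approximate trivialisations to every precision, and the
    restricted cocycle would be a coboundary.\<close>
  have "\<exists>\<delta>0>0. \<forall>h. (\<forall>k\<in>carrier K. 1 / 2 \<le> cmod (h k) \<and> cmod (h k) \<le> 2) \<longrightarrow>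
      (\<exists>x\<in>carrier K. \<exists>y\<in>carrier K. \<delta>0 < cmod (h x * h y - h (x \<otimes>\<^bsub>K\<^esub> y) / ?\<omega> (j x) (j y)))"
  proof (rule ccontr)
    assume *: "\<not> ?thesis"
    have "(\<lambda>k l. ?\<omega> (j k) (j l)) \<in> coboundaries2 K"
    proof (rule approx_coboundary[OF K unit])
      fix \<epsilon> :: real assume "0 < \<epsilon>"
      then obtain h where "\<forall>k\<in>carrier K. 1 / 2 \<le> cmod (h k) \<and> cmod (h k) \<le> 2"
        "\<not> (\<exists>x\<in>carrier K. \<exists>y\<in>carrier K. \<epsilon> < cmod (h x * h y - h (x \<otimes>\<^bsub>K\<^esub> y) / ?\<omega> (j x) (j y)))"
        using * by blast
      then show "\<exists>c. (\<forall>k\<in>carrier K. 1 / 2 \<le> cmod (c k) \<and> cmod (c k) \<le> 2) \<and>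
        (\<forall>x\<in>carrier K. \<forall>y\<in>carrier K. cmod (c x * c y - c (x \<otimes>\<^bsub>K\<^esub> y) / ?\<omega> (j x) (j y)) \<le> \<epsilon>)"
        by (intro exI[of _ h]) (auto simp: not_less)
    qed
    then show False using nt by blast
  qed
  then obtain \<delta>0 where \<delta>0: "0 < \<delta>0" "\<And>h. (\<forall>k\<in>carrier K. 1 / 2 \<le> cmod (h k) \<and> cmod (h k) \<le> 2) \<Longrightarrow>
      (\<exists>x\<in>carrier K. \<exists>y\<in>carrier K. \<delta>0 < cmod (h x * h y - h (x \<otimes>\<^bsub>K\<^esub> y) / ?\<omega> (j x) (j y)))" by blast
  obtain r N L0 where N: "1 \<le> N" and e: "\<And>L. L0 \<le> L \<Longrightarrow> edges K G C ?\<omega> r N L"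
    by (rule mspt_edges[OF K G m \<alpha> \<chi>]) blast
  define \<epsilon> where "\<epsilon> = (1 / real N)\<^sup>2 * ((min (1 / 2) (\<delta>0 / 4) / 2 ^ N\<^sup>2)\<^sup>2 / 2 ^ N\<^sup>2 / 2 ^ N\<^sup>2)"
  have "0 < \<epsilon>" using \<delta>0(1) N by (simp add: \<epsilon>_def)
  then show ?thesis
  proof (rule boundary_orderI[of \<epsilon> L0 C r])
    fix L assume "L0 \<le> L"
    from e[OF this] obtain R D b a c c2 rng W \<phi> E F E2 F2 where
      ed: "edge K G C L ?\<omega> R D b a c c2 rng W \<phi> E F E2 F2" and rc: "a \<le> r" "L - r \<le> c"
      and cards: "card (chain.pats L (doubled (chain_family.dim C L)) {..<a}) \<le> N"
        "card (chain.pats L (doubled (chain_family.dim C L)) {c..<L}) \<le> N"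
      unfolding edges_def by (elim exE conjE)
    have "edge_sub K G C L ?\<omega> R D b a c c2 rng W \<phi> E F E2 F2 j \<Theta> \<delta>0 N"
    proof (rule edge_sub.intro[OF ed], rule edge_sub_axioms.intro)
      show "\<And>k. k \<in> carrier K \<Longrightarrow> j k \<in> carrier ?H" by (rule j(1))
      show "\<And>k l. k \<in> carrier K \<Longrightarrow> l \<in> carrier K \<Longrightarrow> j (k \<otimes>\<^bsub>K\<^esub> l) = j k \<otimes>\<^bsub>?H\<^esub> j l" by (rule j(2))
      show "\<Theta> \<subseteq> carrier ?H" by (rule \<Theta>(1))
      show "\<And>k y. k \<in> carrier K \<Longrightarrow> y \<in> \<Theta> \<Longrightarrow> j k \<otimes>\<^bsub>?H\<^esub> y = y \<otimes>\<^bsub>?H\<^esub> j k" by (rule \<Theta>(2))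
      show "\<And>k y. k \<in> carrier K \<Longrightarrow> y \<in> \<Theta> \<Longrightarrow> ?\<omega> (j k) y = ?\<omega> y (j k)" by (rule \<Theta>(3))
      show "\<And>k l. k \<in> carrier K \<Longrightarrow> l \<in> carrier K \<Longrightarrow> cmod (?\<omega> (j k) (j l)) = 1" by (rule unit)
      show "0 < \<delta>0" by (rule \<delta>0(1))
      show "\<And>h. (\<forall>k\<in>carrier K. 1 / 2 \<le> cmod (h k) \<and> cmod (h k) \<le> 2) \<Longrightarrow>
        \<exists>x\<in>carrier K. \<exists>y\<in>carrier K. \<delta>0 < cmod (h x * h y - h (x \<otimes>\<^bsub>K\<^esub> y) / ?\<omega> (j x) (j y))" by (rule \<delta>0(2))
    qed (rule cards N)+
    then interpret edge_sub K G C L ?\<omega> R D b a c c2 rng W \<phi> E F E2 F2 j \<Theta> \<delta>0 N .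
    obtain B B' where B: "supp {..<a} B" "supp {c..<L} B'" "contraction_op X B" "contraction_op X B'"
      "\<And>y. y \<in> \<Theta> \<Longrightarrow> CS y B = B" "\<And>y. y \<in> \<Theta> \<Longrightarrow> CS y B' = B'"
      "\<forall>\<Gamma>'. (\<forall>x\<in>\<Gamma>'. \<exists>k\<in>carrier K. \<forall>A. (\<forall>y\<in>\<Theta>. CS y A = A) \<longrightarrow> CS x A = CS (j k) A) \<and>
        (\<forall>k\<in>carrier K. \<exists>x\<in>\<Gamma>'. \<forall>A. (\<forall>y\<in>\<Theta>. CS y A = A) \<longrightarrow> CS x A = CS (j k) A) \<longrightarrow>
        charged C L \<Gamma>' B \<and> charged C L \<Gamma>' B'"
      "\<epsilon> \<le> cmod (inner_on X \<psi> (app_op X (times_op X B B') \<psi>))"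
      by (rule exact_pair[unfolded \<delta>_def, folded \<epsilon>_def], rule that)
    have s: "supp {..<r} B" "supp {L - r..<L} B'"
      using rc by (auto intro: supp_mono[OF B(1)] supp_mono[OF B(2)])
    have ch: "\<forall>\<Gamma>'. (\<forall>x\<in>\<Gamma>'. \<exists>k\<in>carrier K. \<forall>A. (\<forall>y\<in>\<Theta>. CS y A = A) \<longrightarrow> CS x A = CS (j k) A) \<and>
        (\<forall>k\<in>carrier K. \<exists>x\<in>\<Gamma>'. \<forall>A. (\<forall>y\<in>\<Theta>. CS y A = A) \<longrightarrow> CS x A = CS (j k) A) \<longrightarrow> charged C L \<Gamma>' B"
      "\<forall>\<Gamma>'. (\<forall>x\<in>\<Gamma>'. \<exists>k\<in>carrier K. \<forall>A. (\<forall>y\<in>\<Theta>. CS y A = A) \<longrightarrow> CS x A = CS (j k) A) \<and>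
        (\<forall>k\<in>carrier K. \<exists>x\<in>\<Gamma>'. \<forall>A. (\<forall>y\<in>\<Theta>. CS y A = A) \<longrightarrow> CS x A = CS (j k) A) \<longrightarrow> charged C L \<Gamma>' B'"
      by (intro allI impI, drule mp[OF spec[OF B(7)]], erule conjunct1)
        (intro allI impI, drule mp[OF spec[OF B(7)]], erule conjunct2)
    have neu: "\<forall>y\<in>\<Theta>. CS y B = B" "\<forall>y\<in>\<Theta>. CS y B' = B'" using B(5,6) by blast+
    show "\<exists>B B'. supp {..<r} B \<and> supp {L - r..<L} B' \<and> contraction_op X B \<and> contraction_op X B' \<and>
      ((\<forall>y\<in>\<Theta>. CS y B = B) \<and> (\<forall>\<Gamma>'. (\<forall>x\<in>\<Gamma>'. \<exists>k\<in>carrier K. \<forall>A. (\<forall>y\<in>\<Theta>. CS y A = A) \<longrightarrow> CS x A = CS (j k) A) \<and>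
        (\<forall>k\<in>carrier K. \<exists>x\<in>\<Gamma>'. \<forall>A. (\<forall>y\<in>\<Theta>. CS y A = A) \<longrightarrow> CS x A = CS (j k) A) \<longrightarrow> charged C L \<Gamma>' B)) \<and>
      ((\<forall>y\<in>\<Theta>. CS y B' = B') \<and> (\<forall>\<Gamma>'. (\<forall>x\<in>\<Gamma>'. \<exists>k\<in>carrier K. \<forall>A. (\<forall>y\<in>\<Theta>. CS y A = A) \<longrightarrow> CS x A = CS (j k) A) \<and>
        (\<forall>k\<in>carrier K. \<exists>x\<in>\<Gamma>'. \<forall>A. (\<forall>y\<in>\<Theta>. CS y A = A) \<longrightarrow> CS x A = CS (j k) A) \<longrightarrow> charged C L \<Gamma>' B')) \<and>
      \<epsilon> \<le> cmod (inner_on X (choi_state C L) (app_op X (times_op X B B') (choi_state C L)) /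
        inner_on X (choi_state C L) (choi_state C L))"
      unfolding correlator
      by (rule exI[of _ B], rule exI[of _ B']) (intro conjI s B(3,4,8) neu ch)
  qed
qed

section \<open>Breaking patterns\<close>

lemma mspt_family:
  assumes "group K" "group G" "mspt K G C \<alpha> \<chi>"
  shows "family K G C L"
  by (rule family.intro) (use assms in \<open>auto simp: mspt_def\<close>)

text \<open>A constant phase is the coboundary of a constant function. Restriction of the cocycle to
  one copy of \<open>K\<close> produces such a constant from the value at the neutral element of the
  other copy.\<close>

lemma coboundaries2_scale:
  assumes K: "group K" and z: "cmod z = 1" and c: "(\<lambda>k l. \<alpha> k l * z) \<in> coboundaries2 K"
  shows "\<alpha> \<in> coboundaries2 K"
proof -
  obtain \<mu> where \<mu>: "\<And>x. x \<in> carrier K \<Longrightarrow> cmod (\<mu> x) = 1"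
    "\<And>x y. x \<in> carrier K \<Longrightarrow> y \<in> carrier K \<Longrightarrow> \<alpha> x y * z = \<mu> x * \<mu> y / \<mu> (x \<otimes>\<^bsub>K\<^esub> y)"
    using c unfolding coboundaries2_def by blast
  have z0: "z \<noteq> 0" using z by auto
  have "\<alpha> x y = (\<mu> x / z) * (\<mu> y / z) / (\<mu> (x \<otimes>\<^bsub>K\<^esub> y) / z)" if "x \<in> carrier K" "y \<in> carrier K" for x y
  proof -
    have "\<alpha> x y = \<mu> x * \<mu> y / \<mu> (x \<otimes>\<^bsub>K\<^esub> y) / z" unfolding \<mu>(2)[OF that, symmetric] using z0 by simp
    then show ?thesis using z0 by simp
  qed
  then show ?thesis unfolding coboundaries2_def using \<mu>(1) z
    by (intro CollectI exI[of _ "\<lambda>x. \<mu> x / z"]) (simp add: norm_divide)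
qed

lemma coboundaries2_cnj:
  assumes "(\<lambda>k l. cnj (\<alpha> k l)) \<in> coboundaries2 K"
  shows "\<alpha> \<in> coboundaries2 K"
proof -
  obtain \<mu> where \<mu>: "\<And>x. x \<in> carrier K \<Longrightarrow> cmod (\<mu> x) = 1"
    "\<And>x y. x \<in> carrier K \<Longrightarrow> y \<in> carrier K \<Longrightarrow> cnj (\<alpha> x y) = \<mu> x * \<mu> y / \<mu> (x \<otimes>\<^bsub>K\<^esub> y)"
    using assms unfolding coboundaries2_def by blast
  have "\<alpha> x y = cnj (\<mu> x) * cnj (\<mu> y) / cnj (\<mu> (x \<otimes>\<^bsub>K\<^esub> y))" if "x \<in> carrier K" "y \<in> carrier K" for x y
    using arg_cong[OF \<mu>(2)[OF that], of cnj] by simp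
  then show ?thesis unfolding coboundaries2_def using \<mu>(1)
    by (intro CollectI exI[of _ "\<lambda>x. cnj (\<mu> x)"]) simp
qed

lemma one_H1: "(\<lambda>_ _. 1) \<in> H1_of_characters K G"
  by (simp add: H1_of_characters_def)

lemma one_cocycle: "(\<lambda>_ _. 1) \<in> cocycles2 K"
  by (simp add: cocycles2_def)

lemma H1_ones:
  assumes "group K" "group G" "\<chi> \<in> H1_of_characters K G"
  shows "g \<in> carrier G \<Longrightarrow> \<chi> g \<one>\<^bsub>K\<^esub> = 1" "k \<in> carrier K \<Longrightarrow> \<chi> \<one>\<^bsub>G\<^esub> k = 1"
    "g \<in> carrier G \<Longrightarrow> k \<in> carrier K \<Longrightarrow> \<chi> g k \<noteq> 0"
proof -
  interpret K: group K by fact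
  interpret G: group G by fact
  have n: "\<chi> g k \<noteq> 0" if "g \<in> carrier G" "k \<in> carrier K" for g k
  proof -
    have "cmod (\<chi> g k) = 1" using assms(3) that by (simp add: H1_of_characters_def)
    then show ?thesis by auto
  qed
  then show "g \<in> carrier G \<Longrightarrow> k \<in> carrier K \<Longrightarrow> \<chi> g k \<noteq> 0" .
  have K: "\<chi> g (k \<otimes>\<^bsub>K\<^esub> l) = \<chi> g k * \<chi> g l" if "k \<in> carrier K" "l \<in> carrier K" "g \<in> carrier G" for k l g
    using assms(3) that by (simp add: H1_of_characters_def)
  have G: "\<chi> (g \<otimes>\<^bsub>G\<^esub> h) k = \<chi> g k * \<chi> h k" if "k \<in> carrier K" "g \<in> carrier G" "h \<in> carrier G" for k g h
    using assms(3) that by (simp add: H1_of_characters_def)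
  show "\<chi> g \<one>\<^bsub>K\<^esub> = 1" if "g \<in> carrier G" using K[of "\<one>\<^bsub>K\<^esub>" "\<one>\<^bsub>K\<^esub>" g] n[of g "\<one>\<^bsub>K\<^esub>"] that by simp
  show "\<chi> \<one>\<^bsub>G\<^esub> k = 1" if "k \<in> carrier K" using G[of k "\<one>\<^bsub>G\<^esub>" "\<one>\<^bsub>G\<^esub>"] n[of "\<one>\<^bsub>G\<^esub>" k] that by simp
qed

text \<open>A diagonal element is the product of \<open>j k\<close> and \<open>\<theta> k\<close>,
  and the latter acts trivially on operators neutral under the copy \<theta>. On these operators the
  diagonal subgroup acts as \<open>j\<close> does, so charge under one copy is charge under the
  diagonal.\<close>

lemma exact_order_subgroup:
  fixes K :: "('k, 'm) monoid_scheme" and G :: "('g, 'n) monoid_scheme"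
  assumes K: "group K" and G: "group G" and m: "mspt K G C \<alpha> (\<lambda>_ _. 1)"
    and \<alpha>: "\<alpha> \<in> cocycles2 K"
    and j: "\<And>k. k \<in> carrier K \<Longrightarrow> j k \<in> carrier ((K \<times>\<times> K) \<times>\<times> G)"
      "\<And>k l. k \<in> carrier K \<Longrightarrow> l \<in> carrier K \<Longrightarrow> j (k \<otimes>\<^bsub>K\<^esub> l) = j k \<otimes>\<^bsub>(K \<times>\<times> K) \<times>\<times> G\<^esub> j l"
    and \<theta>: "\<And>k. k \<in> carrier K \<Longrightarrow> \<theta> k \<in> carrier ((K \<times>\<times> K) \<times>\<times> G)"
      "\<And>k l. k \<in> carrier K \<Longrightarrow> l \<in> carrier K \<Longrightarrow> j k \<otimes>\<^bsub>(K \<times>\<times> K) \<times>\<times> G\<^esub> \<theta> l = \<theta> l \<otimes>\<^bsub>(K \<times>\<times> K) \<times>\<times> G\<^esub> j k"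
      "\<And>k l. k \<in> carrier K \<Longrightarrow> l \<in> carrier K \<Longrightarrow> mspt_cocycle \<alpha> (\<lambda>_ _. 1) (j k) (\<theta> l) = mspt_cocycle \<alpha> (\<lambda>_ _. 1) (\<theta> l) (j k)"
      "\<And>k. k \<in> carrier K \<Longrightarrow> j k \<otimes>\<^bsub>(K \<times>\<times> K) \<times>\<times> G\<^esub> \<theta> k = ((k, k), \<one>\<^bsub>G\<^esub>)"
    and nt: "(\<lambda>k l. mspt_cocycle \<alpha> (\<lambda>_ _. 1) (j k) (j l)) \<notin> coboundaries2 K"
  shows "boundary_order C (\<lambda>L B. charged C L (j ` carrier K) B \<and> neutral C L (\<theta> ` carrier K) B \<and>
       charged C L (K_diag K G) B)"
proof (rule boundary_order_mono[OF exact_order[OF K G m \<alpha> one_H1 j, of "\<theta> ` carrier K"]])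
  let ?H = "(K \<times>\<times> K) \<times>\<times> G" and ?\<omega> = "mspt_cocycle \<alpha> (\<lambda>_ _. 1)"
  show "\<theta> ` carrier K \<subseteq> carrier ?H" using \<theta>(1) by blast
  show "j k \<otimes>\<^bsub>?H\<^esub> y = y \<otimes>\<^bsub>?H\<^esub> j k" "?\<omega> (j k) y = ?\<omega> y (j k)" if "k \<in> carrier K" "y \<in> \<theta> ` carrier K" for k y
    using \<theta>(2,3) that by auto
  show "(\<lambda>k l. mspt_cocycle \<alpha> (\<lambda>_ _. 1) (j k) (j l)) \<notin> coboundaries2 K" by fact
next
  fix L B
  let ?n = "\<lambda>A. \<forall>y\<in>\<theta> ` carrier K. conj_sym C L y A = A"
  assume B: "?n B \<and> (\<forall>\<Gamma>'. (\<forall>x\<in>\<Gamma>'. \<exists>k\<in>carrier K. \<forall>A. ?n A \<longrightarrow> conj_sym C L x A = conj_sym C L (j k) A) \<and>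
        (\<forall>k\<in>carrier K. \<exists>x\<in>\<Gamma>'. \<forall>A. ?n A \<longrightarrow> conj_sym C L x A = conj_sym C L (j k) A) \<longrightarrow> charged C L \<Gamma>' B)"
  interpret family K G C L by (rule mspt_family[OF K G m])
  have d: "\<forall>A. ?n A \<longrightarrow> CS ((k, k), \<one>\<^bsub>G\<^esub>) A = CS (j k) A" if k: "k \<in> carrier K" for k
  proof (intro allI impI)
    fix A assume "?n A"
    then have "CS (\<theta> k) A = A" using k by blast
    then show "CS ((k, k), \<one>\<^bsub>G\<^esub>) A = CS (j k) A"
      unfolding \<theta>(4)[OF k, symmetric] CS_mult[OF j(1)[OF k] \<theta>(1)[OF k]] by (rule arg_cong)
  qed
  have "charged C L (j ` carrier K) B"
    by (rule mp[OF spec[OF conjunct2[OF B]]]) (intro conjI ballI; blast)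
  moreover have "charged C L (K_diag K G) B"
  proof (rule mp[OF spec[OF conjunct2[OF B]]], intro conjI ballI)
    fix x assume "x \<in> K_diag K G"
    then obtain k where k: "k \<in> carrier K" "x = ((k, k), \<one>\<^bsub>G\<^esub>)" unfolding K_diag_def by blast
    show "\<exists>k\<in>carrier K. \<forall>A. ?n A \<longrightarrow> CS x A = CS (j k) A" unfolding k(2) by (rule bexI[where x = k], rule d) (rule k(1))+
  next
    fix k assume k: "k \<in> carrier K"
    show "\<exists>x\<in>K_diag K G. \<forall>A. ?n A \<longrightarrow> CS x A = CS (j k) A"
      by (rule bexI[where x = "((k, k), \<one>\<^bsub>G\<^esub>)"], rule d[OF k]) (use k in \<open>auto simp: K_diag_def\<close>)
  qed
  ultimately show "charged C L (j ` carrier K) B \<and> neutral C L (\<theta> ` carrier K) B \<and> charged C L (K_diag K G) B"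
    using conjunct1[OF B] unfolding neutral_def by (intro conjI)
qed

lemma K_plus_image: "K_plus K G = (\<lambda>k. ((k, \<one>\<^bsub>K\<^esub>), \<one>\<^bsub>G\<^esub>)) ` carrier K"
  and K_minus_image: "K_minus K G = (\<lambda>k. ((\<one>\<^bsub>K\<^esub>, k), \<one>\<^bsub>G\<^esub>)) ` carrier K"
  unfolding K_plus_def K_minus_def by blast+

lemma exact_broken:
  fixes K :: "('k, 'm) monoid_scheme" and G :: "('g, 'n) monoid_scheme"
  assumes K: "group K" and G: "group G" and m: "mspt K G C \<alpha> (\<lambda>_ _. 1)"
    and \<alpha>: "\<alpha> \<in> cocycles2 K" and nt: "\<alpha> \<notin> coboundaries2 K"
  shows "exact_broken_without_diagonal K G C"
proof -
  interpret K: group K by (rule K)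
  interpret G: group G by (rule G)
  have u: "cmod (\<alpha> \<one>\<^bsub>K\<^esub> \<one>\<^bsub>K\<^esub>) = 1" using \<alpha> by (simp add: cocycles2_def)
  \<comment> \<open>The restrictions of the cocycle to the two copies are \<alpha> and its
    conjugate, each times a constant phase.\<close>
  have nt1: "(\<lambda>k l. \<alpha> k l * cnj (\<alpha> \<one>\<^bsub>K\<^esub> \<one>\<^bsub>K\<^esub>)) \<notin> coboundaries2 K"
    using coboundaries2_scale[OF K, of "cnj (\<alpha> \<one>\<^bsub>K\<^esub> \<one>\<^bsub>K\<^esub>)" \<alpha>] u nt by auto
  have nt2: "(\<lambda>k l. \<alpha> \<one>\<^bsub>K\<^esub> \<one>\<^bsub>K\<^esub> * cnj (\<alpha> k l)) \<notin> coboundaries2 K"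
  proof
    assume "(\<lambda>k l. \<alpha> \<one>\<^bsub>K\<^esub> \<one>\<^bsub>K\<^esub> * cnj (\<alpha> k l)) \<in> coboundaries2 K"
    then have "(\<lambda>k l. cnj (\<alpha> k l) * \<alpha> \<one>\<^bsub>K\<^esub> \<one>\<^bsub>K\<^esub>) \<in> coboundaries2 K" by (simp only: mult.commute)
    from coboundaries2_scale[OF K u this] show False using coboundaries2_cnj nt by blast
  qed
  show ?thesis
    unfolding exact_broken_without_diagonal_def K_plus_image K_minus_image
  proof (intro conjI)
    let ?\<omega> = "mspt_cocycle \<alpha> (\<lambda>_ _. 1)"
    have sym: "?\<omega> ((k, \<one>\<^bsub>K\<^esub>), \<one>\<^bsub>G\<^esub>) ((\<one>\<^bsub>K\<^esub>, l), \<one>\<^bsub>G\<^esub>) = ?\<omega> ((\<one>\<^bsub>K\<^esub>, l), \<one>\<^bsub>G\<^esub>) ((k, \<one>\<^bsub>K\<^esub>), \<one>\<^bsub>G\<^esub>)"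
      if "k \<in> carrier K" "l \<in> carrier K" for k l
      unfolding mspt_cocycle_def prod.case cocycle_ones[OF K \<alpha> that(1)] cocycle_ones[OF K \<alpha> that(2)] ..
    show "boundary_order C (\<lambda>L B. charged C L ((\<lambda>k. ((k, \<one>\<^bsub>K\<^esub>), \<one>\<^bsub>G\<^esub>)) ` carrier K) B \<and>
        neutral C L ((\<lambda>k. ((\<one>\<^bsub>K\<^esub>, k), \<one>\<^bsub>G\<^esub>)) ` carrier K) B \<and> charged C L (K_diag K G) B)"
    proof (rule exact_order_subgroup[OF K G m \<alpha>])
      show "(\<lambda>k l. ?\<omega> ((k, \<one>\<^bsub>K\<^esub>), \<one>\<^bsub>G\<^esub>) ((l, \<one>\<^bsub>K\<^esub>), \<one>\<^bsub>G\<^esub>)) \<notin> coboundaries2 K"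
        using nt1 by (simp add: mspt_cocycle_def)
    qed (simp_all add: sym)
    show "boundary_order C (\<lambda>L B. charged C L ((\<lambda>k. ((\<one>\<^bsub>K\<^esub>, k), \<one>\<^bsub>G\<^esub>)) ` carrier K) B \<and>
        neutral C L ((\<lambda>k. ((k, \<one>\<^bsub>K\<^esub>), \<one>\<^bsub>G\<^esub>)) ` carrier K) B \<and> charged C L (K_diag K G) B)"
    proof (rule exact_order_subgroup[OF K G m \<alpha>])
      show "(\<lambda>k l. ?\<omega> ((\<one>\<^bsub>K\<^esub>, k), \<one>\<^bsub>G\<^esub>) ((\<one>\<^bsub>K\<^esub>, l), \<one>\<^bsub>G\<^esub>)) \<notin> coboundaries2 K"
        using nt2 by (simp add: mspt_cocycle_def)
    qed (simp_all add: sym)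
  qed
qed

text \<open>If \<open>k\<close> has a nontrivial commutator with some \<open>y\<close> in the
  cocycle, the edge operator of \<open>y\<close> in the first copy is charged under
  \<open>k\<close>. Commutativity of \<open>K\<close> is what makes this charge a number.\<close>

lemma exact_center:
  fixes K :: "('k, 'm) monoid_scheme" and G :: "('g, 'n) monoid_scheme"
  assumes K: "group K" and G: "group G" and m: "mspt K G C \<alpha> (\<lambda>_ _. 1)"
    and \<alpha>: "\<alpha> \<in> cocycles2 K" and c: "comm_group K"
  shows "unbroken_K K G C \<subseteq> projective_center K \<alpha>"
proof
  interpret K: comm_group K by (rule c)
  interpret G: group G by (rule G)
  fix k assume k: "k \<in> unbroken_K K G C"
  then have kc: "k \<in> carrier K" by (simp add: unbroken_K_def)
  show "k \<in> projective_center K \<alpha>"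
  proof (rule ccontr)
    assume "k \<notin> projective_center K \<alpha>"
    then obtain y where y: "y \<in> carrier K" "\<alpha> k y \<noteq> \<alpha> y k" using kc by (auto simp: projective_center_def)
    have a1: "cmod (\<alpha> k l) = 1" if "k \<in> carrier K" "l \<in> carrier K" for k l
      using \<alpha> that by (simp add: cocycles2_def)
    then have n: "\<alpha> k l \<noteq> 0" if "k \<in> carrier K" "l \<in> carrier K" for k l using that by fastforce
    have "element_broken C ((k, \<one>\<^bsub>K\<^esub>), \<one>\<^bsub>G\<^esub>)"
      unfolding element_broken_def
    proof (rule boundary_order_mono[OF commutator_order[OF K G m \<alpha> one_H1, of "((y, \<one>\<^bsub>K\<^esub>), \<one>\<^bsub>G\<^esub>)"]])
      show "((y, \<one>\<^bsub>K\<^esub>), \<one>\<^bsub>G\<^esub>) \<in> carrier ((K \<times>\<times> K) \<times>\<times> G)" using y by simp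
      let ?H = "(K \<times>\<times> K) \<times>\<times> G" and ?\<omega> = "mspt_cocycle \<alpha> (\<lambda>_ _. 1)"
      let ?x = "((k, \<one>\<^bsub>K\<^esub>), \<one>\<^bsub>G\<^esub>)" and ?y = "((y, \<one>\<^bsub>K\<^esub>), \<one>\<^bsub>G\<^esub>)"
      fix L B assume "B \<in> ops (dbasis C L) \<and> B \<noteq> (\<lambda>s t. 0) \<and>
        (\<exists>f\<in>{\<lambda>x. ?\<omega> ?y x / ?\<omega> x ?y, \<lambda>x. ?\<omega> x ?y / ?\<omega> ?y x}.
          \<forall>x\<in>carrier ?H. x \<otimes>\<^bsub>?H\<^esub> ?y = ?y \<otimes>\<^bsub>?H\<^esub> x \<longrightarrow> conj_sym C L x B = scale_op (f x) B)"
      then obtain f where f: "f = (\<lambda>x. ?\<omega> ?y x / ?\<omega> x ?y) \<or> f = (\<lambda>x. ?\<omega> x ?y / ?\<omega> ?y x)"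
        "\<And>x. x \<in> carrier ?H \<Longrightarrow> x \<otimes>\<^bsub>?H\<^esub> ?y = ?y \<otimes>\<^bsub>?H\<^esub> x \<Longrightarrow> conj_sym C L x B = scale_op (f x) B" by blast
      have "f ?x \<noteq> 1" using f(1) y kc n[of k y] n[of y k] n[of "\<one>\<^bsub>K\<^esub>" "\<one>\<^bsub>K\<^esub>"] by (auto simp: mspt_cocycle_def)
      moreover have "conj_sym C L ?x B = scale_op (f ?x) B"
        by (rule f(2)) (use y kc K.m_comm[of k y] in auto)
      ultimately show "\<exists>z. z \<noteq> 1 \<and> conj_sym C L ?x B = scale_op z B" by blast
    qed
    then show False using k by (simp add: unbroken_K_def)
  qed
qed

text \<open>The same commutator is used from both sides. The edge operator of a domain wall
  \<open>g\<close> has charges \<chi> and conjugate \<chi> under the two copies of \<open>K\<close>,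
  which cancel on the diagonal; the edge operator of \<open>k\<close> in the first copy has charge
  \<chi> under \<open>G\<close>.\<close>

lemma joint_broken:
  fixes K :: "('k, 'm) monoid_scheme" and G :: "('g, 'n) monoid_scheme"
  assumes K: "group K" and G: "group G" and m: "mspt K G C (\<lambda>_ _. 1) \<chi>"
    and \<chi>: "\<chi> \<in> H1_of_characters K G" and nt: "nontrivial_H1 K G \<chi>"
  shows "exact_broken_to_diagonal K G C" "average_broken K G C"
proof -
  interpret K: group K by (rule K)
  interpret G: group G by (rule G)
  note ones = H1_ones[OF K G \<chi>]
  let ?H = "(K \<times>\<times> K) \<times>\<times> G" and ?\<omega> = "mspt_cocycle (\<lambda>_ _. 1) \<chi>"
  obtain g k where gk: "g \<in> carrier G" "k \<in> carrier K" "\<chi> g k \<noteq> 1" using nt unfolding nontrivial_H1_def by blast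
  have unit: "cmod (\<chi> g k) = 1" if "g \<in> carrier G" "k \<in> carrier K" for g k
    using \<chi> that by (simp add: H1_of_characters_def)
  have cu: "\<chi> g k * cnj (\<chi> g k) = 1" if "g \<in> carrier G" "k \<in> carrier K" for g k
    unfolding complex_norm_square[symmetric] unit[OF that] by simp
  have cn: "cnj (\<chi> g k) \<noteq> 1" using gk(3) by (metis complex_cnj_cnj complex_cnj_one)
  show "exact_broken_to_diagonal K G C"
    unfolding exact_broken_to_diagonal_def
  proof (rule boundary_order_mono[OF commutator_order[OF K G m one_cocycle \<chi>, of "((\<one>\<^bsub>K\<^esub>, \<one>\<^bsub>K\<^esub>), g)"]])
    let ?y = "((\<one>\<^bsub>K\<^esub>, \<one>\<^bsub>K\<^esub>), g)"
    show "?y \<in> carrier ?H" using gk by simp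
    fix L B assume B: "B \<in> ops (dbasis C L) \<and> B \<noteq> (\<lambda>s t. 0) \<and>
      (\<exists>f\<in>{\<lambda>x. ?\<omega> ?y x / ?\<omega> x ?y, \<lambda>x. ?\<omega> x ?y / ?\<omega> ?y x}.
        \<forall>x\<in>carrier ?H. x \<otimes>\<^bsub>?H\<^esub> ?y = ?y \<otimes>\<^bsub>?H\<^esub> x \<longrightarrow> conj_sym C L x B = scale_op (f x) B)"
    then obtain f where f: "f = (\<lambda>x. ?\<omega> ?y x / ?\<omega> x ?y) \<or> f = (\<lambda>x. ?\<omega> x ?y / ?\<omega> ?y x)"
      "\<And>x. x \<in> carrier ?H \<Longrightarrow> x \<otimes>\<^bsub>?H\<^esub> ?y = ?y \<otimes>\<^bsub>?H\<^esub> x \<Longrightarrow> conj_sym C L x B = scale_op (f x) B" by blast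
    have B2: "B \<in> ops (dbasis C L)" "B \<noteq> (\<lambda>s t. 0)" using B by blast+
    have p: "conj_sym C L x B = scale_op (f x) B" if "x \<in> K_plus K G \<or> x \<in> K_minus K G \<or> x \<in> K_diag K G" for x
      by (rule f(2)) (use that gk in \<open>auto simp: K_plus_def K_minus_def K_diag_def\<close>)
    interpret family K G C L by (rule mspt_family[OF K G m])
    show "charged C L (K_plus K G) B \<and> charged C L (K_minus K G) B \<and> neutral C L (K_diag K G) B"
    proof (intro conjI)
      show "charged C L (K_plus K G) B"
      proof (rule charged_character[OF B2, of _ f])
        show "CS x B = scale_op (f x) B" if "x \<in> K_plus K G" for x using p that by blast
        show "\<exists>x\<in>K_plus K G. f x \<noteq> 1"
          by (rule bexI[of _ "((k, \<one>\<^bsub>K\<^esub>), \<one>\<^bsub>G\<^esub>)"])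
            (use f(1) gk ones in \<open>auto simp: K_plus_def mspt_cocycle_def divide_eq_eq\<close>)
      qed
      show "charged C L (K_minus K G) B"
      proof (rule charged_character[OF B2, of _ f])
        show "CS x B = scale_op (f x) B" if "x \<in> K_minus K G" for x using p that by blast
        show "\<exists>x\<in>K_minus K G. f x \<noteq> 1"
          by (rule bexI[of _ "((\<one>\<^bsub>K\<^esub>, k), \<one>\<^bsub>G\<^esub>)"])
            (use f(1) gk cn ones in \<open>auto simp: K_minus_def mspt_cocycle_def divide_eq_eq\<close>)
      qed
      have "f x = 1" if "x \<in> K_diag K G" for x
        using f(1) gk that ones cu by (auto simp: K_diag_def mspt_cocycle_def)
      then show "neutral C L (K_diag K G) B"
        unfolding neutral_def using p by (simp add: scale_op_def)
    qed
  qed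
  show "average_broken K G C"
    unfolding average_broken_def
  proof (rule boundary_order_mono[OF commutator_order[OF K G m one_cocycle \<chi>, of "((k, \<one>\<^bsub>K\<^esub>), \<one>\<^bsub>G\<^esub>)"]])
    let ?y = "((k, \<one>\<^bsub>K\<^esub>), \<one>\<^bsub>G\<^esub>)"
    show "?y \<in> carrier ?H" using gk by simp
    fix L B assume B: "B \<in> ops (dbasis C L) \<and> B \<noteq> (\<lambda>s t. 0) \<and>
      (\<exists>f\<in>{\<lambda>x. ?\<omega> ?y x / ?\<omega> x ?y, \<lambda>x. ?\<omega> x ?y / ?\<omega> ?y x}.
        \<forall>x\<in>carrier ?H. x \<otimes>\<^bsub>?H\<^esub> ?y = ?y \<otimes>\<^bsub>?H\<^esub> x \<longrightarrow> conj_sym C L x B = scale_op (f x) B)"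
    then obtain f where f: "f = (\<lambda>x. ?\<omega> ?y x / ?\<omega> x ?y) \<or> f = (\<lambda>x. ?\<omega> x ?y / ?\<omega> ?y x)"
      "\<And>x. x \<in> carrier ?H \<Longrightarrow> x \<otimes>\<^bsub>?H\<^esub> ?y = ?y \<otimes>\<^bsub>?H\<^esub> x \<Longrightarrow> conj_sym C L x B = scale_op (f x) B" by blast
    have B2: "B \<in> ops (dbasis C L)" "B \<noteq> (\<lambda>s t. 0)" using B by blast+
    have p: "conj_sym C L x B = scale_op (f x) B" if "x \<in> G_average K G" for x
      by (rule f(2)) (use that gk in \<open>auto simp: G_average_def\<close>)
    interpret family K G C L by (rule mspt_family[OF K G m])
    show "charged C L (G_average K G) B"
    proof (rule charged_character[OF B2, of _ f])
      show "CS x B = scale_op (f x) B" if "x \<in> G_average K G" for x by (rule p[OF that])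
      show "\<exists>x\<in>G_average K G. f x \<noteq> 1"
        by (rule bexI[of _ "((\<one>\<^bsub>K\<^esub>, \<one>\<^bsub>K\<^esub>), g)"])
          (use f(1) gk ones in \<open>auto simp: G_average_def mspt_cocycle_def divide_eq_eq\<close>)
    qed
  qed
qed

text \<open>On the first copy of \<open>K\<close> together with \<open>G\<close> the cocycle is the
  pairing by \<chi>; a pair outside its projective center is detected by the edge operator of the
  element it fails to commute with.\<close>

lemma joint_center:
  fixes K :: "('k, 'm) monoid_scheme" and G :: "('g, 'n) monoid_scheme"
  assumes K: "group K" and G: "group G" and m: "mspt K G C (\<lambda>_ _. 1) \<chi>"
    and \<chi>: "\<chi> \<in> H1_of_characters K G" and c: "comm_group (K \<times>\<times> G)"
  shows "unbroken_KG K G C \<subseteq> projective_center (K \<times>\<times> G) (\<lambda>(k, g) (k', g'). \<chi> g' k)"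
proof
  interpret K: group K by (rule K)
  interpret G: group G by (rule G)
  note ones = H1_ones[OF K G \<chi>]
  let ?H = "(K \<times>\<times> K) \<times>\<times> G" and ?\<omega> = "mspt_cocycle (\<lambda>_ _. 1) \<chi>"
  fix kg assume kg0: "kg \<in> unbroken_KG K G C"
  obtain k g where kg: "kg = (k, g)" by (cases kg)
  have kc: "k \<in> carrier K" "g \<in> carrier G" using kg0 by (auto simp: unbroken_KG_def kg)
  show "kg \<in> projective_center (K \<times>\<times> G) (\<lambda>(k, g) (k', g'). \<chi> g' k)"
  proof (rule ccontr)
    assume "kg \<notin> projective_center (K \<times>\<times> G) (\<lambda>(k, g) (k', g'). \<chi> g' k)"
    then obtain k' g' where y: "k' \<in> carrier K" "g' \<in> carrier G" "\<chi> g' k \<noteq> \<chi> g k'"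
      using kc by (auto simp: projective_center_def kg)
    have cm: "k \<otimes>\<^bsub>K\<^esub> k' = k' \<otimes>\<^bsub>K\<^esub> k" "g \<otimes>\<^bsub>G\<^esub> g' = g' \<otimes>\<^bsub>G\<^esub> g"
      using comm_groupE(4)[OF c, of "(k, g)" "(k', g')"] kc y by auto
    let ?x = "((k, \<one>\<^bsub>K\<^esub>), g)" and ?y = "((k', \<one>\<^bsub>K\<^esub>), g')"
    have "element_broken C ?x"
      unfolding element_broken_def
    proof (rule boundary_order_mono[OF commutator_order[OF K G m one_cocycle \<chi>, of ?y]])
      show "?y \<in> carrier ?H" using y by simp
      fix L B assume "B \<in> ops (dbasis C L) \<and> B \<noteq> (\<lambda>s t. 0) \<and>
        (\<exists>f\<in>{\<lambda>x. ?\<omega> ?y x / ?\<omega> x ?y, \<lambda>x. ?\<omega> x ?y / ?\<omega> ?y x}.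
          \<forall>x\<in>carrier ?H. x \<otimes>\<^bsub>?H\<^esub> ?y = ?y \<otimes>\<^bsub>?H\<^esub> x \<longrightarrow> conj_sym C L x B = scale_op (f x) B)"
      then obtain f where f: "f = (\<lambda>x. ?\<omega> ?y x / ?\<omega> x ?y) \<or> f = (\<lambda>x. ?\<omega> x ?y / ?\<omega> ?y x)"
        "\<And>x. x \<in> carrier ?H \<Longrightarrow> x \<otimes>\<^bsub>?H\<^esub> ?y = ?y \<otimes>\<^bsub>?H\<^esub> x \<Longrightarrow> conj_sym C L x B = scale_op (f x) B" by blast
      have "f ?x \<noteq> 1" using f(1) y kc ones by (auto simp: mspt_cocycle_def divide_eq_eq)
      moreover have "conj_sym C L ?x B = scale_op (f ?x) B"
        by (rule f(2)) (use y kc cm in auto)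
      ultimately show "\<exists>z. z \<noteq> 1 \<and> conj_sym C L ?x B = scale_op z B" by blast
    qed
    then show False using kg0 by (simp add: unbroken_KG_def kg)
  qed
qed

section \<open>Irreducible projective representations\<close>

locale finite_comm_group = A: comm_group A for A :: "('x, 'm) monoid_scheme" +
  assumes fin: "finite (carrier A)"
begin

sublocale fin_basis "carrier A"
  by unfold_locales (rule fin)

abbreviation mula (infixl "\<odot>" 70) where "S \<odot> T \<equiv> times_op (carrier A) S T"
abbreviation appa (infixr "\<triangleright>" 65) where "S \<triangleright> v \<equiv> app_op (carrier A) S v"

text \<open>The regular representation twisted by \<open>a\<close> contains an irreducible subspace,
  and its matrices in an orthonormal basis of that subspace are the required unitaries. For
  commutative \<open>A\<close>, an element of the projective center commutes with the whole
  representation, so Schur's lemma makes it a scalar.\<close>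

lemma irreducible_projective_rep:
  assumes a: "a \<in> cocycles2 A"
  obtains n V where "(0 :: nat) < n" "\<And>x. x \<in> carrier A \<Longrightarrow> unitary_op {..<n} (V x)"
    "\<And>x y. x \<in> carrier A \<Longrightarrow> y \<in> carrier A \<Longrightarrow>
       times_op {..<n} (V x) (V y) = scale_op (a x y) (V (x \<otimes>\<^bsub>A\<^esub> y))"
    "\<And>x. x \<in> projective_center A a \<Longrightarrow> \<exists>z. V x = scale_op z (one_op {..<n})"
proof -
  let ?X = "carrier A"
  have unit: "cmod (a x y) = 1" if "x \<in> ?X" "y \<in> ?X" for x y using a that by (simp add: cocycles2_def)
  then have n0: "a x y \<noteq> 0" if "x \<in> ?X" "y \<in> ?X" for x y using that by fastforce
  have cc: "a x y * cnj (a x y) = 1" "cnj (a x y) * a x y = 1" if "x \<in> ?X" "y \<in> ?X" for x y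
    using unit[OF that] by (simp_all add: complex_norm_square[symmetric] mult.commute[of "cnj _"])
  have coc: "a x y * a (x \<otimes>\<^bsub>A\<^esub> y) z = a y z * a x (y \<otimes>\<^bsub>A\<^esub> z)"
    if "x \<in> ?X" "y \<in> ?X" "z \<in> ?X" for x y z using a that by (simp add: cocycles2_def)
  \<comment> \<open>Left translation twisted by the cocycle: the basis vector of \<open>t\<close>
    goes to \<open>a x t\<close> times that of the product of \<open>x\<close> and
    \<open>t\<close>.\<close>
  define R where "R x = (\<lambda>u t. if t \<in> ?X \<and> u = x \<otimes>\<^bsub>A\<^esub> t then a x t else 0)" for x
  have scale_scale: "scale_op z (scale_op w T) = scale_op (z * w) T" for z w and T :: "'x op"
    unfolding scale_op_def mult.assoc ..
  have R_ops: "R x \<in> ops ?X" if "x \<in> ?X" for x using that by (auto simp: R_def ops_def)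
  have R_mult: "R x \<odot> R y = scale_op (a x y) (R (x \<otimes>\<^bsub>A\<^esub> y))" if xy: "x \<in> ?X" "y \<in> ?X" for x y
  proof (intro ext)
    fix u t
    show "(R x \<odot> R y) u t = scale_op (a x y) (R (x \<otimes>\<^bsub>A\<^esub> y)) u t"
    proof (cases "t \<in> ?X")
      case True
      have "(R x \<odot> R y) u t = (\<Sum>r\<in>?X. if r = y \<otimes>\<^bsub>A\<^esub> t then R x u r * a y t else 0)"
        unfolding times_op_def by (rule sum.cong) (auto simp: R_def True)
      also have "\<dots> = R x u (y \<otimes>\<^bsub>A\<^esub> t) * a y t" using xy True fin by simp
      also have "\<dots> = scale_op (a x y) (R (x \<otimes>\<^bsub>A\<^esub> y)) u t"
        using xy True coc[OF xy True] by (simp add: R_def scale_op_def A.m_assoc mult.commute)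
      finally show ?thesis .
    qed (simp add: times_op_def R_def scale_op_def)
  qed
  have R_one: "R \<one>\<^bsub>A\<^esub> = scale_op (a \<one>\<^bsub>A\<^esub> \<one>\<^bsub>A\<^esub>) (one_op ?X)"
    by (auto simp: R_def scale_op_def one_op_def fun_eq_iff intro: cocycle_ones(2)[OF A.is_group a])
  have R_unit1: "adj_op (R x) \<odot> R x = one_op ?X" if x: "x \<in> ?X" for x
  proof (intro ext)
    fix u t
    show "(adj_op (R x) \<odot> R x) u t = one_op ?X u t"
    proof (cases "u \<in> ?X \<and> t \<in> ?X")
      case True
      have "(adj_op (R x) \<odot> R x) u t = (\<Sum>r\<in>?X. if r = x \<otimes>\<^bsub>A\<^esub> t then adj_op (R x) u r * a x t else 0)"
        unfolding times_op_def by (rule sum.cong) (auto simp: R_def True)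
      also have "\<dots> = adj_op (R x) u (x \<otimes>\<^bsub>A\<^esub> t) * a x t" using x True fin by simp
      also have "\<dots> = one_op ?X u t" using x True cc by (auto simp: adj_op_def R_def one_op_def)
      finally show ?thesis .
    qed (auto simp: times_op_def R_def adj_op_def one_op_def)
  qed
  define \<kappa> where "\<kappa> x = a x (inv\<^bsub>A\<^esub> x) * a \<one>\<^bsub>A\<^esub> \<one>\<^bsub>A\<^esub>" for x
  have \<kappa>0: "\<kappa> x \<noteq> 0" if "x \<in> ?X" for x using n0 that by (simp add: \<kappa>_def)
  have R_inv: "R x \<odot> R (inv\<^bsub>A\<^esub> x) = scale_op (\<kappa> x) (one_op ?X)" if x: "x \<in> ?X" for x
    unfolding R_mult[OF x A.inv_closed[OF x]] A.r_inv[OF x] R_one scale_scale \<kappa>_def ..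
  have R_adj: "R (inv\<^bsub>A\<^esub> x) = scale_op (\<kappa> x) (adj_op (R x))" if x: "x \<in> ?X" for x
  proof -
    have "R (inv\<^bsub>A\<^esub> x) = adj_op (R x) \<odot> R x \<odot> R (inv\<^bsub>A\<^esub> x)"
      unfolding R_unit1[OF x] using R_ops x by simp
    also have "\<dots> = adj_op (R x) \<odot> scale_op (\<kappa> x) (one_op ?X)" unfolding times_assoc R_inv[OF x] ..
    also have "\<dots> = scale_op (\<kappa> x) (adj_op (R x) \<odot> one_op ?X)"
      by (simp add: times_op_def scale_op_def sum_distrib_left mult_ac)
    finally show ?thesis using R_ops x by simp
  qed
  have R_adj': "adj_op (R x) \<triangleright> v = (\<lambda>s. 1 / \<kappa> x * (R (inv\<^bsub>A\<^esub> x) \<triangleright> v) s)" if x: "x \<in> ?X" for x v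
    unfolding R_adj[OF x] using \<kappa>0[OF x] by (simp add: app_op_def scale_op_def sum_distrib_left mult.assoc)
  define \<Phi> where "\<Phi> = (\<lambda>x. app_op ?X (R x)) ` ?X"
  \<comment> \<open>The starting vector is the basis vector of the neutral element and the
    functional is evaluation there; the lower bound serves only to make the subspace
    nonzero.\<close>
  have "\<exists>W B'. irreducible_under ?X \<Phi> W \<and> W \<subseteq> vecs ?X \<and> B' \<in> W \<and> 1 / 2 ^ card ?X \<le> cmod (B' \<one>\<^bsub>A\<^esub>) \<and>
     nsq ?X B' \<le> nsq ?X (\<lambda>s. if s = \<one>\<^bsub>A\<^esub> then 1 else 0) \<and>
     (\<forall>w\<in>W. inn w (\<lambda>s. (if s = \<one>\<^bsub>A\<^esub> then 1 else 0) - B' s) = 0)"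
  proof (rule irreducible_component[where f = "\<lambda>u. u \<one>\<^bsub>A\<^esub>", OF fin vsub_vecs])
    show "\<forall>\<phi>\<in>\<Phi>. \<phi> ` vecs ?X \<subseteq> vecs ?X" using R_ops by (auto simp: \<Phi>_def)
    show "\<forall>\<phi>\<in>\<Phi>. \<exists>\<phi>'\<in>\<Phi>. \<exists>\<kappa>. \<forall>u\<in>vecs ?X. \<forall>w\<in>vecs ?X. inn (\<phi> u) w = \<kappa> * inn u (\<phi>' w)"
    proof
      fix \<phi> assume "\<phi> \<in> \<Phi>"
      then obtain x where x: "x \<in> ?X" "\<phi> = app_op ?X (R x)" unfolding \<Phi>_def by blast
      have "inn (\<phi> u) w = 1 / \<kappa> x * inn u (R (inv\<^bsub>A\<^esub> x) \<triangleright> w)" for u w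
      proof -
        have "inn (\<phi> u) w = inn u (adj_op (R x) \<triangleright> w)" unfolding x inner_adj adj_adj ..
        then show ?thesis unfolding R_adj'[OF x(1)] inner_scale_right .
      qed
      moreover have "app_op ?X (R (inv\<^bsub>A\<^esub> x)) \<in> \<Phi>" using x by (simp add: \<Phi>_def)
      ultimately show "\<exists>\<phi>'\<in>\<Phi>. \<exists>\<kappa>. \<forall>u\<in>vecs ?X. \<forall>w\<in>vecs ?X. inn (\<phi> u) w = \<kappa> * inn u (\<phi>' w)" by blast
    qed
    show "rank_le ?X (vecs ?X) (card ?X)" by (rule rank_le_vecs[OF fin]) simp
    show "(\<lambda>s. if s = \<one>\<^bsub>A\<^esub> then 1 else 0) \<in> vecs ?X" by (auto simp: vecs_def)
  qed simp_all
  then obtain W B' where W: "irreducible_under ?X \<Phi> W" "B' \<in> W" "1 / 2 ^ card ?X \<le> cmod (B' \<one>\<^bsub>A\<^esub>)" by blast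
  have "(0::real) < 1 / 2 ^ card ?X" by simp
  also note W(3)
  finally have "B' \<one>\<^bsub>A\<^esub> \<noteq> 0" by simp
  then have W0: "W \<noteq> {\<lambda>s. 0}" using W(2) by auto
  have WV: "vsub ?X W" using W(1) by (simp add: irreducible_under_def)
  have Winv: "R x \<triangleright> w \<in> W" if "x \<in> ?X" "w \<in> W" for x w
    using W(1) that by (auto simp: irreducible_under_def \<Phi>_def)
  have Wadj: "adj_op (R x) \<triangleright> w \<in> W" if "x \<in> ?X" "w \<in> W" for x w
    unfolding R_adj'[OF that(1)] using vsubD(3)[OF WV Winv[OF A.inv_closed[OF that(1)] that(2)] Winv[OF A.inv_closed[OF that(1)] that(2)], of "1 / \<kappa> x" 0]
    by simp
  obtain E where E: "orthonormal ?X E" "finite E" "E \<subseteq> W" "\<And>u. u \<in> W \<Longrightarrow> proj ?X E u = u"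
    using obtain_onb[OF fin WV] by blast
  define n where "n = card E"
  obtain e where e: "bij_betw e {..<n} E"
    using ex_bij_betw_nat_finite[OF E(2)] by (auto simp: n_def lessThan_atLeast0)
  have eW: "e i \<in> W" if "i < n" for i using bij_betwE[OF e] E(3) that by auto
  have eo: "inn (e i) (e j) = (if i = j then 1 else 0)" if "i < n" "j < n" for i j
    using E(1) bij_betwE[OF e] bij_betw_imp_inj_on[OF e] that by (auto simp: orthonormal_def inj_on_def)
  have ep: "(\<lambda>s. \<Sum>i<n. inn (e i) u * e i s) = u" if "u \<in> W" for u
  proof -
    have "(\<Sum>i<n. inn (e i) u * e i s) = proj ?X E u s" for s
      unfolding proj_def by (rule sum.reindex_bij_betw[OF e])
    then show ?thesis using E(4)[OF that] by simp
  qed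
  have n: "0 < n"
  proof (rule ccontr)
    assume "\<not> 0 < n"
    then have "B' = (\<lambda>s. 0)" using ep[OF W(2)] by simp
    then show False using \<open>B' \<one>\<^bsub>A\<^esub> \<noteq> 0\<close> by simp
  qed
  \<comment> \<open>Matrix elements in the orthonormal basis of \<open>W\<close>. Multiplicativity
    in \<open>M_times\<close> needs only the right factor to preserve \<open>W\<close>.\<close>
  define M where "M T = (\<lambda>i j. if i < n \<and> j < n then inn (e i) (T \<triangleright> e j) else 0)" for T
  have M_ops: "M T \<in> ops {..<n}" for T by (auto simp: M_def ops_def)
  have M_times: "times_op {..<n} (M S) (M T) = M (S \<odot> T)" if T: "\<And>w. w \<in> W \<Longrightarrow> T \<triangleright> w \<in> W" for S T
  proof (intro ext)
    fix i j
    show "times_op {..<n} (M S) (M T) i j = M (S \<odot> T) i j"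
    proof (cases "i < n \<and> j < n")
      case True
      have "S \<triangleright> T \<triangleright> e j = (\<lambda>s. \<Sum>m<n. inn (e m) (T \<triangleright> e j) * (S \<triangleright> e m) s)"
        unfolding app_sum[symmetric] using ep[OF T[OF eW]] True by simp
      then have "inn (e i) ((S \<odot> T) \<triangleright> e j) = (\<Sum>m<n. inn (e m) (T \<triangleright> e j) * inn (e i) (S \<triangleright> e m))"
        unfolding app_times by (simp only: inner_sum_right)
      then show ?thesis using True by (simp add: M_def times_op_def mult.commute)
    qed (auto simp: M_def times_op_def)
  qed
  have M_adj: "adj_op (M T) = M (adj_op T)" for T
    by (auto simp: adj_op_def M_def fun_eq_iff inner_cnj inner_adj)
  have M_scalar: "M T = scale_op z (one_op {..<n})" if T: "\<And>w. w \<in> W \<Longrightarrow> T \<triangleright> w = (\<lambda>s. z * w s)" for T z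
  proof -
    have "inn (e i) (T \<triangleright> e j) = z * (if i = j then 1 else 0)" if "i < n" "j < n" for i j
      unfolding T[OF eW[OF that(2)]] inner_scale_right eo[OF that] ..
    then show ?thesis by (auto simp: M_def scale_op_def one_op_def fun_eq_iff)
  qed
  have M_one: "M (one_op ?X) = one_op {..<n}"
  proof -
    have "one_op ?X \<triangleright> w = (\<lambda>s. 1 * w s)" if "w \<in> W" for w
      using WV that app_one[of w] by (auto simp: vsub_def)
    from M_scalar[OF this] show ?thesis by (simp add: scale_op_def)
  qed
  have R_unit2: "R x \<odot> adj_op (R x) = one_op ?X" if x: "x \<in> ?X" for x
  proof -
    have "scale_op (\<kappa> x) (R x \<odot> adj_op (R x)) = scale_op (\<kappa> x) (one_op ?X)"
      unfolding R_inv[OF x, symmetric] R_adj[OF x] by (simp add: times_op_def scale_op_def sum_distrib_left mult_ac)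
    then have "\<kappa> x * (R x \<odot> adj_op (R x)) s t = \<kappa> x * one_op ?X s t" for s t
      unfolding scale_op_def by meson
    then show ?thesis using \<kappa>0[OF x] by (intro ext) simp
  qed
  have M_unitary: "unitary_op {..<n} (M (R x))" if x: "x \<in> ?X" for x
    unfolding unitary_op_def M_adj
    by (simp add: M_ops M_times Winv[OF x] Wadj[OF x] R_unit1[OF x] R_unit2[OF x] M_one)
  have M_R_times: "times_op {..<n} (M (R x)) (M (R y)) = scale_op (a x y) (M (R (x \<otimes>\<^bsub>A\<^esub> y)))"
    if "x \<in> ?X" "y \<in> ?X" for x y
  proof -
    have "M (scale_op z T) = scale_op z (M T)" for z T
    proof -
      have "scale_op z T \<triangleright> v = (\<lambda>s. z * (T \<triangleright> v) s)" for v
        by (simp add: app_op_def scale_op_def sum_distrib_left mult.assoc)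
      then have "M (scale_op z T) i j = z * M T i j" for i j by (simp add: M_def inner_scale_right)
      then show ?thesis by (simp add: scale_op_def fun_eq_iff)
    qed
    then have scale: "M (scale_op (a x y) (R (x \<otimes>\<^bsub>A\<^esub> y))) = scale_op (a x y) (M (R (x \<otimes>\<^bsub>A\<^esub> y)))" .
    have "times_op {..<n} (M (R x)) (M (R y)) = M (R x \<odot> R y)"
      by (rule M_times) (rule Winv[OF that(2)])
    then show ?thesis unfolding R_mult[OF that] scale .
  qed
  \<comment> \<open>Commutativity of \<open>A\<close> and the symmetry of the cocycle at
    \<open>x\<close> are both used to exchange \<open>R x\<close> with every
    \<open>R y\<close>.\<close>
  have M_center: "\<exists>z. M (R x) = scale_op z (one_op {..<n})" if xc: "x \<in> projective_center A a" for x
  proof -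
    have x: "x \<in> ?X" "\<And>y. y \<in> ?X \<Longrightarrow> a x y = a y x" using xc by (auto simp: projective_center_def)
    have "\<exists>z. \<forall>u\<in>W. R x \<triangleright> u = (\<lambda>s. z * u s)"
    proof (rule schur[OF fin W(1) W0, of "app_op ?X (R x)"])
      show "R x \<triangleright> u \<in> W" if "u \<in> W" for u by (rule Winv[OF x(1) that])
      show "\<phi> (\<lambda>s. c * u s) = (\<lambda>s. c * \<phi> u s)" if "\<phi> \<in> \<Phi>" for \<phi> c u
        using that by (auto simp: \<Phi>_def app_scale)
      show "R x \<triangleright> \<phi> u = \<phi> (R x \<triangleright> u)" if f: "\<phi> \<in> \<Phi>" for \<phi> u
      proof -
        obtain y where y: "y \<in> ?X" "\<phi> = app_op ?X (R y)"
          using f unfolding \<Phi>_def by blast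
        show ?thesis unfolding y(2) app_times[symmetric] R_mult[OF x(1) y(1)] R_mult[OF y(1) x(1)] x(2)[OF y(1)]
          A.m_comm[OF x(1) y(1)] ..
      qed
      show "\<exists>z. \<forall>u\<in>W. R x \<triangleright> u = (\<lambda>s. z * u s)" if "\<And>u. u \<in> W \<Longrightarrow> R x \<triangleright> u = (\<lambda>s. c * u s)" for c
        using that by (intro exI ballI)
    qed (rule app_lin)
    then obtain z where "\<forall>u\<in>W. R x \<triangleright> u = (\<lambda>s. z * u s)" ..
    then have "M (R x) = scale_op z (one_op {..<n})" by (intro M_scalar) (erule bspec)
    then show ?thesis ..
  qed
  show ?thesis
    by (rule that[of n "\<lambda>x. M (R x)"], rule n, erule M_unitary, erule M_R_times, assumption, erule M_center)
qed

end

section \<open>A chain of maximally entangled bonds\<close>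

text \<open>
  A site of dimension \<open>n\<^sup>2\<close> holds a left and a right constituent, the remainder and the quotient of
  its label modulo \<open>n\<close>. Bond \<open>i\<close> joins the right constituent of site \<open>i\<close> to the left one of
  the next site; the last bond joins the two ends of the open chain.
\<close>

locale bond_chain =
  fixes L n :: nat
  assumes n: "0 < n"
begin

sublocale dchain L "\<lambda>_. n * n" .

sublocale b: fin_basis "{..<n}"
  by unfold_locales simp

abbreviation mulb (infixl "**" 70) where "A ** B \<equiv> times_op {..<n} A B"
abbreviation mulpb (infixl "\<otimes>\<otimes>" 70) where "A \<otimes>\<otimes> B \<equiv> times_op p.X A B"
abbreviation appp (infixr "\<rightharpoonup>" 65) where "A \<rightharpoonup> v \<equiv> app_op p.X A v"
abbreviation appb (infixr "\<triangleright>" 65) where "A \<triangleright> v \<equiv> app_op X A v"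

text \<open>\<open>A\<close> acts on the left constituent and \<open>B\<close> on the right one, in
  the encoding of a site label by remainder and quotient.\<close>

definition site :: "nat op \<Rightarrow> nat op \<Rightarrow> nat op" where
  "site A B = (\<lambda>p q. if p < n * n \<and> q < n * n then A (p mod n) (q mod n) * B (p div n) (q div n) else 0)"

lemma quot_less: "p < n * n \<Longrightarrow> p div n < n"
  by (rule less_mult_imp_div_less)

lemma rem_less: "p mod n < n"
  using n by simp

lemma code_less: "l < n \<Longrightarrow> r < n \<Longrightarrow> r * n + l < n * n"
  using mult_le_mono1[of "Suc r" n n] by simp

lemma site_times: "times_op {..<n * n} (site A B) (site A' B') = site (A ** A') (B ** B')"
proof (intro ext)
  fix p q
  show "times_op {..<n * n} (site A B) (site A' B') p q = site (A ** A') (B ** B') p q"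
  proof (cases "p < n * n \<and> q < n * n")
    case True
    have "times_op {..<n * n} (site A B) (site A' B') p q =
        (\<Sum>(x, y)\<in>{..<n} \<times> {..<n}. A (p mod n) x * B (p div n) y * (A' x (q mod n) * B' y (q div n)))"
      unfolding times_op_def
      by (rule sum.reindex_bij_witness[of _ "\<lambda>(x, y). y * n + x" "\<lambda>r. (r mod n, r div n)"])
        (use True in \<open>auto simp: site_def quot_less rem_less code_less\<close>)
    also have "\<dots> = (\<Sum>x<n. \<Sum>y<n. A (p mod n) x * A' x (q mod n) * (B (p div n) y * B' y (q div n)))"
      unfolding sum.cartesian_product[symmetric] by (simp add: mult_ac)
    also have "\<dots> = site (A ** A') (B ** B') p q"
      unfolding sum_product[symmetric] using True by (simp add: site_def times_op_def)
    finally show ?thesis .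
  qed (auto simp: site_def times_op_def)
qed

lemma site_adj: "adj_op (site A B) = site (adj_op A) (adj_op B)"
  by (auto simp: adj_op_def site_def fun_eq_iff)

lemma site_one: "site (one_op {..<n}) (one_op {..<n}) = one_op {..<n * n}"
proof (intro ext)
  fix p q
  have "p mod n = q mod n \<Longrightarrow> p div n = q div n \<Longrightarrow> p = q" by (metis div_mult_mod_eq)
  then show "site (one_op {..<n}) (one_op {..<n}) p q = one_op {..<n * n} p q"
    by (auto simp: site_def one_op_def quot_less rem_less)
qed

lemma site_unitary:
  assumes "unitary_op {..<n} A" "unitary_op {..<n} B"
  shows "unitary_op {..<n * n} (site A B)"
  using assms unfolding unitary_op_def
  by (auto simp: site_adj site_times site_one) (auto simp: ops_def site_def)

section \<open>Bond states and onsite actions on them\<close>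

definition cj :: "nat op \<Rightarrow> nat op" where
  "cj A = (\<lambda>p q. cnj (A p q))"

definition tr :: "nat op \<Rightarrow> nat op" where
  "tr A = (\<lambda>p q. A q p)"

lemma cj_ops: "A \<in> ops {..<n} \<Longrightarrow> cj A \<in> ops {..<n}"
  by (simp add: cj_def ops_def)

lemma cj_times: "cj (A ** B) = cj A ** cj B"
  by (simp add: cj_def times_op_def)

lemma cj_one: "cj (one_op {..<n}) = one_op {..<n}"
  by (auto simp: cj_def one_op_def fun_eq_iff)

lemma cj_adj: "adj_op (cj A) = cj (adj_op A)"
  by (simp add: cj_def adj_op_def)

lemma cj_unitary: "unitary_op {..<n} A \<Longrightarrow> unitary_op {..<n} (cj A)"
  unfolding unitary_op_def cj_adj by (simp add: cj_ops cj_times[symmetric] cj_one)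

lemma tr_cj: "tr (cj A) = adj_op A"
  by (simp add: tr_def cj_def adj_op_def)

lemma tr_one: "tr (one_op {..<n}) = one_op {..<n}"
  by (auto simp: tr_def one_op_def fun_eq_iff)

text \<open>Cyclic successor: the bonds form a ring, although the chain is open as far as locality
  is concerned.\<close>

definition nxt :: "nat \<Rightarrow> nat" where
  "nxt i = (if Suc i = L then 0 else Suc i)"

definition prv :: "nat \<Rightarrow> nat" where
  "prv i = (if i = 0 then L - 1 else i - 1)"

lemma nxt_less: "i < L \<Longrightarrow> nxt i < L"
  by (auto simp: nxt_def)

lemma prv_less: "i < L \<Longrightarrow> prv i < L"
  by (auto simp: prv_def)

lemma nxt_prv: "i < L \<Longrightarrow> nxt (prv i) = i" "i < L \<Longrightarrow> prv (nxt i) = i"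
  by (auto simp: nxt_def prv_def)

text \<open>The state in which bond \<open>i\<close> has the coefficient matrix \<open>M i\<close>,
  with rows for the right constituent of site \<open>i\<close> and columns for the left one of the
  next site.\<close>

definition bonds :: "(nat \<Rightarrow> nat op) \<Rightarrow> (nat \<Rightarrow> nat) \<Rightarrow> complex" where
  "bonds M s = (if s \<in> p.X then \<Prod>i<L. M i (s i div n) (s (nxt i) mod n) else 0)"

lemma bonds_vecs [simp]: "bonds M \<in> vecs p.X"
  by (auto simp: bonds_def vecs_def)

lemma p_mem: "s \<in> p.X \<longleftrightarrow> s \<in> extensional {..<L} \<and> (\<forall>i<L. s i < n * n)"
  by (auto simp: p.configs_mem phys_def)

text \<open>The constituents are regrouped from sites to bonds, a bijection of configurations after
  which the sum factors.\<close>

lemma sum_bonds: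
  "(\<Sum>t\<in>p.X. \<Prod>i<L. h i (t i div n) (t (nxt i) mod n)) = (\<Prod>i<L. \<Sum>x<n. \<Sum>y<n. (h i x y :: complex))"
proof -
  let ?P = "PiE {..<L} (\<lambda>_. {..<n} \<times> {..<n})"
  let ?f = "\<lambda>t. \<lambda>i\<in>{..<L}. (t i div n, t (nxt i) mod n)"
  let ?g = "\<lambda>g. \<lambda>i\<in>{..<L}. fst (g i) * n + snd (g (prv i))"
  have "(\<Sum>t\<in>p.X. \<Prod>i<L. h i (t i div n) (t (nxt i) mod n)) = (\<Sum>g\<in>?P. \<Prod>i<L. case_prod (h i) (g i))"
  proof (rule sum.reindex_bij_witness[of _ ?g ?f])
    fix t assume t: "t \<in> p.X"
    show "?g (?f t) = t"
    proof (rule p.configs_ext[OF _ t])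
      show "?g (?f t) \<in> p.X"
        unfolding p_mem using t by (auto simp: p_mem prv_less nxt_prv div_mult_mod_eq)
      show "?g (?f t) i = t i" if "i < L" for i using that by (simp add: prv_less nxt_prv)
    qed
    show "?f t \<in> ?P" using t by (auto simp: p_mem quot_less rem_less)
    show "(\<Prod>i<L. case_prod (h i) (?f t i)) = (\<Prod>i<L. h i (t i div n) (t (nxt i) mod n))" by simp
  next
    fix g assume g: "g \<in> ?P"
    have gi: "fst (g i) < n" "snd (g i) < n" if "i < L" for i
      using g that by (auto simp: PiE_def Pi_def mem_Times_iff)
    show "?g g \<in> p.X" using gi by (auto simp: p_mem prv_less code_less)
    show "?f (?g g) = g"
    proof
      fix i
      show "?f (?g g) i = g i"
      proof (cases "i < L")
        case True
        then show ?thesis using gi[OF True] gi[OF prv_less[OF True]]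
          by (simp add: nxt_less nxt_prv prod_eq_iff)
      next
        case False
        then show ?thesis using PiE_arb[OF g, of i] by simp
      qed
    qed
  qed
  also have "\<dots> = (\<Prod>i<L. \<Sum>b\<in>{..<n} \<times> {..<n}. case_prod (h i) b)"
    by (rule prod_sum_PiE[symmetric]) auto
  finally show ?thesis by (simp add: sum.cartesian_product)
qed

lemma prod_nxt: "(\<Prod>i<L. f i) = (\<Prod>i<L. f (nxt i) :: complex)"
  by (rule prod.reindex_bij_witness[of _ nxt prv]) (auto simp: nxt_less prv_less nxt_prv)

definition U :: "(nat \<Rightarrow> nat op) \<Rightarrow> (nat \<Rightarrow> nat op) \<Rightarrow> (nat \<Rightarrow> nat) op" where
  "U A B = p.prod_op (\<lambda>i. site (A i) (B i))"

text \<open>A bond sees the right factor of its first site from the left and the transposed left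
  factor of its second site from the right; onsite operators thus reduce to matrix products on
  bonds.\<close>

lemma U_bonds: "U A B \<rightharpoonup> bonds M = bonds (\<lambda>i. B i ** M i ** tr (A (nxt i)))"
proof
  fix s
  show "(U A B \<rightharpoonup> bonds M) s = bonds (\<lambda>i. B i ** M i ** tr (A (nxt i))) s"
  proof (cases "s \<in> p.X")
    case True
    let ?h = "\<lambda>i x y. B i (s i div n) x * M i x y * A (nxt i) (s (nxt i) mod n) y"
    have "(U A B \<rightharpoonup> bonds M) s = (\<Sum>t\<in>p.X. \<Prod>i<L. ?h i (t i div n) (t (nxt i) mod n))"
      unfolding app_op_def
    proof (rule sum.cong[OF refl])
      fix t assume t: "t \<in> p.X"
      have "U A B s t = (\<Prod>i<L. A i (s i mod n) (t i mod n)) * (\<Prod>i<L. B i (s i div n) (t i div n))"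
        using True t unfolding U_def p.prod_op_def prod.distrib[symmetric]
        by (auto simp: site_def p_mem intro!: prod.cong)
      also have "(\<Prod>i<L. A i (s i mod n) (t i mod n)) = (\<Prod>i<L. A (nxt i) (s (nxt i) mod n) (t (nxt i) mod n))"
        by (rule prod_nxt)
      finally show "U A B s t * bonds M t = (\<Prod>i<L. ?h i (t i div n) (t (nxt i) mod n))"
        using t by (simp add: bonds_def prod.distrib mult_ac)
    qed
    also have "\<dots> = (\<Prod>i<L. \<Sum>x<n. \<Sum>y<n. ?h i x y)" by (rule sum_bonds)
    also have "\<dots> = (\<Prod>i<L. (B i ** M i ** tr (A (nxt i))) (s i div n) (s (nxt i) mod n))"
    proof (rule prod.cong[OF refl])
      fix i
      have "(\<Sum>x<n. \<Sum>y<n. ?h i x y) = (\<Sum>y<n. \<Sum>x<n. ?h i x y)" by (rule sum.swap)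
      then show "(\<Sum>x<n. \<Sum>y<n. ?h i x y) = (B i ** M i ** tr (A (nxt i))) (s i div n) (s (nxt i) mod n)"
        by (simp add: times_op_def tr_def sum_distrib_right)
    qed
    finally show ?thesis using True by (simp add: bonds_def)
  qed (auto simp: bonds_def app_op_def U_def p.prod_op_def)
qed

lemma U_times: "U A B \<otimes>\<otimes> U A' B' = U (\<lambda>i. A i ** A' i) (\<lambda>i. B i ** B' i)"
  unfolding U_def p.prod_op_times phys_def site_times ..

definition \<phi> :: "(nat \<Rightarrow> nat) \<Rightarrow> complex" where
  "\<phi> = bonds (\<lambda>_. one_op {..<n})"

text \<open>The left constituents in \<open>S\<close> and the right ones in \<open>S'\<close> are
  chosen separately. Equal sets give the truncated onsite symmetry, while a single constituent gives
  an end operator.\<close>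

definition V :: "nat op \<Rightarrow> nat set \<Rightarrow> nat set \<Rightarrow> (nat \<Rightarrow> nat) op" where
  "V W S S' = U (\<lambda>i. if i \<in> S then cj W else one_op {..<n}) (\<lambda>i. if i \<in> S' then W else one_op {..<n})"

text \<open>A maximally entangled bond is unchanged when the conjugate of a unitary acts on one end
  and the unitary on the other. The condition on \<open>S\<close> and \<open>S'\<close> says that
  each bond is acted on at both ends or at none.\<close>

lemma V_\<phi>:
  assumes W: "unitary_op {..<n} W" and S: "\<And>i. i < L \<Longrightarrow> i \<in> S' \<longleftrightarrow> nxt i \<in> S"
  shows "V W S S' \<rightharpoonup> \<phi> = \<phi>"
proof -
  have "(if i \<in> S' then W else one_op {..<n}) ** one_op {..<n} ** tr (if nxt i \<in> S then cj W else one_op {..<n}) =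
      one_op {..<n}" if "i < L" for i
    using W S[OF that] by (auto simp: tr_cj tr_one unitary_op_def)
  then show ?thesis
    unfolding V_def \<phi>_def U_bonds by (auto simp: bonds_def intro!: prod.cong ext)
qed

lemma V_mult:
  assumes "W \<in> ops {..<n}" "S1 \<inter> S2 = {}" "S1' \<inter> S2' = {}"
  shows "V W S1 S1' \<otimes>\<otimes> V W S2 S2' = V W (S1 \<union> S2) (S1' \<union> S2')"
  unfolding V_def U_times
  by (rule arg_cong2[of _ _ _ _ U]; rule ext) (use assms in \<open>auto simp: cj_ops\<close>)

lemma V_times: "V W S S' \<otimes>\<otimes> V W' S S' = V (W ** W') S S'"
  unfolding V_def U_times
  by (rule arg_cong2[of _ _ _ _ U]; rule ext) (auto simp: cj_times)

lemma V_unitary: "unitary_op {..<n} W \<Longrightarrow> p.unitary (V W S S')"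
  unfolding V_def U_def by (rule p.prod_op_unitary) (auto simp: phys_def intro!: site_unitary cj_unitary)

lemma V_supp: "S \<union> S' \<subseteq> T \<Longrightarrow> p.supp T (V W S S')"
  unfolding V_def U_def by (rule p.prod_op_supp) (auto simp: phys_def site_one)

text \<open>Phases of \<open>W\<close> cancel between the two constituents of a site. Therefore a
  projective representation on the constituents becomes a linear one on sites.\<close>

lemma site_phase:
  assumes "cmod z = 1"
  shows "site (cj (scale_op z W)) (scale_op z W) = site (cj W) W"
  using assms complex_norm_square[of z] by (auto simp: site_def cj_def scale_op_def fun_eq_iff mult_ac)

lemma V_phase: "cmod z = 1 \<Longrightarrow> V (scale_op z W) S S = V W S S"
  unfolding V_def U_def using site_phase[of z W] by (intro p.prod_op_cong) auto

text \<open>On a single constituent nothing cancels the phase; this is where the cocycle becomes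
  visible at the end of a string.\<close>

lemma V_scale:
  assumes "j < L"
  shows "V (scale_op z W) {} {j} = scale_op z (V W {} {j})"
proof (intro ext)
  fix s t
  let ?f = "\<lambda>W i. site (one_op {..<n}) (if i \<in> {j} then W else one_op {..<n}) (s i) (t i)"
  have "(\<Prod>i<L. ?f (scale_op z W) i) = ?f (scale_op z W) j * (\<Prod>i\<in>{..<L} - {j}. ?f (scale_op z W) i)"
    using assms by (intro prod.remove) auto
  also have "\<dots> = z * (?f W j * (\<Prod>i\<in>{..<L} - {j}. ?f W i))"
    by (auto simp: site_def scale_op_def intro!: prod.cong)
  also have "?f W j * (\<Prod>i\<in>{..<L} - {j}. ?f W i) = (\<Prod>i<L. ?f W i)"
    using assms by (intro prod.remove[symmetric]) auto
  finally show "V (scale_op z W) {} {j} s t = scale_op z (V W {} {j}) s t"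
    unfolding fun_cong[OF fun_cong[OF scale_op_def[of z "V W {} {j}"]]]
    unfolding V_def U_def p.prod_op_def by simp
qed

lemma V_one: "V (one_op {..<n}) S S' = one_op p.X"
  unfolding V_def U_def cj_one if_cancel site_one using p.prod_op_one by (simp add: phys_def)

definition dyad :: "((nat \<Rightarrow> nat) \<Rightarrow> complex) \<Rightarrow> ((nat \<Rightarrow> nat) \<Rightarrow> complex) \<Rightarrow> (nat \<Rightarrow> nat) op" where
  "dyad u v = (\<lambda>s t. u s * cnj (v t))"

lemma times_dyad: "A \<otimes>\<otimes> dyad u v = dyad (A \<rightharpoonup> u) v"
  by (simp add: times_op_def dyad_def app_op_def sum_distrib_right mult.assoc)

lemma dyad_adj: "adj_op (dyad u v) = dyad v u"
  by (simp add: dyad_def adj_op_def mult.commute)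

lemma dyad_times: "dyad u v \<otimes>\<otimes> B = dyad u (adj_op B \<rightharpoonup> v)"
proof -
  have "adj_op (adj_op B \<otimes>\<otimes> adj_op (dyad u v)) = adj_op (dyad (adj_op B \<rightharpoonup> v) u)"
    unfolding dyad_adj times_dyad ..
  then show ?thesis unfolding p.adj_times p.adj_adj dyad_adj .
qed

lemma tc_dyad: "tc A B \<triangleright> vop (dyad u v) = vop (dyad (A \<rightharpoonup> u) (B \<rightharpoonup> v))"
  unfolding tc_vop times_dyad dyad_times p.adj_adj ..

end

section \<open>Preparing the bonds by a circuit of depth two\<close>

context bond_chain
begin

text \<open>A controlled transposition: if the right constituent of site \<open>i\<close> is in
  state x, then 0 and x are exchanged in the left constituent of the next site. It copies x onto 0,
  which creates the bond, and it is its own inverse, so that the gate is hermitian.\<close>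

definition flip :: "nat \<Rightarrow> (nat \<Rightarrow> nat) \<Rightarrow> nat \<Rightarrow> nat" where
  "flip i s = s(Suc i := (s (Suc i) div n) * n + transpose 0 (s i div n) (s (Suc i) mod n))"

definition gate :: "nat \<Rightarrow> (nat \<Rightarrow> nat) op" where
  "gate i = (\<lambda>s t. if s \<in> p.X \<and> t = flip i s then 1 else 0)"

lemma transpose_less: "p < n \<Longrightarrow> q < n \<Longrightarrow> transpose 0 p q < n"
  using n by (simp add: transpose_def)

lemma flip_div:
  assumes "s \<in> p.X" "Suc i < L"
  shows "flip i s j div n = s j div n"
    "flip i s j mod n = (if j = Suc i then transpose 0 (s i div n) (s j mod n) else s j mod n)"
proof -
  have "transpose 0 (s i div n) (s (Suc i) mod n) < n"
    using assms by (intro transpose_less) (auto simp: p_mem quot_less rem_less)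
  then show "flip i s j div n = s j div n"
    "flip i s j mod n = (if j = Suc i then transpose 0 (s i div n) (s j mod n) else s j mod n)"
    by (auto simp: flip_def)
qed

lemma flip_configs:
  assumes "s \<in> p.X" "Suc i < L"
  shows "flip i s \<in> p.X"
proof -
  have "transpose 0 (s i div n) (s (Suc i) mod n) < n"
    using assms by (intro transpose_less) (auto simp: p_mem quot_less rem_less)
  then show ?thesis using assms by (auto simp: p_mem flip_def code_less quot_less extensional_def)
qed

lemma flip_flip:
  assumes "s \<in> p.X" "Suc i < L"
  shows "flip i (flip i s) = s"
proof
  fix j
  have "flip i (flip i s) j div n = s j div n"
    using flip_div(1)[OF flip_configs[OF assms] assms(2)] flip_div(1)[OF assms] by simp
  moreover have "flip i (flip i s) j mod n = s j mod n"
    using flip_div(2)[OF flip_configs[OF assms] assms(2), of j] flip_div[OF assms] by simp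
  ultimately show "flip i (flip i s) j = s j" by (metis div_mult_mod_eq)
qed

lemma gate_app: 
  assumes "Suc i < L"
  shows "gate i \<rightharpoonup> v = (\<lambda>s. if s \<in> p.X then v (flip i s) else 0)"
proof
  fix s
  show "(gate i \<rightharpoonup> v) s = (if s \<in> p.X then v (flip i s) else 0)"
  proof (cases "s \<in> p.X")
    case True
    then have "(gate i \<rightharpoonup> v) s = (\<Sum>t\<in>p.X. if t = flip i s then v t else 0)"
      unfolding app_op_def gate_def by (intro sum.cong) auto
    then show ?thesis using True flip_configs[OF True assms] p.finX by simp
  qed (simp add: app_op_def gate_def)
qed

lemma gate_ops: "Suc i < L \<Longrightarrow> gate i \<in> ops p.X"
  by (auto simp: gate_def ops_def flip_configs)

lemma gate_unitary:
  assumes i: "Suc i < L"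
  shows "p.unitary (gate i)"
proof -
  have adj: "adj_op (gate i) = gate i"
  proof (intro ext)
    fix s t
    have "t \<in> p.X \<and> s = flip i t \<longleftrightarrow> s \<in> p.X \<and> t = flip i s"
      using flip_flip[OF _ i] flip_configs[OF _ i] by metis
    then show "adj_op (gate i) s t = gate i s t" by (simp add: adj_op_def gate_def)
  qed
  have "gate i \<otimes>\<otimes> gate i = one_op p.X"
  proof (intro ext)
    fix s t
    have "(gate i \<otimes>\<otimes> gate i) s t = (gate i \<rightharpoonup> (\<lambda>r. gate i r t)) s"
      by (simp add: times_op_def app_op_def)
    also have "\<dots> = one_op p.X s t"
      unfolding gate_app[OF i] using flip_flip[OF _ i, of s] flip_configs[OF _ i, of s]
      by (auto simp: gate_def one_op_def)
    finally show "(gate i \<otimes>\<otimes> gate i) s t = one_op p.X s t" .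
  qed
  then show ?thesis unfolding unitary_op_def adj using gate_ops[OF i] by simp
qed

lemma flip_iff:
  assumes "s \<in> p.X" "t \<in> p.X" "Suc i < L"
  shows "t = flip i s \<longleftrightarrow> (\<forall>j<L. j \<noteq> i \<and> j \<noteq> Suc i \<longrightarrow> t j = s j) \<and> t i = s i \<and> t (Suc i) = flip i s (Suc i)"
    (is "_ \<longleftrightarrow> ?r")
proof
  assume r: ?r
  show "t = flip i s"
  proof (rule p.configs_ext[OF assms(2) flip_configs[OF assms(1,3)]])
    show "t j = flip i s j" if "j < L" for j
      using r that by (cases "j = i"; cases "j = Suc i") (auto simp: flip_def)
  qed
qed (auto simp: flip_def)

lemma gate_supp:
  assumes i: "Suc i < L"
  shows "p.supp {i..<i + 2} (gate i)"
proof (rule p.suppI[OF gate_ops[OF i]])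
  fix s t j assume *: "s \<in> p.X" "t \<in> p.X" "j < L" "j \<notin> {i..<i + 2}" "s j \<noteq> t j"
  then show "gate i s t = 0" using flip_iff[OF *(1,2) i] by (auto simp: gate_def)
next
  fix s t s' t'
  assume *: "s \<in> p.X" "t \<in> p.X" "s' \<in> p.X" "t' \<in> p.X"
      "\<And>j. j < L \<Longrightarrow> j \<notin> {i..<i + 2} \<Longrightarrow> s j = t j" "\<And>j. j < L \<Longrightarrow> j \<notin> {i..<i + 2} \<Longrightarrow> s' j = t' j"
      "\<And>j. j < L \<Longrightarrow> j \<in> {i..<i + 2} \<Longrightarrow> s j = s' j" "\<And>j. j < L \<Longrightarrow> j \<in> {i..<i + 2} \<Longrightarrow> t j = t' j"
  have eq: "s i = s' i" "t i = t' i" "s (Suc i) = s' (Suc i)" "t (Suc i) = t' (Suc i)"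
    using *(7,8)[of i] *(7,8)[of "Suc i"] i by auto
  have off: "t j = s j" "t' j = s' j" if "j < L" "j \<noteq> i" "j \<noteq> Suc i" for j
    using *(5,6)[of j] that by auto
  have "t = flip i s \<longleftrightarrow> t' = flip i s'"
    unfolding flip_iff[OF *(1,2) i] flip_iff[OF *(3,4) i] using eq off by (auto simp: flip_def)
  then show "gate i s t = gate i s' t'" using *(1-4) by (simp add: gate_def)
qed

text \<open>The effect of a gate on the coefficient matrix of its bond. It takes the matrix of the
  product state, with ones in column 0, to the identity.\<close>

definition link :: "nat op \<Rightarrow> nat op" where
  "link A = (\<lambda>p q. A p (transpose 0 p q))"

lemma gate_bonds:
  assumes i: "Suc i < L"
  shows "gate i \<rightharpoonup> bonds M = bonds (M(i := link (M i)))"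
proof
  fix s
  show "(gate i \<rightharpoonup> bonds M) s = bonds (M(i := link (M i))) s"
  proof (cases "s \<in> p.X")
    case True
    have "nxt j = Suc i \<longleftrightarrow> j = i" if "j < L" for j using that i by (auto simp: nxt_def)
    then have "bonds M (flip i s) = bonds (M(i := link (M i))) s"
      unfolding bonds_def flip_div[OF True i] using True flip_configs[OF True i]
      by (auto simp: link_def intro!: prod.cong)
    then show ?thesis unfolding gate_app[OF i] using True by simp
  qed (simp add: gate_app[OF i] bonds_def)
qed

definition layer :: "nat list \<Rightarrow> (nat \<Rightarrow> nat) op" where
  "layer xs = foldr (times_op p.X) (map gate xs) (one_op p.X)"

lemma layer_bonds:
  assumes "distinct xs" "\<And>i. i \<in> set xs \<Longrightarrow> Suc i < L"
  shows "layer xs \<rightharpoonup> bonds M = bonds (\<lambda>i. if i \<in> set xs then link (M i) else M i)"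
  using assms
proof (induction xs)
  case Nil
  then show ?case by (simp add: layer_def)
next
  case (Cons x xs)
  have "layer (x # xs) \<rightharpoonup> bonds M = gate x \<rightharpoonup> layer xs \<rightharpoonup> bonds M"
    by (simp add: layer_def p.app_times)
  also have "layer xs \<rightharpoonup> bonds M = bonds (\<lambda>i. if i \<in> set xs then link (M i) else M i)"
    using Cons by simp
  also have "gate x \<rightharpoonup> \<dots> = bonds ((\<lambda>i. if i \<in> set xs then link (M i) else M i)
      (x := link (if x \<in> set xs then link (M x) else M x)))"
    using Cons.prems by (intro gate_bonds) simp
  also have "\<dots> = bonds (\<lambda>i. if i \<in> set (x # xs) then link (M i) else M i)"
    using Cons.prems by (intro arg_cong[of _ _ bonds]) auto
  finally show ?case .
qed

lemma tc_layer:
  "tc (layer xs) (layer xs) = foldr (times_op X) (map (\<lambda>i. tc (gate i) (gate i)) xs) (one_op X)"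
  by (induction xs) (simp_all add: layer_def tc_one tc_times[symmetric])

lemma circuit_layer_tc:
  assumes "sorted_wrt (\<lambda>i j. i + 2 \<le> j) xs" "\<And>i. i \<in> set xs \<Longrightarrow> Suc i < L"
  shows "circuit_layer L (doubled (\<lambda>_. n * n)) 2 (tc (layer xs) (layer xs))"
  unfolding circuit_layer_def
proof (intro exI[of _ "map (\<lambda>i. (i, tc (gate i) (gate i))) xs"] conjI)
  show "\<forall>(q, A)\<in>set (map (\<lambda>i. (i, tc (gate i) (gate i))) xs). unitary_op X A \<and> supp {q..<q + 2} A"
  proof
    fix y assume "y \<in> set (map (\<lambda>i. (i, tc (gate i) (gate i))) xs)"
    then obtain i where i: "i \<in> set xs" "y = (i, tc (gate i) (gate i))" by auto
    show "case y of (q, A) \<Rightarrow> unitary_op X A \<and> supp {q..<q + 2} A"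
      unfolding i(2) prod.case by (intro conjI tc_unitary gate_unitary tc_supp gate_supp assms(2)[OF i(1)])
  qed
  show "sorted_wrt (\<lambda>(q, A) (q', A'). q + 2 \<le> q') (map (\<lambda>i. (i, tc (gate i) (gate i))) xs)"
    using assms(1) by (simp add: sorted_wrt_map)
  show "tc (layer xs) (layer xs) =
      foldr (times_op X) (map snd (map (\<lambda>i. (i, tc (gate i) (gate i))) xs)) (one_op X)"
    by (simp add: tc_layer comp_def)
qed

text \<open>All bonds but the last are products: the right constituent is in the uniform
  superposition and the left one of the next site is in state 0. The last bond joins the two ends,
  which no local gate could entangle, so it is present from the beginning; a bulk product allows
  this.\<close>

definition start :: "(nat \<Rightarrow> nat) \<Rightarrow> complex" where
  "start = bonds (\<lambda>i. if Suc i = L then one_op {..<n} else (\<lambda>p q. if q = 0 then 1 else 0))"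

abbreviation "steps P \<equiv> filter P [0..<L - 1]"

lemma sorted_steps:
  assumes "\<And>i j. P i \<Longrightarrow> P j \<Longrightarrow> i < j \<Longrightarrow> i + 2 \<le> j"
  shows "sorted_wrt (\<lambda>i j. i + 2 \<le> j) (steps P)"
  by (rule sorted_wrt_mono_rel[OF _ sorted_wrt_filter[OF sorted_wrt_upt]]) (use assms in auto)

text \<open>Gates on neighbouring bonds share a site, so the bonds are linked in two layers
  according to parity, each bond exactly once.\<close>

lemma layers_start: "layer (steps even) \<rightharpoonup> layer (steps odd) \<rightharpoonup> start = \<phi>"
proof -
  let ?M = "\<lambda>i. if Suc i = L then one_op {..<n} else (\<lambda>p q. if q = 0 then 1 else 0 :: complex)"
  have l: "layer (steps P) \<rightharpoonup> bonds M = bonds (\<lambda>i. if i < L - 1 \<and> P i then link (M i) else M i)" for P M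
    by (subst layer_bonds) auto
  have "bonds (\<lambda>i. if i < L - 1 \<and> even i then link (if i < L - 1 \<and> odd i then link (?M i) else ?M i)
      else if i < L - 1 \<and> odd i then link (?M i) else ?M i) = \<phi>"
    (is "bonds ?B = _")
  proof
    fix s
    have B: "?B i (s i div n) q = one_op {..<n} (s i div n) q" if s: "s \<in> p.X" and i: "i < L" for i q
    proof -
      have "s i div n < n" using s i by (auto simp: p_mem quot_less)
      then show ?thesis using i by (auto simp: link_def one_op_def transpose_def)
    qed
    show "bonds ?B s = \<phi> s"
    proof (cases "s \<in> p.X")
      case True
      show ?thesis
        unfolding \<phi>_def bonds_def if_P[OF True] by (rule prod.cong[OF refl], rule B[OF True]) simp
    qed (simp add: \<phi>_def bonds_def)
  qed
  then show ?thesis unfolding start_def l .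
qed

definition clear :: "(nat \<Rightarrow> nat) \<Rightarrow> bool" where
  "clear s \<longleftrightarrow> (\<forall>j. 0 < j \<and> j < L \<longrightarrow> s j mod n = 0) \<and> (0 < L \<longrightarrow> s (L - 1) div n = s 0 mod n)"

lemma start_eq: "start s = (if s \<in> p.X \<and> clear s then 1 else 0)"
proof (cases "s \<in> p.X")
  case True
  let ?M = "\<lambda>i. if Suc i = L then one_op {..<n} else (\<lambda>p q. if q = 0 then 1 else 0 :: complex)"
  let ?c = "\<lambda>i. if Suc i = L then s i div n = s 0 mod n else s (Suc i) mod n = 0"
  have M: "?M i (s i div n) (s (nxt i) mod n) = (if ?c i then 1 else 0)" if "i < L" for i
  proof -
    have "s i div n < n" using True that by (auto simp: p_mem quot_less)
    then show ?thesis by (auto simp: nxt_def one_op_def)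
  qed
  have "start s = (\<Prod>i<L. if ?c i then 1 else 0)"
    unfolding start_def bonds_def if_P[OF True] by (rule prod.cong[OF refl], rule M) simp
  also have "\<dots> = (if \<forall>i<L. ?c i then 1 else 0)" by (auto intro!: prod.neutral)
  also have "(\<forall>i<L. ?c i) \<longleftrightarrow> clear s"
  proof
    assume c: "\<forall>i<L. ?c i"
    have "s j mod n = 0" if j: "0 < j" "j < L" for j
      using c[rule_format, of "j - 1"] j by (simp split: if_splits)
    moreover have "s (L - 1) div n = s 0 mod n" if "0 < L"
      using c[rule_format, of "L - 1"] that by simp
    ultimately show "clear s" by (auto simp: clear_def)
  next
    assume "clear s"
    then show "\<forall>i<L. ?c i" unfolding clear_def by (metis Suc_lessI diff_Suc_1 zero_less_Suc)
  qed
  finally show ?thesis using True by simp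
qed (simp add: start_def bonds_def)

text \<open>The last bond touches only the first and the last site, so margin 1 suffices. In
  between, the left constituents are fixed to 0 and the right ones are unconstrained, a product over
  sites on both halves of the doubled chain.\<close>

lemma bulk_product_start: "bulk_product L (doubled (\<lambda>_. n * n)) 1 (\<lambda>s. \<kappa> * vop (dyad start start) s)"
  unfolding bulk_product_def
proof
  show "(\<lambda>s. \<kappa> * vop (dyad start start) s) \<in> vecs X" by (auto simp: vecs_def vop_def)
  let ?B = "{1..<L - 1}"
  \<comment> \<open>\<eta> may see only the end sites, so the bulk is filled with the label 0, which
    satisfies the bulk constraints.\<close>
  let ?fill = "\<lambda>t :: nat \<Rightarrow> nat \<times> nat. \<lambda>i\<in>{..<L}. if i \<in> ?B then (0, 0) else t i"
  let ?v = "\<lambda>(i :: nat) x :: nat \<times> nat. if fst x mod n = 0 \<and> snd x mod n = 0 then 1 else 0 :: complex"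
  let ?\<eta> = "\<lambda>t. \<kappa> * vop (dyad start start) (?fill t)"
  have c: "clear k \<longleftrightarrow> (\<forall>i\<in>?B. k i mod n = 0) \<and> clear (\<lambda>i\<in>{..<L}. if i \<in> ?B then 0 else k i)" for k
  proof
    assume "clear k"
    then show "(\<forall>i\<in>?B. k i mod n = 0) \<and> clear (\<lambda>i\<in>{..<L}. if i \<in> ?B then 0 else k i)"
      by (auto simp: clear_def)
  next
    assume A: "(\<forall>i\<in>?B. k i mod n = 0) \<and> clear (\<lambda>i\<in>{..<L}. if i \<in> ?B then 0 else k i)"
    have "k j mod n = 0" if j: "0 < j" "j < L" for j
    proof (cases "j \<in> ?B")
      case False
      have "(\<lambda>i\<in>{..<L}. if i \<in> ?B then 0 else k i) j mod n = 0"
        using A j unfolding clear_def by blast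
      then show ?thesis unfolding restrict_def if_not_P[OF False] using j by simp
    qed (use A in blast)
    then show "clear k" using A by (auto simp: clear_def)
  qed
  show "\<exists>v \<eta>. \<forall>s\<in>X. \<kappa> * vop (dyad start start) s =
      (\<Prod>i\<in>?B. v i (s i)) * \<eta> (restrict s ({..<L} - ?B))"
  proof (intro exI[of _ ?v] exI[of _ ?\<eta>] ballI)
    fix s assume s: "s \<in> X"
    have fill: "?fill (restrict s ({..<L} - ?B)) = ?fill s" by (rule ext) auto
    have "\<forall>i<L. s i \<in> {..<n * n} \<times> {..<n * n}" using s by (auto simp: configs_mem doubled_def)
    then have fX: "?fill s \<in> X" using n by (auto simp: configs_mem doubled_def)
    have k: "ket (?fill s) = (\<lambda>i\<in>{..<L}. if i \<in> ?B then 0 else ket s i)"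
      "bra (?fill s) = (\<lambda>i\<in>{..<L}. if i \<in> ?B then 0 else bra s i)"
      by (auto simp: ket_part_def bra_part_def fun_eq_iff)
    have "(\<Prod>i\<in>?B. ?v i (s i)) = (if \<forall>i\<in>?B. ket s i mod n = 0 \<and> bra s i mod n = 0 then 1 else 0)"
      by (auto simp: ket_part_def bra_part_def intro!: prod.neutral)
    moreover have "vop (dyad start start) s = (if clear (ket s) \<and> clear (bra s) then 1 else 0)"
      "vop (dyad start start) (?fill s) = (if clear (ket (?fill s)) \<and> clear (bra (?fill s)) then 1 else 0)"
      using s fX ket_bra_configs[OF s] ket_bra_configs[OF fX] by (auto simp: vop_def dyad_def start_eq)
    ultimately show "\<kappa> * vop (dyad start start) s = (\<Prod>i\<in>?B. ?v i (s i)) * ?\<eta> (restrict s ({..<L} - ?B))"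
      unfolding fill k using c[of "ket s"] c[of "bra s"] by auto
  qed
qed

lemma bonds_short_range:
  "\<exists>W \<phi>'. local_circuit L (doubled (\<lambda>_. n * n)) 2 2 W \<and> bulk_product L (doubled (\<lambda>_. n * n)) 1 \<phi>' \<and>
     (\<lambda>s. \<kappa> * vop (dyad \<phi> \<phi>) s) = W \<triangleright> \<phi>'"
proof (intro exI conjI)
  let ?l = "\<lambda>P. tc (layer (steps P)) (layer (steps P))"
  let ?W = "foldr (times_op X) [?l even, ?l odd] (one_op X)"
  have "\<forall>A\<in>set [?l even, ?l odd]. circuit_layer L (doubled (\<lambda>_. n * n)) 2 A"
  proof -
    have "circuit_layer L (doubled (\<lambda>_. n * n)) 2 (?l even)"
      by (rule circuit_layer_tc, rule sorted_steps) (auto, presburger)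
    moreover have "circuit_layer L (doubled (\<lambda>_. n * n)) 2 (?l odd)"
      by (rule circuit_layer_tc, rule sorted_steps) (auto, presburger)
    ultimately show ?thesis by simp
  qed
  then show "local_circuit L (doubled (\<lambda>_. n * n)) 2 2 ?W"
    unfolding local_circuit_def by (intro exI[of _ "[?l even, ?l odd]"]) simp
  show "bulk_product L (doubled (\<lambda>_. n * n)) 1 (\<lambda>s. \<kappa> * vop (dyad start start) s)"
    by (rule bulk_product_start)
  have "?W \<triangleright> vop (dyad start start) = vop (dyad \<phi> \<phi>)"
    by (simp add: app_times tc_dyad layers_start[simplified])
  then show "(\<lambda>s. \<kappa> * vop (dyad \<phi> \<phi>) s) = ?W \<triangleright> (\<lambda>s. \<kappa> * vop (dyad start start) s)"
    unfolding app_scale by simp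
qed

end

section \<open>States saturating the bound\<close>

text \<open>A projective representation of \<open>K\<close> with cocycle \<alpha> and a linear one
  of \<open>G\<close> that commute up to \<chi>. With trivial \<open>VG\<close> it gives the example
  for (a), with trivial \<alpha> the one for (b).\<close>

locale projective_pair =
  fixes K :: "('k, 'm) monoid_scheme" and G :: "('g, 'n) monoid_scheme" and n :: nat
    and VK :: "'k \<Rightarrow> nat op" and VG :: "'g \<Rightarrow> nat op"
    and \<alpha> :: "'k \<Rightarrow> 'k \<Rightarrow> complex" and \<chi> :: "'g \<Rightarrow> 'k \<Rightarrow> complex"
  assumes K: "group K" and G: "group G" and n: "0 < n"
    and VK: "\<And>k. k \<in> carrier K \<Longrightarrow> unitary_op {..<n} (VK k)"
    and VG: "\<And>g. g \<in> carrier G \<Longrightarrow> unitary_op {..<n} (VG g)"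
    and VK_times: "\<And>k l. k \<in> carrier K \<Longrightarrow> l \<in> carrier K \<Longrightarrow>
      times_op {..<n} (VK k) (VK l) = scale_op (\<alpha> k l) (VK (k \<otimes>\<^bsub>K\<^esub> l))"
    and VG_times: "\<And>g h. g \<in> carrier G \<Longrightarrow> h \<in> carrier G \<Longrightarrow>
      times_op {..<n} (VG g) (VG h) = VG (g \<otimes>\<^bsub>G\<^esub> h)"
    and VK_VG: "\<And>k g. k \<in> carrier K \<Longrightarrow> g \<in> carrier G \<Longrightarrow>
      times_op {..<n} (VK k) (VG g) = scale_op (\<chi> g k) (times_op {..<n} (VG g) (VK k))"
    and \<alpha>: "\<And>k l. k \<in> carrier K \<Longrightarrow> l \<in> carrier K \<Longrightarrow> cmod (\<alpha> k l) = 1"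
    and \<chi>: "\<And>k g. k \<in> carrier K \<Longrightarrow> g \<in> carrier G \<Longrightarrow> cmod (\<chi> g k) = 1"
begin

text \<open>The density matrix is the pure bond state. Each constituent on the right carries the
  projective action and the one on the left its conjugate, so the onsite actions are linear and
  commute.\<close>

definition fam :: "('k, 'g) chain_family" where
  "fam = \<lparr>dim = \<lambda>_ _. n * n, repK = \<lambda>_ _ k. bond_chain.site n (bond_chain.cj (VK k)) (VK k),
     repG = \<lambda>_ _ g. bond_chain.site n (bond_chain.cj (VG g)) (VG g),
     rho = \<lambda>L. scale_op (1 / complex_of_real (nsq (configs L (phys (\<lambda>_. n * n))) (bond_chain.\<phi> L n)))
       (bond_chain.dyad (bond_chain.\<phi> L n) (bond_chain.\<phi> L n))\<rparr>"

lemma fam_dim: "chain_family.dim fam L = (\<lambda>_. n * n)"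
  by (simp add: fam_def)

lemma bc: "bond_chain n"
  by unfold_locales (rule n)

context
  fixes L :: nat
begin

interpretation bond_chain L n
  by (rule bc)

abbreviation (input) "Nm \<equiv> nsq p.X \<phi>"

lemma rho_fam: "rho fam L = scale_op (1 / complex_of_real Nm) (dyad \<phi> \<phi>)"
  by (simp add: fam_def)

lemma Nm_pos: "0 < Nm"
proof -
  let ?z = "\<lambda>i\<in>{..<L}. 0 :: nat"
  have z: "?z \<in> p.X" using n by (simp add: p_mem)
  have "\<phi> ?z = 1" using z n unfolding \<phi>_def bonds_def by (auto simp: one_op_def nxt_less intro!: prod.neutral)
  then have "(cmod (\<phi> ?z))\<^sup>2 = 1" by simp
  then have "1 \<le> Nm" unfolding nsq_def using member_le_sum[OF z, of "\<lambda>s. (cmod (\<phi> s))\<^sup>2"] p.finX by simp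
  then show ?thesis by simp
qed

lemma density_fam: "density_op (basis fam L) (rho fam L)"
  unfolding density_op_def fam_dim rho_fam
proof (intro conjI allI)
  have \<phi>v: "\<phi> \<in> vecs p.X" by (simp add: \<phi>_def)
  show "scale_op (1 / complex_of_real Nm) (dyad \<phi> \<phi>) \<in> ops p.X"
    using \<phi>v by (auto simp: ops_def vecs_def scale_op_def dyad_def)
  show "adj_op (scale_op (1 / complex_of_real Nm) (dyad \<phi> \<phi>)) = scale_op (1 / complex_of_real Nm) (dyad \<phi> \<phi>)"
    by (simp add: adj_op_def scale_op_def dyad_def mult.commute)
  fix v
  have "scale_op (1 / complex_of_real Nm) (dyad \<phi> \<phi>) \<rightharpoonup> v =
      (\<lambda>s. (1 / complex_of_real Nm * inner_on p.X \<phi> v) * \<phi> s)"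
    by (simp add: app_op_def scale_op_def dyad_def inner_on_def sum_distrib_left sum_distrib_right sum_divide_distrib mult_ac)
  then have "inner_on p.X v (scale_op (1 / complex_of_real Nm) (dyad \<phi> \<phi>) \<rightharpoonup> v) =
      1 / complex_of_real Nm * (inner_on p.X \<phi> v * cnj (inner_on p.X \<phi> v))"
    unfolding inner_scale_right inner_cnj by (simp only: inner_scale_right mult.assoc)
  also have "\<dots> = complex_of_real (1 / Nm * (cmod (inner_on p.X \<phi> v))\<^sup>2)"
    unfolding complex_norm_square[symmetric] by simp
  finally show "0 \<le> Re (inner_on p.X v (scale_op (1 / complex_of_real Nm) (dyad \<phi> \<phi>) \<rightharpoonup> v))"
    using Nm_pos by simp
next
  have "(\<Sum>s\<in>p.X. scale_op (1 / complex_of_real Nm) (dyad \<phi> \<phi>) s s) =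
      1 / complex_of_real Nm * inner_on p.X \<phi> \<phi>"
    unfolding inner_on_def sum_distrib_left by (simp add: scale_op_def dyad_def mult.commute)
  then show "(\<Sum>s\<in>p.X. scale_op (1 / complex_of_real Nm) (dyad \<phi> \<phi>) s s) = 1"
    unfolding inner_self using Nm_pos by simp
qed

lemma UK_fam: "UK fam L S k = V (VK k) S S"
proof -
  have "UK fam L S k = onsite_op L (phys (\<lambda>_. n * n)) S (\<lambda>_. site (cj (VK k)) (VK k))"
    unfolding UK_def fam_dim by (simp add: fam_def)
  also have "\<dots> = V (VK k) S S"
    unfolding p.onsite_prod_op V_def U_def
    by (rule p.prod_op_cong) (auto simp: site_one phys_def)
  finally show ?thesis .
qed

lemma UG_fam: "UG fam L S g = V (VG g) S S"
proof -
  have "UG fam L S g = onsite_op L (phys (\<lambda>_. n * n)) S (\<lambda>_. site (cj (VG g)) (VG g))"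
    unfolding UG_def fam_dim by (simp add: fam_def)
  also have "\<dots> = V (VG g) S S"
    unfolding p.onsite_prod_op V_def U_def
    by (rule p.prod_op_cong) (auto simp: site_one phys_def)
  finally show ?thesis .
qed

lemma onsite_fam:
  "unitary_rep K (phys (chain_family.dim fam L) i) (repK fam L i)"
  "unitary_rep G (phys (chain_family.dim fam L) i) (repG fam L i)"
  "k \<in> carrier K \<Longrightarrow> g \<in> carrier G \<Longrightarrow>
    times_op (phys (chain_family.dim fam L) i) (repK fam L i k) (repG fam L i g) =
    times_op (phys (chain_family.dim fam L) i) (repG fam L i g) (repK fam L i k)"
proof -
  have rep: "repK fam L i k = site (cj (VK k)) (VK k)" "repG fam L i g = site (cj (VG g)) (VG g)" for k g
    by (simp_all add: fam_def)
  have st: "times_op {..<n * n} (site (cj A) A) (site (cj B) B) = site (cj (A ** B)) (A ** B)" for A B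
    unfolding site_times cj_times ..
  show "unitary_rep K (phys (chain_family.dim fam L) i) (repK fam L i)"
    unfolding unitary_rep_def fam_dim phys_def rep st
    by (auto intro!: site_unitary cj_unitary VK simp: VK_times site_phase \<alpha>)
  show "unitary_rep G (phys (chain_family.dim fam L) i) (repG fam L i)"
    unfolding unitary_rep_def fam_dim phys_def rep st
    by (auto intro!: site_unitary cj_unitary VG simp: VG_times)
  show "times_op (phys (chain_family.dim fam L) i) (repK fam L i k) (repG fam L i g) =
    times_op (phys (chain_family.dim fam L) i) (repG fam L i g) (repK fam L i k)"
    if "k \<in> carrier K" "g \<in> carrier G"
    unfolding fam_dim phys_def rep st VK_VG[OF that] site_phase[OF \<chi>[OF that]] ..
qed

lemma V_all_\<phi>:
  assumes "unitary_op {..<n} W"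
  shows "V W {..<L} {..<L} \<rightharpoonup> \<phi> = \<phi>" "adj_op (V W {..<L} {..<L}) \<rightharpoonup> \<phi> = \<phi>"
proof -
  show *: "V W {..<L} {..<L} \<rightharpoonup> \<phi> = \<phi>" by (rule V_\<phi>[OF assms]) (simp add: nxt_less)
  have "adj_op (V W {..<L} {..<L}) \<rightharpoonup> V W {..<L} {..<L} \<rightharpoonup> \<phi> = \<phi>"
    by (rule p.unitary_app(1)[OF V_unitary[OF assms]]) (simp add: \<phi>_def)
  then show "adj_op (V W {..<L} {..<L}) \<rightharpoonup> \<phi> = \<phi>" unfolding * .
qed

lemma times_scale:
  "times_op p.X A (scale_op z B) = scale_op z (times_op p.X A B)"
  "times_op p.X (scale_op z B) A = scale_op z (times_op p.X B A)"
  by (simp_all add: times_op_def scale_op_def sum_distrib_left mult_ac)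

lemma exact_fam:
  assumes "k \<in> carrier K"
  shows "times_op (basis fam L) (UK fam L {..<L} k) (rho fam L) = rho fam L"
    "times_op (basis fam L) (rho fam L) (UK fam L {..<L} k) = rho fam L"
  unfolding fam_dim rho_fam UK_fam times_scale times_dyad dyad_times V_all_\<phi>[OF VK[OF assms]] by (rule refl)+

lemma average_fam:
  assumes "g \<in> carrier G"
  shows "times_op (basis fam L) (times_op (basis fam L) (UG fam L {..<L} g) (rho fam L))
    (adj_op (UG fam L {..<L} g)) = rho fam L"
  unfolding fam_dim rho_fam UG_fam times_scale times_dyad dyad_times p.adj_adj V_all_\<phi>[OF VG[OF assms]] ..

section \<open>Strings on the bond state and the cocycle of their ends\<close>

abbreviation (input) "amp \<equiv> 1 / complex_of_real (sqrt (\<Prod>i<L. real (n * n))) * (1 / complex_of_real Nm)"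

lemma choi_fam: "choi_state fam L = (\<lambda>s. amp * vop (dyad \<phi> \<phi>) s)"
  unfolding fam_dim rho_fam choi_vop vop_scale by (simp only: mult.assoc)

abbreviation (input) "Wd k g \<equiv> times_op {..<n} (VG g) (VK k)"

lemma Wd_unitary: "k \<in> carrier K \<Longrightarrow> g \<in> carrier G \<Longrightarrow> unitary_op {..<n} (Wd k g)"
  using VK VG by simp

lemma dsym_fam:
  assumes "k \<in> carrier K" "k' \<in> carrier K" "g \<in> carrier G"
  shows "dsym fam L S ((k, k'), g) = tc (V (Wd k g) S S) (V (Wd k' g) S S)"
proof -
  have "times_op p.X (UK fam L S k) (UG fam L S g) = V (Wd k g) S S" if "k \<in> carrier K" for k
    unfolding UK_fam UG_fam V_times VK_VG[OF that assms(3)] by (rule V_phase[OF \<chi>[OF that assms(3)]])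
  then show ?thesis using assms by (simp add: dsym_def fam_dim)
qed

lemma tc_choi: "tc A B \<triangleright> (\<lambda>s. z * vop (dyad u v) s) = (\<lambda>s. z * vop (dyad (A \<rightharpoonup> u) (B \<rightharpoonup> v)) s)"
  unfolding app_scale tc_dyad ..

text \<open>Moving \<open>VK k\<close> past \<open>VG h\<close> produces \<chi>, and the products
  within \<open>K\<close> produce \<alpha>: together this is the factor of the ket half of
  \<open>mspt_cocycle\<close>.\<close>

lemma Wd_mult:
  assumes "k \<in> carrier K" "l \<in> carrier K" "g \<in> carrier G" "h \<in> carrier G"
  shows "Wd k g ** Wd l h = scale_op (\<alpha> k l * \<chi> h k) (Wd (k \<otimes>\<^bsub>K\<^esub> l) (g \<otimes>\<^bsub>G\<^esub> h))"
proof -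
  have sc: "A ** scale_op z B = scale_op z (A ** B)" "scale_op z A ** B = scale_op z (A ** B)" for z A B
    by (simp_all add: times_op_def scale_op_def sum_distrib_left mult_ac)
  have ss: "scale_op z (scale_op w A) = scale_op (z * w) A" for z w and A :: "nat op"
    unfolding scale_op_def mult.assoc ..
  have "Wd k g ** Wd l h = VG g ** (VK k ** VG h) ** VK l" by (simp only: b.times_assoc)
  also have "\<dots> = scale_op (\<chi> h k) ((VG g ** VG h) ** (VK k ** VK l))"
    unfolding VK_VG[OF assms(1,4)] sc by (simp only: b.times_assoc)
  also have "\<dots> = scale_op (\<alpha> k l * \<chi> h k) (Wd (k \<otimes>\<^bsub>K\<^esub> l) (g \<otimes>\<^bsub>G\<^esub> h))"
    unfolding VG_times[OF assms(3,4)] VK_times[OF assms(1,2)] sc ss mult.commute[of "\<chi> h k"] ..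
  finally show ?thesis .
qed

text \<open>The string on \<open>{a..<c}\<close> acts on one end of the bond entering at
  \<open>a\<close>; \<open>El\<close> acts on its other end, the right constituent of site
  \<open>a - 1\<close>. Likewise \<open>Er\<close> acts on the left constituent of site
  \<open>c\<close>.\<close>

definition El :: "nat \<Rightarrow> ('k \<times> 'k) \<times> 'g \<Rightarrow> (nat \<Rightarrow> nat \<times> nat) op" where
  "El a = (\<lambda>((k, k'), g). tc (V (Wd k g) {} {a - 1}) (V (Wd k' g) {} {a - 1}))"

definition Er :: "nat \<Rightarrow> ('k \<times> 'k) \<times> 'g \<Rightarrow> (nat \<Rightarrow> nat \<times> nat) op" where
  "Er c = (\<lambda>((k, k'), g). tc (V (Wd k g) {c} {}) (V (Wd k' g) {c} {}))"

lemma El_Er_unitary: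
  assumes "x \<in> carrier ((K \<times>\<times> K) \<times>\<times> G)"
  shows "unitary (El a x)" "unitary (Er c x)"
proof -
  obtain k k' g where x: "x = ((k, k'), g)" by (metis prod.collapse)
  show "unitary (El a x)" "unitary (Er c x)"
    using assms unfolding x El_def Er_def prod.case
    by (auto intro!: tc_unitary V_unitary Wd_unitary)
qed

lemma El_Er_supp:
  assumes "1 \<le> a"
  shows "supp {a - 1..<a} (El a x)" "supp {c..<c + 1} (Er c x)"
proof -
  obtain k k' g where x: "x = ((k, k'), g)" by (metis prod.collapse)
  show "supp {a - 1..<a} (El a x)" "supp {c..<c + 1} (Er c x)"
    using assms unfolding x El_def Er_def prod.case by (auto intro!: tc_supp V_supp)
qed

text \<open>With the end operators added, every bond is acted on at both ends or at none, separately
  on the ket and on the bra.\<close>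

lemma string_fam:
  assumes x: "x \<in> carrier ((K \<times>\<times> K) \<times>\<times> G)" and ac: "1 \<le> a" "a + 1 \<le> c" "c + 1 \<le> L"
  shows "dsym fam L {a..<c} x \<triangleright> El a x \<triangleright> Er c x \<triangleright> choi_state fam L = choi_state fam L"
proof -
  obtain k k' g where xe: "x = ((k, k'), g)" by (metis prod.collapse)
  have c: "k \<in> carrier K" "k' \<in> carrier K" "g \<in> carrier G" using x by (auto simp: xe)
  have "V W {a..<c} {a..<c} \<rightharpoonup> V W {} {a - 1} \<rightharpoonup> V W {c} {} \<rightharpoonup> \<phi> = \<phi>" if W: "unitary_op {..<n} W" for W
  proof -
    have ops: "W \<in> ops {..<n}" using W by (simp add: unitary_op_def)
    have "V W {} {a - 1} \<otimes>\<otimes> V W {c} {} = V W {c} {a - 1}"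
      using V_mult[OF ops, of "{}" "{c}" "{a - 1}" "{}"] by simp
    moreover have "V W {a..<c} {a..<c} \<otimes>\<otimes> V W {c} {a - 1} = V W ({a..<c} \<union> {c}) ({a..<c} \<union> {a - 1})"
      by (rule V_mult[OF ops]) (use ac in auto)
    moreover have "V W ({a..<c} \<union> {c}) ({a..<c} \<union> {a - 1}) \<rightharpoonup> \<phi> = \<phi>"
      by (rule V_\<phi>[OF W]) (use ac in \<open>auto simp: nxt_def\<close>)
    ultimately show ?thesis by (metis p.app_times)
  qed
  then show ?thesis
    unfolding xe El_def Er_def prod.case dsym_fam[OF c] choi_fam tc_choi
    using Wd_unitary c by simp
qed

text \<open>The ket contributes the factor of \<open>Wd_mult\<close> and the bra its conjugate,
  since the second vector of a dyad enters conjugated.\<close>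

lemma cocycle_fam:
  assumes x: "x \<in> carrier ((K \<times>\<times> K) \<times>\<times> G)" and y: "y \<in> carrier ((K \<times>\<times> K) \<times>\<times> G)"
    and a: "1 \<le> a" "a \<le> L"
  shows "El a x \<triangleright> El a y \<triangleright> choi_state fam L =
    (\<lambda>s. mspt_cocycle \<alpha> \<chi> x y * (El a (x \<otimes>\<^bsub>(K \<times>\<times> K) \<times>\<times> G\<^esub> y) \<triangleright> choi_state fam L) s)"
proof -
  obtain k1 k2 g where xe: "x = ((k1, k2), g)" by (metis prod.collapse)
  obtain l1 l2 h where ye: "y = ((l1, l2), h)" by (metis prod.collapse)
  have c: "k1 \<in> carrier K" "k2 \<in> carrier K" "g \<in> carrier G" "l1 \<in> carrier K" "l2 \<in> carrier K" "h \<in> carrier G"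
    using x y by (auto simp: xe ye)
  have j: "a - 1 < L" using a by simp
  have app_scale_op: "scale_op z A \<rightharpoonup> v = (\<lambda>s. z * (A \<rightharpoonup> v) s)" for z A v
    by (simp add: app_op_def scale_op_def sum_distrib_left mult.assoc)
  have m: "V (Wd k g) {} {a - 1} \<rightharpoonup> V (Wd l h) {} {a - 1} \<rightharpoonup> \<phi> =
      (\<lambda>s. (\<alpha> k l * \<chi> h k) * (V (Wd (k \<otimes>\<^bsub>K\<^esub> l) (g \<otimes>\<^bsub>G\<^esub> h)) {} {a - 1} \<rightharpoonup> \<phi>) s)"
    if "k \<in> carrier K" "l \<in> carrier K" for k l
    unfolding p.app_times[symmetric] V_times Wd_mult[OF that c(3,6)] V_scale[OF j] app_scale_op ..
  have dz: "vop (dyad (\<lambda>s. z * u s) (\<lambda>s. w * v s)) s = z * cnj w * vop (dyad u v) s" for z w u v s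
    by (simp add: vop_def dyad_def)
  show ?thesis
    unfolding xe ye El_def mult_DirProd prod.case choi_fam tc_choi m[OF c(1,4)] m[OF c(2,5)] dz
    by (simp add: mspt_cocycle_def mult_ac)
qed

text \<open>Scalars on the constituents are phases by unitarity and cancel on every site, so the
  element acts as the identity on the whole Hilbert space and not only on the state.\<close>

lemma trivial_sym_fam:
  assumes c: "k \<in> carrier K" "k' \<in> carrier K" "g \<in> carrier G"
    and s: "VK k = scale_op z (one_op {..<n})" "VK k' = scale_op z' (one_op {..<n})" "VG g = scale_op w (one_op {..<n})"
  shows "dsym fam L {..<L} ((k, k'), g) = one_op X"
proof -
  have "V (Wd k g) {..<L} {..<L} = one_op p.X"
    if k: "k \<in> carrier K" and s: "VK k = scale_op z (one_op {..<n})" for k z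
  proof -
    have "Wd k g = scale_op (w * z) (one_op {..<n} ** one_op {..<n})"
      unfolding s \<open>VG g = _\<close> by (simp add: times_op_def scale_op_def sum_distrib_left mult_ac)
    then have W: "Wd k g = scale_op (w * z) (one_op {..<n})" by simp
    \<comment> \<open>The diagonal entry at 0, which exists as \<open>n\<close> is positive, shows
      that the scalar has modulus one.\<close>
    have "unitary_op {..<n} (scale_op (w * z) (one_op {..<n}))"
      using Wd_unitary[OF k c(3)] unfolding W .
    then have "times_op {..<n} (scale_op (w * z) (one_op {..<n})) (adj_op (scale_op (w * z) (one_op {..<n}))) 0 0 = one_op {..<n} 0 0"
      unfolding unitary_op_def by simp
    moreover have "times_op {..<n} (scale_op (w * z) (one_op {..<n})) (adj_op (scale_op (w * z) (one_op {..<n}))) 0 0 =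
        (\<Sum>r<n. if r = 0 then (w * z) * cnj (w * z) else 0)"
      unfolding times_op_def by (rule sum.cong) (auto simp: scale_op_def adj_op_def one_op_def)
    ultimately have "(w * z) * cnj (w * z) = 1" using n by (simp add: one_op_def)
    then have "complex_of_real ((cmod (w * z))\<^sup>2) = 1" unfolding complex_norm_square .
    then have "(cmod (w * z))\<^sup>2 = 1" unfolding of_real_eq_1_iff .
    then have "cmod (w * z) = 1" unfolding abs_square_eq_1 by simp
    then show ?thesis unfolding W using V_phase V_one by simp
  qed
  then show ?thesis unfolding dsym_fam[OF c] using c s by (simp add: tc_one)
qed

end

lemma mspt_fam: "mspt K G fam \<alpha> \<chi>"
  unfolding mspt_def
proof (intro conjI)
  show "\<exists>m. \<forall>L. \<forall>i<L. 0 < chain_family.dim fam L i \<and> chain_family.dim fam L i \<le> m"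
    unfolding fam_dim using n by (intro exI[of _ "n * n"]) simp
  show "\<forall>L. density_op (basis fam L) (rho fam L)" using density_fam by blast
  show "onsite_symmetry K G fam" unfolding onsite_symmetry_def using onsite_fam by blast
  show "exact_symmetry K fam"
    unfolding exact_symmetry_def
    by (intro allI exI[of _ "\<lambda>_. 0"]) (simp add: exact_fam scale_op_def)
  show "average_symmetry G fam" unfolding average_symmetry_def using average_fam by blast
  show "bulk_short_range_entangled (\<lambda>L. doubled (chain_family.dim fam L)) (choi_state fam)"
    unfolding bulk_short_range_entangled_def
  proof (rule exI[of _ 2], rule exI[of _ 2], rule exI[of _ 1], rule allI)
    fix L
    interpret bond_chain L n by (rule bc)
    show "\<exists>W \<phi>. local_circuit L (doubled (chain_family.dim fam L)) 2 2 W \<and>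
        bulk_product L (doubled (chain_family.dim fam L)) 1 \<phi> \<and> choi_state fam L = app_op (dbasis fam L) W \<phi>"
      unfolding choi_fam unfolding fam_dim by (rule bonds_short_range)
  qed
  show "bulk_spt_class ((K \<times>\<times> K) \<times>\<times> G) (\<lambda>L. doubled (chain_family.dim fam L)) (dsym fam) (choi_state fam)
      (mspt_cocycle \<alpha> \<chi>)"
    unfolding bulk_spt_class_def
  proof (rule exI[of _ 1], rule exI[of _ 1], intro allI impI)
    fix L a c :: nat assume ac: "1 \<le> a \<and> a + 1 \<le> c \<and> c + 1 \<le> L"
    interpret bond_chain L n by (rule bc)
    show "\<exists>El Er.
        (\<forall>x\<in>carrier ((K \<times>\<times> K) \<times>\<times> G).
           unitary_op (dbasis fam L) (El x) \<and> supported_on L (doubled (chain_family.dim fam L)) {a - 1..<a} (El x) \<and>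
           unitary_op (dbasis fam L) (Er x) \<and> supported_on L (doubled (chain_family.dim fam L)) {c..<c + 1} (Er x) \<and>
           app_op (dbasis fam L) (dsym fam L {a..<c} x)
             (app_op (dbasis fam L) (El x) (app_op (dbasis fam L) (Er x) (choi_state fam L))) = choi_state fam L) \<and>
        (\<forall>x\<in>carrier ((K \<times>\<times> K) \<times>\<times> G). \<forall>y\<in>carrier ((K \<times>\<times> K) \<times>\<times> G).
           app_op (dbasis fam L) (El x) (app_op (dbasis fam L) (El y) (choi_state fam L)) =
           (\<lambda>s. mspt_cocycle \<alpha> \<chi> x y * app_op (dbasis fam L) (El (x \<otimes>\<^bsub>(K \<times>\<times> K) \<times>\<times> G\<^esub> y)) (choi_state fam L) s))"
    proof (rule exI[of _ "El L a"], rule exI[of _ "Er L c"], intro conjI ballI)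
      fix x assume x: "x \<in> carrier ((K \<times>\<times> K) \<times>\<times> G)"
      show "unitary_op (dbasis fam L) (El L a x)" "unitary_op (dbasis fam L) (Er L c x)"
        unfolding fam_dim by (rule El_Er_unitary[OF x])+
      show "supported_on L (doubled (chain_family.dim fam L)) {a - 1..<a} (El L a x)"
        "supported_on L (doubled (chain_family.dim fam L)) {c..<c + 1} (Er L c x)"
        unfolding fam_dim by (rule El_Er_supp[OF conjunct1[OF ac]])+
      show "app_op (dbasis fam L) (dsym fam L {a..<c} x)
          (app_op (dbasis fam L) (El L a x) (app_op (dbasis fam L) (Er L c x) (choi_state fam L))) = choi_state fam L"
        using string_fam[OF x, of a c L] ac unfolding fam_dim by blast
      fix y assume y: "y \<in> carrier ((K \<times>\<times> K) \<times>\<times> G)"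
      show "app_op (dbasis fam L) (El L a x) (app_op (dbasis fam L) (El L a y) (choi_state fam L)) =
          (\<lambda>s. mspt_cocycle \<alpha> \<chi> x y * app_op (dbasis fam L) (El L a (x \<otimes>\<^bsub>(K \<times>\<times> K) \<times>\<times> G\<^esub> y)) (choi_state fam L) s)"
        unfolding fam_dim by (rule cocycle_fam[OF x y, unfolded fam_dim]) (use ac in auto)
    qed
  qed
qed

text \<open>An element that acts as the identity leaves every operator neutral, so an operator with
  a nontrivial charge vanishes, and so does its correlator.\<close>

lemma not_broken:
  assumes c: "k \<in> carrier K" "k' \<in> carrier K" "g \<in> carrier G"
    and s: "VK k = scale_op z (one_op {..<n})" "VK k' = scale_op z' (one_op {..<n})" "VG g = scale_op w (one_op {..<n})"
  shows "\<not> element_broken fam ((k, k'), g)"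
proof
  assume "element_broken fam ((k, k'), g)"
  then obtain r Bl Br \<epsilon> where \<epsilon>: "0 < \<epsilon>" and ev: "\<forall>\<^sub>F L in sequentially.
     supported_on L (doubled (chain_family.dim fam L)) {..<r} (Bl L) \<and>
     supported_on L (doubled (chain_family.dim fam L)) {L - r..<L} (Br L) \<and>
     contraction_op (dbasis fam L) (Bl L) \<and> contraction_op (dbasis fam L) (Br L) \<and>
     (\<exists>z. z \<noteq> 1 \<and> conj_sym fam L ((k, k'), g) (Bl L) = scale_op z (Bl L)) \<and>
     (\<exists>z. z \<noteq> 1 \<and> conj_sym fam L ((k, k'), g) (Br L) = scale_op z (Br L)) \<and>
     \<epsilon> \<le> cmod (inner_on (dbasis fam L) (choi_state fam L)
              (app_op (dbasis fam L) (times_op (dbasis fam L) (Bl L) (Br L)) (choi_state fam L))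
            / inner_on (dbasis fam L) (choi_state fam L) (choi_state fam L))"
    unfolding element_broken_def boundary_order_def by blast
  obtain L u where B: "contraction_op (dbasis fam L) (Bl L)" "u \<noteq> 1" "conj_sym fam L ((k, k'), g) (Bl L) = scale_op u (Bl L)"
    "\<epsilon> \<le> cmod (inner_on (dbasis fam L) (choi_state fam L)
              (app_op (dbasis fam L) (times_op (dbasis fam L) (Bl L) (Br L)) (choi_state fam L))
            / inner_on (dbasis fam L) (choi_state fam L) (choi_state fam L))"
    using eventually_happens'[OF sequentially_bot ev] by blast
  interpret bond_chain L n by (rule bc)
  have ops: "Bl L \<in> ops X" using B(1) unfolding fam_dim contraction_op_def by blast
  have "conj_sym fam L ((k, k'), g) (Bl L) = Bl L"
    unfolding conj_sym_def fam_dim trivial_sym_fam[OF c s] adj_one one_times[OF ops] times_one[OF ops] ..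
  then have "Bl L = scale_op u (Bl L)" using B(3) by simp
  then have "Bl L s t = u * Bl L s t" for s t unfolding scale_op_def by meson
  then have "Bl L s t = 0" for s t using B(2) by (metis mult_cancel_right1)
  then have "Bl L = (\<lambda>s t. 0)" by (intro ext)
  then show False using B(4) \<epsilon> by (simp add: times_op_def app_op_def inner_on_def)
qed

end

text \<open>An irreducible projective representation is placed on the bonds, with \<open>G\<close>
  acting trivially; elements of the projective center are then scalars.\<close>

lemma exact_center_attained:
  assumes K: "comm_group K" "finite (carrier K)" and G: "group G" and \<alpha>: "\<alpha> \<in> cocycles2 K"
  obtains C where "mspt K G C \<alpha> (\<lambda>_ _. 1)" "projective_center K \<alpha> \<subseteq> unbroken_K K G C"
proof -
  interpret K: comm_group K by (rule K)
  interpret G: group G by (rule G)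
  interpret A: finite_comm_group K by unfold_locales (rule K)
  obtain n V where V: "(0 :: nat) < n" "\<And>x. x \<in> carrier K \<Longrightarrow> unitary_op {..<n} (V x)"
    "\<And>x y. x \<in> carrier K \<Longrightarrow> y \<in> carrier K \<Longrightarrow> times_op {..<n} (V x) (V y) = scale_op (\<alpha> x y) (V (x \<otimes>\<^bsub>K\<^esub> y))"
    "\<And>x. x \<in> projective_center K \<alpha> \<Longrightarrow> \<exists>z. V x = scale_op z (one_op {..<n})"
    by (rule A.irreducible_projective_rep[OF \<alpha>]) blast
  interpret b: fin_basis "{..<n}" by unfold_locales simp
  interpret P: projective_pair K G n V "\<lambda>_. one_op {..<n}" \<alpha> "\<lambda>_ _. 1"
  proof
    show "cmod (\<alpha> k l) = 1" if "k \<in> carrier K" "l \<in> carrier K" for k l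
      using \<alpha> that by (simp add: cocycles2_def)
    show "times_op {..<n} (V k) (one_op {..<n}) = scale_op 1 (times_op {..<n} (one_op {..<n}) (V k))"
      if "k \<in> carrier K" for k
      using b.unitaryD(1)[OF V(2)[OF that]] by (simp add: scale_op_def)
    show "times_op {..<n} (V k) (V l) = scale_op (\<alpha> k l) (V (k \<otimes>\<^bsub>K\<^esub> l))"
      if "k \<in> carrier K" "l \<in> carrier K" for k l by (rule V(3)[OF that])
    show "unitary_op {..<n} (V k)" if "k \<in> carrier K" for k by (rule V(2)[OF that])
  qed (simp_all add: V(1))
  have one: "\<one>\<^bsub>K\<^esub> \<in> projective_center K \<alpha>"
  proof -
    have "\<alpha> \<one>\<^bsub>K\<^esub> y = \<alpha> y \<one>\<^bsub>K\<^esub>" if "y \<in> carrier K" for y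
      unfolding cocycle_ones[OF K.is_group \<alpha> that] ..
    then show ?thesis by (simp add: projective_center_def)
  qed
  have "\<not> element_broken P.fam ((k, \<one>\<^bsub>K\<^esub>), \<one>\<^bsub>G\<^esub>)" if k: "k \<in> projective_center K \<alpha>" for k
  proof -
    obtain z z' where z: "V k = scale_op z (one_op {..<n})" "V \<one>\<^bsub>K\<^esub> = scale_op z' (one_op {..<n})"
      using V(4)[OF k] V(4)[OF one] by blast
    have kc: "k \<in> carrier K" using k by (simp add: projective_center_def)
    show ?thesis
      by (rule P.not_broken[OF kc K.one_closed G.one_closed z, of 1]) (simp add: scale_op_def)
  qed
  then have "projective_center K \<alpha> \<subseteq> unbroken_K K G P.fam"
    by (auto simp: unbroken_K_def projective_center_def)
  then show ?thesis using P.mspt_fam that by blast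
qed

text \<open>The pairing by \<chi> is a cocycle on the product group. An irreducible projective
  representation of it restricts to linear representations of both factors that commute up to
  \<chi>.\<close>

lemma joint_center_attained:
  fixes K :: "('k, 'm) monoid_scheme" and G :: "('g, 'n) monoid_scheme"
  assumes K: "group K" and G: "group G" and KG: "comm_group (K \<times>\<times> G)" "finite (carrier (K \<times>\<times> G))"
    and \<chi>: "\<chi> \<in> H1_of_characters K G"
  obtains C where "mspt K G C (\<lambda>_ _. 1) \<chi>"
    "projective_center (K \<times>\<times> G) (\<lambda>(k, g) (k', g'). \<chi> g' k) \<subseteq> unbroken_KG K G C"
proof -
  interpret K: group K by (rule K)
  interpret G: group G by (rule G)
  interpret A: finite_comm_group "K \<times>\<times> G"
    by (rule finite_comm_group.intro[OF KG(1)], rule finite_comm_group_axioms.intro[OF KG(2)])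
  note ones = H1_ones[OF K G \<chi>]
  let ?a = "\<lambda>(k, g) (k', g'). \<chi> g' k"
  have unit: "cmod (\<chi> g k) = 1" if "g \<in> carrier G" "k \<in> carrier K" for g k
    using \<chi> that by (simp add: H1_of_characters_def)
  have \<chi>K: "\<chi> g (k \<otimes>\<^bsub>K\<^esub> l) = \<chi> g k * \<chi> g l" if "k \<in> carrier K" "l \<in> carrier K" "g \<in> carrier G" for k l g
    using \<chi> that by (simp add: H1_of_characters_def)
  have \<chi>G: "\<chi> (g \<otimes>\<^bsub>G\<^esub> h) k = \<chi> g k * \<chi> h k" if "k \<in> carrier K" "g \<in> carrier G" "h \<in> carrier G" for k g h
    using \<chi> that by (simp add: H1_of_characters_def)
  have a: "?a \<in> cocycles2 (K \<times>\<times> G)"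
    by (auto simp: cocycles2_def unit \<chi>K \<chi>G mult_ac)
  obtain n V where V: "(0 :: nat) < n" "\<And>x. x \<in> carrier (K \<times>\<times> G) \<Longrightarrow> unitary_op {..<n} (V x)"
    "\<And>x y. x \<in> carrier (K \<times>\<times> G) \<Longrightarrow> y \<in> carrier (K \<times>\<times> G) \<Longrightarrow>
      times_op {..<n} (V x) (V y) = scale_op (?a x y) (V (x \<otimes>\<^bsub>K \<times>\<times> G\<^esub> y))"
    "\<And>x. x \<in> projective_center (K \<times>\<times> G) ?a \<Longrightarrow> \<exists>z. V x = scale_op z (one_op {..<n})"
    by (rule A.irreducible_projective_rep[OF a]) blast
  have s1: "scale_op 1 A = A" for A :: "nat op" by (simp add: scale_op_def)
  have vm: "times_op {..<n} (V (k, g)) (V (k', g')) = scale_op (\<chi> g' k) (V (k \<otimes>\<^bsub>K\<^esub> k', g \<otimes>\<^bsub>G\<^esub> g'))"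
    if "k \<in> carrier K" "k' \<in> carrier K" "g \<in> carrier G" "g' \<in> carrier G" for k k' g g'
    using V(3)[of "(k, g)" "(k', g')"] that by simp
  interpret P: projective_pair K G n "\<lambda>k. V (k, \<one>\<^bsub>G\<^esub>)" "\<lambda>g. V (\<one>\<^bsub>K\<^esub>, g)" "\<lambda>_ _. 1" \<chi>
  proof
    show "times_op {..<n} (V (k, \<one>\<^bsub>G\<^esub>)) (V (l, \<one>\<^bsub>G\<^esub>)) = scale_op 1 (V (k \<otimes>\<^bsub>K\<^esub> l, \<one>\<^bsub>G\<^esub>))"
      if "k \<in> carrier K" "l \<in> carrier K" for k l
      using vm[of k l "\<one>\<^bsub>G\<^esub>" "\<one>\<^bsub>G\<^esub>"] that ones by simp
    show "times_op {..<n} (V (\<one>\<^bsub>K\<^esub>, g)) (V (\<one>\<^bsub>K\<^esub>, h)) = V (\<one>\<^bsub>K\<^esub>, g \<otimes>\<^bsub>G\<^esub> h)"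
      if "g \<in> carrier G" "h \<in> carrier G" for g h
      using vm[of "\<one>\<^bsub>K\<^esub>" "\<one>\<^bsub>K\<^esub>" g h] that ones by (simp add: s1)
    show "times_op {..<n} (V (k, \<one>\<^bsub>G\<^esub>)) (V (\<one>\<^bsub>K\<^esub>, g)) =
        scale_op (\<chi> g k) (times_op {..<n} (V (\<one>\<^bsub>K\<^esub>, g)) (V (k, \<one>\<^bsub>G\<^esub>)))"
      if "k \<in> carrier K" "g \<in> carrier G" for k g
      using vm[of k "\<one>\<^bsub>K\<^esub>" "\<one>\<^bsub>G\<^esub>" g] vm[of "\<one>\<^bsub>K\<^esub>" k g "\<one>\<^bsub>G\<^esub>"] that ones by (simp add: s1)
  qed (use V(1,2) unit in auto)
  have "\<not> element_broken P.fam ((k, \<one>\<^bsub>K\<^esub>), g)" if kg: "(k, g) \<in> projective_center (K \<times>\<times> G) ?a" for k g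
  proof -
    have z: "\<chi> g' k = \<chi> g k'" if "k' \<in> carrier K" "g' \<in> carrier G" for k' g'
      using kg that by (auto simp: projective_center_def)
    have c: "k \<in> carrier K" "g \<in> carrier G" using kg by (auto simp: projective_center_def)
    \<comment> \<open>Testing against elements of one factor at a time shows that both components of
      a central pair are central, hence each of them is represented by a scalar.\<close>
    have "\<chi> g' k = 1" if "g' \<in> carrier G" for g' using z[of "\<one>\<^bsub>K\<^esub>" g'] that ones c by simp
    then have k: "(k, \<one>\<^bsub>G\<^esub>) \<in> projective_center (K \<times>\<times> G) ?a"
      using c ones by (auto simp: projective_center_def)
    have "\<chi> g k' = 1" if "k' \<in> carrier K" for k' using z[of k' "\<one>\<^bsub>G\<^esub>"] that ones c by simp
    then have g: "(\<one>\<^bsub>K\<^esub>, g) \<in> projective_center (K \<times>\<times> G) ?a"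
      using c ones by (auto simp: projective_center_def)
    have "(\<one>\<^bsub>K\<^esub>, \<one>\<^bsub>G\<^esub>) \<in> projective_center (K \<times>\<times> G) ?a"
      using ones by (auto simp: projective_center_def)
    from V(4)[OF this] V(4)[OF k] V(4)[OF g] obtain z1 z2 z3 where
      "V (k, \<one>\<^bsub>G\<^esub>) = scale_op z1 (one_op {..<n})" "V (\<one>\<^bsub>K\<^esub>, \<one>\<^bsub>G\<^esub>) = scale_op z2 (one_op {..<n})"
      "V (\<one>\<^bsub>K\<^esub>, g) = scale_op z3 (one_op {..<n})" by blast
    then show ?thesis by (rule P.not_broken[OF c(1) K.one_closed c(2)])
  qed
  then have "projective_center (K \<times>\<times> G) ?a \<subseteq> unbroken_KG K G P.fam"
    by (auto simp: unbroken_KG_def projective_center_def)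
  then show ?thesis using P.mspt_fam that by blast
qed

theorem theorem11:
  fixes K :: "('k, 'm) monoid_scheme" and G :: "('g, 'n) monoid_scheme"
  assumes "group K" and "group G"
  shows
    "(\<forall>\<alpha>. \<alpha> \<in> cocycles2 K \<and> \<alpha> \<notin> coboundaries2 K \<longrightarrow>
        (\<forall>C. mspt K G C \<alpha> (\<lambda>_ _. 1) \<longrightarrow> exact_broken_without_diagonal K G C) \<and>
        (comm_group K \<and> finite (carrier K) \<longrightarrow>
          (\<forall>C. mspt K G C \<alpha> (\<lambda>_ _. 1) \<longrightarrow> unbroken_K K G C \<subseteq> projective_center K \<alpha>) \<and>
          (\<exists>C. mspt K G C \<alpha> (\<lambda>_ _. 1) \<and> unbroken_K K G C = projective_center K \<alpha>)))
     \<and>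
     (\<forall>\<chi>. \<chi> \<in> H1_of_characters K G \<and> nontrivial_H1 K G \<chi> \<longrightarrow>
        (\<forall>C. mspt K G C (\<lambda>_ _. 1) \<chi> \<longrightarrow>
           exact_broken_to_diagonal K G C \<and> average_broken K G C) \<and>
        (comm_group (K \<times>\<times> G) \<and> finite (carrier (K \<times>\<times> G)) \<longrightarrow>
          (\<forall>C. mspt K G C (\<lambda>_ _. 1) \<chi> \<longrightarrow>
             unbroken_KG K G C \<subseteq> projective_center (K \<times>\<times> G) (\<lambda>(k, g) (k', g'). \<chi> g' k)) \<and>
          (\<exists>C. mspt K G C (\<lambda>_ _. 1) \<chi> \<and>
             unbroken_KG K G C = projective_center (K \<times>\<times> G) (\<lambda>(k, g) (k', g'). \<chi> g' k))))"
proof (intro conjI allI impI; (elim conjE)?)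
  fix \<alpha> :: "'k \<Rightarrow> 'k \<Rightarrow> complex" and C :: "('k, 'g) chain_family"
  assume "\<alpha> \<in> cocycles2 K" "\<alpha> \<notin> coboundaries2 K" "mspt K G C \<alpha> (\<lambda>_ _. 1)"
  then show "exact_broken_without_diagonal K G C" using exact_broken assms by blast
next
  fix \<alpha> :: "'k \<Rightarrow> 'k \<Rightarrow> complex" and C :: "('k, 'g) chain_family"
  assume "\<alpha> \<in> cocycles2 K" "mspt K G C \<alpha> (\<lambda>_ _. 1)" "comm_group K"
  then show "unbroken_K K G C \<subseteq> projective_center K \<alpha>" using exact_center assms by blast
next
  fix \<alpha> :: "'k \<Rightarrow> 'k \<Rightarrow> complex"
  assume a: "\<alpha> \<in> cocycles2 K" "comm_group K" "finite (carrier K)"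
  obtain C :: "('k, 'g) chain_family" where
    C: "mspt K G C \<alpha> (\<lambda>_ _. 1)" "projective_center K \<alpha> \<subseteq> unbroken_K K G C"
    by (rule exact_center_attained[OF a(2,3) assms(2) a(1)])
  show "\<exists>C. mspt K G C \<alpha> (\<lambda>_ _. 1) \<and> unbroken_K K G C = projective_center K \<alpha>"
    by (intro exI[of _ C] conjI C(1) subset_antisym C(2) exact_center[OF assms C(1) a(1,2)])
next
  fix \<chi> :: "'g \<Rightarrow> 'k \<Rightarrow> complex" and C :: "('k, 'g) chain_family"
  assume "\<chi> \<in> H1_of_characters K G" "nontrivial_H1 K G \<chi>" "mspt K G C (\<lambda>_ _. 1) \<chi>"
  note b = joint_broken[OF assms this(3,1,2)]
  show "exact_broken_to_diagonal K G C" "average_broken K G C" by (rule b)+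
next
  fix \<chi> :: "'g \<Rightarrow> 'k \<Rightarrow> complex" and C :: "('k, 'g) chain_family"
  assume a: "\<chi> \<in> H1_of_characters K G" "mspt K G C (\<lambda>_ _. 1) \<chi>" "comm_group (K \<times>\<times> G)"
  show "unbroken_KG K G C \<subseteq> projective_center (K \<times>\<times> G) (\<lambda>(k, g) (k', g'). \<chi> g' k)"
    by (rule joint_center[OF assms a(2,1,3)])
next
  fix \<chi> :: "'g \<Rightarrow> 'k \<Rightarrow> complex"
  assume a: "\<chi> \<in> H1_of_characters K G" "comm_group (K \<times>\<times> G)" "finite (carrier (K \<times>\<times> G))"
  obtain C :: "('k, 'g) chain_family" where C: "mspt K G C (\<lambda>_ _. 1) \<chi>"
    "projective_center (K \<times>\<times> G) (\<lambda>(k, g) (k', g'). \<chi> g' k) \<subseteq> unbroken_KG K G C"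
    by (rule joint_center_attained[OF assms a(2,3,1)])
  show "\<exists>C. mspt K G C (\<lambda>_ _. 1) \<chi> \<and>
      unbroken_KG K G C = projective_center (K \<times>\<times> G) (\<lambda>(k, g) (k', g'). \<chi> g' k)"
    by (intro exI[of _ C] conjI C(1) subset_antisym C(2) joint_center[OF assms C(1) a(1,2)])
qed

end
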